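(* (Mixed Adem relations) Suppose $X$ is an $E_\infty$--ring space. Then for all $r,s\in\bigoplus_{k\ge0}H_*(\Sigma_k)$ and $x\in H_*(X)$ (homogeneous), $$r\mathbin{\sharp}(s\circ x)=\sum(-1)^{\deg(s)\deg(r'')}(r'\mathbin{\sharp}s)\circ(r''\mathbin{\sharp}x),$$ where $\psi(r)=\sum r'\otimes r''$.
   Context: Fix a prime $p$; $H_*$ denotes homology with $\mathbb{F}_p$-coefficients. Spaces are compactly generated weak Hausdorff. Operads are operads in spaces with $0$-th space a point, indexed functorially on finite sets and bijections ($\mathcal{O}(n)=\mathcal{O}(\{1,\dots,n\})$), with unit $1_{\mathcal{O}}$ and compositions $\gamma:\mathcal{O}(A)\times\prod_{a\in A}\mathcal{O}(B_a)\to\mathcal{O}(\bigsqcup_aB_a)$. An $E_\infty$-operad is an operad $\mathcal{C}$ such that every $\mathcal{C}(n)$ is contractible, has a free $\Sigma_n$-action, and is $\Sigma_n$-equivariantly homotopy equivalent to a $\Sigma_n$-CW complex. An action of an operad $\mathcal{G}$ on an operad $\mathcal{C}$ (in the sense of May) consists of maps $\lambda:\mathcal{G}(A)\times\prod_{a\in A}\mathcal{C}(B_a)\to\mathcal{C}(\prod_{a\in A}B_a)$ for finite sets $A,B_a$, natural in bijections of $A$ and the $B_a$, such that (under the evident bijections of indexing sets) $\lambda(1_{\mathcal{G}};c)=c$; $\lambda(g;(1_{\mathcal{C}})_a)=1_{\mathcal{C}}$; $\lambda(\gamma(g;(g_a)_a);(c_{a,b})_{a\in A,b\in B_a})=\lambda(g;(\lambda(g_a;(c_{a,b})_b))_a)$;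 and $\lambda(g;(\gamma(c_a;(d_{a,b})_{b\in B_a}))_a)=\gamma(\lambda(g;(c_a)_a);(\lambda(g;(d_{a,b_a})_a))_{(b_a)_a\in\prod_aB_a})$. Fix an $E_\infty$-operad pair $(\mathcal{C},\mathcal{G})$, i.e. two $E_\infty$-operads with an action of $\mathcal{G}$ on $\mathcal{C}$. An $E_\infty$--ring space is a space $X$ with a $\mathcal{C}$-algebra structure $\theta$ (additive $E_\infty$-structure) and a $\mathcal{G}$-algebra structure $\xi$ (multiplicative $E_\infty$-structure) such that for all finite sets $A$, $B_a$, $$\xi\bigl(g;(\theta(c_a;(x_{a,b})_{b\in B_a}))_{a\in A}\bigr)=\theta\bigl(\lambda(g;(c_a)_{a});(\xi(g;(x_{a,b_a})_{a\in A}))_{(b_a)_a\in\prod_aB_a}\bigr).$$ For $r\in H_*(\Sigma_k)$ and $x\in H_*(X)$: $r\circ x$ is the image of $r\times x\in H_*((\mathcal{C}(k)/\Sigma_k)\times X)$ under the map induced by $([c],x)\mapsto\theta(c;x,\dots,x)$, and $r\mathbin{\sharp}x$ is the image of $r\times x\in H_*((\mathcal{G}(k)/\Sigma_k)\times X)$ under the map induced by $([g],x)\mapsto\xi(g;x,\dots,x)$ (both $\mathcal{C}(k)/\Sigma_k$ and $\mathcal{G}(k)/\Sigma_k$ are models for $B\Sigma_k$). Both are extended linearly to $r\in\bigoplus_kH_*(\Sigma_k)$. The free $\mathcal{C}$-algebra on a point $C(\mathrm{pt})=\bigsqcup_k\mathcal{C}(k)/\Sigma_k$ is an $E_\infty$--ring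 space with $\mathcal{G}$-action $\xi(g;([c_a])_a)=[\lambda(g;(c_a)_a)]$; identifying $H_*(C(\mathrm{pt}))=\bigoplus_kH_*(\Sigma_k)$, the operation $\sharp$ for $X=C(\mathrm{pt})$ gives the product $r\mathbin{\sharp}s$ on $\bigoplus_kH_*(\Sigma_k)$. Concretely, it is induced by the homomorphisms $\Sigma_m\times\Sigma_n\to\Sigma_{n^m}$ (well defined up to conjugacy) given by the evident action of $\Sigma_m\times\Sigma_n$ on the set of functions $\{1,\dots,n\}^{\{1,\dots,m\}}$. The coproduct $\psi$ on $\bigoplus_kH_*(\Sigma_k)$ is induced by the diagonals of the groups $\Sigma_k$. *)

theory Defs
  imports
    "HOL-Homology.Homology"
    "HOL-Algebra.Sym_Groups"
    "HOL-Library.Nat_Bijection"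
    "HOL-Computational_Algebra.Primes"
begin

section \<open>Compactly generated weak Hausdorff spaces\<close>

text \<open>
  Compact Hausdorff test spaces \<open>K\<close> for a space on the type \<open>'a\<close>. A quantifier over all compact
  Hausdorff spaces is not available in HOL, but nothing is lost on this type, which has at least
  \<open>2^2^|'a|\<close> elements. For \<open>u : K \<rightarrow> X\<close> choose \<open>D \<subseteq> K\<close> with \<open>|D| \<le> |X|\<close> and \<open>u(D) = u(K)\<close>; the closure
  of \<open>D\<close> has at most \<open>2^2^|X|\<close> points and the same image as \<open>K\<close>, so weak Hausdorffness may be tested
  on this type. If \<open>X\<close> is weak Hausdorff then \<open>K \<rightarrow> u(K)\<close> is a quotient map onto a compact Hausdorff
  subspace of \<open>X\<close>, so the k-topology may be tested on this type as well. (The summand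
  \<open>nat \<Rightarrow> real\<close> only provides room for the standard simplices.)
\<close>

type_synonym 'a test_topology = "('a + (nat \<Rightarrow> real)) set set topology"

definition weak_Hausdorff :: "'a topology \<Rightarrow> bool" where
  "weak_Hausdorff X \<longleftrightarrow>
     (\<forall>(K :: 'a test_topology) u. compact_space K \<and> Hausdorff_space K \<and> continuous_map K X u
        \<longrightarrow> closedin X (u ` topspace K))"

definition k_open :: "'a topology \<Rightarrow> 'a set \<Rightarrow> bool" where
  "k_open X U \<longleftrightarrow> U \<subseteq> topspace X \<and>
     (\<forall>(K :: 'a test_topology) u. compact_space K \<and> Hausdorff_space K \<and> continuous_map K X u
        \<longrightarrow> openin K {z \<in> topspace K. u z \<in> U})"

definition k_refine :: "'a topology \<Rightarrow> 'a topology" where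
  "k_refine X = topology (k_open X)"

lemma istopology_k_open: "istopology (k_open X)"
  unfolding istopology_def
proof (intro conjI allI impI)
  fix S T assume S: "k_open X S" and T: "k_open X T"
  have "{z \<in> topspace K. u z \<in> S \<inter> T} = {z \<in> topspace K. u z \<in> S} \<inter> {z \<in> topspace K. u z \<in> T}"
    for K :: "'a test_topology" and u by blast
  then show "k_open X (S \<inter> T)"
    using S T unfolding k_open_def by (auto simp: openin_Int)
next
  fix \<K> assume K: "\<forall>S\<in>\<K>. k_open X S"
  have "{z \<in> topspace K. u z \<in> \<Union>\<K>} = (\<Union>S\<in>\<K>. {z \<in> topspace K. u z \<in> S})"
    for K :: "'a test_topology" and u by blast
  then show "k_open X (\<Union>\<K>)"
    using K unfolding k_open_def by (auto intro!: openin_Union)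
qed

lemma openin_k_refine: "openin (k_refine X) U \<longleftrightarrow> k_open X U"
  by (simp add: k_refine_def istopology_k_open topology_inverse')

definition CGWH :: "'a topology \<Rightarrow> bool" where
  "CGWH X \<longleftrightarrow> weak_Hausdorff X \<and> k_refine X = X"

definition kprod :: "'a topology \<Rightarrow> 'b topology \<Rightarrow> ('a \<times> 'b) topology" where
  "kprod X Y = k_refine (prod_topology X Y)"

text \<open>The product of \<open>X\<close> and the \<open>Y a\<close>, \<open>a \<in> A\<close>. One k-refinement suffices, because
  \<open>k (X \<times> k Z) = k (X \<times> Z)\<close>.\<close>

definition kprod_family ::
  "'a topology \<Rightarrow> ('i \<Rightarrow> 'b topology) \<Rightarrow> 'i set \<Rightarrow> ('a \<times> ('i \<Rightarrow> 'b)) topology" where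
  "kprod_family X Y A = k_refine (prod_topology X (product_topology Y A))"

definition quot_topology :: "'a topology \<Rightarrow> ('a \<Rightarrow> 'b) \<Rightarrow> 'b topology" where
  "quot_topology X q =
     topology (\<lambda>U. U \<subseteq> q ` topspace X \<and> openin X {x \<in> topspace X. q x \<in> U})"

lemma openin_quot_topology:
  "openin (quot_topology X q) U \<longleftrightarrow> U \<subseteq> q ` topspace X \<and> openin X {x \<in> topspace X. q x \<in> U}"
proof -
  have "istopology (\<lambda>U. U \<subseteq> q ` topspace X \<and> openin X {x \<in> topspace X. q x \<in> U})"
    unfolding istopology_def
  proof (intro conjI allI impI; (elim conjE)?)
    fix S T assume "openin X {x \<in> topspace X. q x \<in> S}" "openin X {x \<in> topspace X. q x \<in> T}"
    moreover have "{x \<in> topspace X. q x \<in> S \<inter> T}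
      = {x \<in> topspace X. q x \<in> S} \<inter> {x \<in> topspace X. q x \<in> T}" by blast
    ultimately show "openin X {x \<in> topspace X. q x \<in> S \<inter> T}" by (simp add: openin_Int)
  next
    fix \<K> assume "\<forall>S\<in>\<K>. S \<subseteq> q ` topspace X \<and> openin X {x \<in> topspace X. q x \<in> S}"
    moreover have "{x \<in> topspace X. q x \<in> \<Union>\<K>} = (\<Union>S\<in>\<K>. {x \<in> topspace X. q x \<in> S})" by blast
    ultimately show "openin X {x \<in> topspace X. q x \<in> \<Union>\<K>}" by auto
  qed blast+
  then show ?thesis by (simp add: quot_topology_def topology_inverse')
qed


section \<open>Equivariant cell complexes\<close>

definition group_acts :: "('g, 'm) monoid_scheme \<Rightarrow> 'y topology \<Rightarrow> ('g \<Rightarrow> 'y \<Rightarrow> 'y) \<Rightarrow> bool" where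
  "group_acts G Y act \<longleftrightarrow>
     (\<forall>g \<in> carrier G. continuous_map Y Y (act g)) \<and>
     (\<forall>y \<in> topspace Y. act \<one>\<^bsub>G\<^esub> y = y) \<and>
     (\<forall>g \<in> carrier G. \<forall>h \<in> carrier G. \<forall>y \<in> topspace Y. act (g \<otimes>\<^bsub>G\<^esub> h) y = act g (act h y))"

definition free_action :: "('g, 'm) monoid_scheme \<Rightarrow> 'y topology \<Rightarrow> ('g \<Rightarrow> 'y \<Rightarrow> 'y) \<Rightarrow> bool" where
  "free_action G Y act \<longleftrightarrow>
     (\<forall>g \<in> carrier G. \<forall>y \<in> topspace Y. act g y = y \<longrightarrow> g = \<one>\<^bsub>G\<^esub>)"

definition equivariant ::
  "('g, 'm) monoid_scheme \<Rightarrow> 'x topology \<Rightarrow> ('g \<Rightarrow> 'x \<Rightarrow> 'x) \<Rightarrow> ('g \<Rightarrow> 'y \<Rightarrow> 'y) \<Rightarrow> ('x \<Rightarrow> 'y) \<Rightarrow> bool"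
  where
  "equivariant G X actX actY f \<longleftrightarrow>
     (\<forall>g \<in> carrier G. \<forall>x \<in> topspace X. f (actX g x) = actY g (f x))"

definition equivariantly_homotopy_equivalent ::
  "('g, 'm) monoid_scheme \<Rightarrow> 'x topology \<Rightarrow> ('g \<Rightarrow> 'x \<Rightarrow> 'x) \<Rightarrow> 'y topology \<Rightarrow> ('g \<Rightarrow> 'y \<Rightarrow> 'y) \<Rightarrow> bool"
  where
  "equivariantly_homotopy_equivalent G X actX Y actY \<longleftrightarrow>
     (\<exists>f h. continuous_map X Y f \<and> equivariant G X actX actY f \<and>
            continuous_map Y X h \<and> equivariant G Y actY actX h \<and>
            homotopic_with (equivariant G X actX actX) X X (h \<circ> f) id \<and>
            homotopic_with (equivariant G Y actY actY) Y Y (f \<circ> h) id)"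

definition norm_sq :: "nat \<Rightarrow> (nat \<Rightarrow> real) \<Rightarrow> real" where
  "norm_sq n t = (\<Sum>i<n. (t i)\<^sup>2)"

definition disk :: "nat \<Rightarrow> (nat \<Rightarrow> real) topology" where
  "disk n = subtopology (Euclidean_space n) {t. norm_sq n t \<le> 1}"

text \<open>
  \<open>G\<close> is a discrete group. \<open>Sk n\<close> is the \<open>n\<close>-skeleton, and every \<open>\<phi> \<in> \<Phi> n\<close> is the restriction to
  \<open>H \<times> D\<^sup>n\<close> of the characteristic map \<open>(g H, t) \<mapsto> g \<cdot> \<phi> t\<close> of an equivariant cell \<open>G/H \<times> D\<^sup>n\<close>. The
  isotropy group \<open>H\<close> need not be recorded: by the injectivity clause it is the pointwise stabiliser
  of \<open>\<phi>\<close>. The clauses say that \<open>Sk n\<close> is the pushout of \<open>Sk (n - 1)\<close> along the attaching maps of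
  these cells, and that \<open>Y\<close> is the colimit of its skeleta.
\<close>

definition equivariant_CW_complex ::
  "('g, 'm) monoid_scheme \<Rightarrow> 'y topology \<Rightarrow> ('g \<Rightarrow> 'y \<Rightarrow> 'y) \<Rightarrow> bool" where
  "equivariant_CW_complex G Y act \<longleftrightarrow> group_acts G Y act \<and>
     (\<exists>(Sk :: nat \<Rightarrow> 'y set) (\<Phi> :: nat \<Rightarrow> ((nat \<Rightarrow> real) \<Rightarrow> 'y) set).
        let below = (\<lambda>n. if n = 0 then {} else Sk (n - 1));
            cell = (\<lambda>n. {t \<in> topspace (disk n). norm_sq n t < 1})
        in
          (\<Union>n. Sk n) = topspace Y \<and>
          (\<forall>n. below n \<subseteq> Sk n) \<and>
          (\<forall>n. \<forall>\<phi> \<in> \<Phi> n. continuous_map (disk n) (subtopology Y (Sk n)) \<phi> \<and>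
                 (\<forall>t \<in> topspace (disk n). norm_sq n t = 1 \<longrightarrow> \<phi> t \<in> below n)) \<and>
          (\<forall>n. Sk n - below n = {act g (\<phi> t) |g \<phi> t. g \<in> carrier G \<and> \<phi> \<in> \<Phi> n \<and> t \<in> cell n}) \<and>
          (\<forall>n. \<forall>\<phi> \<in> \<Phi> n. \<forall>\<phi>' \<in> \<Phi> n. \<forall>g \<in> carrier G. \<forall>g' \<in> carrier G. \<forall>t \<in> cell n. \<forall>t' \<in> cell n.
                 act g (\<phi> t) = act g' (\<phi>' t') \<longrightarrow>
                   \<phi> = \<phi>' \<and> t = t' \<and> (\<forall>v \<in> topspace (disk n). act g (\<phi> v) = act g' (\<phi> v))) \<and>
          (\<forall>n U. U \<subseteq> Sk n \<longrightarrow>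
                 (closedin (subtopology Y (Sk n)) U \<longleftrightarrow>
                    closedin (subtopology Y (below n)) (U \<inter> below n) \<and>
                    (\<forall>\<phi> \<in> \<Phi> n. \<forall>g \<in> carrier G.
                       closedin (disk n) {t \<in> topspace (disk n). act g (\<phi> t) \<in> U}))) \<and>
          (\<forall>U. U \<subseteq> topspace Y \<longrightarrow>
                 (closedin Y U \<longleftrightarrow> (\<forall>n. closedin (subtopology Y (Sk n)) (U \<inter> Sk n)))))"


section \<open>Operads\<close>

text \<open>
  The indexing category of finite sets and bijections is represented by the finite sets of natural
  numbers. It is made closed under disjoint unions and products of families by coding pairs as
  numbers, and functions as the codes of their (finite) graphs.
\<close>

definition dsum :: "nat set \<Rightarrow> (nat \<Rightarrow> nat set) \<Rightarrow> nat set" where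
  "dsum A B = prod_encode ` Sigma A B"

definition fun_code :: "nat set \<Rightarrow> (nat \<Rightarrow> nat) \<Rightarrow> nat" where
  "fun_code A b = set_encode ((\<lambda>a. prod_encode (a, b a)) ` A)"

definition fun_decode :: "nat \<Rightarrow> nat \<Rightarrow> nat" where
  "fun_decode z a = (THE b. prod_encode (a, b) \<in> set_decode z)"

definition dprod :: "nat set \<Rightarrow> (nat \<Rightarrow> nat set) \<Rightarrow> nat set" where
  "dprod A B = fun_code A ` (\<Pi>\<^sub>E a\<in>A. B a)"

lemma fun_decode_code:
  assumes "finite A" "a \<in> A"
  shows "fun_decode (fun_code A b) a = b a"
  using assms by (auto simp: fun_decode_def fun_code_def set_encode_inverse)

definition transport :: "nat set \<Rightarrow> (nat \<Rightarrow> nat) \<Rightarrow> (nat \<Rightarrow> 'a) \<Rightarrow> nat \<Rightarrow> 'a" where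
  "transport A \<sigma> d = (\<lambda>i\<in>\<sigma> ` A. d (inv_into A \<sigma> i))"

definition dsum_map :: "(nat \<Rightarrow> nat) \<Rightarrow> (nat \<Rightarrow> nat \<Rightarrow> nat) \<Rightarrow> nat \<Rightarrow> nat" where
  "dsum_map \<sigma> \<tau> z = (case prod_decode z of (a, b) \<Rightarrow> prod_encode (\<sigma> a, \<tau> a b))"

definition dprod_map :: "nat set \<Rightarrow> (nat \<Rightarrow> nat) \<Rightarrow> (nat \<Rightarrow> nat \<Rightarrow> nat) \<Rightarrow> nat \<Rightarrow> nat" where
  "dprod_map A \<sigma> \<tau> z = fun_code (\<sigma> ` A) (transport A \<sigma> (\<lambda>a. \<tau> a (fun_decode z a)))"

text \<open>The bijections \<open>(a, (b, e)) \<mapsto> ((a, b), e)\<close>; \<open>(f\<^sub>a)\<^sub>a \<mapsto> (f\<^sub>a b)\<^bsub>(a, b)\<^esub>\<close>; and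
  \<open>((b\<^sub>a)\<^sub>a, (e\<^sub>a)\<^sub>a) \<mapsto> ((b\<^sub>a, e\<^sub>a))\<^sub>a\<close>.\<close>

definition dsum_assoc :: "nat \<Rightarrow> nat" where
  "dsum_assoc z = (case prod_decode z of (a, w) \<Rightarrow>
     case prod_decode w of (b, e) \<Rightarrow> prod_encode (prod_encode (a, b), e))"

definition dprod_uncurry :: "nat set \<Rightarrow> (nat \<Rightarrow> nat set) \<Rightarrow> nat \<Rightarrow> nat" where
  "dprod_uncurry A B z = fun_code (dsum A B)
     (\<lambda>w. case prod_decode w of (a, b) \<Rightarrow> fun_decode (fun_decode z a) b)"

definition dprod_distrib :: "nat set \<Rightarrow> nat \<Rightarrow> nat" where
  "dprod_distrib A z = (case prod_decode z of (u, v) \<Rightarrow>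
     fun_code A (\<lambda>a. prod_encode (fun_decode u a, fun_decode v a)))"

text \<open>\<open>omap P A \<sigma> : P(A) \<rightarrow> P(\<sigma>(A))\<close> is the map induced by the bijection \<open>\<sigma> : A \<rightarrow> \<sigma>(A)\<close>; the unit lies
  in \<open>P({1})\<close>; \<open>ocomp P A B : P(A) \<times> \<Prod>\<^sub>a P(B a) \<rightarrow> P(\<Squnion>\<^sub>a B a)\<close>.\<close>

record 'c operad_data =
  ospace :: "nat set \<Rightarrow> 'c topology"
  omap :: "nat set \<Rightarrow> (nat \<Rightarrow> nat) \<Rightarrow> 'c \<Rightarrow> 'c"
  ounit :: "'c"
  ocomp :: "nat set \<Rightarrow> (nat \<Rightarrow> nat set) \<Rightarrow> 'c \<Rightarrow> (nat \<Rightarrow> 'c) \<Rightarrow> 'c"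

abbreviation opts :: "'c operad_data \<Rightarrow> nat set \<Rightarrow> 'c set" where
  "opts P A \<equiv> topspace (ospace P A)"

locale operad =
  fixes P :: "'c operad_data"
  assumes CGWH_ospace: "finite A \<Longrightarrow> CGWH (ospace P A)"
    and ospace_empty: "\<exists>c. opts P {} = {c}"
    and omap_continuous:
      "\<lbrakk>finite A; inj_on \<sigma> A\<rbrakk> \<Longrightarrow> continuous_map (ospace P A) (ospace P (\<sigma> ` A)) (omap P A \<sigma>)"
    and omap_cong:
      "\<lbrakk>finite A; inj_on \<sigma> A; \<And>a. a \<in> A \<Longrightarrow> \<sigma> a = \<rho> a; c \<in> opts P A\<rbrakk>
         \<Longrightarrow> omap P A \<sigma> c = omap P A \<rho> c"
    and omap_id: "\<lbrakk>finite A; c \<in> opts P A\<rbrakk> \<Longrightarrow> omap P A id c = c"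
    and omap_comp:
      "\<lbrakk>finite A; inj_on \<sigma> A; inj_on \<rho> (\<sigma> ` A); c \<in> opts P A\<rbrakk>
         \<Longrightarrow> omap P (\<sigma> ` A) \<rho> (omap P A \<sigma> c) = omap P A (\<rho> \<circ> \<sigma>) c"
    and ounit_in: "ounit P \<in> opts P {1}"
    and ocomp_continuous:
      "\<lbrakk>finite A; \<And>a. a \<in> A \<Longrightarrow> finite (B a)\<rbrakk>
         \<Longrightarrow> continuous_map (kprod_family (ospace P A) (\<lambda>a. ospace P (B a)) A) (ospace P (dsum A B))
               (\<lambda>(c, d). ocomp P A B c d)"
    and ocomp_cong:
      "\<lbrakk>finite A; \<And>a. a \<in> A \<Longrightarrow> finite (B a); \<And>a. a \<in> A \<Longrightarrow> B a = B' a;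
        c \<in> opts P A; d \<in> (\<Pi>\<^sub>E a\<in>A. opts P (B a))\<rbrakk>
         \<Longrightarrow> ocomp P A B c d = ocomp P A B' c d"
    and ocomp_natural:
      "\<lbrakk>finite A; \<And>a. a \<in> A \<Longrightarrow> finite (B a); inj_on \<sigma> A; \<And>a. a \<in> A \<Longrightarrow> inj_on (\<tau> a) (B a);
        c \<in> opts P A; d \<in> (\<Pi>\<^sub>E a\<in>A. opts P (B a))\<rbrakk>
         \<Longrightarrow> ocomp P (\<sigma> ` A) (transport A \<sigma> (\<lambda>a. \<tau> a ` B a)) (omap P A \<sigma> c)
                (transport A \<sigma> (\<lambda>a. omap P (B a) (\<tau> a) (d a)))
             = omap P (dsum A B) (dsum_map \<sigma> \<tau>) (ocomp P A B c d)"
    and ocomp_unit_left: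
      "\<lbrakk>finite D; c \<in> opts P D\<rbrakk>
         \<Longrightarrow> ocomp P {1} (\<lambda>_. D) (ounit P) (\<lambda>a\<in>{1}. c) = omap P D (\<lambda>b. prod_encode (1, b)) c"
    and ocomp_unit_right:
      "\<lbrakk>finite A; c \<in> opts P A\<rbrakk>
         \<Longrightarrow> ocomp P A (\<lambda>_. {1}) c (\<lambda>a\<in>A. ounit P) = omap P A (\<lambda>a. prod_encode (a, 1)) c"
    and ocomp_assoc:
      "\<lbrakk>finite A; \<And>a. a \<in> A \<Longrightarrow> finite (B a); \<And>a b. \<lbrakk>a \<in> A; b \<in> B a\<rbrakk> \<Longrightarrow> finite (E a b);
        c \<in> opts P A; \<And>a. a \<in> A \<Longrightarrow> d a \<in> opts P (B a);
        \<And>a b. \<lbrakk>a \<in> A; b \<in> B a\<rbrakk> \<Longrightarrow> e a b \<in> opts P (E a b)\<rbrakk>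
         \<Longrightarrow> ocomp P (dsum A B) (\<lambda>z. case prod_decode z of (a, b) \<Rightarrow> E a b)
                (ocomp P A B c (\<lambda>a\<in>A. d a))
                (\<lambda>z\<in>dsum A B. case prod_decode z of (a, b) \<Rightarrow> e a b)
             = omap P (dsum A (\<lambda>a. dsum (B a) (E a))) dsum_assoc
                (ocomp P A (\<lambda>a. dsum (B a) (E a)) c
                   (\<lambda>a\<in>A. ocomp P (B a) (E a) (d a) (\<lambda>b\<in>B a. e a b)))"

text \<open>The cell complexes in the definition may live on any type \<open>'y\<close>, which is a parameter because
  HOL has no existential quantifier over types.\<close>

definition E_infinity_operad :: "'y itself \<Rightarrow> 'c operad_data \<Rightarrow> bool" where
  "E_infinity_operad _ P \<longleftrightarrow> operad P \<and>
     (\<forall>n. opts P {1..n} \<noteq> {} \<and>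
          contractible_space (ospace P {1..n}) \<and>
          free_action (sym_group n) (ospace P {1..n}) (omap P {1..n}) \<and>
          (\<exists>(Y :: 'y topology) act.
             equivariant_CW_complex (sym_group n) Y act \<and>
             equivariantly_homotopy_equivalent (sym_group n)
               (ospace P {1..n}) (omap P {1..n}) Y act))"

locale operad_algebra = operad P for P :: "'c operad_data" +
  fixes X :: "'x topology" and \<theta> :: "nat set \<Rightarrow> 'c \<Rightarrow> (nat \<Rightarrow> 'x) \<Rightarrow> 'x"
  assumes CGWH_space: "CGWH X"
    and act_continuous:
      "finite A \<Longrightarrow> continuous_map (kprod_family (ospace P A) (\<lambda>_. X) A) X (\<lambda>(c, x). \<theta> A c x)"
    and act_natural:
      "\<lbrakk>finite A; inj_on \<sigma> A; c \<in> opts P A; y \<in> (\<Pi>\<^sub>E a\<in>A. topspace X)\<rbrakk>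
         \<Longrightarrow> \<theta> (\<sigma> ` A) (omap P A \<sigma> c) (transport A \<sigma> y) = \<theta> A c y"
    and act_unit: "z \<in> topspace X \<Longrightarrow> \<theta> {1} (ounit P) (\<lambda>a\<in>{1}. z) = z"
    and act_comp:
      "\<lbrakk>finite A; \<And>a. a \<in> A \<Longrightarrow> finite (B a); c \<in> opts P A; \<And>a. a \<in> A \<Longrightarrow> d a \<in> opts P (B a);
        \<And>a b. \<lbrakk>a \<in> A; b \<in> B a\<rbrakk> \<Longrightarrow> x a b \<in> topspace X\<rbrakk>
         \<Longrightarrow> \<theta> (dsum A B) (ocomp P A B c (\<lambda>a\<in>A. d a))
                (\<lambda>z\<in>dsum A B. case prod_decode z of (a, b) \<Rightarrow> x a b)
             = \<theta> A c (\<lambda>a\<in>A. \<theta> (B a) (d a) (\<lambda>b\<in>B a. x a b))"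

locale operad_pair = C: operad C + G: operad G
  for C :: "'c operad_data" and G :: "'g operad_data" +
  fixes lam :: "nat set \<Rightarrow> (nat \<Rightarrow> nat set) \<Rightarrow> 'g \<Rightarrow> (nat \<Rightarrow> 'c) \<Rightarrow> 'c"
  assumes lam_continuous:
      "\<lbrakk>finite A; \<And>a. a \<in> A \<Longrightarrow> finite (B a)\<rbrakk>
         \<Longrightarrow> continuous_map (kprod_family (ospace G A) (\<lambda>a. ospace C (B a)) A) (ospace C (dprod A B))
               (\<lambda>(g, c). lam A B g c)"
    and lam_cong:
      "\<lbrakk>finite A; \<And>a. a \<in> A \<Longrightarrow> finite (B a); \<And>a. a \<in> A \<Longrightarrow> B a = B' a;
        g \<in> opts G A; c \<in> (\<Pi>\<^sub>E a\<in>A. opts C (B a))\<rbrakk>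
         \<Longrightarrow> lam A B g c = lam A B' g c"
    and lam_natural:
      "\<lbrakk>finite A; \<And>a. a \<in> A \<Longrightarrow> finite (B a); inj_on \<sigma> A; \<And>a. a \<in> A \<Longrightarrow> inj_on (\<tau> a) (B a);
        g \<in> opts G A; c \<in> (\<Pi>\<^sub>E a\<in>A. opts C (B a))\<rbrakk>
         \<Longrightarrow> lam (\<sigma> ` A) (transport A \<sigma> (\<lambda>a. \<tau> a ` B a)) (omap G A \<sigma> g)
                (transport A \<sigma> (\<lambda>a. omap C (B a) (\<tau> a) (c a)))
             = omap C (dprod A B) (dprod_map A \<sigma> \<tau>) (lam A B g c)"
    and lam_unit_left:
      "\<lbrakk>finite D; u \<in> opts C D\<rbrakk>
         \<Longrightarrow> lam {1} (\<lambda>_. D) (ounit G) (\<lambda>a\<in>{1}. u) = omap C D (\<lambda>b. fun_code {1} (\<lambda>_. b)) u"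
    and lam_unit_right:
      "\<lbrakk>finite A; g \<in> opts G A\<rbrakk>
         \<Longrightarrow> lam A (\<lambda>_. {1}) g (\<lambda>a\<in>A. ounit C) = omap C {1} (\<lambda>_. fun_code A (\<lambda>_. 1)) (ounit C)"
    and lam_comp:
      "\<lbrakk>finite A; \<And>a. a \<in> A \<Longrightarrow> finite (B a); \<And>a b. \<lbrakk>a \<in> A; b \<in> B a\<rbrakk> \<Longrightarrow> finite (E a b);
        g \<in> opts G A; \<And>a. a \<in> A \<Longrightarrow> h a \<in> opts G (B a);
        \<And>a b. \<lbrakk>a \<in> A; b \<in> B a\<rbrakk> \<Longrightarrow> d a b \<in> opts C (E a b)\<rbrakk>
         \<Longrightarrow> lam (dsum A B) (\<lambda>z. case prod_decode z of (a, b) \<Rightarrow> E a b)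
                (ocomp G A B g (\<lambda>a\<in>A. h a))
                (\<lambda>z\<in>dsum A B. case prod_decode z of (a, b) \<Rightarrow> d a b)
             = omap C (dprod A (\<lambda>a. dprod (B a) (E a))) (dprod_uncurry A B)
                (lam A (\<lambda>a. dprod (B a) (E a)) g
                   (\<lambda>a\<in>A. lam (B a) (E a) (h a) (\<lambda>b\<in>B a. d a b)))"
    and lam_distrib:
      "\<lbrakk>finite A; \<And>a. a \<in> A \<Longrightarrow> finite (B a); \<And>a b. \<lbrakk>a \<in> A; b \<in> B a\<rbrakk> \<Longrightarrow> finite (E a b);
        g \<in> opts G A; \<And>a. a \<in> A \<Longrightarrow> c a \<in> opts C (B a);
        \<And>a b. \<lbrakk>a \<in> A; b \<in> B a\<rbrakk> \<Longrightarrow> d a b \<in> opts C (E a b)\<rbrakk>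
         \<Longrightarrow> lam A (\<lambda>a. dsum (B a) (E a)) g (\<lambda>a\<in>A. ocomp C (B a) (E a) (c a) (\<lambda>b\<in>B a. d a b))
             = omap C (dsum (dprod A B) (\<lambda>z. dprod A (\<lambda>a. E a (fun_decode z a)))) (dprod_distrib A)
                (ocomp C (dprod A B) (\<lambda>z. dprod A (\<lambda>a. E a (fun_decode z a)))
                   (lam A B g (\<lambda>a\<in>A. c a))
                   (\<lambda>z\<in>dprod A B.
                      lam A (\<lambda>a. E a (fun_decode z a)) g (\<lambda>a\<in>A. d a (fun_decode z a))))"

definition E_infinity_operad_pair ::
  "'y itself \<Rightarrow> 'z itself \<Rightarrow> 'c operad_data \<Rightarrow> 'g operad_data \<Rightarrow>
   (nat set \<Rightarrow> (nat \<Rightarrow> nat set) \<Rightarrow> 'g \<Rightarrow> (nat \<Rightarrow> 'c) \<Rightarrow> 'c) \<Rightarrow> bool" where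
  "E_infinity_operad_pair TY TZ C G lam \<longleftrightarrow>
     E_infinity_operad TY C \<and> E_infinity_operad TZ G \<and> operad_pair C G lam"

definition E_infinity_ring_space ::
  "'c operad_data \<Rightarrow> 'g operad_data \<Rightarrow> (nat set \<Rightarrow> (nat \<Rightarrow> nat set) \<Rightarrow> 'g \<Rightarrow> (nat \<Rightarrow> 'c) \<Rightarrow> 'c) \<Rightarrow>
   'x topology \<Rightarrow> (nat set \<Rightarrow> 'c \<Rightarrow> (nat \<Rightarrow> 'x) \<Rightarrow> 'x) \<Rightarrow> (nat set \<Rightarrow> 'g \<Rightarrow> (nat \<Rightarrow> 'x) \<Rightarrow> 'x) \<Rightarrow> bool"
  where
  "E_infinity_ring_space C G lam X \<theta> \<xi> \<longleftrightarrow>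
     operad_algebra C X \<theta> \<and> operad_algebra G X \<xi> \<and>
     (\<forall>A B g c x.
        finite A \<and> (\<forall>a\<in>A. finite (B a)) \<and> g \<in> opts G A \<and> (\<forall>a\<in>A. c a \<in> opts C (B a)) \<and>
        (\<forall>a\<in>A. \<forall>b\<in>B a. x a b \<in> topspace X) \<longrightarrow>
        \<xi> A g (\<lambda>a\<in>A. \<theta> (B a) (c a) (\<lambda>b\<in>B a. x a b))
        = \<theta> (dprod A B) (lam A B g (\<lambda>a\<in>A. c a))
             (\<lambda>z\<in>dprod A B. \<xi> A g (\<lambda>a\<in>A. x a (fun_decode z a))))"


section \<open>The free algebra on a point\<close>

text \<open>The class in \<open>P(k)/\<Sigma>\<^sub>k\<close>, \<open>k = |D|\<close>, of an element of \<open>P(D)\<close>: its images in \<open>P(k)\<close> under all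
  bijections of \<open>D\<close> with \<open>{1, \<dots>, k}\<close>. For \<open>D = {1, \<dots>, k}\<close> this is the \<open>\<Sigma>\<^sub>k\<close>-orbit.\<close>

definition orbit_class :: "'c operad_data \<Rightarrow> nat set \<Rightarrow> 'c \<Rightarrow> 'c set" where
  "orbit_class P D c = {omap P D \<beta> c |\<beta>. bij_betw \<beta> D {1..card D}}"

definition orbit_space :: "'c operad_data \<Rightarrow> nat \<Rightarrow> 'c set topology" where
  "orbit_space P k = quot_topology (ospace P {1..k}) (orbit_class P {1..k})"

definition free_on_point :: "'c operad_data \<Rightarrow> (nat \<times> 'c set) topology" where
  "free_on_point P = sum_topology (orbit_space P) UNIV"

text \<open>The action \<open>\<xi>(g; ([c\<^sub>a])\<^sub>a) = [\<lambda>(g; (c\<^sub>a)\<^sub>a)]\<close> of \<open>G\<close> on the free \<open>C\<close>-algebra on a point.\<close>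

definition free_on_point_mult ::
  "'c operad_data \<Rightarrow> (nat set \<Rightarrow> (nat \<Rightarrow> nat set) \<Rightarrow> 'g \<Rightarrow> (nat \<Rightarrow> 'c) \<Rightarrow> 'c) \<Rightarrow>
   nat set \<Rightarrow> 'g \<Rightarrow> (nat \<Rightarrow> nat \<times> 'c set) \<Rightarrow> nat \<times> 'c set" where
  "free_on_point_mult C lam A g x =
     (let B = (\<lambda>a. {1..fst (x a)}); D = dprod A B
      in (card D, orbit_class C D (lam A B g (\<lambda>a\<in>A. SOME c. c \<in> snd (x a)))))"


section \<open>Homology with coefficients modulo \<open>p\<close>\<close>

text \<open>
  For a chain complex \<open>S\<^sub>*\<close> of free abelian groups, \<open>S n\<close> being the basis in degree \<open>n\<close>, the homology
  of \<open>S\<^sub>* \<otimes> \<int>/p = S\<^sub>*/pS\<^sub>*\<close>: integral chains which are cycles modulo \<open>p\<close>, modulo the sums of boundaries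
  and multiples of \<open>p\<close>. As in the library the groups are written multiplicatively, and the elements
  are cosets. The operations on classes below are defined on all representatives at once.
\<close>

definition mod_cycles ::
  "nat \<Rightarrow> (nat \<Rightarrow> 's set) \<Rightarrow> (nat \<Rightarrow> ('s \<Rightarrow>\<^sub>0 int) \<Rightarrow> ('s \<Rightarrow>\<^sub>0 int)) \<Rightarrow> nat \<Rightarrow> ('s \<Rightarrow>\<^sub>0 int) set" where
  "mod_cycles p S bd n =
     {c. Poly_Mapping.keys c \<subseteq> S n \<and> (\<exists>e. bd n c = frag_cmul (int p) e)}"

definition mod_boundaries ::
  "nat \<Rightarrow> (nat \<Rightarrow> 's set) \<Rightarrow> (nat \<Rightarrow> ('s \<Rightarrow>\<^sub>0 int) \<Rightarrow> ('s \<Rightarrow>\<^sub>0 int)) \<Rightarrow> nat \<Rightarrow> ('s \<Rightarrow>\<^sub>0 int) set" where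
  "mod_boundaries p S bd n =
     {bd (Suc n) d + frag_cmul (int p) e |d e.
        Poly_Mapping.keys d \<subseteq> S (Suc n) \<and> Poly_Mapping.keys e \<subseteq> S n}"

definition mod_homology ::
  "nat \<Rightarrow> (nat \<Rightarrow> 's set) \<Rightarrow> (nat \<Rightarrow> ('s \<Rightarrow>\<^sub>0 int) \<Rightarrow> ('s \<Rightarrow>\<^sub>0 int)) \<Rightarrow> nat \<Rightarrow> ('s \<Rightarrow>\<^sub>0 int) set monoid"
  where
  "mod_homology p S bd n =
     subgroup_generated (free_Abelian_group (S n)) (mod_cycles p S bd n) Mod mod_boundaries p S bd n"

text \<open>The sum over all \<open>(m, n)\<close>-shuffles. A shuffle is given by the set \<open>\<mu>\<close> of those of the \<open>m + n\<close>
  steps of a lattice path from \<open>(0, 0)\<close> to \<open>(m, n)\<close> that go in the first direction, and after \<open>i\<close>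
  steps the path is at \<open>(steps \<mu> i, steps (- \<mu>) i)\<close>.\<close>

definition steps :: "nat set \<Rightarrow> nat \<Rightarrow> nat" where
  "steps \<mu> i = card (\<mu> \<inter> {..<i})"

definition shuffle_sum :: "nat \<Rightarrow> nat \<Rightarrow> (nat set \<Rightarrow> 's) \<Rightarrow> 's \<Rightarrow>\<^sub>0 int" where
  "shuffle_sum m n F =
     (\<Sum>\<mu> | \<mu> \<subseteq> {..<m + n} \<and> card \<mu> = m.
        frag_cmul ((-1) ^ card {(i, j). i \<in> \<mu> \<and> j \<notin> \<mu> \<and> j < i}) (frag_of (F \<mu>)))"


subsection \<open>Spaces\<close>

abbreviation sing_homology :: "nat \<Rightarrow> nat \<Rightarrow> 'a topology \<Rightarrow> 'a chain set monoid" where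
  "sing_homology p n X \<equiv> mod_homology p (\<lambda>k. singular_simplex_set k X) chain_boundary n"

abbreviation sing_boundaries :: "nat \<Rightarrow> nat \<Rightarrow> 'a topology \<Rightarrow> 'a chain set" where
  "sing_boundaries p n X \<equiv> mod_boundaries p (\<lambda>k. singular_simplex_set k X) chain_boundary n"

definition sing_induced :: "nat \<Rightarrow> nat \<Rightarrow> 'b topology \<Rightarrow> ('a \<Rightarrow> 'b) \<Rightarrow> 'a chain set \<Rightarrow> 'b chain set" where
  "sing_induced p n Y f a = {chain_map n f c + w |c w. c \<in> a \<and> w \<in> sing_boundaries p n Y}"

text \<open>The simplicial operator \<open>\<alpha>\<^sup>*\<close> for a map \<open>\<alpha> : {0, \<dots>, m} \<rightarrow> {0, \<dots>, n}\<close>: composition of \<open>n\<close>-simplices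
  with the affine map of standard simplices given by \<open>\<alpha>\<close> on the vertices.\<close>

definition simplicial_op :: "nat \<Rightarrow> (nat \<Rightarrow> nat) \<Rightarrow> ((nat \<Rightarrow> real) \<Rightarrow> 'a) \<Rightarrow> (nat \<Rightarrow> real) \<Rightarrow> 'a" where
  "simplicial_op m \<alpha> \<sigma> = simplex_map m \<sigma> (oriented_simplex m (\<lambda>i j. if j = \<alpha> i then 1 else 0))"

definition sing_cross_simplex ::
  "nat \<Rightarrow> ((nat \<Rightarrow> real) \<Rightarrow> 'a) \<Rightarrow> ((nat \<Rightarrow> real) \<Rightarrow> 'b) \<Rightarrow> nat set \<Rightarrow> (nat \<Rightarrow> real) \<Rightarrow> 'a \<times> 'b" where
  "sing_cross_simplex k \<sigma> \<tau> \<mu> =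
     (\<lambda>t\<in>standard_simplex k. (simplicial_op k (steps \<mu>) \<sigma> t, simplicial_op k (steps (- \<mu>)) \<tau> t))"

definition sing_cross_chain :: "nat \<Rightarrow> nat \<Rightarrow> 'a chain \<Rightarrow> 'b chain \<Rightarrow> ('a \<times> 'b) chain" where
  "sing_cross_chain m n c d =
     frag_extend (\<lambda>\<sigma>. frag_extend (\<lambda>\<tau>. shuffle_sum m n (sing_cross_simplex (m + n) \<sigma> \<tau>)) d) c"

definition sing_cross ::
  "nat \<Rightarrow> nat \<Rightarrow> nat \<Rightarrow> 'a topology \<Rightarrow> 'b topology \<Rightarrow> 'a chain set \<Rightarrow> 'b chain set \<Rightarrow> ('a \<times> 'b) chain set"
  where
  "sing_cross p m n X Y a b =
     {sing_cross_chain m n c d + w |c d w.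
        c \<in> a \<and> d \<in> b \<and> w \<in> sing_boundaries p (m + n) (kprod X Y)}"


subsection \<open>Groups\<close>

text \<open>The homology of a discrete group, by the (unnormalised, inhomogeneous) bar complex: a list
  \<open>[g\<^sub>1, \<dots>, g\<^sub>n]\<close> is the bar symbol \<open>[g\<^sub>1|\<dots>|g\<^sub>n]\<close>.\<close>

definition bar_simplices :: "('g, 'm) monoid_scheme \<Rightarrow> nat \<Rightarrow> 'g list set" where
  "bar_simplices G n = {gs. length gs = n \<and> set gs \<subseteq> carrier G}"

definition bar_face :: "('g, 'm) monoid_scheme \<Rightarrow> nat \<Rightarrow> nat \<Rightarrow> 'g list \<Rightarrow> 'g list" where
  "bar_face G n i gs =
     (if i = 0 then tl gs else if i = n then butlast gs
      else take (i - 1) gs @ (gs ! (i - 1) \<otimes>\<^bsub>G\<^esub> gs ! i) # drop (i + 1) gs)"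

definition bar_boundary ::
  "('g, 'm) monoid_scheme \<Rightarrow> nat \<Rightarrow> ('g list \<Rightarrow>\<^sub>0 int) \<Rightarrow> ('g list \<Rightarrow>\<^sub>0 int)" where
  "bar_boundary G n c =
     (if n = 0 then 0
      else frag_extend (\<lambda>gs. \<Sum>i\<le>n. frag_cmul ((-1) ^ i) (frag_of (bar_face G n i gs))) c)"

abbreviation group_homology ::
  "nat \<Rightarrow> nat \<Rightarrow> ('g, 'm) monoid_scheme \<Rightarrow> ('g list \<Rightarrow>\<^sub>0 int) set monoid" where
  "group_homology p n G \<equiv> mod_homology p (bar_simplices G) (bar_boundary G) n"

abbreviation bar_boundaries ::
  "nat \<Rightarrow> nat \<Rightarrow> ('g, 'm) monoid_scheme \<Rightarrow> ('g list \<Rightarrow>\<^sub>0 int) set" where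
  "bar_boundaries p n G \<equiv> mod_boundaries p (bar_simplices G) (bar_boundary G) n"

definition group_induced ::
  "nat \<Rightarrow> nat \<Rightarrow> ('h, 'm) monoid_scheme \<Rightarrow> ('g \<Rightarrow> 'h) \<Rightarrow> ('g list \<Rightarrow>\<^sub>0 int) set \<Rightarrow> ('h list \<Rightarrow>\<^sub>0 int) set"
  where
  "group_induced p n H \<phi> a =
     {frag_extend (\<lambda>gs. frag_of (map \<phi> gs)) c + w |c w. c \<in> a \<and> w \<in> bar_boundaries p n H}"

definition bar_cross_simplex ::
  "('g, 'm) monoid_scheme \<Rightarrow> ('h, 'l) monoid_scheme \<Rightarrow> nat \<Rightarrow> 'g list \<Rightarrow> 'h list \<Rightarrow> nat set \<Rightarrow> ('g \<times> 'h) list"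
  where
  "bar_cross_simplex G H k gs hs \<mu> =
     map (\<lambda>i. if i \<in> \<mu> then (gs ! steps \<mu> i, \<one>\<^bsub>H\<^esub>) else (\<one>\<^bsub>G\<^esub>, hs ! steps (- \<mu>) i)) [0..<k]"

definition group_cross ::
  "nat \<Rightarrow> nat \<Rightarrow> nat \<Rightarrow> ('g, 'm) monoid_scheme \<Rightarrow> ('h, 'l) monoid_scheme \<Rightarrow>
   ('g list \<Rightarrow>\<^sub>0 int) set \<Rightarrow> ('h list \<Rightarrow>\<^sub>0 int) set \<Rightarrow> (('g \<times> 'h) list \<Rightarrow>\<^sub>0 int) set" where
  "group_cross p m n G H a b =
     {frag_extend (\<lambda>gs. frag_extend (\<lambda>hs. shuffle_sum m n (bar_cross_simplex G H (m + n) gs hs)) d) c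
        + w |c d w. c \<in> a \<and> d \<in> b \<and> w \<in> bar_boundaries p (m + n) (G \<times>\<times> H)}"


section \<open>Homology of the symmetric groups\<close>

text \<open>The degree \<open>d\<close> part of \<open>\<Oplus>\<^sub>k H\<^sub>*(\<Sigma>\<^sub>k)\<close>.\<close>

definition sym_homology :: "nat \<Rightarrow> nat \<Rightarrow> (nat \<Rightarrow> ((nat \<Rightarrow> nat) list \<Rightarrow>\<^sub>0 int) set) set" where
  "sym_homology p d =
     {r. (\<forall>k. r k \<in> carrier (group_homology p d (sym_group k))) \<and>
         finite {k. r k \<noteq> \<one>\<^bsub>group_homology p d (sym_group k)\<^esub>}}"

text \<open>
  \<open>\<psi>(r) = \<Sum>\<^sub>i r' i \<otimes> r'' i\<close>, with homogeneous \<open>r' i\<close> and \<open>r'' i\<close> of degrees \<open>d' i\<close> and \<open>d'' i\<close>. The coproduct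
  is the composite of the maps induced by the diagonals \<open>\<Sigma>\<^sub>k \<rightarrow> \<Sigma>\<^sub>k \<times> \<Sigma>\<^sub>k\<close> and the inverse of the Kuenneth
  isomorphism \<open>(\<Oplus>\<^sub>k H\<^sub>*(\<Sigma>\<^sub>k)) \<otimes> (\<Oplus>\<^sub>l H\<^sub>*(\<Sigma>\<^sub>l)) \<cong> \<Oplus>\<^bsub>k,l\<^esub> H\<^sub>*(\<Sigma>\<^sub>k \<times> \<Sigma>\<^sub>l)\<close>, which is the cross product.
\<close>

definition is_coproduct ::
  "nat \<Rightarrow> nat \<Rightarrow> (nat \<Rightarrow> ((nat \<Rightarrow> nat) list \<Rightarrow>\<^sub>0 int) set) \<Rightarrow> 'i set \<Rightarrow>
   ('i \<Rightarrow> nat) \<Rightarrow> ('i \<Rightarrow> nat \<Rightarrow> ((nat \<Rightarrow> nat) list \<Rightarrow>\<^sub>0 int) set) \<Rightarrow>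
   ('i \<Rightarrow> nat) \<Rightarrow> ('i \<Rightarrow> nat \<Rightarrow> ((nat \<Rightarrow> nat) list \<Rightarrow>\<^sub>0 int) set) \<Rightarrow> bool" where
  "is_coproduct p d r I d' r' d'' r'' \<longleftrightarrow>
     finite I \<and>
     (\<forall>i\<in>I. d' i + d'' i = d \<and> r' i \<in> sym_homology p (d' i) \<and> r'' i \<in> sym_homology p (d'' i)) \<and>
     (\<forall>k l. finprod (group_homology p d (sym_group k \<times>\<times> sym_group l))
              (\<lambda>i. group_cross p (d' i) (d'' i) (sym_group k) (sym_group l) (r' i k) (r'' i l)) I
            = (if k = l then group_induced p d (sym_group k \<times>\<times> sym_group l) (\<lambda>g. (g, g)) (r k)
               else \<one>\<^bsub>group_homology p d (sym_group k \<times>\<times> sym_group l)\<^esub>))"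

text \<open>
  \<open>H\<^sub>*(\<Sigma>\<^sub>k)\<close> is identified with \<open>H\<^sub>*(P(k)/\<Sigma>\<^sub>k)\<close>, for an \<open>E\<^sub>\<infinity>\<close>-operad \<open>P\<close>, by a classifying map. Let
  \<open>E\<Sigma>\<^sub>k\<close> be the simplicial set whose \<open>n\<close>-simplices are the lists of \<open>n + 1\<close> elements of \<open>\<Sigma>\<^sub>k\<close>. Up to
  homotopy there is exactly one equivariant simplicial map \<open>f\<close> from \<open>E\<Sigma>\<^sub>k\<close> to the singular simplicial
  set of \<open>P(k)\<close>; on orbits it gives a map from the bar complex, \<open>[g\<^sub>1|\<dots>|g\<^sub>n]\<close> being the orbit of
  \<open>(1, g\<^sub>1, g\<^sub>1g\<^sub>2, \<dots>, g\<^sub>1\<cdots>g\<^sub>n)\<close>.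
\<close>

definition classifying_map ::
  "'c operad_data \<Rightarrow> nat \<Rightarrow> ((nat \<Rightarrow> nat) list \<Rightarrow> (nat \<Rightarrow> real) \<Rightarrow> 'c) \<Rightarrow> bool" where
  "classifying_map P k f \<longleftrightarrow>
     (\<forall>n gs. length gs = Suc n \<and> set gs \<subseteq> carrier (sym_group k) \<longrightarrow>
        singular_simplex n (ospace P {1..k}) (f gs) \<and>
        (\<forall>m \<alpha>. mono_on {..m} \<alpha> \<and> \<alpha> ` {..m} \<subseteq> {..n} \<longrightarrow>
           f (map (\<lambda>i. gs ! \<alpha> i) [0..<Suc m]) = simplicial_op m \<alpha> (f gs)) \<and>
        (\<forall>g \<in> carrier (sym_group k).
           f (map (\<lambda>h. g \<otimes>\<^bsub>sym_group k\<^esub> h) gs) = simplex_map n (omap P {1..k} g) (f gs)))"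

definition partial_products :: "('g, 'm) monoid_scheme \<Rightarrow> 'g list \<Rightarrow> 'g list" where
  "partial_products G gs =
     map (\<lambda>i. foldr (\<lambda>g h. g \<otimes>\<^bsub>G\<^esub> h) (take i gs) \<one>\<^bsub>G\<^esub>) [0..<Suc (length gs)]"

definition sym_class ::
  "nat \<Rightarrow> nat \<Rightarrow> 'c operad_data \<Rightarrow> nat \<Rightarrow> ((nat \<Rightarrow> nat) list \<Rightarrow>\<^sub>0 int) set \<Rightarrow> 'c set chain set" where
  "sym_class p d P k a =
     (let f = (SOME f. classifying_map P k f) in
      {frag_extend (\<lambda>gs. frag_of (simplex_map d (orbit_class P {1..k})
                                    (f (partial_products (sym_group k) gs)))) c + w |c w.
         c \<in> a \<and> w \<in> sing_boundaries p d (orbit_space P k)})"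

text \<open>The identification of \<open>\<Oplus>\<^sub>k H\<^sub>d(\<Sigma>\<^sub>k)\<close> with \<open>H\<^sub>d(\<Squnion>\<^sub>k P(k)/\<Sigma>\<^sub>k)\<close>.\<close>

definition point_class ::
  "nat \<Rightarrow> nat \<Rightarrow> 'c operad_data \<Rightarrow> (nat \<Rightarrow> ((nat \<Rightarrow> nat) list \<Rightarrow>\<^sub>0 int) set) \<Rightarrow> (nat \<times> 'c set) chain set"
  where
  "point_class p d P r =
     gfinprod (sing_homology p d (free_on_point P))
       (\<lambda>k. sing_induced p d (free_on_point P) (\<lambda>c. (k, c)) (sym_class p d P k (r k))) UNIV"


section \<open>The operations\<close>

text \<open>
  For a \<open>P\<close>-algebra \<open>X\<close>, the action of \<open>H\<^sub>d(\<Squnion>\<^sub>k P(k)/\<Sigma>\<^sub>k)\<close> on \<open>H\<^sub>n(X)\<close> induced by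
  \<open>([c], x) \<mapsto> \<theta>(c; x, \<dots>, x)\<close>. On the summand \<open>H\<^sub>d(P(k)/\<Sigma>\<^sub>k)\<close> it is induced by the restriction of this
  map to \<open>P(k)/\<Sigma>\<^sub>k \<times> X\<close>. The same operation written with \<open>r \<in> \<Oplus>\<^sub>k H\<^sub>d(\<Sigma>\<^sub>k)\<close> is \<open>sym_op\<close>, which is
  \<open>r \<circ> x\<close> for \<open>P = C\<close> and \<open>r \<sharp> x\<close> for \<open>P = G\<close>.
\<close>

definition class_op ::
  "nat \<Rightarrow> 'c operad_data \<Rightarrow> 'x topology \<Rightarrow> (nat set \<Rightarrow> 'c \<Rightarrow> (nat \<Rightarrow> 'x) \<Rightarrow> 'x) \<Rightarrow> nat \<Rightarrow> nat \<Rightarrow>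
   (nat \<times> 'c set) chain set \<Rightarrow> 'x chain set \<Rightarrow> 'x chain set" where
  "class_op p P X \<theta> d n a x =
     sing_induced p (d + n) X (\<lambda>((k, c), y). \<theta> {1..k} (SOME c'. c' \<in> c) (\<lambda>i\<in>{1..k}. y))
       (sing_cross p d n (free_on_point P) X a x)"

definition sym_op ::
  "nat \<Rightarrow> 'c operad_data \<Rightarrow> 'x topology \<Rightarrow> (nat set \<Rightarrow> 'c \<Rightarrow> (nat \<Rightarrow> 'x) \<Rightarrow> 'x) \<Rightarrow> nat \<Rightarrow> nat \<Rightarrow>
   (nat \<Rightarrow> ((nat \<Rightarrow> nat) list \<Rightarrow>\<^sub>0 int) set) \<Rightarrow> 'x chain set \<Rightarrow> 'x chain set" where
  "sym_op p P X \<theta> d n r x = class_op p P X \<theta> d n (point_class p d P r) x"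

text \<open>The product \<open>r \<sharp> s\<close>, as an element of \<open>H\<^sub>*(\<Squnion>\<^sub>k C(k)/\<Sigma>\<^sub>k) = \<Oplus>\<^sub>k H\<^sub>*(\<Sigma>\<^sub>k)\<close>.\<close>

definition sym_sharp ::
  "nat \<Rightarrow> 'c operad_data \<Rightarrow> 'g operad_data \<Rightarrow> (nat set \<Rightarrow> (nat \<Rightarrow> nat set) \<Rightarrow> 'g \<Rightarrow> (nat \<Rightarrow> 'c) \<Rightarrow> 'c) \<Rightarrow>
   nat \<Rightarrow> nat \<Rightarrow> (nat \<Rightarrow> ((nat \<Rightarrow> nat) list \<Rightarrow>\<^sub>0 int) set) \<Rightarrow> (nat \<Rightarrow> ((nat \<Rightarrow> nat) list \<Rightarrow>\<^sub>0 int) set) \<Rightarrow>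
   (nat \<times> 'c set) chain set" where
  "sym_sharp p C G lam d e r s =
     sym_op p G (free_on_point C) (free_on_point_mult C lam) d e r (point_class p e C s)"

end

theory Submission
  imports Defs "HOL-Analysis.Abstract_Topological_Spaces" "HOL-Analysis.Sum_Topology"
begin

text \<open>
  Both sides are values of one map on classes of product spaces. Write \<open>F\<^sub>\<theta>\<close>, \<open>F\<^sub>\<xi>\<close>, \<open>F\<^sub>\<lambda>\<close> for the maps
  \<open>([c], y) \<mapsto> \<theta>(c; y, \<dots>, y)\<close>, \<open>([g], y) \<mapsto> \<xi>(g; y, \<dots>, y)\<close>, \<open>([g], [c]) \<mapsto> [\<lambda>(g; c, \<dots>, c)]\<close>. Evaluating the
  distributivity law of a ring space at constant families gives the identity of points
  \<open>F\<^sub>\<xi>(u, F\<^sub>\<theta>(v, y)) = F\<^sub>\<theta>(F\<^sub>\<lambda>(u, v), F\<^sub>\<xi>(u, y))\<close>, in which \<open>u\<close> occurs twice on the right. So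
  \<open>r \<sharp> (s \<circ> x)\<close> is obtained from the diagonal class of \<open>r\<close>, which is \<open>\<Sum> r' \<times> r''\<close>, by crossing
  with \<open>s \<times> x\<close>, interchanging \<open>r''\<close> and \<open>s\<close>, and applying \<open>F\<^sub>\<theta> \<circ> (F\<^sub>\<lambda> \<times> F\<^sub>\<xi>)\<close>. The interchange
  holds on the level of shuffle chains, with the sign \<open>(-1)^(deg(s) deg(r''))\<close>.

  Continuity of \<open>F\<^sub>\<theta>\<close>, \<open>F\<^sub>\<xi>\<close> and \<open>F\<^sub>\<lambda>\<close> on k-products is not needed: it is enough that they send
  singular simplices to singular simplices, where lifting a pair of maps along the orbit maps is a
  problem over a compact Hausdorff space.
\<close>

section \<open>Chains on lattice paths\<close>

text \<open>The coproduct of \<open>r\<close> is given in the bar homology of the groups, whereas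
  the operations act on singular classes, so the diagonal class has to be carried from one side to
  the other. This works on chains because a classifying map commutes with all simplicial operators:
  it turns the shuffle product of bar chains into the shuffle product of singular chains exactly,
  without a chain homotopy. The price is that such a map, which \<open>sym_class\<close> picks with
  \<open>SOME\<close>, has to be constructed; this is where the contractibility of
  \<open>P(k)\<close> enters. Naturality of the shuffle product, the interchange and the identity of
  points are equalities of chains, so once representatives are chosen only the coproduct formula
  introduces a boundary. One Leibniz rule serves both complexes: it is proved for lists of vertices
  and transported to any simplicial set. As classes modulo \<open>p\<close> are represented by
  integral chains whose boundary is merely divisible by \<open>p\<close>, the products have to
  respect this weaker kind of cycle.\<close>

lemma frag_extend_frag_extend:
  "frag_extend f (frag_extend g c) = frag_extend (\<lambda>x. frag_extend f (g x)) c"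
  by (rule frag_induction[where S=UNIV and P="\<lambda>c. frag_extend f (frag_extend g c) = frag_extend (\<lambda>x. frag_extend f (g x)) c"])
     (simp_all add: frag_extend_diff)

lemma frag_extend_fun_add:
  "frag_extend (\<lambda>x. f x + g x) c = frag_extend f c + frag_extend g c"
  by (simp add: frag_extend_def frag_cmul_distrib2 sum.distrib)

lemma frag_extend_fun_cmul:
  "frag_extend (\<lambda>x. frag_cmul k (f x)) c = frag_cmul k (frag_extend f c)"
  by (simp add: frag_extend_def frag_cmul_sum mult.commute)

lemma frag_extend_fun_sum:
  "frag_extend (\<lambda>x. \<Sum>i\<in>I. f i x) c = (\<Sum>i\<in>I. frag_extend (f i) c)"
  by (simp add: frag_extend_def frag_cmul_sum sum.swap[of _ I])

lemma frag_extend_swap: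
  "frag_extend (\<lambda>x. frag_extend (f x) d) c = frag_extend (\<lambda>y. frag_extend (\<lambda>x. f x y) c) d"
  unfolding frag_extend_def frag_cmul_sum by (subst sum.swap) (simp add: mult.commute)

lemma frag_extend_ident: "frag_extend frag_of c = c"
  using frag_expansion by metis

text \<open>Lists of vertices are written in reverse order, so that the last vertex is the head; the
  boundary is augmented, the empty list being the simplex of dimension \<open>-1\<close>.\<close>

fun vertex_boundary :: "'v list \<Rightarrow> 'v list \<Rightarrow>\<^sub>0 int" where
  "vertex_boundary [] = 0"
| "vertex_boundary (v # vs) =
     frag_extend (\<lambda>l. frag_of (v # l)) (vertex_boundary vs) + frag_cmul ((-1) ^ length vs) (frag_of vs)"

lemma keys_add_subset:
  assumes "Poly_Mapping.keys a \<subseteq> S" "Poly_Mapping.keys b \<subseteq> S"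
  shows "Poly_Mapping.keys (a + b) \<subseteq> S"
  using assms keys_add[of a b] by blast

lemma keys_extend_subset:
  assumes "\<And>x. x \<in> Poly_Mapping.keys c \<Longrightarrow> Poly_Mapping.keys (f x) \<subseteq> S"
  shows "Poly_Mapping.keys (frag_extend f c) \<subseteq> S"
  using keys_frag_extend[of f c] assms by blast

lemma keys_cmul_subset:
  assumes "Poly_Mapping.keys a \<subseteq> S"
  shows "Poly_Mapping.keys (frag_cmul k a) \<subseteq> S"
  using assms by auto

lemma keys_sum_subset:
  assumes "\<And>i. i \<in> I \<Longrightarrow> Poly_Mapping.keys (a i) \<subseteq> S"
  shows "Poly_Mapping.keys (sum a I) \<subseteq> S"
  using keys_sum[of a I] assms by blast

lemma length_vertex_boundary:
  "Poly_Mapping.keys (vertex_boundary vs) \<subseteq> {l. Suc (length l) = length vs}"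
proof (induction vs)
  case (Cons v vs)
  show ?case
    unfolding vertex_boundary.simps
    by (intro keys_add_subset keys_extend_subset keys_cmul_subset) (use Cons in auto)
qed simp

text \<open>The boundary of \<open>vs\<close> arises twice from the face opposite the last vertex,
  with the signs of \<open>length vs - 1\<close> and of \<open>length vs\<close>, and
  cancels.\<close>

lemma vertex_boundary_boundary: "frag_extend vertex_boundary (vertex_boundary vs) = 0"
proof (induction vs)
  case (Cons v vs)
  have "frag_extend (\<lambda>l. frag_cmul ((-1) ^ length l) (frag_of l)) (vertex_boundary vs)
      = frag_extend (\<lambda>l. frag_cmul ((-1) ^ (length vs - 1)) (frag_of l)) (vertex_boundary vs)"
    using length_vertex_boundary[of vs]
    by (intro frag_extend_eq) (metis (mono_tags, lifting) diff_Suc_1 mem_Collect_eq subsetD)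
  also have "\<dots> = frag_cmul ((-1) ^ (length vs - 1)) (vertex_boundary vs)"
    by (simp add: frag_extend_fun_cmul frag_extend_ident)
  finally have 1: "frag_extend (\<lambda>l. frag_cmul ((-1) ^ length l) (frag_of l)) (vertex_boundary vs)
     = frag_cmul ((-1) ^ (length vs - 1)) (vertex_boundary vs)" .
  have 2: "frag_extend (\<lambda>l. frag_extend (\<lambda>l. frag_of (v # l)) (vertex_boundary l)) (vertex_boundary vs) = 0"
    using Cons by (simp flip: frag_extend_frag_extend)
  show ?case
  proof (cases "vs = []")
    case False
    then have "(-1 :: int) ^ length vs = - ((-1) ^ (length vs - 1))"
      by (cases vs) auto
    then show ?thesis
      using 1 2 by (simp add: frag_extend_add frag_extend_frag_extend frag_extend_fun_add frag_extend_cmul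
          flip: frag_cmul_distrib)
  qed simp
qed simp

text \<open>The shuffle product of two simplices as a signed sum over monotone lattice paths, by
  recursion on the last step. A last step in the first direction comes after all
  \<open>length ys\<close> steps in the second direction; each such pair of steps is an inversion,
  whence the sign. An empty list of vertices carries no path, so it gives 0.\<close>

fun lattice_chain :: "'a list \<Rightarrow> 'b list \<Rightarrow> ('a \<times> 'b) list \<Rightarrow>\<^sub>0 int" where
  "lattice_chain [] ys = 0"
| "lattice_chain (x # xs) [] = 0"
| "lattice_chain (x # xs) (y # ys) =
     (if xs = [] \<and> ys = [] then frag_of [(x, y)]
      else frag_extend (\<lambda>l. frag_of ((x, y) # l))
             (frag_cmul ((-1) ^ length ys) (lattice_chain xs (y # ys)) + lattice_chain (x # xs) ys))"

lemma lattice_chain_Nil2 [simp]: "lattice_chain xs [] = 0"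
  by (cases xs) auto

lemma keys_lattice_chain:
  "Poly_Mapping.keys (lattice_chain xs ys) \<subseteq>
     {l. Suc (length l) = length xs + length ys \<and> set l \<subseteq> set xs \<times> set ys}"
proof (induction xs ys rule: lattice_chain.induct)
  case (3 x xs y ys)
  show ?case
  proof (cases "xs = [] \<and> ys = []")
    case False
    then have "Poly_Mapping.keys (lattice_chain xs (y # ys)) \<union> Poly_Mapping.keys (lattice_chain (x # xs) ys)
        \<subseteq> {l. length l = length xs + length ys \<and> set l \<subseteq> set (x # xs) \<times> set (y # ys)}"
      using 3[OF False] by fastforce
    then have "Poly_Mapping.keys (frag_cmul ((-1) ^ length ys) (lattice_chain xs (y # ys)) + lattice_chain (x # xs) ys)
         \<subseteq> {l. length l = length xs + length ys \<and> set l \<subseteq> set (x # xs) \<times> set (y # ys)}"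
      by (intro keys_add_subset keys_cmul_subset) auto
    then have "Poly_Mapping.keys (frag_extend (\<lambda>l. frag_of ((x, y) # l))
        (frag_cmul ((-1) ^ length ys) (lattice_chain xs (y # ys)) + lattice_chain (x # xs) ys))
       \<subseteq> {l. Suc (length l) = length (x # xs) + length (y # ys) \<and> set l \<subseteq> set (x # xs) \<times> set (y # ys)}"
      by (intro keys_extend_subset) auto
    then show ?thesis
      using False by (simp only: lattice_chain.simps if_False)
  qed simp
qed auto

lemma lattice_chain_map:
  "lattice_chain (map f xs) (map g ys) = frag_extend (\<lambda>l. frag_of (map (map_prod f g) l)) (lattice_chain xs ys)"
  by (induction xs ys rule: lattice_chain.induct)
     (simp_all add: frag_extend_frag_extend frag_extend_add frag_extend_cmul)

lemma boundary_cons_chain: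
  assumes "\<And>l. l \<in> Poly_Mapping.keys c \<Longrightarrow> length l = k"
  shows "frag_extend vertex_boundary (frag_extend (\<lambda>l. frag_of (v # l)) c)
       = frag_extend (\<lambda>l. frag_of (v # l)) (frag_extend vertex_boundary c) + frag_cmul ((-1) ^ k) c"
proof -
  have "frag_extend (\<lambda>l. frag_cmul ((-1) ^ length l) (frag_of l)) c
      = frag_extend (\<lambda>l. frag_cmul ((-1) ^ k) (frag_of l)) c"
    by (rule frag_extend_eq) (simp add: assms)
  then show ?thesis
    by (simp add: frag_extend_frag_extend frag_extend_fun_add frag_extend_fun_cmul frag_extend_ident)
qed

text \<open>The hypothesis keeps away the path with a single vertex, for which the recursive clause
  of \<open>lattice_chain\<close> fails.\<close>

lemma lattice_chain_cons_left:
  assumes "\<And>l. l \<in> Poly_Mapping.keys c \<Longrightarrow> l \<noteq> [] \<or> ys \<noteq> []"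
  shows "frag_extend (\<lambda>l. lattice_chain l (y # ys)) (frag_extend (\<lambda>l. frag_of (x # l)) c)
    = frag_extend (\<lambda>l. frag_of ((x, y) # l))
        (frag_cmul ((-1) ^ length ys) (frag_extend (\<lambda>l. lattice_chain l (y # ys)) c)
         + frag_extend (\<lambda>l. lattice_chain (x # l) ys) c)"
proof -
  have "frag_extend (\<lambda>l. lattice_chain (x # l) (y # ys)) c
      = frag_extend (\<lambda>l. frag_extend (\<lambda>l. frag_of ((x, y) # l))
             (frag_cmul ((-1) ^ length ys) (lattice_chain l (y # ys)) + lattice_chain (x # l) ys)) c"
    by (rule frag_extend_eq) (use assms in auto)
  then show ?thesis
    by (simp add: frag_extend_frag_extend frag_extend_fun_add frag_extend_fun_cmul frag_extend_add frag_extend_cmul)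
qed

lemma lattice_chain_cons_right:
  assumes "\<And>l. l \<in> Poly_Mapping.keys c \<Longrightarrow> (xs \<noteq> [] \<or> l \<noteq> []) \<and> length l = k"
  shows "frag_extend (\<lambda>l. lattice_chain (x # xs) l) (frag_extend (\<lambda>l. frag_of (y # l)) c)
    = frag_extend (\<lambda>l. frag_of ((x, y) # l))
        (frag_cmul ((-1) ^ k) (frag_extend (\<lambda>l. lattice_chain xs (y # l)) c)
         + frag_extend (\<lambda>l. lattice_chain (x # xs) l) c)"
proof -
  have "frag_extend (\<lambda>l. lattice_chain (x # xs) (y # l)) c
      = frag_extend (\<lambda>l. frag_extend (\<lambda>l. frag_of ((x, y) # l))
             (frag_cmul ((-1) ^ k) (lattice_chain xs (y # l)) + lattice_chain (x # xs) l)) c"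
    by (rule frag_extend_eq) (use assms in auto)
  then show ?thesis
    by (simp add: frag_extend_frag_extend frag_extend_fun_add frag_extend_fun_cmul frag_extend_add frag_extend_cmul)
qed

text \<open>Faces that omit a corner of a path cancel in pairs: the two ways round a unit square
  share this face and differ by one inversion. The other faces assemble to the two products. The
  induction treats the last square, whose diagonal gives the terms in \<open>P\<close>. Two single
  vertices are excluded because the augmented boundary of a point is the empty list, while the
  right-hand side is 0 there.\<close>

lemma lattice_chain_boundary:
  assumes "\<not> (length xs = 1 \<and> length ys = 1)"
  shows "frag_extend vertex_boundary (lattice_chain xs ys)
       = frag_extend (\<lambda>l. lattice_chain l ys) (vertex_boundary xs)
         + frag_cmul ((-1) ^ (length xs - 1)) (frag_extend (lattice_chain xs) (vertex_boundary ys))"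
  using assms
proof (induction xs ys rule: lattice_chain.induct)
  case (1 ys)
  then show ?case by (simp add: frag_extend_eq_0)
next
  case (2 x xs)
  then show ?case by (simp add: frag_extend_eq_0)
next
  case (3 x xs y ys)
  define m n where "m = length xs" and "n = length ys"
  have ne: "\<not> (xs = [] \<and> ys = [])" using 3(3) by auto
  define app where "app = frag_extend (\<lambda>l. frag_of ((x, y) # l))"
  have app_add: "app (a + b) = app a + app b" and app_cmul: "app (frag_cmul k a) = frag_cmul k (app a)"
    for a b k by (simp_all add: app_def frag_extend_add frag_extend_cmul)
  \<comment> \<open>The two smallest cases are computed, as the induction hypothesis would be
    required for two single vertices.\<close>
  consider (a) "m = 1" "n = 0" | (b) "m = 0" "n = 1" | (c) "\<not> (m = 1 \<and> n = 0)" "\<not> (m = 0 \<and> n = 1)"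
    by blast
  then show ?case
  proof cases
    case a
    then obtain x' where "xs = [x']" "ys = []" by (metis m_def n_def One_nat_def length_0_conv length_Suc_conv)
    then show ?thesis by (simp add: frag_extend_add frag_extend_minus frag_extend_cmul frag_extend_diff)
  next
    case b
    then obtain x' where "ys = [x']" "xs = []" by (metis m_def n_def One_nat_def length_0_conv length_Suc_conv)
    then show ?thesis by (simp add: frag_extend_add frag_extend_minus frag_extend_cmul frag_extend_diff)
  next
    case c
    define A B where "A = lattice_chain xs (y # ys)" and "B = lattice_chain (x # xs) ys"
    define P where "P = lattice_chain xs ys"
    define A1 where "A1 = frag_extend (\<lambda>l. lattice_chain l (y # ys)) (vertex_boundary xs)"
    define A2 where "A2 = frag_extend (\<lambda>l. lattice_chain xs (y # l)) (vertex_boundary ys)"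
    define B1 where "B1 = frag_extend (\<lambda>l. lattice_chain (x # l) ys) (vertex_boundary xs)"
    define B2 where "B2 = frag_extend (lattice_chain (x # xs)) (vertex_boundary ys)"
    have dA: "frag_extend vertex_boundary A =
        A1 + frag_cmul ((-1) ^ (m - 1)) (A2 + frag_cmul ((-1) ^ n) P)"
      using 3(1)[OF ne] c
      by (simp add: A_def A1_def A2_def P_def m_def n_def frag_extend_add frag_extend_cmul frag_extend_frag_extend)
    have dB: "frag_extend vertex_boundary B =
        B1 + frag_cmul ((-1) ^ m) P + frag_cmul ((-1) ^ m) B2"
      using 3(2)[OF ne] c
      by (simp add: B_def B1_def B2_def P_def m_def n_def frag_extend_add frag_extend_cmul frag_extend_frag_extend)
    have lenA: "length l = m + n" if "l \<in> Poly_Mapping.keys A" for l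
      using keys_lattice_chain[of xs "y # ys"] that by (auto simp: A_def m_def n_def)
    have lenB: "length l = m + n" if "l \<in> Poly_Mapping.keys B" for l
      using keys_lattice_chain[of "x # xs" ys] that by (auto simp: B_def m_def n_def)
    have len: "length l = m + n" if "l \<in> Poly_Mapping.keys (frag_cmul ((-1) ^ n) A + B)" for l
      using that keys_add[of "frag_cmul ((-1) ^ n) A" B] lenA lenB by auto
    have "frag_extend vertex_boundary (lattice_chain (x # xs) (y # ys))
        = frag_extend vertex_boundary (app (frag_cmul ((-1) ^ n) A + B))"
      using ne by (auto simp: app_def A_def B_def n_def)
    also have "\<dots> = app (frag_extend vertex_boundary (frag_cmul ((-1) ^ n) A + B))
          + frag_cmul ((-1) ^ (m + n)) (frag_cmul ((-1) ^ n) A + B)"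
      unfolding app_def by (rule boundary_cons_chain) (use len in auto)
    finally have L: "frag_extend vertex_boundary (lattice_chain (x # xs) (y # ys))
        = app (frag_cmul ((-1) ^ n) (A1 + frag_cmul ((-1) ^ (m - 1)) (A2 + frag_cmul ((-1) ^ n) P))
               + (B1 + frag_cmul ((-1) ^ m) P + frag_cmul ((-1) ^ m) B2))
          + frag_cmul ((-1) ^ (m + n)) (frag_cmul ((-1) ^ n) A + B)"
      by (simp add: frag_extend_add frag_extend_cmul dA dB)
    have R1: "frag_extend (\<lambda>l. lattice_chain l (y # ys)) (vertex_boundary (x # xs))
        = app (frag_cmul ((-1) ^ n) A1 + B1) + frag_cmul ((-1) ^ m) A"
    proof -
      have "frag_extend (\<lambda>l. lattice_chain l (y # ys)) (frag_extend (\<lambda>l. frag_of (x # l)) (vertex_boundary xs))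
          = app (frag_cmul ((-1) ^ n) A1 + B1)"
        unfolding app_def A1_def B1_def n_def
        by (rule lattice_chain_cons_left) (use length_vertex_boundary[of xs] c in \<open>auto simp: m_def n_def\<close>)
      then show ?thesis
        by (simp add: frag_extend_add frag_extend_cmul A_def m_def)
    qed
    have R2: "frag_extend (lattice_chain (x # xs)) (vertex_boundary (y # ys))
        = app (frag_cmul ((-1) ^ (n - 1)) A2 + B2) + frag_cmul ((-1) ^ n) B"
    proof -
      have "frag_extend (lattice_chain (x # xs)) (frag_extend (\<lambda>l. frag_of (y # l)) (vertex_boundary ys))
          = app (frag_cmul ((-1) ^ (n - 1)) A2 + B2)"
        unfolding app_def A2_def B2_def n_def
        by (rule lattice_chain_cons_right) (use length_vertex_boundary[of ys] c in \<open>auto simp: m_def n_def\<close>)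
      then show ?thesis
        by (simp add: frag_extend_add frag_extend_cmul B_def n_def)
    qed
    \<comment> \<open>The exponents \<open>m - 1\<close> and \<open>n - 1\<close> are truncated
      subtractions; in dimension 0 the chains that they multiply vanish.\<close>
    have z: "m = 0 \<Longrightarrow> A1 = 0 \<and> A2 = 0 \<and> P = 0 \<and> B1 = 0" "n = 0 \<Longrightarrow> A2 = 0 \<and> P = 0 \<and> B2 = 0"
      by (auto simp: A1_def A2_def P_def B1_def B2_def m_def n_def frag_extend_eq_0)
    have "frag_cmul ((-1) ^ n) A1 + frag_cmul ((-1) ^ n * (-1) ^ (m - 1)) A2
        = frag_cmul ((-1) ^ n) A1 + frag_cmul ((-1) ^ m * (-1) ^ (n - 1)) A2"
      using z by (cases m; cases n) (auto simp: mult.commute)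
    moreover have "frag_cmul ((-1) ^ n * ((-1) ^ (m - 1) * (-1) ^ n)) P + frag_cmul ((-1) ^ m) P = 0"
    proof -
      have "(-1 :: int) ^ n * ((-1) ^ (m - 1) * (-1) ^ n) = (-1) ^ (m - 1)"
        by (cases "even n") auto
      then show ?thesis
        using z by (cases m) (auto simp flip: frag_cmul_distrib)
    qed
    ultimately have eq: "frag_cmul ((-1) ^ n) (A1 + frag_cmul ((-1) ^ (m - 1)) (A2 + frag_cmul ((-1) ^ n) P))
               + (B1 + frag_cmul ((-1) ^ m) P + frag_cmul ((-1) ^ m) B2)
        = (frag_cmul ((-1) ^ n) A1 + B1) + frag_cmul ((-1) ^ m) (frag_cmul ((-1) ^ (n - 1)) A2 + B2)"
      by (simp add: frag_cmul_distrib2 add_eq_0_iff algebra_simps)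
    show ?thesis
      unfolding L R1 R2 eq app_add app_cmul
      by (simp add: frag_cmul_distrib2 power_add m_def algebra_simps flip: power_mult_distrib)
  qed
qed

section \<open>Faces and monotonicity of lists of vertices\<close>

definition remove_vertex :: "nat \<Rightarrow> 'v list \<Rightarrow> 'v list" where
  "remove_vertex i vs = rev (take i (rev vs) @ drop (Suc i) (rev vs))"

text \<open>Positions count from the first vertex, which is the end of the list. Removing the head
  is thus the last face, in agreement with the sign in the recursion, and \<open>i\<close> becomes
  the index of a simplicial face.\<close>

lemma vertex_boundary_sum:
  "vertex_boundary vs = (\<Sum>i<length vs. frag_cmul ((-1) ^ i) (frag_of (remove_vertex i vs)))"
proof (induction vs)
  case (Cons v vs)
  have "frag_extend (\<lambda>l. frag_of (v # l)) (vertex_boundary vs)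
      = (\<Sum>i<length vs. frag_cmul ((-1) ^ i) (frag_of (remove_vertex i (v # vs))))"
    unfolding Cons
    by (subst frag_extend_sum) (auto intro!: sum.cong simp: frag_extend_cmul remove_vertex_def)
  then show ?case
    by (simp add: remove_vertex_def)
qed simp

lemma sorted_vertex_boundary:
  assumes "sorted (rev vs)"
  shows "Poly_Mapping.keys (vertex_boundary vs) \<subseteq> {l. sorted (rev l) \<and> set l \<subseteq> set vs}"
  using assms
proof (induction vs)
  case (Cons v vs)
  show ?case
    unfolding vertex_boundary.simps
    by (intro keys_add_subset keys_extend_subset keys_cmul_subset) (use Cons in \<open>auto simp: sorted_append\<close>)
qed simp

lemma length_remove_vertex: "i < length vs \<Longrightarrow> length (remove_vertex i vs) = length vs - 1"
  by (simp add: remove_vertex_def)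

lemma map_remove_vertex: "map f (remove_vertex i vs) = remove_vertex i (map f vs)"
  by (simp add: remove_vertex_def rev_map take_map drop_map)

text \<open>The coface map of the simplex category with index \<open>i\<close>: the increasing map
  that misses \<open>i\<close>.\<close>

definition skip :: "nat \<Rightarrow> nat \<Rightarrow> nat" where
  "skip i j = (if j < i then j else Suc j)"

lemma mono_on_skip: "mono_on A (skip i)"
  by (auto simp: mono_on_def skip_def)

lemma skip_into: "1 \<le> n \<Longrightarrow> skip i ` {..n - 1} \<subseteq> {..n}"
  by (auto simp: skip_def)

lemma nth_rev_remove_vertex:
  assumes "i < length vs" "Suc j < length vs"
  shows "rev (remove_vertex i vs) ! j = rev vs ! skip i j"
  using assms by (auto simp: remove_vertex_def skip_def nth_append min_def)

lemma sorted_lattice_chain: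
  assumes "sorted (rev xs)" "sorted (rev ys)"
  shows "Poly_Mapping.keys (lattice_chain xs ys) \<subseteq> {l. sorted (rev (map fst l)) \<and> sorted (rev (map snd l))}"
  using assms
proof (induction xs ys rule: lattice_chain.induct)
  case (3 x xs y ys)
  show ?case
  proof (cases "xs = [] \<and> ys = []")
    case False
    \<comment> \<open>Sortedness is carried together with the containment of the vertices: the
      latter bounds every vertex of the path by \<open>(x, y)\<close>, so that \<open>(x, y)\<close>
      may be put in front.\<close>
    define W where "W = {l. (sorted (rev (map fst l)) \<and> sorted (rev (map snd l))) \<and> set l \<subseteq> set (x # xs) \<times> set (y # ys)}"
    have 1: "Poly_Mapping.keys (lattice_chain xs (y # ys)) \<subseteq> W"
      unfolding W_def using 3(1)[OF False] 3(3,4) keys_lattice_chain[of xs "y # ys"]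
      by (fastforce simp: sorted_append)
    have 2: "Poly_Mapping.keys (lattice_chain (x # xs) ys) \<subseteq> W"
      unfolding W_def using 3(2)[OF False] 3(3,4) keys_lattice_chain[of "x # xs" ys]
      by (fastforce simp: sorted_append)
    have k: "Poly_Mapping.keys (frag_cmul ((-1) ^ length ys) (lattice_chain xs (y # ys)) + lattice_chain (x # xs) ys) \<subseteq> W"
      using 1 2 by (intro keys_add_subset keys_cmul_subset)
    have "Poly_Mapping.keys (frag_extend (\<lambda>l. frag_of ((x, y) # l))
        (frag_cmul ((-1) ^ length ys) (lattice_chain xs (y # ys)) + lattice_chain (x # xs) ys))
       \<subseteq> {l. sorted (rev (map fst l)) \<and> sorted (rev (map snd l))}"
    proof (rule keys_extend_subset)
      fix l assume "l \<in> Poly_Mapping.keys (frag_cmul ((-1) ^ length ys) (lattice_chain xs (y # ys)) + lattice_chain (x # xs) ys)"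
      then have "l \<in> W" using k by blast
      then show "Poly_Mapping.keys (frag_of ((x, y) # l)) \<subseteq> {l. sorted (rev (map fst l)) \<and> sorted (rev (map snd l))}"
        using "3.prems" by (force simp: W_def sorted_append)
    qed
    then show ?thesis
      using False by (simp only: lattice_chain.simps if_False)
  qed simp
qed auto

section \<open>Shuffles\<close>

definition inversions :: "nat set \<Rightarrow> nat" where
  "inversions \<mu> = card {(i, j). i \<in> \<mu> \<and> j \<notin> \<mu> \<and> j < i}"

lemma shuffle_sum_inversions:
  "shuffle_sum m n F =
     (\<Sum>\<mu> | \<mu> \<subseteq> {..<m + n} \<and> card \<mu> = m. frag_cmul ((-1) ^ inversions \<mu>) (frag_of (F \<mu>)))"
  by (simp add: shuffle_sum_def inversions_def)

lemma shuffle_sum_cong: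
  assumes "\<And>\<mu>. \<lbrakk>\<mu> \<subseteq> {..<m + n}; card \<mu> = m\<rbrakk> \<Longrightarrow> F \<mu> = F' \<mu>"
  shows "shuffle_sum m n F = shuffle_sum m n F'"
  unfolding shuffle_sum_def by (rule sum.cong) (use assms in auto)

lemma finite_shuffles [simp]: "finite {\<mu>. \<mu> \<subseteq> {..<k::nat} \<and> P \<mu>}"
  by (rule finite_subset[of _ "Pow {..<k}"]) auto

lemma frag_extend_shuffle_sum:
  "frag_extend (\<lambda>x. frag_of (f x)) (shuffle_sum m n F) = shuffle_sum m n (f \<circ> F)"
  unfolding shuffle_sum_def
  by (subst frag_extend_sum) (auto simp: frag_extend_cmul intro!: sum.cong)

lemma frag_extend_shuffle_sum':
  "frag_extend f (shuffle_sum m n F)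
    = (\<Sum>\<mu> | \<mu> \<subseteq> {..<m + n} \<and> card \<mu> = m. frag_cmul ((-1) ^ inversions \<mu>) (f (F \<mu>)))"
  unfolding shuffle_sum_inversions
  by (subst frag_extend_sum) (auto simp: frag_extend_cmul intro!: sum.cong)

lemma finite_inversions: "finite \<mu> \<Longrightarrow> finite {(i, j). i \<in> \<mu> \<and> j \<notin> \<mu> \<and> j < (i::nat)}"
  by (rule finite_subset[of _ "Sigma \<mu> (\<lambda>i. {..<i})"]) auto

lemma inversions_insert:
  assumes "\<mu> \<subseteq> {..<N}"
  shows "inversions (insert N \<mu>) = inversions \<mu> + (N - card \<mu>)"
proof -
  have f: "finite \<mu>" using assms finite_subset by blast
  have "{(i, j). i \<in> insert N \<mu> \<and> j \<notin> insert N \<mu> \<and> j < i}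
      = {(i, j). i \<in> \<mu> \<and> j \<notin> \<mu> \<and> j < i} \<union> Pair N ` ({..<N} - \<mu>)"
    using assms by fastforce
  moreover have "card (Pair N ` ({..<N} - \<mu>)) = N - card \<mu>"
    using assms f by (simp add: card_image inj_on_def card_Diff_subset)
  moreover have "{(i, j). i \<in> \<mu> \<and> j \<notin> \<mu> \<and> j < i} \<inter> Pair N ` ({..<N} - \<mu>) = {}"
    using assms by auto
  ultimately show ?thesis
    using finite_inversions[OF f] by (simp add: inversions_def card_Un_disjoint)
qed

lemma shuffle_sum_0 [simp]: "shuffle_sum 0 n F = frag_of (F {})"
proof -
  have "{\<mu>. \<mu> \<subseteq> {..<0 + n} \<and> card \<mu> = 0} = {{}}"
    using finite_subset by fastforce
  then show ?thesis by (simp add: shuffle_sum_def)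
qed

lemma shuffle_sum_0_right [simp]: "shuffle_sum m 0 F = frag_of (F {..<m})"
proof -
  have "{\<mu>. \<mu> \<subseteq> {..<m + 0} \<and> card \<mu> = m} = {{..<m}}"
    by auto (metis card_lessThan card_subset_eq finite_lessThan lessThan_iff)+
  moreover have "{(i, j). i \<in> {..<m} \<and> j \<notin> {..<m} \<and> j < i} = {}" by auto
  then have "inversions {..<m} = 0" by (simp only: inversions_def card.empty)
  ultimately show ?thesis by (simp add: shuffle_sum_inversions)
qed

text \<open>The shuffles are split by the direction of the last step. If it goes in the first
  direction, all \<open>Suc n\<close> steps of the other kind precede it and are inverted with
  it.\<close>

lemma shuffle_sum_Suc_Suc:
  "shuffle_sum (Suc m) (Suc n) F =
     frag_cmul ((-1) ^ Suc n) (shuffle_sum m (Suc n) (\<lambda>\<mu>. F (insert (m + Suc n) \<mu>)))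
     + shuffle_sum (Suc m) n F"
proof -
  define N where "N = m + Suc n"
  define f where "f \<mu> = frag_cmul ((-1) ^ inversions \<mu>) (frag_of (F \<mu>))" for \<mu>
  define A where "A = {\<mu>. \<mu> \<subseteq> {..<N} \<and> card \<mu> = m}"
  define B where "B = {\<mu>. \<mu> \<subseteq> {..<N} \<and> card \<mu> = Suc m}"
  have "{\<mu>. \<mu> \<subseteq> {..<Suc m + Suc n} \<and> card \<mu> = Suc m} = insert N ` A \<union> B"
  proof (intro equalityI subsetI)
    fix \<mu> assume "\<mu> \<in> {\<mu>. \<mu> \<subseteq> {..<Suc m + Suc n} \<and> card \<mu> = Suc m}"
    then have \<mu>: "\<mu> \<subseteq> {..<Suc N}" "card \<mu> = Suc m" by (auto simp: N_def)
    have fin: "finite \<mu>" using \<mu> finite_subset by blast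
    show "\<mu> \<in> insert N ` A \<union> B"
    proof (cases "N \<in> \<mu>")
      case True
      then have "\<mu> = insert N (\<mu> - {N})" "\<mu> - {N} \<in> A"
        using \<mu> fin by (auto simp: A_def less_Suc_eq)
      then show ?thesis by blast
    next
      case False
      then show ?thesis using \<mu> by (auto simp: B_def less_Suc_eq dest!: subsetD)
    qed
  next
    fix \<mu> assume "\<mu> \<in> insert N ` A \<union> B"
    then consider \<nu> where "\<mu> = insert N \<nu>" "\<nu> \<in> A" | "\<mu> \<in> B" by blast
    then show "\<mu> \<in> {\<mu>. \<mu> \<subseteq> {..<Suc m + Suc n} \<and> card \<mu> = Suc m}"
    proof cases
      case 1
      then have "finite \<nu>" "N \<notin> \<nu>" using finite_subset by (auto simp: A_def)
      then show ?thesis using 1 by (auto simp: A_def N_def)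
    qed (auto simp: B_def N_def)
  qed
  moreover have "finite A" "finite B" "insert N ` A \<inter> B = {}"
    by (auto simp: A_def B_def)
  ultimately have "shuffle_sum (Suc m) (Suc n) F = sum f (insert N ` A) + sum f B"
    unfolding shuffle_sum_inversions f_def by (simp add: sum.union_disjoint)
  moreover have "inj_on (insert N) A"
    by (auto simp: A_def inj_on_def)
  moreover have "f (insert N \<mu>) = frag_cmul ((-1) ^ Suc n) (frag_cmul ((-1) ^ inversions \<mu>) (frag_of (F (insert N \<mu>))))"
    if "\<mu> \<in> A" for \<mu>
    using that inversions_insert[of \<mu> N] by (simp add: f_def A_def N_def power_add mult.commute)
  ultimately show ?thesis
    by (simp add: sum.reindex shuffle_sum_inversions A_def B_def f_def N_def frag_cmul_sum)
qed

lemma steps_insert: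
  assumes "\<mu> \<subseteq> {..<N}" "i \<le> N"
  shows "steps (insert N \<mu>) i = steps \<mu> i" "steps (- insert N \<mu>) i = steps (- \<mu>) i"
  using assms by (auto simp: steps_def intro!: arg_cong[where f=card])

lemma steps_mono: "i \<le> j \<Longrightarrow> steps \<mu> i \<le> steps \<mu> j"
  unfolding steps_def by (rule card_mono) auto

lemma steps_le_card: "finite \<mu> \<Longrightarrow> steps \<mu> i \<le> card \<mu>"
  unfolding steps_def by (rule card_mono) auto

lemma steps_all: "\<mu> \<subseteq> {..<N} \<Longrightarrow> N \<le> i \<Longrightarrow> steps \<mu> i = card \<mu>"
  unfolding steps_def by (rule arg_cong[where f=card]) auto

lemma steps_Compl: "steps \<mu> i + steps (- \<mu>) i = i"
proof -
  have "card (\<mu> \<inter> {..<i}) + card (- \<mu> \<inter> {..<i}) = card ((\<mu> \<inter> {..<i}) \<union> (- \<mu> \<inter> {..<i}))"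
    by (subst card_Un_disjoint) auto
  also have "(\<mu> \<inter> {..<i}) \<union> (- \<mu> \<inter> {..<i}) = {..<i}" by auto
  finally show ?thesis by (simp add: steps_def)
qed

lemma steps_Compl_le:
  assumes "\<mu> \<subseteq> {..<m + n}" "card \<mu> = m" "i \<le> m + n"
  shows "steps (- \<mu>) i \<le> n"
  using steps_mono[of i "m + n" "- \<mu>"] steps_Compl[of \<mu> "m + n"] steps_all[of \<mu> "m + n" "m + n"] assms by simp

lemma steps_le:
  assumes "\<mu> \<subseteq> {..<m + n}" "card \<mu> = m"
  shows "steps \<mu> i \<le> m"
  using steps_le_card[of \<mu> i] assms finite_subset by blast

definition path_of :: "nat \<Rightarrow> nat set \<Rightarrow> (nat \<times> nat) list" where
  "path_of N \<mu> = rev (map (\<lambda>i. (steps \<mu> i, steps (- \<mu>) i)) [0..<Suc N])"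

lemma steps_full: "steps {..<m} i = min m i" "steps {} i = 0" "steps UNIV i = i"
  "i \<le> m \<Longrightarrow> steps (- {..<m}) i = 0"
proof -
  have "{..<m} \<inter> {..<i} = {..<min m i}" by auto
  then show "steps {..<m} i = min m i" by (simp add: steps_def)
qed (auto simp: steps_def disjoint_iff)

lemma lattice_chain_single_left:
  "ys \<noteq> [] \<Longrightarrow> lattice_chain [x] ys = frag_of (map (Pair x) ys)"
proof (induction ys)
  case (Cons y ys)
  then show ?case by (cases ys) auto
qed simp

lemma lattice_chain_single_right:
  "xs \<noteq> [] \<Longrightarrow> lattice_chain xs [y] = frag_of (map (\<lambda>x. (x, y)) xs)"
proof (induction xs)
  case (Cons x xs)
  then show ?case by (cases xs) auto
qed simp

text \<open>Both sides obey the same recursion on the last step, and for \<open>m = 0\<close> or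
  \<open>n = 0\<close> there is just one path. This links the products, which are defined by sets of
  steps, to the Leibniz rule, which is proved for lists.\<close>

lemma shuffle_sum_path:
  "shuffle_sum m n (path_of (m + n)) = lattice_chain (rev [0..<Suc m]) (rev [0..<Suc n])"
proof (induction "m + n" arbitrary: m n rule: less_induct)
  case less
  consider "m = 0" | "n = 0" | m' n' where "m = Suc m'" "n = Suc n'"
    using not0_implies_Suc by blast
  then show ?case
  proof cases
    case 1
    have "lattice_chain [0 :: nat] (rev [0..<Suc n]) = frag_of (map (Pair 0) (rev [0..<Suc n]))"
      by (rule lattice_chain_single_left) simp
    moreover have "rev [0..<Suc 0] = [0 :: nat]" by simp
    ultimately show ?thesis using 1
      by (simp add: path_of_def steps_full rev_map del: upt_Suc)
  next
    case 2
    have "lattice_chain (rev [0..<Suc m]) [0 :: nat] = frag_of (map (\<lambda>x. (x, 0)) (rev [0..<Suc m]))"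
      by (rule lattice_chain_single_right) simp
    moreover have "path_of m {..<m} = map (\<lambda>x. (x, 0)) (rev [0..<Suc m])"
      using steps_full(4)[of _ m]
      by (auto simp: path_of_def rev_map steps_full(1) simp del: upt_Suc Compl_lessThan)
    ultimately show ?thesis using 2 by (simp del: upt_Suc add: upt_rec[of 0 "Suc 0"])
  next
    case 3
    have step: "path_of (Suc N) \<mu> = (steps \<mu> (Suc N), steps (- \<mu>) (Suc N)) # path_of N \<mu>" for N \<mu>
      by (simp add: path_of_def)
    have a: "path_of (Suc (m' + n)) (insert (m' + n) \<mu>) = (m, n) # path_of (m' + n) \<mu>"
      if "\<mu> \<subseteq> {..<m' + n}" "card \<mu> = m'" for \<mu>
    proof -
      have "finite \<mu>" "m' + n \<notin> \<mu>" using that finite_subset by auto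
      then have "steps (insert (m' + n) \<mu>) (Suc (m' + n)) = m"
        using that 3 by (subst steps_all[of _ "Suc (m' + n)"]) auto
      moreover from this have "steps (- insert (m' + n) \<mu>) (Suc (m' + n)) = n"
        using steps_Compl[of "insert (m' + n) \<mu>" "Suc (m' + n)"] 3 by simp
      moreover have "path_of (m' + n) (insert (m' + n) \<mu>) = path_of (m' + n) \<mu>"
        unfolding path_of_def using that by (auto simp: steps_insert less_Suc_eq_le simp del: upt_Suc)
      ultimately show ?thesis by (simp only: step)
    qed
    have b: "path_of (Suc (m + n')) \<mu> = (m, n) # path_of (m + n') \<mu>"
      if "\<mu> \<subseteq> {..<m + n'}" "card \<mu> = m" for \<mu>
    proof -
      have "steps \<mu> (Suc (m + n')) = m"
        using that by (subst steps_all[of _ "m + n'"]) auto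
      moreover from this have "steps (- \<mu>) (Suc (m + n')) = n"
        using steps_Compl[of "\<mu>" "Suc (m + n')"] 3 by simp
      ultimately show ?thesis by (simp only: step)
    qed
    define c where "c = frag_extend (\<lambda>l. frag_of ((m, n) # l))"
    have "shuffle_sum m n (path_of (m + n)) =
       frag_cmul ((-1) ^ n) (shuffle_sum m' n (\<lambda>\<mu>. path_of (Suc (m' + n)) (insert (m' + n) \<mu>)))
       + shuffle_sum m n' (path_of (Suc (m + n')))"
      using shuffle_sum_Suc_Suc[of m' n' "path_of (m + n)"] 3 by simp
    also have "shuffle_sum m' n (\<lambda>\<mu>. path_of (Suc (m' + n)) (insert (m' + n) \<mu>))
        = shuffle_sum m' n (Cons (m, n) \<circ> path_of (m' + n))"
      by (rule shuffle_sum_cong) (simp add: a)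
    also have "\<dots> = c (lattice_chain (rev [0..<Suc m']) (rev [0..<Suc n]))"
      unfolding c_def using less[of m' n] 3 by (simp flip: frag_extend_shuffle_sum)
    also have "shuffle_sum m n' (path_of (Suc (m + n'))) = shuffle_sum m n' (Cons (m, n) \<circ> path_of (m + n'))"
      by (rule shuffle_sum_cong) (simp add: b)
    also have "\<dots> = c (lattice_chain (rev [0..<Suc m]) (rev [0..<Suc n']))"
      unfolding c_def using less[of m n'] 3 by (simp flip: frag_extend_shuffle_sum)
    finally show ?thesis
      using 3 by (simp add: c_def frag_extend_add frag_extend_cmul)
  qed
qed

section \<open>Simplicial sets and the shuffle product\<close>

text \<open>All simplicial operators are primitive, rather than faces and degeneracies, because a
  shuffle acts by a composite degeneracy given directly as \<open>steps \<mu>\<close>. An operator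
  is a function on all numbers of which the values up to \<open>m\<close> count, whence
  \<open>act_cong\<close>. Faces and boundary are parameters, so that those of the singular and of
  the bar complex can be inserted as they stand.\<close>

locale simplicial_set =
  fixes S :: "nat \<Rightarrow> 's set" and act :: "nat \<Rightarrow> (nat \<Rightarrow> nat) \<Rightarrow> 's \<Rightarrow> 's"
    and face :: "nat \<Rightarrow> nat \<Rightarrow> 's \<Rightarrow> 's" and bd :: "nat \<Rightarrow> ('s \<Rightarrow>\<^sub>0 int) \<Rightarrow> ('s \<Rightarrow>\<^sub>0 int)"
  assumes act_closed: "\<lbrakk>s \<in> S n; mono_on {..m} \<alpha>; \<alpha> ` {..m} \<subseteq> {..n}\<rbrakk> \<Longrightarrow> act m \<alpha> s \<in> S m"
    and act_act: "\<lbrakk>s \<in> S n; mono_on {..m} \<alpha>; \<alpha> ` {..m} \<subseteq> {..n}; mono_on {..l} \<beta>; \<beta> ` {..l} \<subseteq> {..m}\<rbrakk>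
        \<Longrightarrow> act l \<beta> (act m \<alpha> s) = act l (\<alpha> \<circ> \<beta>) s"
    and act_cong: "\<lbrakk>s \<in> S n; \<And>i. i \<le> m \<Longrightarrow> \<alpha> i = \<beta> i\<rbrakk> \<Longrightarrow> act m \<alpha> s = act m \<beta> s"
    and act_id: "s \<in> S n \<Longrightarrow> act n id s = s"
    and face_eq: "\<lbrakk>s \<in> S n; 1 \<le> n; i \<le> n\<rbrakk> \<Longrightarrow> face n i s = act (n - 1) (skip i) s"
    and bd_eq: "bd n c = (if n = 0 then 0
          else frag_extend (\<lambda>s. \<Sum>i\<le>n. frag_cmul ((-1) ^ i) (frag_of (face n i s))) c)"
begin

text \<open>The simplex of \<open>s\<close> on the vertices \<open>vs\<close>, which are listed
  backwards and may repeat.\<close>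

definition along :: "'s \<Rightarrow> nat list \<Rightarrow> 's" where
  "along s vs = act (length vs - 1) (\<lambda>i. rev vs ! i) s"

definition chain_of :: "nat \<Rightarrow> nat \<Rightarrow> nat list \<Rightarrow> bool" where
  "chain_of n k vs \<longleftrightarrow> length vs = Suc k \<and> sorted (rev vs) \<and> set vs \<subseteq> {..n}"

lemma chain_ofD:
  assumes "chain_of n k vs"
  shows "mono_on {..k} (\<lambda>i. rev vs ! i)" "(\<lambda>i. rev vs ! i) ` {..k} \<subseteq> {..n}"
proof -
  show "mono_on {..k} (\<lambda>i. rev vs ! i)"
    using assms by (auto simp: chain_of_def mono_on_def less_Suc_eq_le intro!: sorted_nth_mono)
  have "rev vs ! i \<in> set vs" if "i \<le> k" for i
    using that assms nth_mem[of i "rev vs"] by (simp add: chain_of_def)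
  then show "(\<lambda>i. rev vs ! i) ` {..k} \<subseteq> {..n}"
    using assms by (auto simp: chain_of_def)
qed

lemma along_closed: "\<lbrakk>s \<in> S n; chain_of n k vs\<rbrakk> \<Longrightarrow> along s vs \<in> S k"
  unfolding along_def using act_closed[OF _ chain_ofD(1)[of n k vs] chain_ofD(2)[of n k vs]] by (simp add: chain_of_def)

lemma along_id: "s \<in> S n \<Longrightarrow> along s (rev [0..<Suc n]) = s"
proof -
  assume s: "s \<in> S n"
  have "along s (rev [0..<Suc n]) = act n id s"
    unfolding along_def using s by (simp del: upt_Suc) (rule act_cong[OF s], simp del: upt_Suc)
  then show ?thesis using act_id[OF s] by simp
qed

lemma along_map:
  assumes s: "s \<in> S n" and l: "chain_of n m l" and vs: "chain_of m k vs"
  shows "along s (map (\<lambda>i. rev l ! i) vs) = along (along s l) vs"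
proof -
  have "along (along s l) vs = act k (\<lambda>i. rev vs ! i) (act m (\<lambda>i. rev l ! i) s)"
    using l vs by (simp add: along_def chain_of_def)
  also have "\<dots> = act k ((\<lambda>i. rev l ! i) \<circ> (\<lambda>i. rev vs ! i)) s"
    by (rule act_act[OF s chain_ofD[OF l] chain_ofD[OF vs]])
  also have "\<dots> = along s (map (\<lambda>i. rev l ! i) vs)"
    unfolding along_def using vs
    by (auto simp: chain_of_def rev_map intro!: act_cong[OF s])
  finally show ?thesis by simp
qed

lemma face_along:
  assumes s: "s \<in> S n" and vs: "chain_of n k vs" and k: "1 \<le> k" and i: "i \<le> k"
  shows "face k i (along s vs) = along s (remove_vertex i vs)"
proof -
  have len: "length vs = Suc k" using vs by (simp add: chain_of_def)
  have "face k i (along s vs) = act (k - 1) (skip i) (act k (\<lambda>i. rev vs ! i) s)"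
    using face_eq[OF along_closed[OF s vs] k i] len by (simp add: along_def)
  also have "\<dots> = act (k - 1) ((\<lambda>i. rev vs ! i) \<circ> skip i) s"
    by (rule act_act[OF s chain_ofD[OF vs] mono_on_skip skip_into[OF k]])
  also have "\<dots> = along s (remove_vertex i vs)"
    unfolding along_def using len i k
    by (auto simp: length_remove_vertex nth_rev_remove_vertex intro!: act_cong[OF s])
  finally show ?thesis .
qed

lemma chain_of_boundary:
  assumes "chain_of n (Suc k) vs" "l \<in> Poly_Mapping.keys (vertex_boundary vs)"
  shows "chain_of n k l"
  using assms sorted_vertex_boundary[of vs] length_vertex_boundary[of vs]
  by (fastforce simp: chain_of_def)

lemma bd_frag_of: "1 \<le> n \<Longrightarrow> bd n (frag_of s) = (\<Sum>i\<le>n. frag_cmul ((-1) ^ i) (frag_of (face n i s)))"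
  by (simp add: bd_eq)

text \<open>For the full list of vertices this expresses the boundary of \<open>s\<close> itself, so
  identities between lists of vertices become identities in every simplicial set. In dimension 0 it
  would fail, as \<open>vertex_boundary\<close> is augmented.\<close>

lemma bd_along:
  assumes "s \<in> S n" "chain_of n k vs" "1 \<le> k"
  shows "bd k (frag_of (along s vs)) = frag_extend (\<lambda>l. frag_of (along s l)) (vertex_boundary vs)"
proof -
  have "length vs = Suc k" using assms by (simp add: chain_of_def)
  then show ?thesis
    unfolding vertex_boundary_sum bd_frag_of[OF assms(3)]
    by (subst frag_extend_sum)
       (auto simp: frag_extend_cmul face_along[OF assms] lessThan_Suc_atMost intro!: sum.cong)
qed

lemma bd_add: "bd n (a + b) = bd n a + bd n b"
  by (simp add: bd_eq frag_extend_add)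

lemma bd_cmul: "bd n (frag_cmul k a) = frag_cmul k (bd n a)"
  by (simp add: bd_eq frag_extend_cmul)

lemma bd_0 [simp]: "bd n 0 = 0"
  by (simp add: bd_eq)

lemma bd_zero_dim [simp]: "bd 0 c = 0"
  by (simp add: bd_eq)

lemma bd_extend: "bd n (frag_extend f c) = frag_extend (\<lambda>x. bd n (f x)) c"
  by (simp add: bd_eq frag_extend_frag_extend frag_extend_eq_0)

lemma chain_of_full: "chain_of n n (rev [0..<Suc n])"
  by (auto simp: chain_of_def simp del: upt_Suc)

lemma bd_closed:
  assumes "Poly_Mapping.keys c \<subseteq> S (Suc n)"
  shows "Poly_Mapping.keys (bd (Suc n) c) \<subseteq> S n"
proof -
  have "face (Suc n) i s \<in> S n" if "i \<le> Suc n" "s \<in> Poly_Mapping.keys c" for i s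
    using that assms face_eq[of s "Suc n" i] act_closed[of s "Suc n" n "skip i"] skip_into[of "Suc n" i]
    by (auto simp: mono_on_skip)
  moreover have "bd (Suc n) c = frag_extend (\<lambda>s. \<Sum>i\<le>Suc n. frag_cmul ((-1) ^ i) (frag_of (face (Suc n) i s))) c"
    by (subst bd_eq) (simp only: nat.simps if_False)
  ultimately show ?thesis
    by (simp only:) (intro keys_extend_subset keys_sum_subset keys_cmul_subset, simp)
qed

lemma bd_bd:
  assumes "Poly_Mapping.keys c \<subseteq> S (Suc n)"
  shows "bd n (bd (Suc n) c) = 0"
proof (cases n)
  case (Suc k)
  have "bd n (bd (Suc n) (frag_of s)) = 0" if s: "s \<in> S (Suc n)" for s
  proof -
    let ?vs = "rev [0..<Suc (Suc n)]"
    have "bd (Suc n) (frag_of s) = frag_extend (\<lambda>l. frag_of (along s l)) (vertex_boundary ?vs)"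
      using bd_along[OF s chain_of_full] along_id[OF s] by simp
    then have "bd n (bd (Suc n) (frag_of s)) = frag_extend (\<lambda>l. bd n (frag_of (along s l))) (vertex_boundary ?vs)"
      by (simp only: bd_extend)
    also have "\<dots> = frag_extend (\<lambda>l. frag_extend (\<lambda>l. frag_of (along s l)) (vertex_boundary l)) (vertex_boundary ?vs)"
      by (rule frag_extend_eq) (use bd_along[OF s chain_of_boundary[OF chain_of_full]] Suc in auto)
    also have "\<dots> = 0"
      by (simp only: vertex_boundary_boundary frag_extend_0 flip: frag_extend_frag_extend)
    finally show ?thesis .
  qed
  moreover have "bd n (bd (Suc n) c) = frag_extend (\<lambda>s. bd n (bd (Suc n) (frag_of s))) c"
    by (subst (1) frag_expansion[of c]) (simp only: bd_extend)
  ultimately show ?thesis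
    using assms by (auto intro!: frag_extend_eq_0)
qed simp

end

text \<open>The target has to receive a map from the product that commutes with the simplicial
  operators. This covers singular simplices of a k-product, paired pointwise, as well as bar symbols
  of a product group, paired by \<open>zip\<close>.\<close>

locale simplicial_product =
  S: simplicial_set S sact sface sbd + T: simplicial_set T tact tface tbd + U: simplicial_set U uact uface ubd
  for S :: "nat \<Rightarrow> 's set" and sact sface sbd and T :: "nat \<Rightarrow> 't set" and tact tface tbd
    and U :: "nat \<Rightarrow> 'u set" and uact uface ubd +
  fixes pair :: "nat \<Rightarrow> 's \<Rightarrow> 't \<Rightarrow> 'u"
  assumes pair_closed: "\<lbrakk>s \<in> S n; t \<in> T n\<rbrakk> \<Longrightarrow> pair n s t \<in> U n"
    and act_pair: "\<lbrakk>s \<in> S n; t \<in> T n; mono_on {..m} \<alpha>; \<alpha> ` {..m} \<subseteq> {..n}\<rbrakk>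
       \<Longrightarrow> uact m \<alpha> (pair n s t) = pair m (sact m \<alpha> s) (tact m \<alpha> t)"
begin

definition cross_simplex :: "nat \<Rightarrow> 's \<Rightarrow> 't \<Rightarrow> nat set \<Rightarrow> 'u" where
  "cross_simplex k s t \<mu> = pair k (sact k (steps \<mu>) s) (tact k (steps (- \<mu>)) t)"

definition cross :: "nat \<Rightarrow> nat \<Rightarrow> 's \<Rightarrow> 't \<Rightarrow> 'u \<Rightarrow>\<^sub>0 int" where
  "cross m n s t = shuffle_sum m n (cross_simplex (m + n) s t)"

definition cross_chain :: "nat \<Rightarrow> nat \<Rightarrow> ('s \<Rightarrow>\<^sub>0 int) \<Rightarrow> ('t \<Rightarrow>\<^sub>0 int) \<Rightarrow> 'u \<Rightarrow>\<^sub>0 int" where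
  "cross_chain m n c d = frag_extend (\<lambda>s. frag_extend (cross m n s) d) c"

definition along2 :: "'s \<Rightarrow> 't \<Rightarrow> (nat \<times> nat) list \<Rightarrow> 'u" where
  "along2 s t zs = pair (length zs - 1) (S.along s (map fst zs)) (T.along t (map snd zs))"

text \<open>The coordinates along the path of a shuffle \<open>\<mu>\<close> are
  \<open>steps \<mu>\<close> and \<open>steps (- \<mu>)\<close>, which are the degeneracies in
  \<open>cross_simplex\<close>.\<close>

lemma cross_lattice:
  assumes s: "s \<in> S m" and t: "t \<in> T n"
  shows "cross m n s t = frag_extend (\<lambda>l. frag_of (along2 s t l)) (lattice_chain (rev [0..<Suc m]) (rev [0..<Suc n]))"
proof -
  have "cross m n s t = shuffle_sum m n (along2 s t \<circ> path_of (m + n))"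
    unfolding cross_def cross_simplex_def
  proof (rule shuffle_sum_cong)
    fix \<mu>
    have 1: "S.along s (map fst (path_of (m + n) \<mu>)) = sact (m + n) (steps \<mu>) s"
      unfolding S.along_def path_of_def
      by (simp add: rev_map del: upt_Suc) (rule S.act_cong[OF s], simp del: upt_Suc)
    have 2: "T.along t (map snd (path_of (m + n) \<mu>)) = tact (m + n) (steps (- \<mu>)) t"
      unfolding T.along_def path_of_def
      by (simp add: rev_map del: upt_Suc) (rule T.act_cong[OF t], simp del: upt_Suc)
    have "length (path_of (m + n) \<mu>) - 1 = m + n" by (simp add: path_of_def)
    then show "pair (m + n) (sact (m + n) (steps \<mu>) s) (tact (m + n) (steps (- \<mu>)) t)
        = (along2 s t \<circ> path_of (m + n)) \<mu>"
      by (simp add: along2_def 1 2)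
  qed
  then show ?thesis
    by (simp only: frag_extend_shuffle_sum flip: shuffle_sum_path)
qed

lemma lattice_chain_of:
  assumes "l \<in> Poly_Mapping.keys (lattice_chain (rev [0..<Suc m]) (rev [0..<Suc n]))"
  shows "S.chain_of m (m + n) (map fst l)" "T.chain_of n (m + n) (map snd l)" "length l = Suc (m + n)"
proof -
  have l: "Suc (length l) = Suc m + Suc n" "set l \<subseteq> {..m} \<times> {..n}"
    using keys_lattice_chain[of "rev [0..<Suc m]" "rev [0..<Suc n]"] assms
    by (fastforce simp del: upt_Suc)+
  moreover have "sorted (rev (map fst l))" "sorted (rev (map snd l))"
    using sorted_lattice_chain[of "rev [0..<Suc m]" "rev [0..<Suc n]"] assms
    by (auto simp del: upt_Suc)
  ultimately show "S.chain_of m (m + n) (map fst l)" "T.chain_of n (m + n) (map snd l)" "length l = Suc (m + n)"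
    by (auto simp: S.chain_of_def T.chain_of_def)
qed

lemma along2_closed:
  assumes "s \<in> S m" "t \<in> T n" "S.chain_of m k (map fst l)" "T.chain_of n k (map snd l)"
  shows "along2 s t l \<in> U k"
proof -
  have "length l = Suc k" using assms(3) by (simp add: S.chain_of_def)
  then show ?thesis
    using S.along_closed[OF assms(1,3)] T.along_closed[OF assms(2,4)] pair_closed by (simp add: along2_def)
qed

lemma cross_closed:
  assumes s: "s \<in> S m" and t: "t \<in> T n"
  shows "Poly_Mapping.keys (cross m n s t) \<subseteq> U (m + n)"
  unfolding cross_lattice[OF assms]
  by (rule keys_extend_subset) (use along2_closed[OF s t lattice_chain_of(1,2)] in auto)

lemma cross_chain_closed:
  assumes "Poly_Mapping.keys c \<subseteq> S m" "Poly_Mapping.keys d \<subseteq> T n"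
  shows "Poly_Mapping.keys (cross_chain m n c d) \<subseteq> U (m + n)"
  unfolding cross_chain_def using assms
  by (intro keys_extend_subset cross_closed) auto

text \<open>The paths on two sublists are relabelled paths on full lists
  (\<open>lattice_chain_map\<close>). Hence the paths in a product of faces compute the product of
  these faces.\<close>

lemma along2_lattice:
  assumes s: "s \<in> S m" and t: "t \<in> T n" and l: "S.chain_of m m' l" and l': "T.chain_of n n' l'"
  shows "frag_extend (\<lambda>z. frag_of (along2 s t z)) (lattice_chain l l') = cross m' n' (S.along s l) (T.along t l')"
proof -
  have len: "length l = Suc m'" "length l' = Suc n'"
    using l l' by (auto simp: S.chain_of_def T.chain_of_def)
  have "map (\<lambda>i. rev l ! i) (rev [0..<Suc m']) = l" "map (\<lambda>i. rev l' ! i) (rev [0..<Suc n']) = l'"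
    using map_nth[of "rev l"] map_nth[of "rev l'"] len by (simp_all flip: rev_map del: upt_Suc)
  then have "lattice_chain l l' = frag_extend (\<lambda>z. frag_of (map (map_prod (\<lambda>i. rev l ! i) (\<lambda>i. rev l' ! i)) z))
       (lattice_chain (rev [0..<Suc m']) (rev [0..<Suc n']))"
    using lattice_chain_map[of "\<lambda>i. rev l ! i" "rev [0..<Suc m']" "\<lambda>i. rev l' ! i" "rev [0..<Suc n']"] by simp
  then have "frag_extend (\<lambda>z. frag_of (along2 s t z)) (lattice_chain l l')
     = frag_extend (\<lambda>z. frag_of (along2 s t (map (map_prod (\<lambda>i. rev l ! i) (\<lambda>i. rev l' ! i)) z)))
        (lattice_chain (rev [0..<Suc m']) (rev [0..<Suc n']))"
    by (simp only: frag_extend_frag_extend frag_extend_of)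
  also have "\<dots> = frag_extend (\<lambda>z. frag_of (along2 (S.along s l) (T.along t l') z))
        (lattice_chain (rev [0..<Suc m']) (rev [0..<Suc n']))"
  proof (rule frag_extend_eq)
    fix z assume z: "z \<in> Poly_Mapping.keys (lattice_chain (rev [0..<Suc m']) (rev [0..<Suc n']))"
    have f: "map fst (map (map_prod (\<lambda>i. rev l ! i) (\<lambda>i. rev l' ! i)) z) = map (\<lambda>i. rev l ! i) (map fst z)"
            "map snd (map (map_prod (\<lambda>i. rev l ! i) (\<lambda>i. rev l' ! i)) z) = map (\<lambda>i. rev l' ! i) (map snd z)"
      by simp_all
    show "frag_of (along2 s t (map (map_prod (\<lambda>i. rev l ! i) (\<lambda>i. rev l' ! i)) z))
        = frag_of (along2 (S.along s l) (T.along t l') z)"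
      unfolding along2_def f
      using S.along_map[OF s l lattice_chain_of(1)[OF z]] T.along_map[OF t l' lattice_chain_of(2)[OF z]] by simp
  qed
  also have "\<dots> = cross m' n' (S.along s l) (T.along t l')"
    using cross_lattice[OF S.along_closed[OF s l] T.along_closed[OF t l']] by simp
  finally show ?thesis .
qed

lemma bd_along2:
  assumes s: "s \<in> S m" and t: "t \<in> T n"
    and l: "S.chain_of m k (map fst l)" "T.chain_of n k (map snd l)" and k: "1 \<le> k"
  shows "ubd k (frag_of (along2 s t l)) = frag_extend (\<lambda>z. frag_of (along2 s t z)) (vertex_boundary l)"
proof -
  have len: "length l = Suc k" using l by (simp add: S.chain_of_def)
  have face: "uface k i (along2 s t l) = along2 s t (remove_vertex i l)" if "i \<le> k" for i
  proof -
    have "uface k i (along2 s t l) = uact (k - 1) (skip i) (along2 s t l)"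
      by (rule U.face_eq[OF along2_closed[OF s t l] k that])
    also have "\<dots> = pair (k - 1) (sact (k - 1) (skip i) (S.along s (map fst l))) (tact (k - 1) (skip i) (T.along t (map snd l)))"
      using act_pair[OF S.along_closed[OF s l(1)] T.along_closed[OF t l(2)] mono_on_skip skip_into[OF k]] len
      by (simp add: along2_def)
    also have "sact (k - 1) (skip i) (S.along s (map fst l)) = S.along s (remove_vertex i (map fst l))"
      using S.face_along[OF s l(1) k that] S.face_eq[OF S.along_closed[OF s l(1)] k that] by simp
    also have "tact (k - 1) (skip i) (T.along t (map snd l)) = T.along t (remove_vertex i (map snd l))"
      using T.face_along[OF t l(2) k that] T.face_eq[OF T.along_closed[OF t l(2)] k that] by simp
    finally show ?thesis
      using that len by (simp add: along2_def map_remove_vertex length_remove_vertex)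
  qed
  show ?thesis
    unfolding vertex_boundary_sum U.bd_frag_of[OF k]
    by (subst frag_extend_sum)
       (auto simp: frag_extend_cmul face lessThan_Suc_atMost len intro!: sum.cong)
qed

text \<open>This is \<open>lattice_chain_boundary\<close> transported by \<open>along2\<close>. The
  pair of points excluded there has boundary 0 on both sides.\<close>

lemma bd_cross:
  assumes s: "s \<in> S m" and t: "t \<in> T n"
  shows "ubd (m + n) (cross m n s t)
       = cross_chain (m - 1) n (sbd m (frag_of s)) (frag_of t)
         + frag_cmul ((-1) ^ m) (cross_chain m (n - 1) (frag_of s) (tbd n (frag_of t)))"
proof (cases "m + n = 0")
  case False
  let ?xs = "rev [0..<Suc m]" and ?ys = "rev [0..<Suc n]"
  let ?A = "frag_extend (\<lambda>z. frag_of (along2 s t z))"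
  have "ubd (m + n) (cross m n s t) = frag_extend (\<lambda>l. ubd (m + n) (frag_of (along2 s t l))) (lattice_chain ?xs ?ys)"
    by (simp only: cross_lattice[OF s t] U.bd_extend)
  also have "\<dots> = frag_extend (\<lambda>l. ?A (vertex_boundary l)) (lattice_chain ?xs ?ys)"
    by (rule frag_extend_eq) (use bd_along2[OF s t lattice_chain_of(1,2)] False in auto)
  also have "\<dots> = ?A (frag_extend vertex_boundary (lattice_chain ?xs ?ys))"
    by (simp only: frag_extend_frag_extend)
  also have "frag_extend vertex_boundary (lattice_chain ?xs ?ys)
      = frag_extend (\<lambda>l. lattice_chain l ?ys) (vertex_boundary ?xs)
         + frag_cmul ((-1) ^ m) (frag_extend (lattice_chain ?xs) (vertex_boundary ?ys))"
    using lattice_chain_boundary[of ?xs ?ys] False by (simp del: upt_Suc)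
  finally have 0: "ubd (m + n) (cross m n s t)
      = frag_extend (\<lambda>l. ?A (lattice_chain l ?ys)) (vertex_boundary ?xs)
        + frag_cmul ((-1) ^ m) (frag_extend (\<lambda>l. ?A (lattice_chain ?xs l)) (vertex_boundary ?ys))"
    by (simp only: frag_extend_add frag_extend_cmul frag_extend_frag_extend)
  have 1: "frag_extend (\<lambda>l. ?A (lattice_chain l ?ys)) (vertex_boundary ?xs)
      = cross_chain (m - 1) n (sbd m (frag_of s)) (frag_of t)"
  proof (cases m)
    \<comment> \<open>The augmented boundary of a vertex is the empty list; its lattice chain is 0,
      in agreement with the boundary of a 0-simplex.\<close>
    case 0
    then show ?thesis by (simp add: cross_chain_def del: upt_Suc) (simp add: frag_extend_eq_0)
  next
    case (Suc k)
    have "frag_extend (\<lambda>l. ?A (lattice_chain l ?ys)) (vertex_boundary ?xs)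
        = frag_extend (\<lambda>l. cross k n (S.along s l) t) (vertex_boundary ?xs)"
    proof (rule frag_extend_eq)
      fix l assume "l \<in> Poly_Mapping.keys (vertex_boundary ?xs)"
      then have "S.chain_of m k l"
        using S.chain_of_boundary[of m k] S.chain_of_full[of m] unfolding Suc by blast
      then show "?A (lattice_chain l ?ys) = cross k n (S.along s l) t"
        using along2_lattice[OF s t _ T.chain_of_full] T.along_id[OF t] by simp
    qed
    moreover have "sbd m (frag_of s) = frag_extend (\<lambda>l. frag_of (S.along s l)) (vertex_boundary ?xs)"
      using S.bd_along[OF s S.chain_of_full] S.along_id[OF s] Suc by simp
    ultimately show ?thesis
      using Suc by (simp only: cross_chain_def frag_extend_frag_extend frag_extend_of diff_Suc_1)
  qed
  have 2: "frag_extend (\<lambda>l. ?A (lattice_chain ?xs l)) (vertex_boundary ?ys)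
      = cross_chain m (n - 1) (frag_of s) (tbd n (frag_of t))"
  proof (cases n)
    case 0
    then show ?thesis by (simp add: cross_chain_def del: upt_Suc) (simp add: frag_extend_eq_0)
  next
    case (Suc k)
    have "frag_extend (\<lambda>l. ?A (lattice_chain ?xs l)) (vertex_boundary ?ys)
        = frag_extend (\<lambda>l. cross m k s (T.along t l)) (vertex_boundary ?ys)"
    proof (rule frag_extend_eq)
      fix l assume "l \<in> Poly_Mapping.keys (vertex_boundary ?ys)"
      then have "T.chain_of n k l"
        using T.chain_of_boundary[of n k] T.chain_of_full[of n] unfolding Suc by blast
      then show "?A (lattice_chain ?xs l) = cross m k s (T.along t l)"
        using along2_lattice[OF s t S.chain_of_full] S.along_id[OF s] by simp
    qed
    moreover have "tbd n (frag_of t) = frag_extend (\<lambda>l. frag_of (T.along t l)) (vertex_boundary ?ys)"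
      using T.bd_along[OF t T.chain_of_full] T.along_id[OF t] Suc by simp
    ultimately show ?thesis
      using Suc by (simp only: cross_chain_def frag_extend_frag_extend frag_extend_of diff_Suc_1)
  qed
  show ?thesis unfolding 0 1 2 ..
qed (simp add: cross_chain_def)

lemma cross_chain_add_left: "cross_chain m n (a + b) c = cross_chain m n a c + cross_chain m n b c"
  by (simp add: cross_chain_def frag_extend_add)

lemma cross_chain_add_right: "cross_chain m n a (b + c) = cross_chain m n a b + cross_chain m n a c"
  by (simp add: cross_chain_def frag_extend_add frag_extend_fun_add)

lemma cross_chain_cmul_left: "cross_chain m n (frag_cmul k a) c = frag_cmul k (cross_chain m n a c)"
  by (simp add: cross_chain_def frag_extend_cmul)

lemma cross_chain_cmul_right: "cross_chain m n a (frag_cmul k c) = frag_cmul k (cross_chain m n a c)"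
  by (simp add: cross_chain_def frag_extend_cmul frag_extend_fun_cmul)

lemma cross_chain_zero [simp]: "cross_chain m n 0 d = 0" "cross_chain m n c 0 = 0"
  by (simp_all add: cross_chain_def frag_extend_eq_0)

lemma bd_cross_chain:
  assumes "Poly_Mapping.keys c \<subseteq> S m" "Poly_Mapping.keys d \<subseteq> T n"
  shows "ubd (m + n) (cross_chain m n c d)
       = cross_chain (m - 1) n (sbd m c) d + frag_cmul ((-1) ^ m) (cross_chain m (n - 1) c (tbd n d))"
proof -
  have c: "sbd m c = frag_extend (\<lambda>s. sbd m (frag_of s)) c" and d: "tbd n d = frag_extend (\<lambda>t. tbd n (frag_of t)) d"
    using S.bd_extend[of m frag_of c] T.bd_extend[of n frag_of d] by (simp_all add: frag_extend_ident)
  have "ubd (m + n) (cross_chain m n c d)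
      = frag_extend (\<lambda>s. frag_extend (\<lambda>t. ubd (m + n) (cross m n s t)) d) c"
    by (simp only: cross_chain_def U.bd_extend)
  also have "\<dots> = frag_extend (\<lambda>s. frag_extend (\<lambda>t. cross_chain (m - 1) n (sbd m (frag_of s)) (frag_of t)
         + frag_cmul ((-1) ^ m) (cross_chain m (n - 1) (frag_of s) (tbd n (frag_of t)))) d) c"
    by (intro frag_extend_eq bd_cross) (use assms in auto)
  also have "\<dots> = frag_extend (\<lambda>s. frag_extend (\<lambda>t. cross_chain (m - 1) n (sbd m (frag_of s)) (frag_of t)) d) c
       + frag_cmul ((-1) ^ m) (frag_extend (\<lambda>s. frag_extend (\<lambda>t. cross_chain m (n - 1) (frag_of s) (tbd n (frag_of t))) d) c)"
    by (simp only: frag_extend_fun_add frag_extend_fun_cmul)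
  also have "frag_extend (\<lambda>s. frag_extend (\<lambda>t. cross_chain m (n - 1) (frag_of s) (tbd n (frag_of t))) d) c
      = cross_chain m (n - 1) c (tbd n d)"
    by (simp only: cross_chain_def d frag_extend_of frag_extend_frag_extend)
  also have "frag_extend (\<lambda>s. frag_extend (\<lambda>t. cross_chain (m - 1) n (sbd m (frag_of s)) (frag_of t)) d) c
      = cross_chain (m - 1) n (sbd m c) d"
    by (simp only: cross_chain_def c frag_extend_of frag_extend_frag_extend)
       (intro frag_extend_eq, rule frag_extend_swap)
  finally show ?thesis .
qed

end

subsection \<open>Interchange of iterated shuffles\<close>

text \<open>\<open>steps M\<close> numbers the elements of \<open>M\<close> in increasing order, and
  the elements of \<open>pull M \<nu>\<close> are those with number in \<open>\<nu>\<close>. Hence a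
  shuffle \<open>\<nu>\<close> of the steps of kind \<open>M\<close> becomes a set of steps of the
  whole path, and the composite degeneracy is again of the form \<open>steps\<close> (see
  \<open>steps_pull\<close>).\<close>

definition pull :: "nat set \<Rightarrow> nat set \<Rightarrow> nat set" where
  "pull M \<nu> = {i \<in> M. steps M i \<in> \<nu>}"

lemma steps_Suc: "steps M (Suc i) = steps M i + (if i \<in> M then 1 else 0)"
  by (simp add: steps_def lessThan_Suc)

lemma steps_strict: "\<lbrakk>i \<in> M; i < j\<rbrakk> \<Longrightarrow> steps M i < steps M j"
  using steps_mono[of "Suc i" j M] by (simp add: steps_Suc)

lemma steps_surj: "j < steps M i \<Longrightarrow> \<exists>k\<in>M. k < i \<and> steps M k = j"
proof (induction i)
  case 0
  then show ?case by (simp add: steps_def)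
next
  case (Suc i)
  then show ?case
    by (cases "j < steps M i") (auto simp: steps_Suc less_Suc_eq split: if_splits)
qed

lemma inj_on_steps: "inj_on (steps M) M"
  by (rule inj_onI) (metis linorder_neqE_nat nat_less_le steps_strict)

lemma steps_less_iff: "\<lbrakk>i \<in> M; j \<in> M\<rbrakk> \<Longrightarrow> steps M i < steps M j \<longleftrightarrow> i < j"
  by (meson linorder_not_le steps_mono steps_strict)

lemma steps_pull: "steps (pull M \<nu>) i = steps \<nu> (steps M i)"
proof -
  have "steps M ` (pull M \<nu> \<inter> {..<i}) = \<nu> \<inter> {..<steps M i}"
    using steps_surj[of _ M i] steps_strict[of _ M i] by (fastforce simp: pull_def)
  moreover have "inj_on (steps M) (pull M \<nu> \<inter> {..<i})"
    by (rule inj_on_subset[OF inj_on_steps]) (auto simp: pull_def)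
  ultimately show ?thesis
    unfolding steps_def by (metis card_image)
qed

lemma pull_Compl: "pull M (- \<nu>) = M - pull M \<nu>"
  by (auto simp: pull_def)

lemma pull_bound:
  assumes "\<nu> \<subseteq> {..<steps M N}"
  shows "pull M \<nu> \<subseteq> M \<inter> {..<N}"
proof
  fix i assume i: "i \<in> pull M \<nu>"
  then have "steps M i < steps M N" using assms by (auto simp: pull_def)
  then have "i < N" using steps_mono[of N i M] by (meson leD linorder_le_less_linear)
  then show "i \<in> M \<inter> {..<N}" using i by (simp add: pull_def)
qed

lemma steps_image_pull:
  assumes "\<nu> \<subseteq> {..<steps M N}"
  shows "steps M ` pull M \<nu> = \<nu>"
  using assms steps_surj[of _ M N] by (fastforce simp: pull_def)

lemma pull_steps_image:
  assumes "A \<subseteq> M"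
  shows "pull M (steps M ` A) = A"
  using assms inj_on_steps[of M] by (auto simp: pull_def inj_on_def)

lemma card_pull:
  assumes "\<nu> \<subseteq> {..<steps M N}"
  shows "card (pull M \<nu>) = card \<nu>"
  using card_image[of "steps M" "pull M \<nu>"] steps_image_pull[OF assms]
    inj_on_subset[OF inj_on_steps, of "pull M \<nu>"] by (simp add: pull_def)

lemma bij_betw_pull:
  "bij_betw (pull M) {\<nu>. \<nu> \<subseteq> {..<steps M N} \<and> card \<nu> = m} {A. A \<subseteq> M \<inter> {..<N} \<and> card A = m}"
proof (rule bij_betw_byWitness[where f' = "(`) (steps M)"])
  show "\<forall>\<nu>\<in>{\<nu>. \<nu> \<subseteq> {..<steps M N} \<and> card \<nu> = m}. steps M ` pull M \<nu> = \<nu>"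
    using steps_image_pull by blast
  show "\<forall>A\<in>{A. A \<subseteq> M \<inter> {..<N} \<and> card A = m}. pull M (steps M ` A) = A"
    using pull_steps_image by blast
  show "pull M ` {\<nu>. \<nu> \<subseteq> {..<steps M N} \<and> card \<nu> = m} \<subseteq> {A. A \<subseteq> M \<inter> {..<N} \<and> card A = m}"
    using pull_bound card_pull by blast
  show "(`) (steps M) ` {A. A \<subseteq> M \<inter> {..<N} \<and> card A = m} \<subseteq> {\<nu>. \<nu> \<subseteq> {..<steps M N} \<and> card \<nu> = m}"
  proof clarify
    fix A assume A: "A \<subseteq> M \<inter> {..<N}" "m = card A"
    have "steps M i < steps M N" if "i \<in> A" for i
      by (rule steps_strict) (use that A in auto)
    then have "steps M ` A \<subseteq> {..<steps M N}" by auto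
    moreover have "card (steps M ` A) = card A"
      using A by (intro card_image inj_on_subset[OF inj_on_steps]) auto
    ultimately show "steps M ` A \<subseteq> {..<steps M N} \<and> card (steps M ` A) = card A" by blast
  qed
qed

section \<open>Inversions between blocks of steps\<close>

definition inv_between :: "nat set \<Rightarrow> nat set \<Rightarrow> nat" where
  "inv_between A B = card {(i, j). i \<in> A \<and> j \<in> B \<and> j < i}"

lemma inversions_eq: "inversions \<mu> = inv_between \<mu> (- \<mu>)"
  by (simp add: inversions_def inv_between_def)

lemma finite_inv_between: "finite A \<Longrightarrow> finite {(i, j). i \<in> A \<and> j \<in> B \<and> j < (i::nat)}"
  by (rule finite_subset[of _ "Sigma A (\<lambda>i. {..<i})"]) auto

lemma inv_between_Un_left:
  assumes "finite A" "finite A'" "A \<inter> A' = {}"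
  shows "inv_between (A \<union> A') B = inv_between A B + inv_between A' B"
proof -
  have "{(i, j). i \<in> A \<union> A' \<and> j \<in> B \<and> j < i} = {(i, j). i \<in> A \<and> j \<in> B \<and> j < i} \<union> {(i, j). i \<in> A' \<and> j \<in> B \<and> j < i}"
    by auto
  then show ?thesis
    unfolding inv_between_def using assms finite_inv_between[of A B] finite_inv_between[of A' B]
    by (subst card_Un_disjoint[symmetric]) auto
qed

lemma inv_between_Un_right:
  assumes "finite A" "B \<inter> B' = {}"
  shows "inv_between A (B \<union> B') = inv_between A B + inv_between A B'"
proof -
  have "{(i, j). i \<in> A \<and> j \<in> B \<union> B' \<and> j < i} = {(i, j). i \<in> A \<and> j \<in> B \<and> j < i} \<union> {(i, j). i \<in> A \<and> j \<in> B' \<and> j < i}"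
    by auto
  then show ?thesis
    unfolding inv_between_def using assms finite_inv_between[of A B] finite_inv_between[of A B']
    by (subst card_Un_disjoint[symmetric]) auto
qed

lemma inv_between_swap:
  assumes "finite A" "finite B" "A \<inter> B = {}"
  shows "inv_between A B + inv_between B A = card A * card B"
proof -
  let ?S = "{(i, j). i \<in> A \<and> j \<in> B \<and> j < i}" and ?T = "{(i, j). i \<in> B \<and> j \<in> A \<and> j < i}"
  have "A \<times> B = ?S \<union> prod.swap ` ?T"
    using assms(3) by (auto simp: image_iff disjoint_iff) (metis linorder_neqE_nat)+
  moreover have "?S \<inter> prod.swap ` ?T = {}" by auto
  ultimately have "card (A \<times> B) = card ?S + card (prod.swap ` ?T)"
    using finite_inv_between[OF assms(1), of B] finite_inv_between[OF assms(2), of A] by (simp add: card_Un_disjoint)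
  also have "card (prod.swap ` ?T) = card ?T"
    by (rule card_image) (simp add: inj_on_def)
  finally show ?thesis by (simp add: inv_between_def card_cartesian_product)
qed

text \<open>\<open>steps M\<close> is strictly increasing on \<open>M\<close>, so it preserves
  inversions; the bound on \<open>\<nu>\<close> makes every number below an element of
  \<open>\<nu>\<close> the number of some step.\<close>

lemma inversions_pull:
  assumes "\<nu> \<subseteq> {..<steps M N}"
  shows "inversions \<nu> = inv_between (pull M \<nu>) (M - pull M \<nu>)"
proof -
  let ?S = "{(i, j). i \<in> pull M \<nu> \<and> j \<in> M - pull M \<nu> \<and> j < i}"
  have "map_prod (steps M) (steps M) ` ?S = {(i, j). i \<in> \<nu> \<and> j \<notin> \<nu> \<and> j < i}"
  proof (intro equalityI subsetI)
    fix z assume "z \<in> map_prod (steps M) (steps M) ` ?S"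
    then show "z \<in> {(i, j). i \<in> \<nu> \<and> j \<notin> \<nu> \<and> j < i}"
      by (auto simp: pull_def steps_less_iff)
  next
    fix z assume "z \<in> {(i, j). i \<in> \<nu> \<and> j \<notin> \<nu> \<and> j < i}"
    then obtain i j where z: "z = (i, j)" "i \<in> \<nu>" "j \<notin> \<nu>" "j < i" by auto
    obtain i' where i': "i' \<in> M" "steps M i' = i" using steps_surj[of i M N] z assms by auto
    obtain j' where j': "j' \<in> M" "j' < i'" "steps M j' = j" using steps_surj[of j M i'] z i' by auto
    have "(i', j') \<in> ?S" using i' j' z by (auto simp: pull_def)
    then show "z \<in> map_prod (steps M) (steps M) ` ?S"
      using i' j' z by (force simp: image_iff)
  qed
  moreover have "inj_on (map_prod (steps M) (steps M)) ?S"
    by (rule inj_on_subset[OF map_prod_inj_on[OF inj_on_steps[of M] inj_on_steps[of M]]]) (auto simp: pull_def)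
  ultimately have "card {(i, j). i \<in> \<nu> \<and> j \<notin> \<nu> \<and> j < i} = card ?S"
    using card_image[of "map_prod (steps M) (steps M)" ?S] by (simp only:)
  then show ?thesis
    by (simp only: inversions_def inv_between_def)
qed

text \<open>The signed sum behind the product of two products, for simplices of dimensions
  \<open>a\<close>, \<open>b\<close>, \<open>c\<close>, \<open>d\<close>. The arguments of
  \<open>F\<close> are the degeneracies applied to the four factors. With \<open>F\<close> left
  open, the interchange becomes a statement about sets of steps.\<close>

definition quad_shuffle_sum ::
  "nat \<Rightarrow> nat \<Rightarrow> nat \<Rightarrow> nat \<Rightarrow> ((nat \<Rightarrow> nat) \<Rightarrow> (nat \<Rightarrow> nat) \<Rightarrow> (nat \<Rightarrow> nat) \<Rightarrow> (nat \<Rightarrow> nat) \<Rightarrow> 's) \<Rightarrow> 's \<Rightarrow>\<^sub>0 int"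
  where
  "quad_shuffle_sum a b c d F =
     (\<Sum>\<mu> | \<mu> \<subseteq> {..<(a + b) + (c + d)} \<and> card \<mu> = a + b. frag_cmul ((-1) ^ inversions \<mu>)
       (\<Sum>\<nu> | \<nu> \<subseteq> {..<a + b} \<and> card \<nu> = a. frag_cmul ((-1) ^ inversions \<nu>)
         (\<Sum>\<rho> | \<rho> \<subseteq> {..<c + d} \<and> card \<rho> = c. frag_cmul ((-1) ^ inversions \<rho>)
           (frag_of (F (steps \<nu> \<circ> steps \<mu>) (steps (- \<nu>) \<circ> steps \<mu>)
                       (steps \<rho> \<circ> steps (- \<mu>)) (steps (- \<rho>) \<circ> steps (- \<mu>)))))))"

text \<open>A shuffle \<open>\<mu>\<close> followed by shuffles \<open>\<nu>\<close>, \<open>\<rho>\<close> of its two kinds of steps is a partition of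
  the steps into four sets: \<open>A = pull \<mu> \<nu>\<close>, \<open>\<mu> - A\<close>, \<open>C = pull (- \<mu>) \<rho>\<close> and the rest.\<close>

definition quads :: "nat \<Rightarrow> nat \<Rightarrow> nat \<Rightarrow> nat \<Rightarrow> (nat set \<times> nat set \<times> nat set) set" where
  "quads a b c d = {(\<mu>, A, C). \<mu> \<subseteq> {..<(a + b) + (c + d)} \<and> card \<mu> = a + b \<and> A \<subseteq> \<mu> \<and> card A = a \<and>
      C \<subseteq> {..<(a + b) + (c + d)} - \<mu> \<and> card C = c}"

text \<open>By \<open>steps_pull\<close> and \<open>inversions_pull\<close> both the degeneracies
  and the signs depend on the four blocks of steps alone. The complements are taken in all numbers,
  but those beyond the last step take part in no inversion, as the larger step of an inversion lies
  in a bounded block.\<close>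

lemma quad_shuffle_sum_quads:
  "quad_shuffle_sum a b c d F = (\<Sum>(\<mu>, A, C)\<in>quads a b c d.
     frag_cmul ((-1) ^ (inv_between \<mu> (- \<mu>) + inv_between A (\<mu> - A) + inv_between C (- \<mu> - C)))
       (frag_of (F (steps A) (steps (\<mu> - A)) (steps C) (steps (- \<mu> - C)))))"
proof -
  define N where "N = (a + b) + (c + d)"
  define f where "f \<mu> A C = frag_cmul ((-1) ^ inv_between C (- \<mu> - C))
       (frag_of (F (steps A) (steps (\<mu> - A)) (steps C) (steps (- \<mu> - C))))" for \<mu> A C
  have bij1: "bij_betw (pull \<mu>) {\<nu>. \<nu> \<subseteq> {..<a + b} \<and> card \<nu> = a} {A. A \<subseteq> \<mu> \<and> card A = a}"
    and bij2: "bij_betw (pull (- \<mu>)) {\<rho>. \<rho> \<subseteq> {..<c + d} \<and> card \<rho> = c} {C. C \<subseteq> {..<N} - \<mu> \<and> card C = c}"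
    and inv1: "\<And>\<nu>. \<nu> \<subseteq> {..<a + b} \<Longrightarrow> inversions \<nu> = inv_between (pull \<mu> \<nu>) (\<mu> - pull \<mu> \<nu>)"
    and inv2: "\<And>\<rho>. \<rho> \<subseteq> {..<c + d} \<Longrightarrow> inversions \<rho> = inv_between (pull (- \<mu>) \<rho>) (- \<mu> - pull (- \<mu>) \<rho>)"
    if \<mu>: "\<mu> \<subseteq> {..<N} \<and> card \<mu> = a + b" for \<mu>
  proof -
    have s: "steps \<mu> N = a + b" using \<mu> steps_all[of \<mu> N N] by simp
    then have s': "steps (- \<mu>) N = c + d" using steps_Compl[of \<mu> N] by (simp add: N_def)
    have "\<mu> \<inter> {..<N} = \<mu>" "- \<mu> \<inter> {..<N} = {..<N} - \<mu>" using \<mu> by auto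
    then show "bij_betw (pull \<mu>) {\<nu>. \<nu> \<subseteq> {..<a + b} \<and> card \<nu> = a} {A. A \<subseteq> \<mu> \<and> card A = a}"
      "bij_betw (pull (- \<mu>)) {\<rho>. \<rho> \<subseteq> {..<c + d} \<and> card \<rho> = c} {C. C \<subseteq> {..<N} - \<mu> \<and> card C = c}"
      using bij_betw_pull[of \<mu> N a] bij_betw_pull[of "- \<mu>" N c] s s' by simp_all
    show "\<And>\<nu>. \<nu> \<subseteq> {..<a + b} \<Longrightarrow> inversions \<nu> = inv_between (pull \<mu> \<nu>) (\<mu> - pull \<mu> \<nu>)"
      "\<And>\<rho>. \<rho> \<subseteq> {..<c + d} \<Longrightarrow> inversions \<rho> = inv_between (pull (- \<mu>) \<rho>) (- \<mu> - pull (- \<mu>) \<rho>)"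
      using inversions_pull[of _ \<mu> N] inversions_pull[of _ "- \<mu>" N] s s' by simp_all
  qed
  have comp: "steps \<nu> \<circ> steps M = steps (pull M \<nu>)" for \<nu> M
    by (simp add: steps_pull fun_eq_iff)
  have in2: "(\<Sum>\<rho> | \<rho> \<subseteq> {..<c + d} \<and> card \<rho> = c. frag_cmul ((-1) ^ inversions \<rho>)
           (frag_of (F (steps A) (steps (\<mu> - A)) (steps (pull (- \<mu>) \<rho>)) (steps (- \<mu> - pull (- \<mu>) \<rho>)))))
      = (\<Sum>C | C \<subseteq> {..<N} - \<mu> \<and> card C = c. f \<mu> A C)"
    if \<mu>: "\<mu> \<subseteq> {..<N} \<and> card \<mu> = a + b" for \<mu> A
    unfolding f_def
    by (subst sum.reindex_bij_betw[OF bij2[OF \<mu>], symmetric]) (auto intro!: sum.cong simp: inv2[OF \<mu>])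
  have in1: "(\<Sum>\<nu> | \<nu> \<subseteq> {..<a + b} \<and> card \<nu> = a. frag_cmul ((-1) ^ inversions \<nu>)
       (\<Sum>C | C \<subseteq> {..<N} - \<mu> \<and> card C = c. f \<mu> (pull \<mu> \<nu>) C))
     = (\<Sum>A | A \<subseteq> \<mu> \<and> card A = a. frag_cmul ((-1) ^ inv_between A (\<mu> - A))
         (\<Sum>C | C \<subseteq> {..<N} - \<mu> \<and> card C = c. f \<mu> A C))"
    if \<mu>: "\<mu> \<subseteq> {..<N} \<and> card \<mu> = a + b" for \<mu>
    by (subst sum.reindex_bij_betw[OF bij1[OF \<mu>], symmetric]) (auto intro!: sum.cong simp: inv1[OF \<mu>])
  have "quad_shuffle_sum a b c d F = (\<Sum>\<mu> | \<mu> \<subseteq> {..<N} \<and> card \<mu> = a + b. frag_cmul ((-1) ^ inv_between \<mu> (- \<mu>))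
      (\<Sum>A | A \<subseteq> \<mu> \<and> card A = a. frag_cmul ((-1) ^ inv_between A (\<mu> - A))
         (\<Sum>C | C \<subseteq> {..<N} - \<mu> \<and> card C = c. f \<mu> A C)))"
    unfolding quad_shuffle_sum_def comp pull_Compl N_def[symmetric]
  proof (rule sum.cong[OF refl], clarify)
    fix \<mu> assume \<mu>: "\<mu> \<subseteq> {..<N}" "card \<mu> = a + b"
    show "frag_cmul ((-1) ^ inversions \<mu>)
       (\<Sum>\<nu> | \<nu> \<subseteq> {..<a + b} \<and> card \<nu> = a. frag_cmul ((-1) ^ inversions \<nu>)
         (\<Sum>\<rho> | \<rho> \<subseteq> {..<c + d} \<and> card \<rho> = c. frag_cmul ((-1) ^ inversions \<rho>)
           (frag_of (F (steps (pull \<mu> \<nu>)) (steps (\<mu> - pull \<mu> \<nu>))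
                       (steps (pull (- \<mu>) \<rho>)) (steps (- \<mu> - pull (- \<mu>) \<rho>))))))
      = frag_cmul ((-1) ^ inv_between \<mu> (- \<mu>))
      (\<Sum>A | A \<subseteq> \<mu> \<and> card A = a. frag_cmul ((-1) ^ inv_between A (\<mu> - A))
         (\<Sum>C | C \<subseteq> {..<N} - \<mu> \<and> card C = c. f \<mu> A C))"
      using \<mu> by (simp only: in1 in2 inversions_eq[of \<mu>])
  qed
  also have "\<dots> = (\<Sum>\<mu> | \<mu> \<subseteq> {..<N} \<and> card \<mu> = a + b. \<Sum>A | A \<subseteq> \<mu> \<and> card A = a. \<Sum>C | C \<subseteq> {..<N} - \<mu> \<and> card C = c.
      frag_cmul ((-1) ^ (inv_between \<mu> (- \<mu>) + inv_between A (\<mu> - A) + inv_between C (- \<mu> - C)))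
       (frag_of (F (steps A) (steps (\<mu> - A)) (steps C) (steps (- \<mu> - C)))))"
    by (simp add: frag_cmul_sum f_def power_add mult.assoc)
  also have "\<dots> = (\<Sum>(\<mu>, A, C)\<in>(SIGMA \<mu>:{\<mu>. \<mu> \<subseteq> {..<N} \<and> card \<mu> = a + b}.
         {A. A \<subseteq> \<mu> \<and> card A = a} \<times> {C. C \<subseteq> {..<N} - \<mu> \<and> card C = c}).
      frag_cmul ((-1) ^ (inv_between \<mu> (- \<mu>) + inv_between A (\<mu> - A) + inv_between C (- \<mu> - C)))
       (frag_of (F (steps A) (steps (\<mu> - A)) (steps C) (steps (- \<mu> - C)))))"
  proof -
    have fin: "finite {A. A \<subseteq> \<mu> \<and> card A = a}" "finite {C. C \<subseteq> {..<N} - \<mu> \<and> card C = c}"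
      if "\<mu> \<in> {\<mu>. \<mu> \<subseteq> {..<N} \<and> card \<mu> = a + b}" for \<mu>
    proof -
      have "finite \<mu>" using that finite_subset by auto
      then show "finite {A. A \<subseteq> \<mu> \<and> card A = a}" by simp
      show "finite {C. C \<subseteq> {..<N} - \<mu> \<and> card C = c}" by simp
    qed
    define g where "g \<mu> A C = frag_cmul ((-1) ^ (inv_between \<mu> (- \<mu>) + inv_between A (\<mu> - A) + inv_between C (- \<mu> - C)))
       (frag_of (F (steps A) (steps (\<mu> - A)) (steps C) (steps (- \<mu> - C))))" for \<mu> A C
    have "(\<Sum>\<mu> | \<mu> \<subseteq> {..<N} \<and> card \<mu> = a + b. \<Sum>(A, C)\<in>{A. A \<subseteq> \<mu> \<and> card A = a} \<times> {C. C \<subseteq> {..<N} - \<mu> \<and> card C = c}. g \<mu> A C)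
        = (\<Sum>(\<mu>, A, C)\<in>(SIGMA \<mu>:{\<mu>. \<mu> \<subseteq> {..<N} \<and> card \<mu> = a + b}.
             {A. A \<subseteq> \<mu> \<and> card A = a} \<times> {C. C \<subseteq> {..<N} - \<mu> \<and> card C = c}). g \<mu> A C)"
    proof (rule sum.Sigma[where g = "\<lambda>\<mu> (A, C). g \<mu> A C"])
      show "\<forall>\<mu>\<in>{\<mu>. \<mu> \<subseteq> {..<N} \<and> card \<mu> = a + b}. finite ({A. A \<subseteq> \<mu> \<and> card A = a} \<times> {C. C \<subseteq> {..<N} - \<mu> \<and> card C = c})"
        using fin by (intro ballI finite_cartesian_product)
    qed (rule finite_shuffles)
    then show ?thesis
      unfolding g_def by (simp only: sum.cartesian_product)
  qed
  also have "(SIGMA \<mu>:{\<mu>. \<mu> \<subseteq> {..<N} \<and> card \<mu> = a + b}.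
         {A. A \<subseteq> \<mu> \<and> card A = a} \<times> {C. C \<subseteq> {..<N} - \<mu> \<and> card C = c}) = quads a b c d"
    by (auto simp: quads_def N_def)
  finally show ?thesis .
qed

text \<open>Let \<open>A\<close>, \<open>B\<close>, \<open>C\<close>, \<open>D\<close> be the blocks
  of the four factors. Both signs count the inversions between all pairs of blocks, in the same
  direction except for \<open>B\<close> and \<open>C\<close>; the two counts for this pair add up to
  \<open>b * c\<close>.\<close>

lemma quad_shuffle_sum_swap:
  "quad_shuffle_sum a b c d F
     = frag_cmul ((-1) ^ (b * c)) (quad_shuffle_sum a c b d (\<lambda>w x y z. F w y x z))"
proof -
  \<comment> \<open>Exchanges the middle blocks: \<open>\<mu> = A \<union> B\<close> becomes
    \<open>A \<union> C\<close>, and \<open>C\<close> becomes \<open>B = \<mu> - A\<close>. Applied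
    twice it is the identity.\<close>
  define h where "h = (\<lambda>(\<mu>, A, C). (A \<union> C, A, \<mu> - A :: nat set))"
  have h: "h z \<in> quads a c b d \<and> h (h z) = z" if "z \<in> quads a b c d" for a b c d z
  proof -
    obtain \<mu> A C where z: "z = (\<mu>, A, C)" by (cases z)
    have q: "\<mu> \<subseteq> {..<(a + b) + (c + d)}" "card \<mu> = a + b" "A \<subseteq> \<mu>" "card A = a"
      "C \<subseteq> {..<(a + b) + (c + d)} - \<mu>" "card C = c"
      using that by (simp_all add: z quads_def)
    have fin: "finite \<mu>" using finite_subset[OF q(1)] by simp
    have fin: "finite \<mu>" "finite A" "finite C"
      using fin finite_subset[OF q(3)] finite_subset[OF q(5)] by simp_all
    have "card (A \<union> C) = a + c" using q fin by (subst card_Un_disjoint) auto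
    moreover have "card (\<mu> - A) = b" using q fin by (simp add: card_Diff_subset)
    moreover have "A \<union> C \<subseteq> {..<(a + c) + (b + d)}" "\<mu> - A \<subseteq> {..<(a + c) + (b + d)} - (A \<union> C)"
      using q(1,3,5) by fastforce+
    moreover have "A \<union> (\<mu> - A) = \<mu>" "(A \<union> C) - A = C" using q by auto
    ultimately show ?thesis
      using q by (simp add: z h_def quads_def)
  qed
  have bij: "bij_betw h (quads a b c d) (quads a c b d)"
    by (rule bij_betw_byWitness[where f' = h]) (use h[of _ a b c d] h[of _ a c b d] in \<open>simp_all add: image_subset_iff\<close>)
  have "quad_shuffle_sum a b c d F = (\<Sum>z\<in>quads a b c d. frag_cmul ((-1) ^ (b * c)) ((\<lambda>(\<mu>, A, C).
     frag_cmul ((-1) ^ (inv_between \<mu> (- \<mu>) + inv_between A (\<mu> - A) + inv_between C (- \<mu> - C)))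
       (frag_of (F (steps A) (steps C) (steps (\<mu> - A)) (steps (- \<mu> - C))))) (h z)))"
    unfolding quad_shuffle_sum_quads
  proof (rule sum.cong[OF refl], clarify)
    fix \<mu> A C assume z: "(\<mu>, A, C) \<in> quads a b c d"
    define B D where "B = \<mu> - A" and "D = - \<mu> - C"
    have q: "\<mu> \<subseteq> {..<(a + b) + (c + d)}" "card \<mu> = a + b" "A \<subseteq> \<mu>" "card A = a"
      "C \<subseteq> {..<(a + b) + (c + d)} - \<mu>" "card C = c"
      using z by (simp_all add: quads_def)
    have fin: "finite \<mu>" using finite_subset[OF q(1)] by simp
    have fin: "finite \<mu>" "finite A" "finite C" "finite B"
      using fin finite_subset[OF q(3)] finite_subset[OF q(5)] by (simp_all add: B_def)
    have eqs: "\<mu> = A \<union> B" "- \<mu> = C \<union> D" "- (A \<union> C) = B \<union> D" "(A \<union> C) - A = C" "- (A \<union> C) - B = D" "\<mu> - A = B" "- \<mu> - C = D"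
      and dis: "A \<inter> B = {}" "C \<inter> D = {}" "B \<inter> D = {}" "A \<inter> C = {}" "B \<inter> C = {}"
      using q by (auto simp: B_def D_def)
    have dif: "C \<union> D - C = D" "B \<union> D - B = D"
      using dis by auto
    have "inv_between B C + inv_between C B = b * c"
      using inv_between_swap[of B C] fin dis q card_Diff_subset[of A \<mu>] by (simp add: B_def)
    moreover have "inv_between (A \<union> B) (C \<union> D) = inv_between A C + inv_between A D + inv_between B C + inv_between B D"
      using fin dis by (simp add: inv_between_Un_left inv_between_Un_right)
    moreover have "inv_between (A \<union> C) (B \<union> D) = inv_between A B + inv_between A D + inv_between C B + inv_between C D"
      using fin dis by (simp add: inv_between_Un_left inv_between_Un_right)
    ultimately have "b * c + (inv_between (A \<union> C) (B \<union> D) + inv_between A C + inv_between B D)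
        = (inv_between (A \<union> B) (C \<union> D) + inv_between A B + inv_between C D) + 2 * inv_between C B"
      by linarith
    then have "even (inv_between (A \<union> B) (C \<union> D) + inv_between A B + inv_between C D)
       \<longleftrightarrow> even (b * c + (inv_between (A \<union> C) (B \<union> D) + inv_between A C + inv_between B D))"
      by simp
    then have sgn: "(-1 :: int) ^ (inv_between (A \<union> B) (C \<union> D) + inv_between A B + inv_between C D)
       = (-1) ^ (b * c) * (-1) ^ (inv_between (A \<union> C) (B \<union> D) + inv_between A C + inv_between B D)"
      by (metis minus_one_power_iff power_add)
    show "frag_cmul ((-1) ^ (inv_between \<mu> (- \<mu>) + inv_between A (\<mu> - A) + inv_between C (- \<mu> - C)))
        (frag_of (F (steps A) (steps (\<mu> - A)) (steps C) (steps (- \<mu> - C))))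
      = frag_cmul ((-1) ^ (b * c)) (case h (\<mu>, A, C) of (\<mu>, A, C) \<Rightarrow>
          frag_cmul ((-1) ^ (inv_between \<mu> (- \<mu>) + inv_between A (\<mu> - A) + inv_between C (- \<mu> - C)))
           (frag_of (F (steps A) (steps C) (steps (\<mu> - A)) (steps (- \<mu> - C)))))"
      unfolding h_def prod.case frag_cmul_cmul eqs(2,3,4,6) dif
      by (simp only: sgn[unfolded eqs(1)[symmetric]])
  qed
  also have "\<dots> = frag_cmul ((-1) ^ (b * c)) (quad_shuffle_sum a c b d (\<lambda>w x y z. F w y x z))"
    unfolding quad_shuffle_sum_quads frag_cmul_sum
    by (rule sum.reindex_bij_betw[OF bij])
  finally show ?thesis .
qed

section \<open>Homology modulo p\<close>

locale chain_complex =
  fixes S :: "nat \<Rightarrow> 's set" and bd :: "nat \<Rightarrow> ('s \<Rightarrow>\<^sub>0 int) \<Rightarrow> ('s \<Rightarrow>\<^sub>0 int)" and p :: nat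
  assumes p_pos: "0 < p"
    and bd_add: "bd n (a + b) = bd n a + bd n b"
    and bd_cmul: "bd n (frag_cmul k a) = frag_cmul k (bd n a)"
    and bd_closed: "Poly_Mapping.keys c \<subseteq> S (Suc n) \<Longrightarrow> Poly_Mapping.keys (bd (Suc n) c) \<subseteq> S n"
    and bd_bd: "Poly_Mapping.keys c \<subseteq> S (Suc n) \<Longrightarrow> bd n (bd (Suc n) c) = 0"
    and bd_zero_dim: "bd 0 c = 0"
begin

abbreviation Z where "Z n \<equiv> mod_cycles p S bd n"
abbreviation B where "B n \<equiv> mod_boundaries p S bd n"
abbreviation H where "H n \<equiv> mod_homology p S bd n"

definition cls :: "nat \<Rightarrow> ('s \<Rightarrow>\<^sub>0 int) \<Rightarrow> ('s \<Rightarrow>\<^sub>0 int) set" where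
  "cls n c = {c + w |w. w \<in> B n}"

lemma bd_0: "bd n 0 = 0"
  using bd_cmul[of n 0 0] by simp

lemma Z_keys: "c \<in> Z n \<Longrightarrow> Poly_Mapping.keys c \<subseteq> S n"
  by (simp add: mod_cycles_def)

lemma Z_0: "0 \<in> Z n"
  by (auto simp: mod_cycles_def bd_0 intro!: exI[of _ 0])

lemma Z_add: "\<lbrakk>a \<in> Z n; b \<in> Z n\<rbrakk> \<Longrightarrow> a + b \<in> Z n"
  unfolding mod_cycles_def
  by (auto simp: bd_add intro: keys_add_subset[THEN subsetD] exI[of _ "_ + _"] simp flip: frag_cmul_distrib2)

lemma Z_cmul: "a \<in> Z n \<Longrightarrow> frag_cmul k a \<in> Z n"
  unfolding mod_cycles_def
  by (auto simp: bd_cmul mult.commute) (metis frag_cmul_cmul mult.commute)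

lemma Z_sum: "(\<And>i. i \<in> I \<Longrightarrow> a i \<in> Z n) \<Longrightarrow> sum a I \<in> Z n"
  by (induction I rule: infinite_finite_induct) (auto simp: Z_0 Z_add)

lemma B_I: "\<lbrakk>Poly_Mapping.keys d \<subseteq> S (Suc n); Poly_Mapping.keys e \<subseteq> S n; c = bd (Suc n) d + frag_cmul (int p) e\<rbrakk> \<Longrightarrow> c \<in> B n"
  by (auto simp: mod_boundaries_def)

lemma B_0: "0 \<in> B n"
  by (rule B_I[of 0 n 0]) (simp_all add: bd_0)

lemma B_add: "\<lbrakk>a \<in> B n; b \<in> B n\<rbrakk> \<Longrightarrow> a + b \<in> B n"
proof -
  assume "a \<in> B n" "b \<in> B n"
  then obtain d e d' e' where *: "a = bd (Suc n) d + frag_cmul (int p) e" "b = bd (Suc n) d' + frag_cmul (int p) e'"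
    "Poly_Mapping.keys d \<subseteq> S (Suc n)" "Poly_Mapping.keys e \<subseteq> S n" "Poly_Mapping.keys d' \<subseteq> S (Suc n)" "Poly_Mapping.keys e' \<subseteq> S n"
    unfolding mod_boundaries_def by blast
  show ?thesis
    by (rule B_I[of "d + d'" n "e + e'"])
       (use * in \<open>simp_all add: keys_add_subset bd_add frag_cmul_distrib2\<close>)
qed

lemma B_cmul: "a \<in> B n \<Longrightarrow> frag_cmul k a \<in> B n"
proof -
  assume "a \<in> B n"
  then obtain d e where *: "a = bd (Suc n) d + frag_cmul (int p) e"
    "Poly_Mapping.keys d \<subseteq> S (Suc n)" "Poly_Mapping.keys e \<subseteq> S n"
    unfolding mod_boundaries_def by blast
  show ?thesis
    by (rule B_I[of "frag_cmul k d" n "frag_cmul k e"])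
       (use * in \<open>auto simp: bd_cmul frag_cmul_distrib2 mult.commute\<close>)
qed

lemma B_minus: "a \<in> B n \<Longrightarrow> - a \<in> B n"
  using B_cmul[of a n "-1"] by simp

lemma B_diff: "\<lbrakk>a \<in> B n; b \<in> B n\<rbrakk> \<Longrightarrow> a - b \<in> B n"
  using B_add[of a n "- b"] B_minus[of b n] by simp

lemma B_sum: "(\<And>i. i \<in> I \<Longrightarrow> a i \<in> B n) \<Longrightarrow> sum a I \<in> B n"
  by (induction I rule: infinite_finite_induct) (auto simp: B_0 B_add)

lemma B_Z: "B n \<subseteq> Z n"
proof
  fix a assume "a \<in> B n"
  then obtain d e where *: "a = bd (Suc n) d + frag_cmul (int p) e"
    "Poly_Mapping.keys d \<subseteq> S (Suc n)" "Poly_Mapping.keys e \<subseteq> S n"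
    unfolding mod_boundaries_def by blast
  have "bd n a = frag_cmul (int p) (bd n e)"
    using * by (simp add: bd_add bd_cmul bd_bd)
  moreover have "Poly_Mapping.keys a \<subseteq> S n"
    unfolding *(1) by (intro keys_add_subset keys_cmul_subset bd_closed *)
  ultimately show "a \<in> Z n" by (auto simp: mod_cycles_def)
qed

text \<open>\<open>mod_cycles\<close> leaves the quotient \<open>e\<close> of the boundary by
  \<open>p\<close> unrestricted. Multiplication by \<open>p > 0\<close> keeps the support, so
  \<open>e\<close> is a chain of the complex.\<close>

lemma Z_boundary_keys:
  assumes "c \<in> Z (Suc n)"
  obtains e where "bd (Suc n) c = frag_cmul (int p) e" "Poly_Mapping.keys e \<subseteq> S n"
proof -
  obtain e where e: "bd (Suc n) c = frag_cmul (int p) e" using assms by (auto simp: mod_cycles_def)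
  have "Poly_Mapping.keys (frag_cmul (int p) e) \<subseteq> S n"
    using bd_closed[OF Z_keys[OF assms]] e by simp
  then have "Poly_Mapping.keys e \<subseteq> S n" using p_pos by (auto simp: subset_iff)
  with e show thesis by (rule that)
qed

lemma cls_eq_iff: "cls n a = cls n b \<longleftrightarrow> a - b \<in> B n"
proof
  assume "cls n a = cls n b"
  moreover have "a \<in> cls n a" by (auto simp: cls_def intro!: exI[of _ 0] B_0)
  ultimately show "a - b \<in> B n" by (auto simp: cls_def)
next
  assume ab: "a - b \<in> B n"
  show "cls n a = cls n b"
  proof (intro equalityI subsetI)
    fix z assume "z \<in> cls n a"
    then obtain w where "w \<in> B n" "z = a + w" by (auto simp: cls_def)
    then show "z \<in> cls n b"
      using B_add[OF ab, of w] by (auto simp: cls_def intro!: exI[of _ "a - b + w"])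
  next
    fix z assume "z \<in> cls n b"
    then obtain w where "w \<in> B n" "z = b + w" by (auto simp: cls_def)
    then show "z \<in> cls n a"
      using B_diff[of w n "a - b"] ab by (auto simp: cls_def intro!: exI[of _ "w - (a - b)"])
  qed
qed

lemma cls_subset_Z: "c \<in> Z n \<Longrightarrow> cls n c \<subseteq> Z n"
  using B_Z Z_add by (fastforce simp: cls_def)

lemma cls_self: "c \<in> cls n c"
  by (auto simp: cls_def intro!: exI[of _ 0] B_0)

section \<open>Homology groups as groups of cosets \<open>cls n c\<close>\<close>

lemma subgroup_Z: "subgroup (Z n) (free_Abelian_group (S n))"
proof (rule group.subgroupI[OF group_free_Abelian_group])
  show "inv\<^bsub>free_Abelian_group (S n)\<^esub> a \<in> Z n" if "a \<in> Z n" for a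
    using Z_cmul[OF that, of "-1"] Z_keys[OF that] by simp
  show "Z n \<noteq> {}" using Z_0 by blast
qed (use Z_keys Z_add in auto)

lemma carrier_Z: "carrier (subgroup_generated (free_Abelian_group (S n)) (Z n)) = Z n"
  by (rule subgroup.carrier_subgroup_generated_subgroup[OF subgroup_Z])

lemma comm_group_Z: "comm_group (subgroup_generated (free_Abelian_group (S n)) (Z n))"
  by (rule group.abelian_subgroup_generated[OF group_free_Abelian_group abelian_free_Abelian_group])

lemma inv_Z: "a \<in> Z n \<Longrightarrow> inv\<^bsub>subgroup_generated (free_Abelian_group (S n)) (Z n)\<^esub> a = - a"
  using group.inv_subgroup_generated[OF group_free_Abelian_group, of a "S n" "Z n"] Z_keys[of a n]
  by (simp add: carrier_Z)

lemma subgroup_B: "subgroup (B n) (subgroup_generated (free_Abelian_group (S n)) (Z n))"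
proof (rule group.subgroupI)
  show "group (subgroup_generated (free_Abelian_group (S n)) (Z n))"
    by (rule comm_group.axioms(2)[OF comm_group_Z])
  show "inv\<^bsub>subgroup_generated (free_Abelian_group (S n)) (Z n)\<^esub> a \<in> B n" if "a \<in> B n" for a
    using inv_Z[OF subsetD[OF B_Z that]] B_minus[OF that] by simp
  show "B n \<noteq> {}" using B_0 by blast
qed (use B_Z B_add carrier_Z in auto)

sublocale H: comm_group "H n" for n
  unfolding mod_homology_def by (rule comm_group.abelian_FactGroup[OF comm_group_Z subgroup_B])

lemma r_coset_cls: "r_coset (subgroup_generated (free_Abelian_group (S n)) (Z n)) (B n) c = cls n c"
  by (auto simp: r_coset_def cls_def add.commute)

lemma carrier_H: "carrier (H n) = cls n ` Z n"
  by (simp add: mod_homology_def carrier_FactGroup r_coset_cls carrier_Z)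

lemma cls_closed: "c \<in> Z n \<Longrightarrow> cls n c \<in> carrier (H n)"
  by (auto simp: carrier_H)

lemma one_H: "\<one>\<^bsub>H n\<^esub> = cls n 0"
  by (simp add: mod_homology_def cls_def)

lemma mult_H: "cls n a \<otimes>\<^bsub>H n\<^esub> cls n b = cls n (a + b)"
proof -
  have "cls n a \<otimes>\<^bsub>H n\<^esub> cls n b = {x + y |x y. x \<in> cls n a \<and> y \<in> cls n b}"
    by (auto simp: mod_homology_def set_mult_def)
  also have "\<dots> = cls n (a + b)"
  proof (intro equalityI subsetI)
    fix z assume "z \<in> {x + y |x y. x \<in> cls n a \<and> y \<in> cls n b}"
    then obtain w w' where "w \<in> B n" "w' \<in> B n" "z = (a + w) + (b + w')" by (auto simp: cls_def)
    then show "z \<in> cls n (a + b)"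
      using B_add[of w n w'] by (auto simp: cls_def algebra_simps)
  next
    fix z assume "z \<in> cls n (a + b)"
    then obtain w where "w \<in> B n" "z = a + (b + w)" by (auto simp: cls_def algebra_simps)
    then show "z \<in> {x + y |x y. x \<in> cls n a \<and> y \<in> cls n b}"
      using cls_self[of a n] unfolding cls_def by blast
  qed
  finally show ?thesis .
qed

lemma finprod_H:
  assumes "finite I" "\<And>i. i \<in> I \<Longrightarrow> c i \<in> Z n"
  shows "finprod (H n) (\<lambda>i. cls n (c i)) I = cls n (sum c I)"
  using assms
proof (induction I rule: finite_induct)
  case empty
  then show ?case by (simp add: one_H)
next
  case (insert i I)
  then show ?case by (simp add: H.finprod_insert Pi_iff cls_closed mult_H)
qed

text \<open>Homology is written multiplicatively, so a sign in front of a class appears as an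
  integer power; on representatives it is a scalar.\<close>

lemma int_pow_sign_H:
  assumes "c \<in> Z n"
  shows "cls n c [^]\<^bsub>H n\<^esub> ((-1) ^ k :: int) = cls n (frag_cmul ((-1) ^ k) c)"
proof (cases "even k")
  case True
  then show ?thesis using cls_closed[OF assms] by (simp add: H.int_pow_1)
next
  case False
  have "inv\<^bsub>H n\<^esub> (cls n c) = cls n (- c)"
    using Z_cmul[OF assms, of "-1"] by (intro H.inv_equality) (simp_all add: mult_H one_H cls_closed assms)
  then show ?thesis using False cls_closed[OF assms] H.int_pow_neg[of "cls n c" n 1] by (simp add: H.int_pow_1)
qed

end

lemma (in simplicial_set) chain_complex: "0 < p \<Longrightarrow> chain_complex S bd p"
  by unfold_locales (auto simp: bd_add bd_cmul bd_closed bd_bd)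

text \<open>Operations on classes are defined by all representatives at once. Adding every boundary
  \<open>w\<close> of the target makes the result a full coset, and additivity with preservation of
  boundaries keeps it to a single one.\<close>

lemma induced_cls:
  assumes "chain_complex S bd p" "chain_complex T bd' p"
    and add: "\<And>c c'. F (c + c') = F c + F c'"
    and B: "\<And>c. c \<in> mod_boundaries p S bd n \<Longrightarrow> F c \<in> mod_boundaries p T bd' n"
  shows "{F c + w |c w. c \<in> chain_complex.cls S bd p n a \<and> w \<in> mod_boundaries p T bd' n}
       = chain_complex.cls T bd' p n (F a)"
proof -
  interpret S: chain_complex S bd p by fact
  interpret T: chain_complex T bd' p by fact
  have "F (a + u) + w = F a + (F u + w)" for u w by (simp add: add add.assoc)
  moreover have "F u + w \<in> T.B n" if "u \<in> S.B n" "w \<in> T.B n" for u w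
    using B T.B_add that by blast
  ultimately show ?thesis
    unfolding T.cls_def S.cls_def
    by (auto; metis S.cls_self S.cls_def mem_Collect_eq add_0_right S.B_0)
qed

lemma induced_Z:
  assumes "\<And>c. Poly_Mapping.keys c \<subseteq> S n \<Longrightarrow> Poly_Mapping.keys (F n c) \<subseteq> T n"
    and "\<And>c k. F (n - 1) (frag_cmul k c) = frag_cmul k (F (n - 1) c)"
    and "\<And>c. Poly_Mapping.keys c \<subseteq> S n \<Longrightarrow> bd' n (F n c) = F (n - 1) (bd n c)"
    and "c \<in> mod_cycles p S bd n"
  shows "F n c \<in> mod_cycles p T bd' n"
  using assms unfolding mod_cycles_def by auto

lemma induced_B:
  assumes "\<And>n c. Poly_Mapping.keys c \<subseteq> S n \<Longrightarrow> Poly_Mapping.keys (F n c) \<subseteq> T n"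
    and "\<And>n c k. F n (frag_cmul k c) = frag_cmul k (F n c)"
    and "\<And>n c c'. F n (c + c') = F n c + F n c'"
    and "\<And>n c. Poly_Mapping.keys c \<subseteq> S n \<Longrightarrow> bd' n (F n c) = F (n - 1) (bd n c)"
    and "c \<in> mod_boundaries p S bd n"
  shows "F n c \<in> mod_boundaries p T bd' n"
proof -
  obtain d e where *: "c = bd (Suc n) d + frag_cmul (int p) e"
    "Poly_Mapping.keys d \<subseteq> S (Suc n)" "Poly_Mapping.keys e \<subseteq> S n"
    using assms(5) unfolding mod_boundaries_def by blast
  have "F n c = bd' (Suc n) (F (Suc n) d) + frag_cmul (int p) (F n e)"
    using assms(4)[OF *(2)] by (simp add: *(1) assms(2,3))
  then show ?thesis
    using assms(1)[OF *(2)] assms(1)[OF *(3)] by (auto simp: mod_boundaries_def)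
qed

section \<open>The cross product on homology modulo p\<close>

context simplicial_product
begin

context
  fixes p :: nat
  assumes p: "0 < p"
begin

interpretation SC: chain_complex S sbd p by (rule S.chain_complex[OF p])
interpretation TC: chain_complex T tbd p by (rule T.chain_complex[OF p])
interpretation UC: chain_complex U ubd p by (rule U.chain_complex[OF p])

lemma cross_Z_Z:
  assumes "c \<in> SC.Z m" "d \<in> TC.Z n"
  shows "cross_chain m n c d \<in> UC.Z (m + n)"
proof -
  obtain e where e: "sbd m c = frag_cmul (int p) e" using assms(1) by (auto simp: mod_cycles_def)
  obtain e' where e': "tbd n d = frag_cmul (int p) e'" using assms(2) by (auto simp: mod_cycles_def)
  have "ubd (m + n) (cross_chain m n c d) = frag_cmul (int p)
     (cross_chain (m - 1) n e d + frag_cmul ((-1) ^ m) (cross_chain m (n - 1) c e'))"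
    using bd_cross_chain[OF SC.Z_keys[OF assms(1)] TC.Z_keys[OF assms(2)]]
    by (simp add: e e' cross_chain_cmul_left cross_chain_cmul_right frag_cmul_distrib2 mult.commute)
  then show ?thesis
    using cross_chain_closed[OF SC.Z_keys[OF assms(1)] TC.Z_keys[OF assms(2)]] by (auto simp: mod_cycles_def)
qed

text \<open>The Leibniz rule for \<open>c\<close> and \<open>u\<close> has a second term with the
  boundary of \<open>c\<close>, which is not 0 but \<open>p\<close> times a chain \<open>f\<close>.
  It contributes \<open>p\<close> times the product of \<open>f\<close> and \<open>u\<close>, again
  a boundary modulo \<open>p\<close>.\<close>

lemma cross_Z_B:
  assumes c: "c \<in> SC.Z m" and d: "d \<in> TC.B n"
  shows "cross_chain m n c d \<in> UC.B (m + n)"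
proof -
  obtain u e where *: "d = tbd (Suc n) u + frag_cmul (int p) e"
    "Poly_Mapping.keys u \<subseteq> T (Suc n)" "Poly_Mapping.keys e \<subseteq> T n"
    using d unfolding mod_boundaries_def by blast
  have bd: "ubd (Suc (m + n)) (cross_chain m (Suc n) c u)
     = cross_chain (m - 1) (Suc n) (sbd m c) u + frag_cmul ((-1) ^ m) (cross_chain m n c (tbd (Suc n) u))"
    using bd_cross_chain[OF SC.Z_keys[OF c] *(2)] by simp
  have "cross_chain (m - 1) (Suc n) (sbd m c) u \<in> UC.B (m + n)"
  proof (cases m)
    case 0
    then show ?thesis by (simp add: UC.B_0)
  next
    case (Suc k)
    obtain f where f: "sbd m c = frag_cmul (int p) f" "Poly_Mapping.keys f \<subseteq> S k"
      using SC.Z_boundary_keys c unfolding Suc by blast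
    have "cross_chain (m - 1) (Suc n) (sbd m c) u = ubd (Suc (m + n)) 0 + frag_cmul (int p) (cross_chain k (Suc n) f u)"
      using f Suc by (simp add: cross_chain_cmul_left)
    then show ?thesis
      using UC.B_I[of 0 "m + n" "cross_chain k (Suc n) f u"] cross_chain_closed[OF f(2) *(2)] Suc by simp
  qed
  moreover have "ubd (Suc (m + n)) (cross_chain m (Suc n) c u) \<in> UC.B (m + n)"
    using UC.B_I[of "cross_chain m (Suc n) c u" "m + n" 0] cross_chain_closed[OF SC.Z_keys[OF c] *(2)] by simp
  ultimately have "frag_cmul ((-1) ^ m) (cross_chain m n c (tbd (Suc n) u)) \<in> UC.B (m + n)"
    using UC.B_diff[of "ubd (Suc (m + n)) (cross_chain m (Suc n) c u)" "m + n"] unfolding bd by fastforce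
  \<comment> \<open>The sign squares to 1, so multiplying by it once more removes it.\<close>
  then have "cross_chain m n c (tbd (Suc n) u) \<in> UC.B (m + n)"
    using UC.B_cmul[of _ "m + n" "(-1) ^ m"] by (fastforce simp flip: power_mult_distrib)
  moreover have "frag_cmul (int p) (cross_chain m n c e) \<in> UC.B (m + n)"
    using UC.B_I[of 0 "m + n" "cross_chain m n c e"] cross_chain_closed[OF SC.Z_keys[OF c] *(3)] by simp
  ultimately show ?thesis
    unfolding *(1) cross_chain_add_right cross_chain_cmul_right by (rule UC.B_add)
qed

lemma cross_B_Z:
  assumes c: "c \<in> SC.B m" and d: "d \<in> TC.Z n"
  shows "cross_chain m n c d \<in> UC.B (m + n)"
proof -
  obtain u e where *: "c = sbd (Suc m) u + frag_cmul (int p) e"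
    "Poly_Mapping.keys u \<subseteq> S (Suc m)" "Poly_Mapping.keys e \<subseteq> S m"
    using c unfolding mod_boundaries_def by blast
  have bd: "ubd (Suc (m + n)) (cross_chain (Suc m) n u d)
     = cross_chain m n (sbd (Suc m) u) d + frag_cmul ((-1) ^ Suc m) (cross_chain (Suc m) (n - 1) u (tbd n d))"
    using bd_cross_chain[OF *(2) TC.Z_keys[OF d]] by simp
  have "cross_chain (Suc m) (n - 1) u (tbd n d) \<in> UC.B (m + n)"
  proof (cases n)
    case 0
    then show ?thesis by (simp add: UC.B_0)
  next
    case (Suc k)
    obtain f where f: "tbd n d = frag_cmul (int p) f" "Poly_Mapping.keys f \<subseteq> T k"
      using TC.Z_boundary_keys d unfolding Suc by blast
    have "cross_chain (Suc m) (n - 1) u (tbd n d) = ubd (Suc (m + n)) 0 + frag_cmul (int p) (cross_chain (Suc m) k u f)"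
      using f Suc by (simp add: cross_chain_cmul_right)
    then show ?thesis
      using UC.B_I[of 0 "m + n" "cross_chain (Suc m) k u f"] cross_chain_closed[OF *(2) f(2)] Suc by simp
  qed
  then have "frag_cmul ((-1) ^ Suc m) (cross_chain (Suc m) (n - 1) u (tbd n d)) \<in> UC.B (m + n)"
    by (rule UC.B_cmul)
  moreover have "ubd (Suc (m + n)) (cross_chain (Suc m) n u d) \<in> UC.B (m + n)"
    using UC.B_I[of "cross_chain (Suc m) n u d" "m + n" 0] cross_chain_closed[OF *(2) TC.Z_keys[OF d]] by simp
  ultimately have "cross_chain m n (sbd (Suc m) u) d \<in> UC.B (m + n)"
    using UC.B_diff[of "ubd (Suc (m + n)) (cross_chain (Suc m) n u d)" "m + n"] unfolding bd by fastforce
  moreover have "frag_cmul (int p) (cross_chain m n e d) \<in> UC.B (m + n)"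
    using UC.B_I[of 0 "m + n" "cross_chain m n e d"] cross_chain_closed[OF *(3) TC.Z_keys[OF d]] by simp
  ultimately show ?thesis
    unfolding *(1) cross_chain_add_left cross_chain_cmul_left by (rule UC.B_add)
qed

lemma cross_cls:
  assumes a: "a \<in> SC.Z m" and b: "b \<in> TC.Z n"
  shows "{cross_chain m n c d + w |c d w. c \<in> SC.cls m a \<and> d \<in> TC.cls n b \<and> w \<in> UC.B (m + n)}
    = UC.cls (m + n) (cross_chain m n a b)"
proof (intro equalityI subsetI)
  fix z assume "z \<in> {cross_chain m n c d + w |c d w. c \<in> SC.cls m a \<and> d \<in> TC.cls n b \<and> w \<in> UC.B (m + n)}"
  then obtain u v w where *: "z = cross_chain m n (a + u) (b + v) + w" "u \<in> SC.B m" "v \<in> TC.B n" "w \<in> UC.B (m + n)"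
    by (auto simp: SC.cls_def TC.cls_def)
  have "z = cross_chain m n a b + (cross_chain m n a v + (cross_chain m n u (b + v) + w))"
    by (simp add: *(1) cross_chain_add_left cross_chain_add_right algebra_simps)
  moreover have "b + v \<in> TC.Z n" using b *(3) TC.B_Z TC.Z_add by blast
  ultimately show "z \<in> UC.cls (m + n) (cross_chain m n a b)"
    using cross_Z_B[OF a *(3)] cross_B_Z[OF *(2)] *(4) UC.B_add unfolding UC.cls_def by blast
next
  fix z assume "z \<in> UC.cls (m + n) (cross_chain m n a b)"
  then show "z \<in> {cross_chain m n c d + w |c d w. c \<in> SC.cls m a \<and> d \<in> TC.cls n b \<and> w \<in> UC.B (m + n)}"
    using SC.cls_self[of a m] TC.cls_self[of b n] unfolding UC.cls_def by blast
qed

end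

end

section \<open>Tests for k-open sets\<close>

lemma topspace_quot_topology: "topspace (quot_topology X q) = q ` topspace X"
proof -
  have "{x \<in> topspace X. q x \<in> q ` topspace X} = topspace X" by auto
  then have "openin (quot_topology X q) (q ` topspace X)"
    by (simp only: openin_quot_topology openin_topspace subset_refl simp_thms)
  then show ?thesis
    by (meson openin_quot_topology openin_subset openin_topspace subset_antisym)
qed

lemma continuous_map_quot_topology: "continuous_map X (quot_topology X q) q"
  unfolding continuous_map_def topspace_quot_topology openin_quot_topology by blast

lemma homeomorphic_map_quot_topology:
  assumes "inj_on q (topspace X)"
  shows "homeomorphic_map X (quot_topology X q) q"
proof (rule bijective_open_imp_homeomorphic_map[OF continuous_map_quot_topology _ _ assms])
  show "open_map X (quot_topology X q) q"
    unfolding open_map_def openin_quot_topology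
  proof (intro allI impI conjI)
    fix U assume U: "openin X U"
    then have "{x \<in> topspace X. q x \<in> q ` U} = U"
      using assms openin_subset[OF U] by (auto simp: inj_on_def)
    then show "openin X {x \<in> topspace X. q x \<in> q ` U}" using U by simp
    show "q ` U \<subseteq> q ` topspace X" using openin_subset[OF U] by blast
  qed
qed (simp add: topspace_quot_topology)

text \<open>k-openness is defined by test spaces on one fixed type. A compact Hausdorff space on any
  other type that injects into it is replaced by its homeomorphic image there.\<close>

lemma k_open_test:
  fixes X :: "'a topology" and j :: "'k \<Rightarrow> ('a + (nat \<Rightarrow> real)) set set"
  assumes V: "k_open X V" and K: "compact_space K" "Hausdorff_space K"
    and u: "continuous_map K X u" and j: "inj_on j (topspace K)"
  shows "openin K {z \<in> topspace K. u z \<in> V}"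
proof -
  define K' where "K' = quot_topology K j"
  have hom: "homeomorphic_map K K' j"
    unfolding K'_def by (rule homeomorphic_map_quot_topology[OF j])
  then have "K homeomorphic_space K'" by (rule homeomorphic_map_imp_homeomorphic_space)
  then have K': "compact_space K'" "Hausdorff_space K'"
    using K homeomorphic_compact_space homeomorphic_Hausdorff_space by blast+
  obtain g where g: "homeomorphic_maps K K' j g"
    using hom by (auto simp: homeomorphic_map_maps)
  then have "continuous_map K' X (u \<circ> g)"
    using u continuous_map_compose by (auto simp: homeomorphic_maps_def)
  then have "openin K' {z \<in> topspace K'. (u \<circ> g) z \<in> V}"
    using V K' unfolding k_open_def by blast
  moreover have "continuous_map K K' j" using g by (simp add: homeomorphic_maps_def)
  ultimately have "openin K {x \<in> topspace K. j x \<in> {z \<in> topspace K'. (u \<circ> g) z \<in> V}}"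
    unfolding continuous_map_def by blast
  also have "{x \<in> topspace K. j x \<in> {z \<in> topspace K'. (u \<circ> g) z \<in> V}} = {z \<in> topspace K. u z \<in> V}"
    using g by (auto simp: homeomorphic_maps_def continuous_map_def)
  finally show ?thesis .
qed

lemma topspace_k_refine [simp]: "topspace (k_refine X) = topspace X"
proof -
  have "{z \<in> topspace K. u z \<in> topspace X} = topspace K" if "continuous_map K X u"
    for K :: "'a test_topology" and u
    using that by (auto simp: continuous_map_def)
  then have "k_open X (topspace X)"
    unfolding k_open_def by auto
  then show ?thesis
    by (metis k_open_def openin_k_refine openin_subset openin_topspace subset_antisym)
qed

lemma openin_imp_k_open: "openin X U \<Longrightarrow> k_open X U"
  unfolding k_open_def continuous_map_def by (simp add: openin_subset)

lemma continuous_map_k_refine_id: "continuous_map (k_refine X) X id"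
proof -
  have "{x \<in> topspace X. id x \<in> U} = U" if "openin X U" for U
    using openin_subset[OF that] by auto
  then show ?thesis
    by (auto simp: continuous_map_def openin_k_refine openin_imp_k_open simp del: id_apply)
qed

lemma continuous_map_into_k_refine:
  fixes X :: "'a topology" and j :: "'k \<Rightarrow> ('a + (nat \<Rightarrow> real)) set set"
  assumes "compact_space K" "Hausdorff_space K" "continuous_map K X u" "inj_on j (topspace K)"
  shows "continuous_map K (k_refine X) u"
  unfolding continuous_map_def openin_k_refine topspace_k_refine
proof (intro conjI allI impI)
  show "u \<in> topspace K \<rightarrow> topspace X" using assms(3) by (simp add: continuous_map_def)
qed (rule k_open_test[OF _ assms])

text \<open>The test spaces for a product lie on a fixed type. Products of test spaces for the factors embed
  into it by \<open>encode_pair\<close>, in which the number in position 0 marks the origin of each element.\<close>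

definition tag :: "real \<Rightarrow> (nat \<Rightarrow> real) \<Rightarrow> nat \<Rightarrow> real" where
  "tag c r n = (case n of 0 \<Rightarrow> c | Suc n \<Rightarrow> r n)"

lemma tag_eq: "tag c r = tag c' r' \<longleftrightarrow> c = c' \<and> r = r'"
proof
  assume *: "tag c r = tag c' r'"
  have "r n = r' n" for n using fun_cong[OF *, of "Suc n"] by (simp add: tag_def)
  then show "c = c' \<and> r = r'" using fun_cong[OF *, of 0] by (auto simp: tag_def)
qed simp

definition encode_left :: "'a + (nat \<Rightarrow> real) \<Rightarrow> 'a \<times> 'b + (nat \<Rightarrow> real)" where
  "encode_left = map_sum (\<lambda>a. (a, undefined)) (tag 0)"

definition encode_right :: "'b + (nat \<Rightarrow> real) \<Rightarrow> 'a \<times> 'b + (nat \<Rightarrow> real)" where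
  "encode_right = map_sum (Pair undefined) (tag 0)"

definition encode_pair ::
  "('a + (nat \<Rightarrow> real)) set set \<times> ('b + (nat \<Rightarrow> real)) set set \<Rightarrow> ('a \<times> 'b + (nat \<Rightarrow> real)) set set" where
  "encode_pair = (\<lambda>(P, Q). (`) encode_left ` P \<union> (\<lambda>q. insert (Inr (tag 1 undefined)) (encode_right ` q)) ` Q)"

text \<open>The members that come from \<open>Q\<close> contain the sequence with tag 1, while in
  those that come from \<open>P\<close> every sequence has tag 0. Hence \<open>P\<close> and
  \<open>Q\<close> can be read off from the union.\<close>

lemma inj_encode_pair: "inj encode_pair"
proof (rule injI, clarify)
  fix P P' :: "('a + (nat \<Rightarrow> real)) set set" and Q Q' :: "('b + (nat \<Rightarrow> real)) set set"
  assume eq: "encode_pair (P, Q) = encode_pair (P', Q')"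
  let ?s = "Inr (tag 1 undefined) :: 'a \<times> 'b + (nat \<Rightarrow> real)"
  have injl: "inj (encode_left :: 'a + (nat \<Rightarrow> real) \<Rightarrow> 'a \<times> 'b + (nat \<Rightarrow> real))"
    unfolding encode_left_def by (intro sum.inj_map injI) (auto simp: tag_eq)
  have injr: "inj (encode_right :: 'b + (nat \<Rightarrow> real) \<Rightarrow> 'a \<times> 'b + (nat \<Rightarrow> real))"
    unfolding encode_right_def by (intro sum.inj_map injI) (auto simp: tag_eq)
  have nl: "?s \<notin> encode_left ` p" for p :: "('a + (nat \<Rightarrow> real)) set"
    by (auto simp: encode_left_def map_sum_def tag_eq split: sum.splits)
  have nr: "?s \<notin> encode_right ` q" for q :: "('b + (nat \<Rightarrow> real)) set"
    by (auto simp: encode_right_def map_sum_def tag_eq split: sum.splits)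
  have P: "encode_left ` p \<in> encode_pair (P, Q) \<longleftrightarrow> p \<in> P"
    for p and P :: "('a + (nat \<Rightarrow> real)) set set" and Q :: "('b + (nat \<Rightarrow> real)) set set"
    using nl[of p] by (auto simp: encode_pair_def inj_image_eq_iff[OF injl])
  have Q: "insert ?s (encode_right ` q) \<in> encode_pair (P, Q) \<longleftrightarrow> q \<in> Q"
    for q and Q :: "('b + (nat \<Rightarrow> real)) set set" and P :: "('a + (nat \<Rightarrow> real)) set set"
  proof
    assume "insert ?s (encode_right ` q) \<in> encode_pair (P, Q)"
    then obtain q' where "q' \<in> Q" "insert ?s (encode_right ` q) = insert ?s (encode_right ` q')"
      using nl unfolding encode_pair_def by (auto, metis insertI1 nl)
    then show "q \<in> Q"
      using nr[of q] nr[of q'] insert_ident inj_image_eq_iff[OF injr] by metis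
  qed (auto simp: encode_pair_def)
  show "P = P' \<and> Q = Q'"
    using P[of _ P Q] P[of _ P' Q'] Q[of _ P Q] Q[of _ P' Q'] unfolding eq by blast
qed

lemma inj_encode_simplex: "inj (\<lambda>r :: nat \<Rightarrow> real. {{Inr r}} :: ('a + (nat \<Rightarrow> real)) set set)"
  by (rule injI, drule singleton_inject, drule singleton_inject, erule Inr_inject)

lemma inj_encode_map:
  assumes "inj f"
  shows "inj ((`) ((`) (map_sum f id)) :: ('a + (nat \<Rightarrow> real)) set set \<Rightarrow> ('b + (nat \<Rightarrow> real)) set set)"
proof -
  have "inj (map_sum f id :: 'a + (nat \<Rightarrow> real) \<Rightarrow> 'b + (nat \<Rightarrow> real))"
    by (intro sum.inj_map assms inj_on_id)
  then have "inj ((`) (map_sum f id :: 'a + (nat \<Rightarrow> real) \<Rightarrow> 'b + (nat \<Rightarrow> real)))"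
    by (intro injI) (simp add: inj_image_eq_iff)
  then show ?thesis
    by (intro injI) (simp add: inj_image_eq_iff)
qed

abbreviation simplex_space :: "nat \<Rightarrow> (nat \<Rightarrow> real) topology" where
  "simplex_space n \<equiv> subtopology (powertop_real UNIV) (standard_simplex n)"

lemma compact_simplex_space: "compact_space (simplex_space n)"
  by (rule compact_space_subtopology[OF compactin_standard_simplex])

lemma Hausdorff_simplex_space: "Hausdorff_space (simplex_space n)"
  by (rule Hausdorff_space_subtopology) (auto simp: Hausdorff_space_product_topology)

text \<open>A standard simplex is compact Hausdorff and embeds into the test type through its
  summand of real sequences, so k-refinement creates and destroys no singular simplices. Therefore
  simplices of a k-product are pairs of simplices.\<close>

lemma singular_simplex_k_refine: "singular_simplex n (k_refine X) f \<longleftrightarrow> singular_simplex n X f"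
proof
  assume "singular_simplex n (k_refine X) f"
  then show "singular_simplex n X f"
    using continuous_map_compose[OF _ continuous_map_k_refine_id] by (fastforce simp: singular_simplex_def)
next
  assume "singular_simplex n X f"
  then show "singular_simplex n (k_refine X) f"
    using continuous_map_into_k_refine[OF compact_simplex_space Hausdorff_simplex_space, of n X f "\<lambda>r. {{Inr r}}"]
      inj_on_subset[OF inj_encode_simplex] by (auto simp: singular_simplex_def)
qed

section \<open>Maps out of products of quotients\<close>

text \<open>The product of a k-space and a compact Hausdorff space is compactly generated. Near
  \<open>(y0, k0)\<close> the slice contains a compact neighbourhood \<open>N\<close> of
  \<open>k0\<close>. The set \<open>A\<close> of those \<open>y\<close> with
  \<open>{y} \<times> N \<subseteq> W\<close> is k-open, because projection along the compact
  \<open>N\<close> is closed, and hence open in \<open>Y\<close>.\<close>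

lemma open_in_product_test:
  fixes Y :: "'y topology" and K :: "'k topology"
  assumes Y: "k_refine Y = Y" and K: "compact_space K" "Hausdorff_space K"
    and W: "W \<subseteq> topspace Y \<times> topspace K"
    and test: "\<And>(L :: 'y test_topology) u. \<lbrakk>compact_space L; Hausdorff_space L; continuous_map L Y u\<rbrakk>
       \<Longrightarrow> openin (prod_topology L K) {(l, k) \<in> topspace L \<times> topspace K. (u l, k) \<in> W}"
  shows "openin (prod_topology Y K) W"
  unfolding openin_prod_topology_alt
proof (intro allI impI)
  fix y0 k0 assume yk: "(y0, k0) \<in> W"
  then have y0: "y0 \<in> topspace Y" and k0: "k0 \<in> topspace K" using W by auto
  \<comment> \<open>A one-point test space at \<open>y0\<close> shows that the slice of
    \<open>W\<close> over \<open>y0\<close> is open.\<close>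
  let ?L = "discrete_topology {undefined} :: 'y test_topology"
  have "compact_space ?L" by (simp add: compact_space_discrete_topology)
  moreover have "Hausdorff_space ?L" by (simp add: Hausdorff_space_discrete_topology)
  moreover have "continuous_map ?L Y (\<lambda>_. y0)" using y0 by simp
  ultimately have "openin (prod_topology ?L K) {(l, k) \<in> topspace ?L \<times> topspace K. (y0, k) \<in> W}"
    by (rule test)
  moreover have "continuous_map K (prod_topology ?L K) (\<lambda>k. (undefined, k))"
    by (auto simp: continuous_map_pairwise o_def)
  ultimately have "openin K {k \<in> topspace K. (undefined, k) \<in> {(l, k) \<in> topspace ?L \<times> topspace K. (y0, k) \<in> W}}"
    unfolding continuous_map_def by blast
  moreover have "{k \<in> topspace K. (undefined, k) \<in> {(l, k) \<in> topspace ?L \<times> topspace K. (y0, k) \<in> W}} = {k \<in> topspace K. (y0, k) \<in> W}"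
    by auto
  ultimately have slice: "openin K {k \<in> topspace K. (y0, k) \<in> W}" by simp
  have "regular_space K" using K by (simp add: compact_Hausdorff_imp_regular_space)
  moreover have "closedin K (topspace K - {k \<in> topspace K. (y0, k) \<in> W})" using slice by blast
  moreover have "k0 \<in> topspace K - (topspace K - {k \<in> topspace K. (y0, k) \<in> W})" using yk k0 by auto
  ultimately have "\<exists>V V'. openin K V \<and> openin K V' \<and> k0 \<in> V \<and>
      topspace K - {k \<in> topspace K. (y0, k) \<in> W} \<subseteq> V' \<and> disjnt V V'"
    unfolding regular_space_def by (elim allE[of _ "topspace K - {k \<in> topspace K. (y0, k) \<in> W}"]) blast
  then obtain V V' where V: "openin K V" "openin K V'" "k0 \<in> V"
    "topspace K - {k \<in> topspace K. (y0, k) \<in> W} \<subseteq> V'" "disjnt V V'"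
    by blast
  \<comment> \<open>Regularity of \<open>K\<close> separates \<open>k0\<close> from the complement
    of the slice; what remains outside \<open>V'\<close> is a closed, hence compact, neighbourhood
    of \<open>k0\<close> in the slice.\<close>
  define N where "N = topspace K - V'"
  have VN: "V \<subseteq> N" using V openin_subset[OF V(1)] by (auto simp: N_def disjnt_def)
  have cN: "compact_space (subtopology K N)"
    using closedin_compact_space[OF K(1) closedin_diff[OF closedin_topspace V(2)]]
    by (simp add: N_def compact_space_subtopology)
  have NK: "N \<subseteq> topspace K" by (auto simp: N_def)
  define A where "A = {y \<in> topspace Y. \<forall>k\<in>N. (y, k) \<in> W}"
  have "y0 \<in> A" using V(4) y0 by (auto simp: A_def N_def)
  have "k_open Y A"
    unfolding k_open_def
  proof (intro conjI allI impI)
    show "A \<subseteq> topspace Y" by (auto simp: A_def)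
    fix L :: "'y test_topology" and u
    assume L: "compact_space L \<and> Hausdorff_space L \<and> continuous_map L Y u"
    define Q where "Q = {(l, k) \<in> topspace L \<times> topspace K. (u l, k) \<in> W}"
    have "openin (prod_topology L K) Q" unfolding Q_def using L test by blast
    then have "openin (subtopology (prod_topology L K) (topspace L \<times> N)) ((topspace L \<times> N) \<inter> Q)"
      by (rule openin_subtopology_Int2)
    moreover have "subtopology (prod_topology L K) (topspace L \<times> N) = prod_topology L (subtopology K N)"
      by (simp only: subtopology_Times subtopology_topspace)
    ultimately have "openin (prod_topology L (subtopology K N)) ((topspace L \<times> N) \<inter> Q)" by simp
    then have "closedin (prod_topology L (subtopology K N)) (topspace L \<times> N - Q)"
      using NK by (simp add: closedin_def topspace_subtopology Int_absorb1 Diff_Diff_Int)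
    then have "closedin L (fst ` (topspace L \<times> N - Q))"
      using closed_map_fst[OF cN, of L] by (auto simp: closed_map_def)
    moreover have "topspace L - fst ` (topspace L \<times> N - Q) = {z \<in> topspace L. u z \<in> A}"
    proof -
      have "z \<notin> fst ` (topspace L \<times> N - Q) \<longleftrightarrow> u z \<in> A" if z: "z \<in> topspace L" for z
      proof -
        have "u z \<in> topspace Y" using L z by (auto simp: continuous_map_def)
        then have "u z \<in> A \<longleftrightarrow> (\<forall>k\<in>N. (u z, k) \<in> W)" by (simp add: A_def)
        also have "\<dots> \<longleftrightarrow> (\<forall>k\<in>N. (z, k) \<in> Q)" using NK z by (auto simp: Q_def)
        also have "\<dots> \<longleftrightarrow> z \<notin> fst ` (topspace L \<times> N - Q)" using z by force
        finally show ?thesis by simp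
      qed
      then show ?thesis by blast
    qed
    ultimately show "openin L {z \<in> topspace L. u z \<in> A}"
      using openin_diff[OF openin_topspace, of L "fst ` (topspace L \<times> N - Q)"] by simp
  qed
  then have "openin Y A" using Y openin_k_refine by metis
  moreover have "A \<times> V \<subseteq> W" using VN by (auto simp: A_def)
  ultimately show "\<exists>U V. openin Y U \<and> openin K V \<and> y0 \<in> U \<and> k0 \<in> V \<and> U \<times> V \<subseteq> W"
    using V \<open>y0 \<in> A\<close> by blast
qed

lemma open_map_prod_id:
  assumes "open_map Y Z q"
  shows "open_map (prod_topology Y K) (prod_topology Z K) (map_prod q id)"
  unfolding open_map_def
proof (intro allI impI)
  fix W assume W: "openin (prod_topology Y K) W"
  show "openin (prod_topology Z K) (map_prod q id ` W)"
    unfolding openin_prod_topology_alt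
  proof (intro allI impI)
    fix z k assume "(z, k) \<in> map_prod q id ` W"
    then obtain y where y: "(y, k) \<in> W" "z = q y" by auto
    from W[unfolded openin_prod_topology_alt, rule_format, OF y(1)]
    obtain U V where UV: "openin Y U" "openin K V" "y \<in> U" "k \<in> V" "U \<times> V \<subseteq> W"
      by blast
    have "openin Z (q ` U)" using assms UV(1) by (simp add: open_map_def)
    moreover have "q ` U \<times> V \<subseteq> map_prod q id ` W"
    proof clarify
      fix u v assume "u \<in> U" "v \<in> V"
      then have "(u, v) \<in> W" using UV(5) by blast
      then show "(q u, v) \<in> map_prod q id ` W" by (auto intro: image_eqI[of _ _ "(u, v)"])
    qed
    moreover have "z \<in> q ` U" using y(2) UV(3) by simp
    ultimately show "\<exists>U V. openin Z U \<and> openin K V \<and> z \<in> U \<and> k \<in> V \<and> U \<times> V \<subseteq> map_prod q id ` W"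
      using UV(2,4) by blast
  qed
qed

text \<open>The map \<open>a\<close> need not lift along \<open>q\<close>. Instead the condition is
  turned into an open subset \<open>W\<close> of \<open>Y \<times> K\<close>, pushed forward by the
  open map \<open>q \<times> id\<close>, and pulled back along the graph of
  \<open>a\<close>.\<close>

lemma quotient_test:
  fixes Y :: "'y topology" and Z :: "'z topology" and K :: "'k topology"
  assumes Y: "k_refine Y = Y" and q: "open_map Y Z q" "q ` topspace Y = topspace Z"
    and K: "compact_space K" "Hausdorff_space K" and a: "continuous_map K Z a"
    and test: "\<And>(L :: 'y test_topology) u. \<lbrakk>compact_space L; Hausdorff_space L; continuous_map L Y u\<rbrakk>
       \<Longrightarrow> openin (prod_topology L K) {(l, k) \<in> topspace L \<times> topspace K. P (q (u l)) k}"
  shows "openin K {k \<in> topspace K. P (a k) k}"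
proof -
  define W where "W = {(y, k) \<in> topspace Y \<times> topspace K. P (q y) k}"
  have "openin (prod_topology Y K) W"
  proof (rule open_in_product_test[OF Y K])
    show "W \<subseteq> topspace Y \<times> topspace K" by (auto simp: W_def)
    fix L :: "'y test_topology" and u
    assume L: "compact_space L" "Hausdorff_space L" "continuous_map L Y u"
    have "{(l, k) \<in> topspace L \<times> topspace K. (u l, k) \<in> W} = {(l, k) \<in> topspace L \<times> topspace K. P (q (u l)) k}"
      using L(3) by (auto simp: W_def continuous_map_def)
    then show "openin (prod_topology L K) {(l, k) \<in> topspace L \<times> topspace K. (u l, k) \<in> W}"
      using test[OF L] by simp
  qed
  then have "openin (prod_topology Z K) (map_prod q id ` W)"
    using open_map_prod_id[OF q(1)] by (auto simp: open_map_def)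
  moreover have "continuous_map K (prod_topology Z K) (\<lambda>k. (a k, k))"
    using a by (auto simp: continuous_map_pairwise o_def)
  ultimately have "openin K {k \<in> topspace K. (a k, k) \<in> map_prod q id ` W}"
    unfolding continuous_map_def by blast
  moreover have "(a k, k) \<in> map_prod q id ` W \<longleftrightarrow> P (a k) k" if "k \<in> topspace K" for k
  proof
    assume "P (a k) k"
    moreover obtain y where "y \<in> topspace Y" "a k = q y"
    proof -
      have "a k \<in> q ` topspace Y" using a \<open>k \<in> topspace K\<close> unfolding q(2) by (auto simp: continuous_map_def)
      then show thesis using that by blast
    qed
    ultimately show "(a k, k) \<in> map_prod q id ` W"
      using that by (force simp: W_def)
  qed (auto simp: W_def)
  then have "{k \<in> topspace K. (a k, k) \<in> map_prod q id ` W} = {k \<in> topspace K. P (a k) k}"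
    by (intro Collect_cong conj_cong refl)
  ultimately show ?thesis by simp
qed

text \<open>\<open>quotient_test\<close> is applied to one factor at a time. After the first use
  \<open>L1 \<times> K\<close> is again compact Hausdorff, so it can serve as the parameter space of
  the second.\<close>

lemma continuous_map_from_quotients:
  fixes Y1 :: "'y topology" and Y2 :: "'v topology" and K :: "'k topology"
  assumes Y1: "k_refine Y1 = Y1" and q1: "open_map Y1 Z1 q1" "q1 ` topspace Y1 = topspace Z1"
    and Y2: "k_refine Y2 = Y2" and q2: "open_map Y2 Z2 q2" "q2 ` topspace Y2 = topspace Z2"
    and K: "compact_space K" "Hausdorff_space K" and a: "continuous_map K Z1 a" and b: "continuous_map K Z2 b"
    and test: "\<And>(L1 :: 'y test_topology) u1 (L2 :: 'v test_topology) u2.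
      \<lbrakk>compact_space L1; Hausdorff_space L1; continuous_map L1 Y1 u1;
       compact_space L2; Hausdorff_space L2; continuous_map L2 Y2 u2\<rbrakk>
      \<Longrightarrow> continuous_map (prod_topology L1 L2) W (\<lambda>(l1, l2). f (q1 (u1 l1)) (q2 (u2 l2)))"
  shows "continuous_map K W (\<lambda>k. f (a k) (b k))"
  unfolding continuous_map_def
proof (intro conjI allI impI)
  show "(\<lambda>k. f (a k) (b k)) \<in> topspace K \<rightarrow> topspace W"
  proof
    fix k assume k: "k \<in> topspace K"
    obtain y where y: "y \<in> topspace Y1" "a k = q1 y"
    proof -
      have "a k \<in> q1 ` topspace Y1" using a k unfolding q1(2) by (auto simp: continuous_map_def)
      then show ?thesis using that by blast
    qed
    obtain z where z: "z \<in> topspace Y2" "b k = q2 z"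
    proof -
      have "b k \<in> q2 ` topspace Y2" using b k unfolding q2(2) by (auto simp: continuous_map_def)
      then show ?thesis using that by blast
    qed
    \<comment> \<open>One-point test spaces turn \<open>test\<close> into the statement that the
      values lie in the space \<open>W\<close>.\<close>
    let ?L = "discrete_topology {undefined} :: 'y test_topology"
    let ?L' = "discrete_topology {undefined} :: 'v test_topology"
    have "continuous_map (prod_topology ?L ?L') W (\<lambda>(l1, l2). f (q1 y) (q2 z))"
      by (rule test[of ?L "\<lambda>_. y" ?L' "\<lambda>_. z"])
         (use y z in \<open>simp_all add: compact_space_discrete_topology Hausdorff_space_discrete_topology\<close>)
    then show "f (a k) (b k) \<in> topspace W" using y z by (auto simp: continuous_map_def)
  qed
  fix Q assume Q: "openin W Q"
  show "openin K {k \<in> topspace K. f (a k) (b k) \<in> Q}"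
  proof (rule quotient_test[OF Y1 q1 K a, where P = "\<lambda>z k. f z (b k) \<in> Q"])
    fix L1 :: "'y test_topology" and u1
    assume L1: "compact_space L1" "Hausdorff_space L1" "continuous_map L1 Y1 u1"
    have b': "continuous_map (prod_topology L1 K) Z2 (\<lambda>z. b (snd z))"
      using continuous_map_compose[OF continuous_map_snd b] by (simp add: o_def)
    have "openin (prod_topology L1 K) {z \<in> topspace (prod_topology L1 K). f (q1 (u1 (fst z))) (b (snd z)) \<in> Q}"
    proof (rule quotient_test[OF Y2 q2 _ _ b', where P = "\<lambda>y z. f (q1 (u1 (fst z))) y \<in> Q"])
      show "compact_space (prod_topology L1 K)" "Hausdorff_space (prod_topology L1 K)"
        using K L1 by (simp_all add: compact_space_prod_topology Hausdorff_space_prod_topology)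
      fix L2 :: "'v test_topology" and u2
      assume L2: "compact_space L2" "Hausdorff_space L2" "continuous_map L2 Y2 u2"
      have c: "continuous_map (prod_topology L2 (prod_topology L1 K)) (prod_topology L1 L2) (\<lambda>z. (fst (snd z), fst z))"
        using continuous_map_compose[OF continuous_map_snd[of L2 "prod_topology L1 K"] continuous_map_fst[of L1 K]]
        by (simp add: continuous_map_pairwise o_def continuous_map_fst)
      have "continuous_map (prod_topology L2 (prod_topology L1 K)) W
         ((\<lambda>(l1, l2). f (q1 (u1 l1)) (q2 (u2 l2))) \<circ> (\<lambda>z. (fst (snd z), fst z)))"
        by (rule continuous_map_compose[OF c test[OF L1 L2]])
      then have "openin (prod_topology L2 (prod_topology L1 K)) {z \<in> topspace (prod_topology L2 (prod_topology L1 K)).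
         ((\<lambda>(l1, l2). f (q1 (u1 l1)) (q2 (u2 l2))) \<circ> (\<lambda>z. (fst (snd z), fst z))) z \<in> Q}"
        using Q by (rule openin_continuous_map_preimage)
      moreover have "{z \<in> topspace (prod_topology L2 (prod_topology L1 K)).
         ((\<lambda>(l1, l2). f (q1 (u1 l1)) (q2 (u2 l2))) \<circ> (\<lambda>z. (fst (snd z), fst z))) z \<in> Q}
        = {(l, z) \<in> topspace L2 \<times> topspace (prod_topology L1 K). f (q1 (u1 (fst z))) (q2 (u2 l)) \<in> Q}"
        by auto
      ultimately show "openin (prod_topology L2 (prod_topology L1 K))
         {(l, z) \<in> topspace L2 \<times> topspace (prod_topology L1 K). f (q1 (u1 (fst z))) (q2 (u2 l)) \<in> Q}"
        by simp
    qed
    moreover have "{z \<in> topspace (prod_topology L1 K). f (q1 (u1 (fst z))) (b (snd z)) \<in> Q}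
       = {(l, k) \<in> topspace L1 \<times> topspace K. f (q1 (u1 l)) (b k) \<in> Q}" by auto
    ultimately show "openin (prod_topology L1 K) {(l, k) \<in> topspace L1 \<times> topspace K. f (q1 (u1 l)) (b k) \<in> Q}"
      by simp
  qed
qed

section \<open>The singular simplicial set\<close>

text \<open>The affine map of simplices with \<open>\<alpha>\<close> on the vertices: the new
  barycentric coordinate \<open>j\<close> collects the coordinates of all vertices over
  \<open>j\<close>.\<close>

definition push :: "nat \<Rightarrow> (nat \<Rightarrow> nat) \<Rightarrow> (nat \<Rightarrow> real) \<Rightarrow> nat \<Rightarrow> real" where
  "push m \<alpha> t j = (\<Sum>i\<le>m. if j = \<alpha> i then t i else 0)"

lemma simplicial_op_eq: "simplicial_op m \<alpha> \<sigma> = (\<lambda>t\<in>standard_simplex m. \<sigma> (push m \<alpha> t))"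
proof
  have "(\<lambda>j. \<Sum>i\<le>m. (if j = \<alpha> i then 1 else 0) * t i) = push m \<alpha> t" for t
    by (rule ext) (auto simp: push_def intro!: sum.cong)
  then show "simplicial_op m \<alpha> \<sigma> t = (\<lambda>t\<in>standard_simplex m. \<sigma> (push m \<alpha> t)) t" for t
    by (simp add: simplicial_op_def simplex_map_def oriented_simplex_def restrict_def)
qed

lemma push_in:
  assumes "t \<in> standard_simplex m" "\<alpha> ` {..m} \<subseteq> {..n}"
  shows "push m \<alpha> t \<in> standard_simplex n"
proof -
  have t: "\<And>i. 0 \<le> t i" "(\<Sum>i\<le>m. t i) = 1" using assms(1) by (auto simp: standard_simplex_def)
  have "0 \<le> push m \<alpha> t j" for j
    unfolding push_def by (rule sum_nonneg) (use t in auto)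
  moreover have "push m \<alpha> t j \<le> 1" for j
    unfolding push_def t(2)[symmetric] by (rule sum_mono) (use t in auto)
  moreover have "push m \<alpha> t j = 0" if "j > n" for j
    unfolding push_def by (rule sum.neutral) (use that assms(2) in auto)
  moreover have "(\<Sum>j\<le>n. push m \<alpha> t j) = (\<Sum>i\<le>m. \<Sum>j\<le>n. if j = \<alpha> i then t i else 0)"
    unfolding push_def by (rule sum.swap)
  moreover have "(\<Sum>i\<le>m. \<Sum>j\<le>n. if j = \<alpha> i then t i else 0) = (\<Sum>i\<le>m. t i)"
    by (rule sum.cong) (use assms(2) in auto)
  ultimately show ?thesis using t(2) by (auto simp: standard_simplex_def)
qed

lemma push_push:
  assumes "\<beta> ` {..l} \<subseteq> {..m}"
  shows "push m \<alpha> (push l \<beta> t) = push l (\<alpha> \<circ> \<beta>) t"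
proof
  fix j
  have "push m \<alpha> (push l \<beta> t) j = (\<Sum>i\<le>m. \<Sum>k\<le>l. if j = \<alpha> i \<and> i = \<beta> k then t k else 0)"
    unfolding push_def by (rule sum.cong) auto
  also have "\<dots> = (\<Sum>k\<le>l. \<Sum>i\<le>m. if j = \<alpha> i \<and> i = \<beta> k then t k else 0)"
    by (rule sum.swap)
  also have "\<dots> = (\<Sum>k\<le>l. if j = \<alpha> (\<beta> k) then t k else 0)"
  proof (rule sum.cong[OF refl])
    fix k assume "k \<in> {..l}"
    then have "\<beta> k \<in> {..m}" using assms by auto
    moreover have "(\<Sum>i\<le>m. if j = \<alpha> i \<and> i = \<beta> k then t k else 0)
        = (\<Sum>i\<le>m. if i = \<beta> k then (if j = \<alpha> (\<beta> k) then t k else 0) else 0)"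
      by (rule sum.cong) auto
    ultimately show "(\<Sum>i\<le>m. if j = \<alpha> i \<and> i = \<beta> k then t k else 0) = (if j = \<alpha> (\<beta> k) then t k else 0)"
      by simp
  qed
  finally show "push m \<alpha> (push l \<beta> t) j = push l (\<alpha> \<circ> \<beta>) t j" by (simp add: push_def)
qed

lemma push_cong: "(\<And>i. i \<le> m \<Longrightarrow> \<alpha> i = \<beta> i) \<Longrightarrow> push m \<alpha> t = push m \<beta> t"
  unfolding push_def by (intro ext sum.cong) auto

lemma push_id:
  assumes "t \<in> standard_simplex m"
  shows "push m id t = t"
proof
  fix j
  have "t j = 0" if "\<not> j \<le> m" using assms that by (simp add: standard_simplex_def)
  then show "push m id t j = t j" by (cases "j \<le> m") (auto simp: push_def)
qed

lemma push_skip: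
  assumes "t \<in> standard_simplex (n - 1)" "1 \<le> n"
  shows "push (n - 1) (skip i) t = simplical_face i t"
proof
  fix j
  have z: "t k = 0" if "k > n - 1" for k using assms that by (simp add: standard_simplex_def)
  consider "j < i" | "j = i" | "j > i" by linarith
  then show "push (n - 1) (skip i) t j = simplical_face i t j"
  proof cases
    case 1
    then have "push (n - 1) (skip i) t j = (\<Sum>k\<le>n - 1. if j = k then t k else 0)"
      unfolding push_def by (intro sum.cong) (auto simp: skip_def)
    then show ?thesis using 1 z[of j] by (simp add: simplical_face_def)
  next
    case 2
    then have "push (n - 1) (skip i) t j = (\<Sum>k\<le>n - 1. 0)"
      unfolding push_def by (intro sum.cong) (auto simp: skip_def)
    then show ?thesis using 2 by (simp add: simplical_face_def)
  next
    case 3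
    then have "push (n - 1) (skip i) t j = (\<Sum>k\<le>n - 1. if j - 1 = k then t k else 0)"
      unfolding push_def by (intro sum.cong) (auto simp: skip_def)
    then show ?thesis using 3 z[of "j - 1"] by (simp add: simplical_face_def)
  qed
qed

lemma continuous_map_push:
  assumes "\<alpha> ` {..m} \<subseteq> {..n}"
  shows "continuous_map (simplex_space m) (simplex_space n) (push m \<alpha>)"
proof -
  have "continuous_map (simplex_space m) euclideanreal (\<lambda>t. push m \<alpha> t j)" for j
  proof -
    have "continuous_map (simplex_space m) euclideanreal (\<lambda>t. if j = \<alpha> i then t i else 0)" for i
      by (cases "j = \<alpha> i") (auto intro!: continuous_map_from_subtopology continuous_map_product_projection)
    then show ?thesis unfolding push_def by (intro continuous_map_sum) auto
  qed
  then have "continuous_map (simplex_space m) (powertop_real UNIV) (push m \<alpha>)"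
    by (simp add: continuous_map_componentwise_UNIV)
  then show ?thesis
    using push_in[OF _ assms] by (auto simp: continuous_map_in_subtopology)
qed

lemma singular_simplex_simplicial_op:
  assumes "singular_simplex n X \<sigma>" "\<alpha> ` {..m} \<subseteq> {..n}"
  shows "singular_simplex m X (simplicial_op m \<alpha> \<sigma>)"
proof -
  have "continuous_map (simplex_space m) X (\<sigma> \<circ> push m \<alpha>)"
    by (rule continuous_map_compose[OF continuous_map_push[OF assms(2)]])
       (use assms(1) in \<open>simp add: singular_simplex_def\<close>)
  then have "continuous_map (simplex_space m) X (simplicial_op m \<alpha> \<sigma>)"
    by (rule continuous_map_eq) (simp add: simplicial_op_eq)
  then show ?thesis by (simp add: singular_simplex_def simplicial_op_eq)
qed

lemma simplicial_op_op:
  assumes "\<beta> ` {..l} \<subseteq> {..m}"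
  shows "simplicial_op l \<beta> (simplicial_op m \<alpha> \<sigma>) = simplicial_op l (\<alpha> \<circ> \<beta>) \<sigma>"
  unfolding simplicial_op_eq by (rule restrict_ext) (simp add: push_in[OF _ assms] push_push[OF assms])

lemma simplicial_op_cong:
  "(\<And>i. i \<le> m \<Longrightarrow> \<alpha> i = \<beta> i) \<Longrightarrow> simplicial_op m \<alpha> \<sigma> = simplicial_op m \<beta> \<sigma>"
  unfolding simplicial_op_eq using push_cong[of m \<alpha> \<beta>] by simp

lemma simplicial_op_simplex_map:
  assumes "\<alpha> ` {..m} \<subseteq> {..n}"
  shows "simplicial_op m \<alpha> (simplex_map n f \<sigma>) = simplex_map m f (simplicial_op m \<alpha> \<sigma>)"
  unfolding simplicial_op_eq simplex_map_def by (rule ext) (simp add: push_in[OF _ assms])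

lemma simplicial_set_singular:
  "simplicial_set (\<lambda>n. singular_simplex_set n X) simplicial_op singular_face chain_boundary"
proof
  fix s :: "(nat \<Rightarrow> real) \<Rightarrow> 'a" and n m l :: nat and \<alpha> \<beta> :: "nat \<Rightarrow> nat" and i
  show "simplicial_op m \<alpha> s \<in> singular_simplex_set m X"
    if "s \<in> singular_simplex_set n X" "\<alpha> ` {..m} \<subseteq> {..n}"
    using that singular_simplex_simplicial_op by auto
  show "simplicial_op l \<beta> (simplicial_op m \<alpha> s) = simplicial_op l (\<alpha> \<circ> \<beta>) s" if "\<beta> ` {..l} \<subseteq> {..m}"
    using that by (rule simplicial_op_op)
  show "simplicial_op m \<alpha> s = simplicial_op m \<beta> s" if "\<And>i. i \<le> m \<Longrightarrow> \<alpha> i = \<beta> i"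
    using that by (rule simplicial_op_cong)
  show "simplicial_op n id s = s" if "s \<in> singular_simplex_set n X"
  proof
    fix t
    show "simplicial_op n id s t = s t"
      using that by (cases "t \<in> standard_simplex n")
        (auto simp: simplicial_op_eq push_id singular_simplex_def extensional_def)
  qed
  show "singular_face n i s = simplicial_op (n - 1) (skip i) s" if "1 \<le> n"
    unfolding singular_face_def simplicial_op_eq using push_skip[OF _ that, of _ i]
    by (auto intro!: restrict_ext)
  show "chain_boundary n c = (if n = 0 then 0
          else frag_extend (\<lambda>s. \<Sum>i\<le>n. frag_cmul ((-1) ^ i) (frag_of (singular_face n i s))) c)" for c :: "'a chain"
    by (simp add: chain_boundary_def)
qed

definition simplex_pair :: "nat \<Rightarrow> ((nat \<Rightarrow> real) \<Rightarrow> 'a) \<Rightarrow> ((nat \<Rightarrow> real) \<Rightarrow> 'b) \<Rightarrow> (nat \<Rightarrow> real) \<Rightarrow> 'a \<times> 'b" where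
  "simplex_pair k \<sigma> \<tau> = (\<lambda>t\<in>standard_simplex k. (\<sigma> t, \<tau> t))"

lemma singular_simplex_kprod:
  "singular_simplex n (kprod X Y) f \<longleftrightarrow> f \<in> extensional (standard_simplex n) \<and>
     continuous_map (simplex_space n) X (fst \<circ> f) \<and> continuous_map (simplex_space n) Y (snd \<circ> f)"
  unfolding kprod_def singular_simplex_k_refine
  by (auto simp: singular_simplex_def continuous_map_pairwise)

lemma singular_simplex_pair:
  assumes "singular_simplex n X \<sigma>" "singular_simplex n Y \<tau>"
  shows "singular_simplex n (kprod X Y) (simplex_pair n \<sigma> \<tau>)"
proof -
  have "continuous_map (simplex_space n) X (fst \<circ> simplex_pair n \<sigma> \<tau>)"
    by (rule continuous_map_eq[of _ _ \<sigma>]) (use assms in \<open>auto simp: simplex_pair_def singular_simplex_def\<close>)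
  moreover have "continuous_map (simplex_space n) Y (snd \<circ> simplex_pair n \<sigma> \<tau>)"
    by (rule continuous_map_eq[of _ _ \<tau>]) (use assms in \<open>auto simp: simplex_pair_def singular_simplex_def\<close>)
  ultimately show ?thesis by (simp add: singular_simplex_kprod simplex_pair_def)
qed

lemma simplicial_product_singular:
  "simplicial_product (\<lambda>n. singular_simplex_set n X) simplicial_op singular_face chain_boundary
     (\<lambda>n. singular_simplex_set n Y) simplicial_op singular_face chain_boundary
     (\<lambda>n. singular_simplex_set n (kprod X Y)) simplicial_op singular_face chain_boundary simplex_pair"
proof (intro simplicial_product.intro simplicial_set_singular simplicial_product_axioms.intro)
  show "simplicial_op m \<alpha> (simplex_pair n s t) = simplex_pair m (simplicial_op m \<alpha> s) (simplicial_op m \<alpha> t)"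
    if "\<alpha> ` {..m} \<subseteq> {..n}" for m n \<alpha> and s :: "(nat \<Rightarrow> real) \<Rightarrow> 'a" and t :: "(nat \<Rightarrow> real) \<Rightarrow> 'b"
    unfolding simplicial_op_eq simplex_pair_def
    by (rule restrict_ext) (simp add: push_in[OF _ that])
qed (simp add: singular_simplex_pair)

abbreviation sing_cls :: "nat \<Rightarrow> nat \<Rightarrow> 'a topology \<Rightarrow> 'a chain \<Rightarrow> 'a chain set" where
  "sing_cls p n X \<equiv> chain_complex.cls (\<lambda>k. singular_simplex_set k X) chain_boundary p n"

abbreviation sing_cycles :: "nat \<Rightarrow> nat \<Rightarrow> 'a topology \<Rightarrow> 'a chain set" where
  "sing_cycles p n X \<equiv> mod_cycles p (\<lambda>k. singular_simplex_set k X) chain_boundary n"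

lemma chain_complex_singular: "0 < p \<Longrightarrow> chain_complex (\<lambda>n. singular_simplex_set n X) chain_boundary p"
  by (rule simplicial_set.chain_complex[OF simplicial_set_singular])

lemma sing_cross_chain_eq:
  "sing_cross_chain m n = simplicial_product.cross_chain simplicial_op simplicial_op simplex_pair m n"
proof -
  interpret simplicial_product "\<lambda>n. singular_simplex_set n X" simplicial_op singular_face chain_boundary
     "\<lambda>n. singular_simplex_set n Y" simplicial_op singular_face chain_boundary
     "\<lambda>n. singular_simplex_set n (kprod X Y)" simplicial_op singular_face chain_boundary simplex_pair
    for X :: "'a topology" and Y :: "'b topology"
    by (rule simplicial_product_singular)
  have "sing_cross_simplex k \<sigma> \<tau> = cross_simplex k \<sigma> \<tau>"
    for k and \<sigma> :: "(nat \<Rightarrow> real) \<Rightarrow> 'a" and \<tau> :: "(nat \<Rightarrow> real) \<Rightarrow> 'b"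
    by (rule ext) (simp add: sing_cross_simplex_def cross_simplex_def simplex_pair_def)
  then show ?thesis
    unfolding sing_cross_chain_def[abs_def] cross_chain_def[abs_def] cross_def[abs_def] by simp
qed

lemma sing_cross_cls:
  assumes p: "0 < p" and a: "a \<in> sing_cycles p m X" and b: "b \<in> sing_cycles p n Y"
  shows "sing_cross p m n X Y (sing_cls p m X a) (sing_cls p n Y b) = sing_cls p (m + n) (kprod X Y) (sing_cross_chain m n a b)"
  unfolding sing_cross_def sing_cross_chain_eq
  by (rule simplicial_product.cross_cls[OF simplicial_product_singular p a b])

lemma sing_cross_Z:
  assumes p: "0 < p" and a: "a \<in> sing_cycles p m X" and b: "b \<in> sing_cycles p n Y"
  shows "sing_cross_chain m n a b \<in> sing_cycles p (m + n) (kprod X Y)"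
  unfolding sing_cross_chain_eq
  by (rule simplicial_product.cross_Z_Z[OF simplicial_product_singular p a b])

lemma sing_cross_B:
  assumes p: "0 < p" and a: "a \<in> sing_boundaries p m X" and b: "b \<in> sing_cycles p n Y"
  shows "sing_cross_chain m n a b \<in> sing_boundaries p (m + n) (kprod X Y)"
  unfolding sing_cross_chain_eq
  by (rule simplicial_product.cross_B_Z[OF simplicial_product_singular p a b])

section \<open>Maps that preserve singular simplices, and naturality of the cross product\<close>

definition simplex_preserving :: "'a topology \<Rightarrow> 'b topology \<Rightarrow> ('a \<Rightarrow> 'b) \<Rightarrow> bool" where
  "simplex_preserving X Y f \<longleftrightarrow> (\<forall>n \<sigma>. singular_simplex n X \<sigma> \<longrightarrow> singular_simplex n Y (simplex_map n f \<sigma>))"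

lemma chain_map_keys:
  assumes "simplex_preserving X Y f" "Poly_Mapping.keys c \<subseteq> singular_simplex_set n X"
  shows "Poly_Mapping.keys (chain_map n f c) \<subseteq> singular_simplex_set n Y"
  unfolding chain_map_def using assms
  by (intro keys_extend_subset) (auto simp: simplex_preserving_def)

lemma chain_boundary_chain_map':
  "Poly_Mapping.keys c \<subseteq> singular_simplex_set n X \<Longrightarrow> chain_boundary n (chain_map n f c) = chain_map (n - 1) f (chain_boundary n c)"
  using chain_boundary_chain_map[of n X c f] by (simp add: singular_chain_def)

lemma chain_map_B:
  assumes "simplex_preserving X Y f" "c \<in> sing_boundaries p n X"
  shows "chain_map n f c \<in> sing_boundaries p n Y"
  by (rule induced_B[where F = "\<lambda>n. chain_map n f" and S = "\<lambda>n. singular_simplex_set n X" and bd = chain_boundary])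
     (use assms chain_map_keys[OF assms(1)] in \<open>auto simp: chain_map_add chain_boundary_chain_map'\<close>)

lemma chain_map_Z:
  assumes "simplex_preserving X Y f" "c \<in> sing_cycles p n X"
  shows "chain_map n f c \<in> sing_cycles p n Y"
  by (rule induced_Z[where F = "\<lambda>n. chain_map n f" and S = "\<lambda>n. singular_simplex_set n X" and bd = chain_boundary])
     (use assms chain_map_keys[OF assms(1)] in \<open>auto simp: chain_boundary_chain_map'\<close>)

lemma sing_induced_cls:
  assumes p: "0 < p" and f: "simplex_preserving X Y f"
  shows "sing_induced p n Y f (sing_cls p n X a) = sing_cls p n Y (chain_map n f a)"
  unfolding sing_induced_def
  by (rule induced_cls[OF chain_complex_singular[OF p] chain_complex_singular[OF p]])
     (auto simp: chain_map_add intro: chain_map_B[OF f])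

lemma chain_map_cross:
  "chain_map (m + n) (map_prod f g) (sing_cross_chain m n c d) = sing_cross_chain m n (chain_map m f c) (chain_map n g d)"
proof -
  have *: "chain_map (m + n) (map_prod f g) (shuffle_sum m n (sing_cross_simplex (m + n) \<sigma> \<tau>))
     = shuffle_sum m n (sing_cross_simplex (m + n) (simplex_map m f \<sigma>) (simplex_map n g \<tau>))" for \<sigma> \<tau>
  proof -
    have "chain_map (m + n) (map_prod f g) (shuffle_sum m n (sing_cross_simplex (m + n) \<sigma> \<tau>))
       = shuffle_sum m n (simplex_map (m + n) (map_prod f g) \<circ> sing_cross_simplex (m + n) \<sigma> \<tau>)"
      using frag_extend_shuffle_sum[of "simplex_map (m + n) (map_prod f g)" m n] by (simp add: chain_map_def o_def)
    also have "\<dots> = shuffle_sum m n (sing_cross_simplex (m + n) (simplex_map m f \<sigma>) (simplex_map n g \<tau>))"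
    proof (rule shuffle_sum_cong)
      fix \<mu> assume \<mu>: "\<mu> \<subseteq> {..<m + n}" "card \<mu> = m"
      have 1: "steps \<mu> ` {..m + n} \<subseteq> {..m}" "steps (- \<mu>) ` {..m + n} \<subseteq> {..n}"
        using steps_le[OF \<mu>] steps_Compl_le[OF \<mu>] by auto
      show "(simplex_map (m + n) (map_prod f g) \<circ> sing_cross_simplex (m + n) \<sigma> \<tau>) \<mu>
          = sing_cross_simplex (m + n) (simplex_map m f \<sigma>) (simplex_map n g \<tau>) \<mu>"
        unfolding sing_cross_simplex_def simplicial_op_simplex_map[OF 1(1)] simplicial_op_simplex_map[OF 1(2)]
        by (auto simp: simplex_map_def)
    qed
    finally show ?thesis .
  qed
  have "chain_map (m + n) (map_prod f g) (sing_cross_chain m n c d)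
     = frag_extend (\<lambda>\<sigma>. frag_extend (\<lambda>\<tau>. chain_map (m + n) (map_prod f g) (shuffle_sum m n (sing_cross_simplex (m + n) \<sigma> \<tau>))) d) c"
    unfolding sing_cross_chain_def chain_map_def frag_extend_frag_extend ..
  then show ?thesis
    unfolding * by (simp add: sing_cross_chain_def chain_map_def frag_extend_frag_extend)
qed

section \<open>Interchange of the middle factors of a fourfold product\<close>

definition interchange :: "('a \<times> 'b) \<times> ('c \<times> 'd) \<Rightarrow> ('a \<times> 'c) \<times> ('b \<times> 'd)" where
  "interchange = (\<lambda>((w, x), (y, z)). ((w, y), (x, z)))"

lemma cross_cross_simplex:
  assumes \<mu>: "\<mu> \<subseteq> {..<(a + b) + (c + d)}" "card \<mu> = a + b"
  shows "sing_cross_simplex ((a + b) + (c + d)) (sing_cross_simplex (a + b) w x \<nu>) (sing_cross_simplex (c + d) y z \<rho>) \<mu>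
    = (\<lambda>t\<in>standard_simplex ((a + b) + (c + d)).
        ((w (push ((a + b) + (c + d)) (steps \<nu> \<circ> steps \<mu>) t), x (push ((a + b) + (c + d)) (steps (- \<nu>) \<circ> steps \<mu>) t)),
         (y (push ((a + b) + (c + d)) (steps \<rho> \<circ> steps (- \<mu>)) t), z (push ((a + b) + (c + d)) (steps (- \<rho>) \<circ> steps (- \<mu>)) t))))"
proof -
  have 1: "steps \<mu> ` {..(a + b) + (c + d)} \<subseteq> {..a + b}" "steps (- \<mu>) ` {..(a + b) + (c + d)} \<subseteq> {..c + d}"
    using steps_le[OF \<mu>] steps_Compl_le[OF \<mu>] by auto
  show ?thesis
    unfolding sing_cross_simplex_def simplicial_op_eq
    by (rule restrict_ext) (simp add: push_in[OF _ 1(1)] push_in[OF _ 1(2)] push_push[OF 1(1)] push_push[OF 1(2)])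
qed

lemma cross_cross_quad:
  "sing_cross_chain (a + b) (c + d) (sing_cross_chain a b (frag_of w) (frag_of x)) (sing_cross_chain c d (frag_of y) (frag_of z))
   = quad_shuffle_sum a b c d (\<lambda>\<alpha> \<beta> \<gamma> \<delta>. \<lambda>t\<in>standard_simplex ((a + b) + (c + d)).
        ((w (push ((a + b) + (c + d)) \<alpha> t), x (push ((a + b) + (c + d)) \<beta> t)),
         (y (push ((a + b) + (c + d)) \<gamma> t), z (push ((a + b) + (c + d)) \<delta> t))))"
  (is "?L = quad_shuffle_sum a b c d ?F")
proof -
  have "?L = (\<Sum>\<nu> | \<nu> \<subseteq> {..<a + b} \<and> card \<nu> = a. frag_cmul ((-1) ^ inversions \<nu>)
         (\<Sum>\<rho> | \<rho> \<subseteq> {..<c + d} \<and> card \<rho> = c. frag_cmul ((-1) ^ inversions \<rho>)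
         (shuffle_sum (a + b) (c + d) (sing_cross_simplex ((a + b) + (c + d)) (sing_cross_simplex (a + b) w x \<nu>) (sing_cross_simplex (c + d) y z \<rho>)))))"
    unfolding sing_cross_chain_def frag_extend_of frag_extend_shuffle_sum' ..
  also have "\<dots> = (\<Sum>\<nu> | \<nu> \<subseteq> {..<a + b} \<and> card \<nu> = a.
         \<Sum>\<rho> | \<rho> \<subseteq> {..<c + d} \<and> card \<rho> = c.
         \<Sum>\<mu> | \<mu> \<subseteq> {..<(a + b) + (c + d)} \<and> card \<mu> = a + b. frag_cmul ((-1) ^ inversions \<mu> * (-1) ^ inversions \<nu> * (-1) ^ inversions \<rho>)
           (frag_of (?F (steps \<nu> \<circ> steps \<mu>) (steps (- \<nu>) \<circ> steps \<mu>)
                       (steps \<rho> \<circ> steps (- \<mu>)) (steps (- \<rho>) \<circ> steps (- \<mu>)))))"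
    unfolding shuffle_sum_inversions frag_cmul_sum frag_cmul_cmul
    by (intro sum.cong refl) (simp only: mem_Collect_eq cross_cross_simplex mult.assoc mult.commute mult.left_commute)
  also have "\<dots> = (\<Sum>\<nu> | \<nu> \<subseteq> {..<a + b} \<and> card \<nu> = a.
         \<Sum>\<mu> | \<mu> \<subseteq> {..<(a + b) + (c + d)} \<and> card \<mu> = a + b. \<Sum>\<rho> | \<rho> \<subseteq> {..<c + d} \<and> card \<rho> = c. frag_cmul ((-1) ^ inversions \<mu> * (-1) ^ inversions \<nu> * (-1) ^ inversions \<rho>)
           (frag_of (?F (steps \<nu> \<circ> steps \<mu>) (steps (- \<nu>) \<circ> steps \<mu>)
                       (steps \<rho> \<circ> steps (- \<mu>)) (steps (- \<rho>) \<circ> steps (- \<mu>)))))"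
    by (intro sum.cong refl sum.swap)
  also have "\<dots> = (\<Sum>\<mu> | \<mu> \<subseteq> {..<(a + b) + (c + d)} \<and> card \<mu> = a + b. \<Sum>\<nu> | \<nu> \<subseteq> {..<a + b} \<and> card \<nu> = a.
         \<Sum>\<rho> | \<rho> \<subseteq> {..<c + d} \<and> card \<rho> = c. frag_cmul ((-1) ^ inversions \<mu> * (-1) ^ inversions \<nu> * (-1) ^ inversions \<rho>)
           (frag_of (?F (steps \<nu> \<circ> steps \<mu>) (steps (- \<nu>) \<circ> steps \<mu>)
                       (steps \<rho> \<circ> steps (- \<mu>)) (steps (- \<rho>) \<circ> steps (- \<mu>)))))"
    by (rule sum.swap)
  also have "\<dots> = quad_shuffle_sum a b c d ?F"
    unfolding quad_shuffle_sum_def frag_cmul_sum frag_cmul_cmul mult.assoc ..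
  finally show ?thesis .
qed

lemma chain_map_quad:
  "chain_map k f (quad_shuffle_sum a b c d F) = quad_shuffle_sum a b c d (\<lambda>\<alpha> \<beta> \<gamma> \<delta>. simplex_map k f (F \<alpha> \<beta> \<gamma> \<delta>))"
  unfolding quad_shuffle_sum_def chain_map_sum[OF finite_shuffles] o_def chain_map_cmul chain_map_of ..

lemma sing_cross_chain_extend_left:
  "sing_cross_chain m n (frag_extend f c) d = frag_extend (\<lambda>s. sing_cross_chain m n (f s) d) c"
  by (simp only: sing_cross_chain_def frag_extend_frag_extend)

lemma sing_cross_chain_extend_right:
  "sing_cross_chain m n c (frag_extend g d) = frag_extend (\<lambda>t. sing_cross_chain m n c (g t)) d"
  unfolding sing_cross_chain_def frag_extend_frag_extend by (rule frag_extend_swap)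

lemma sing_cross_chain_expand:
  "sing_cross_chain m n c d = frag_extend (\<lambda>s. frag_extend (\<lambda>t. sing_cross_chain m n (frag_of s) (frag_of t)) d) c"
  by (simp only: sing_cross_chain_def frag_extend_of)

lemma chain_map_extend: "chain_map n f (frag_extend g c) = frag_extend (\<lambda>x. chain_map n f (g x)) c"
  by (simp only: chain_map_def frag_extend_frag_extend)

text \<open>Both sides are additive in each of the four chains. For single simplices they are the
  same \<open>quad_shuffle_sum\<close> with the middle blocks of steps exchanged.\<close>

lemma sing_cross_interchange:
  "chain_map ((a + b) + (c + d)) interchange
     (sing_cross_chain (a + b) (c + d) (sing_cross_chain a b u v) (sing_cross_chain c d u' v'))
   = frag_cmul ((-1) ^ (b * c)) (sing_cross_chain (a + c) (b + d) (sing_cross_chain a c u u') (sing_cross_chain b d v v'))"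
proof -
  define N where "N = (a + b) + (c + d)"
  have N': "N = (a + c) + (b + d)" by (simp add: N_def)
  have simplex: "chain_map N interchange
     (sing_cross_chain (a + b) (c + d) (sing_cross_chain a b (frag_of w) (frag_of x)) (sing_cross_chain c d (frag_of y) (frag_of z)))
   = frag_cmul ((-1) ^ (b * c)) (sing_cross_chain (a + c) (b + d) (sing_cross_chain a c (frag_of w) (frag_of y)) (sing_cross_chain b d (frag_of x) (frag_of z)))"
    for w x y z
  proof -
    have "simplex_map N interchange (\<lambda>t\<in>standard_simplex N. ((w (push N \<alpha> t), x (push N \<beta> t)), (y (push N \<gamma> t), z (push N \<delta> t))))
       = (\<lambda>t\<in>standard_simplex N. ((w (push N \<alpha> t), y (push N \<gamma> t)), (x (push N \<beta> t), z (push N \<delta> t))))" for \<alpha> \<beta> \<gamma> \<delta>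
      unfolding simplex_map_def by (rule restrict_ext) (simp add: interchange_def)
    then show ?thesis
      unfolding cross_cross_quad N_def[symmetric] chain_map_quad
      unfolding N'[symmetric] by (simp add: quad_shuffle_sum_swap[of a b c d])
  qed
  have L: "chain_map N interchange
     (sing_cross_chain (a + b) (c + d) (sing_cross_chain a b u v) (sing_cross_chain c d u' v'))
    = frag_extend (\<lambda>w. frag_extend (\<lambda>x. frag_extend (\<lambda>y. frag_extend (\<lambda>z. chain_map N interchange
     (sing_cross_chain (a + b) (c + d) (sing_cross_chain a b (frag_of w) (frag_of x)) (sing_cross_chain c d (frag_of y) (frag_of z)))) v') u') v) u"
    unfolding sing_cross_chain_expand[of a b u v] sing_cross_chain_extend_left chain_map_extend
    unfolding sing_cross_chain_expand[of c d u' v'] sing_cross_chain_extend_right chain_map_extend ..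
  have R: "sing_cross_chain (a + c) (b + d) (sing_cross_chain a c u u') (sing_cross_chain b d v v')
    = frag_extend (\<lambda>w. frag_extend (\<lambda>x. frag_extend (\<lambda>y. frag_extend (\<lambda>z.
       sing_cross_chain (a + c) (b + d) (sing_cross_chain a c (frag_of w) (frag_of y)) (sing_cross_chain b d (frag_of x) (frag_of z))) v') u') v) u"
    unfolding sing_cross_chain_expand[of a c u u'] sing_cross_chain_extend_left
    unfolding sing_cross_chain_expand[of b d v v'] sing_cross_chain_extend_right
    by (intro frag_extend_eq) (rule frag_extend_swap)
  show ?thesis
    unfolding N_def[symmetric] L R simplex frag_extend_fun_cmul ..
qed

section \<open>The bar construction\<close>

text \<open>The label of the edge from vertex \<open>i\<close> to vertex \<open>j\<close> of the bar
  simplex \<open>gs\<close>. Describing a simplex by its edges gives one formula for all simplicial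
  operators.\<close>

definition seg :: "('g, 'm) monoid_scheme \<Rightarrow> 'g list \<Rightarrow> nat \<Rightarrow> nat \<Rightarrow> 'g" where
  "seg G gs i j = foldr (\<lambda>g h. g \<otimes>\<^bsub>G\<^esub> h) (take (j - i) (drop i gs)) \<one>\<^bsub>G\<^esub>"

definition bar_act :: "('g, 'm) monoid_scheme \<Rightarrow> nat \<Rightarrow> (nat \<Rightarrow> nat) \<Rightarrow> 'g list \<Rightarrow> 'g list" where
  "bar_act G m \<alpha> gs = map (\<lambda>i. seg G gs (\<alpha> i) (\<alpha> (Suc i))) [0..<m]"

context group
begin

lemma foldr_mult_closed: "set xs \<subseteq> carrier G \<Longrightarrow> foldr (\<lambda>g h. g \<otimes> h) xs \<one> \<in> carrier G"
  by (induction xs) auto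

lemma foldr_mult_append:
  "\<lbrakk>set xs \<subseteq> carrier G; set ys \<subseteq> carrier G\<rbrakk>
   \<Longrightarrow> foldr (\<lambda>g h. g \<otimes> h) (xs @ ys) \<one> = foldr (\<lambda>g h. g \<otimes> h) xs \<one> \<otimes> foldr (\<lambda>g h. g \<otimes> h) ys \<one>"
  by (induction xs) (auto simp: foldr_mult_closed m_assoc)

lemma set_take_drop: "set gs \<subseteq> carrier G \<Longrightarrow> set (take k (drop i gs)) \<subseteq> carrier G"
  by (meson order_trans set_drop_subset set_take_subset)

lemma seg_closed: "set gs \<subseteq> carrier G \<Longrightarrow> seg G gs i j \<in> carrier G"
  unfolding seg_def by (intro foldr_mult_closed set_take_drop)

lemma seg_self [simp]: "seg G gs i i = \<one>"
  by (simp add: seg_def)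

lemma seg_mult:
  assumes "set gs \<subseteq> carrier G" "i \<le> j" "j \<le> k"
  shows "seg G gs i j \<otimes> seg G gs j k = seg G gs i k"
proof -
  have "take (k - i) (drop i gs) = take (j - i) (drop i gs) @ take (k - j) (drop j gs)"
    using assms take_add[of "j - i" "k - j" "drop i gs"] by simp
  then show ?thesis
    unfolding seg_def using foldr_mult_append[OF set_take_drop[OF assms(1)] set_take_drop[OF assms(1)]] by simp
qed

lemma seg_Suc:
  assumes "set gs \<subseteq> carrier G" "i < length gs"
  shows "seg G gs i (Suc i) = gs ! i"
proof -
  have "take 1 (drop i gs) = [gs ! i]" using assms(2) by (simp add: take_Suc_conv_app_nth)
  moreover have "gs ! i \<in> carrier G" using assms by (meson nth_mem subsetD)
  ultimately show ?thesis by (simp add: seg_def)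
qed

lemma bar_act_closed: "set gs \<subseteq> carrier G \<Longrightarrow> bar_act G m \<alpha> gs \<in> bar_simplices G m"
  by (auto simp: bar_simplices_def bar_act_def seg_closed)

lemma seg_bar_act:
  assumes gs: "set gs \<subseteq> carrier G" and \<alpha>: "mono_on {..m} \<alpha>" and ij: "i \<le> j" "j \<le> m"
  shows "seg G (bar_act G m \<alpha> gs) i j = seg G gs (\<alpha> i) (\<alpha> j)"
  using ij
proof (induction j rule: dec_induct)
  case (step j)
  have b: "set (bar_act G m \<alpha> gs) \<subseteq> carrier G" using bar_act_closed[OF gs] by (simp add: bar_simplices_def)
  have "seg G (bar_act G m \<alpha> gs) i (Suc j) = seg G (bar_act G m \<alpha> gs) i j \<otimes> seg G (bar_act G m \<alpha> gs) j (Suc j)"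
    using seg_mult[OF b] step.hyps by simp
  also have "seg G (bar_act G m \<alpha> gs) j (Suc j) = seg G gs (\<alpha> j) (\<alpha> (Suc j))"
    using seg_Suc[OF b, of j] step.prems by (simp add: bar_act_def)
  also have "seg G (bar_act G m \<alpha> gs) i j = seg G gs (\<alpha> i) (\<alpha> j)" using step by simp
  also have "seg G gs (\<alpha> i) (\<alpha> j) \<otimes> seg G gs (\<alpha> j) (\<alpha> (Suc j)) = seg G gs (\<alpha> i) (\<alpha> (Suc j))"
    by (rule seg_mult[OF gs]) (use \<alpha> step in \<open>auto simp: mono_on_def\<close>)
  finally show ?case .
qed simp

lemma bar_act_act:
  assumes gs: "set gs \<subseteq> carrier G" and \<alpha>: "mono_on {..m} \<alpha>" and \<beta>: "mono_on {..l} \<beta>" "\<beta> ` {..l} \<subseteq> {..m}"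
  shows "bar_act G l \<beta> (bar_act G m \<alpha> gs) = bar_act G l (\<alpha> \<circ> \<beta>) gs"
proof -
  have "seg G (bar_act G m \<alpha> gs) (\<beta> i) (\<beta> (Suc i)) = seg G gs (\<alpha> (\<beta> i)) (\<alpha> (\<beta> (Suc i)))" if "i < l" for i
    by (rule seg_bar_act[OF gs \<alpha>]) (use that \<beta> in \<open>auto simp: mono_on_def image_subset_iff\<close>)
  then show ?thesis unfolding bar_act_def[of G l] by simp
qed

lemma bar_act_id: "gs \<in> bar_simplices G n \<Longrightarrow> bar_act G n id gs = gs"
  by (auto simp: bar_simplices_def bar_act_def seg_Suc intro!: nth_equalityI)

text \<open>A face keeps the edges between the remaining vertices. Dropping an outer vertex drops an
  outer entry, and dropping an inner vertex merges the two entries at it.\<close>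

lemma bar_face_eq:
  assumes gs: "gs \<in> bar_simplices G n" and n: "1 \<le> n" and i: "i \<le> n"
  shows "bar_face G n i gs = bar_act G (n - 1) (skip i) gs"
proof -
  have len: "length gs = n" and c: "set gs \<subseteq> carrier G" using gs by (auto simp: bar_simplices_def)
  have cj: "gs ! j \<in> carrier G" if "j < n" for j using c len that by (meson nth_mem subsetD)
  show ?thesis
  proof (rule nth_equalityI)
    show l: "length (bar_face G n i gs) = length (bar_act G (n - 1) (skip i) gs)"
      using len n i by (auto simp: bar_face_def bar_act_def)
    fix j assume "j < length (bar_face G n i gs)"
    then have j: "j < n - 1" using l by (simp add: bar_act_def)
    then have j': "Suc j < n" by simp
    have r: "bar_act G (n - 1) (skip i) gs ! j = seg G gs (skip i j) (skip i (Suc j))"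
      using j by (simp add: bar_act_def)
    consider "i = 0" | "i = n" "i \<noteq> 0" | "0 < i" "i < n" "Suc j < i" | "0 < i" "i < n" "Suc j = i" | "0 < i" "i < n" "i \<le> j"
      using i by linarith
    then show "bar_face G n i gs ! j = bar_act G (n - 1) (skip i) gs ! j"
    proof cases
      case 1
      then show ?thesis unfolding r using j j' len by (simp add: skip_def seg_Suc[OF c] bar_face_def nth_tl)
    next
      case 2
      with j' have "j < i" "Suc j < i" by simp_all
      with 2 show ?thesis unfolding r using j j' len by (simp add: skip_def seg_Suc[OF c] bar_face_def nth_butlast)
    next
      case 3
      then have "j < i - 1" by simp
      with 3 show ?thesis unfolding r using j j' len by (simp add: skip_def seg_Suc[OF c] bar_face_def nth_append)
    next
      \<comment> \<open>This edge runs from \<open>j\<close> to \<open>j + 2\<close> past the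
        omitted vertex \<open>i = j + 1\<close>, so its label is the product of two entries.\<close>
      case 4
      have "seg G gs j (Suc (Suc j)) = seg G gs j (Suc j) \<otimes> seg G gs (Suc j) (Suc (Suc j))"
        by (rule seg_mult[OF c, symmetric]) auto
      moreover from 4 have i_eq: "i = Suc j" by simp
      ultimately show ?thesis unfolding i_eq r[unfolded i_eq] using j j' len by (simp add: skip_def seg_Suc[OF c] bar_face_def nth_append)
    next
      case 5
      then have "\<not> j < i - Suc 0" by simp
      then show ?thesis unfolding r using 5 j j' len by (simp add: skip_def seg_Suc[OF c] bar_face_def nth_append nth_Cons')
    qed
  qed
qed

lemma simplicial_set_bar: "simplicial_set (bar_simplices G) (bar_act G) (bar_face G) (bar_boundary G)"
proof
  show "bar_act G m \<alpha> s = bar_act G m \<beta> s" if "\<And>i. i \<le> m \<Longrightarrow> \<alpha> i = \<beta> i" for m \<alpha> \<beta> and s :: "'a list"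
    using that by (simp add: bar_act_def)
  show "bar_act G m \<alpha> s \<in> bar_simplices G m" if "s \<in> bar_simplices G n" for s :: "'a list" and n m \<alpha>
    using that bar_act_closed by (simp add: bar_simplices_def)
  show "bar_act G l \<beta> (bar_act G m \<alpha> s) = bar_act G l (\<alpha> \<circ> \<beta>) s"
    if "s \<in> bar_simplices G n" "mono_on {..m} \<alpha>" "mono_on {..l} \<beta>" "\<beta> ` {..l} \<subseteq> {..m}"
    for s :: "'a list" and n m \<alpha> l \<beta>
    using that bar_act_act by (simp add: bar_simplices_def)
  show "bar_face G n i s = bar_act G (n - 1) (skip i) s" if "s \<in> bar_simplices G n" "1 \<le> n" "i \<le> n"
    for s :: "'a list" and n i
    using that by (rule bar_face_eq)
  show "bar_boundary G n c = (if n = 0 then 0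
          else frag_extend (\<lambda>s. \<Sum>i\<le>n. frag_cmul ((-1) ^ i) (frag_of (bar_face G n i s))) c)"
    for n and c :: "'a list \<Rightarrow>\<^sub>0 int"
    by (simp only: bar_boundary_def)
qed (rule bar_act_id)

end

section \<open>Bar construction of a product of groups, and its shuffle product\<close>

lemma seg_zip:
  assumes "length gs = length hs"
  shows "seg (G \<times>\<times> H) (zip gs hs) i j = (seg G gs i j, seg H hs i j)"
proof -
  have "foldr (\<lambda>g h. g \<otimes>\<^bsub>G \<times>\<times> H\<^esub> h) (zip xs ys) \<one>\<^bsub>G \<times>\<times> H\<^esub>
      = (foldr (\<lambda>g h. g \<otimes>\<^bsub>G\<^esub> h) xs \<one>\<^bsub>G\<^esub>, foldr (\<lambda>g h. g \<otimes>\<^bsub>H\<^esub> h) ys \<one>\<^bsub>H\<^esub>)" if "length xs = length ys" for xs ys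
    using that by (induction xs ys rule: list_induct2) auto
  then show ?thesis
    using assms by (simp add: seg_def drop_zip take_zip)
qed

lemma simplicial_product_bar:
  assumes "group G" "group H"
  shows "simplicial_product (bar_simplices G) (bar_act G) (bar_face G) (bar_boundary G)
     (bar_simplices H) (bar_act H) (bar_face H) (bar_boundary H)
     (bar_simplices (G \<times>\<times> H)) (bar_act (G \<times>\<times> H)) (bar_face (G \<times>\<times> H)) (bar_boundary (G \<times>\<times> H)) (\<lambda>_. zip)"
proof (intro simplicial_product.intro simplicial_product_axioms.intro group.simplicial_set_bar DirProd_group assms)
  show "zip s t \<in> bar_simplices (G \<times>\<times> H) n" if "s \<in> bar_simplices G n" "t \<in> bar_simplices H n" for s t n
    using that by (fastforce simp: bar_simplices_def dest: set_zip_leftD set_zip_rightD)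
  show "bar_act (G \<times>\<times> H) m \<alpha> (zip s t) = zip (bar_act G m \<alpha> s) (bar_act H m \<alpha> t)"
    if "s \<in> bar_simplices G n" "t \<in> bar_simplices H n" for s t n m \<alpha>
    using that by (auto simp: bar_act_def bar_simplices_def seg_zip intro!: nth_equalityI)
qed

text \<open>A step in one direction leaves the vertex of the other factor unchanged, and the edge
  from a vertex to itself is labelled by the unit. So padding with units is the degeneracy.\<close>

lemma bar_cross_simplex_eq:
  assumes "group G" "group H" "gs \<in> bar_simplices G m" "hs \<in> bar_simplices H n"
    and \<mu>: "\<mu> \<subseteq> {..<m + n}" "card \<mu> = m"
  shows "bar_cross_simplex G H (m + n) gs hs \<mu> = zip (bar_act G (m + n) (steps \<mu>) gs) (bar_act H (m + n) (steps (- \<mu>)) hs)"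
proof (rule nth_equalityI)
  interpret G: group G by fact
  interpret H: group H by fact
  show "length (bar_cross_simplex G H (m + n) gs hs \<mu>)
      = length (zip (bar_act G (m + n) (steps \<mu>) gs) (bar_act H (m + n) (steps (- \<mu>)) hs))"
    by (simp add: bar_cross_simplex_def bar_act_def)
  fix i assume "i < length (bar_cross_simplex G H (m + n) gs hs \<mu>)"
  then have i: "i < m + n" by (simp add: bar_cross_simplex_def)
  have gs: "length gs = m" "set gs \<subseteq> carrier G" and hs: "length hs = n" "set hs \<subseteq> carrier H"
    using assms by (auto simp: bar_simplices_def)
  show "bar_cross_simplex G H (m + n) gs hs \<mu> ! i
      = zip (bar_act G (m + n) (steps \<mu>) gs) (bar_act H (m + n) (steps (- \<mu>)) hs) ! i"
  proof (cases "i \<in> \<mu>")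
    case True
    have "steps \<mu> i < m" using steps_strict[OF True, of "Suc i"] steps_le[OF \<mu>, of "Suc i"] by simp
    then show ?thesis
      using True i gs by (simp add: bar_cross_simplex_def bar_act_def steps_Suc G.seg_Suc)
  next
    case False
    then have "steps (- \<mu>) i < n"
      using steps_strict[of i "- \<mu>" "Suc i"] steps_Compl_le[OF \<mu>, of "Suc i"] i by simp
    then show ?thesis
      using False i hs by (simp add: bar_cross_simplex_def bar_act_def steps_Suc H.seg_Suc)
  qed
qed

definition bar_cross_chain ::
  "('g, 'm) monoid_scheme \<Rightarrow> ('h, 'l) monoid_scheme \<Rightarrow> nat \<Rightarrow> nat \<Rightarrow> ('g list \<Rightarrow>\<^sub>0 int) \<Rightarrow> ('h list \<Rightarrow>\<^sub>0 int)
    \<Rightarrow> (('g \<times> 'h) list \<Rightarrow>\<^sub>0 int)" where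
  "bar_cross_chain G H m n c d =
     frag_extend (\<lambda>gs. frag_extend (\<lambda>hs. shuffle_sum m n (bar_cross_simplex G H (m + n) gs hs)) d) c"

lemma bar_cross_chain_eq:
  assumes "group G" "group H" "Poly_Mapping.keys c \<subseteq> bar_simplices G m" "Poly_Mapping.keys d \<subseteq> bar_simplices H n"
  shows "bar_cross_chain G H m n c d = simplicial_product.cross_chain (bar_act G) (bar_act H) (\<lambda>_. zip) m n c d"
proof -
  interpret simplicial_product "bar_simplices G" "bar_act G" "bar_face G" "bar_boundary G"
    "bar_simplices H" "bar_act H" "bar_face H" "bar_boundary H"
    "bar_simplices (G \<times>\<times> H)" "bar_act (G \<times>\<times> H)" "bar_face (G \<times>\<times> H)" "bar_boundary (G \<times>\<times> H)" "\<lambda>_. zip"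
    by (rule simplicial_product_bar[OF assms(1,2)])
  show ?thesis
    unfolding bar_cross_chain_def cross_chain_def cross_def cross_simplex_def
    by (intro frag_extend_eq shuffle_sum_cong bar_cross_simplex_eq) (use assms in auto)
qed

abbreviation bar_cls :: "nat \<Rightarrow> nat \<Rightarrow> ('g, 'm) monoid_scheme \<Rightarrow> ('g list \<Rightarrow>\<^sub>0 int) \<Rightarrow> ('g list \<Rightarrow>\<^sub>0 int) set" where
  "bar_cls p n G \<equiv> chain_complex.cls (bar_simplices G) (bar_boundary G) p n"

abbreviation bar_cycles :: "nat \<Rightarrow> nat \<Rightarrow> ('g, 'm) monoid_scheme \<Rightarrow> ('g list \<Rightarrow>\<^sub>0 int) set" where
  "bar_cycles p n G \<equiv> mod_cycles p (bar_simplices G) (bar_boundary G) n"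

lemma chain_complex_bar: "\<lbrakk>group G; 0 < p\<rbrakk> \<Longrightarrow> chain_complex (bar_simplices G) (bar_boundary G) p"
  by (rule simplicial_set.chain_complex[OF group.simplicial_set_bar])

lemma bar_cross:
  assumes GH: "group G" "group H" and p: "0 < p" and a: "a \<in> bar_cycles p m G" and b: "b \<in> bar_cycles p n H"
  shows "group_cross p m n G H (bar_cls p m G a) (bar_cls p n H b) = bar_cls p (m + n) (G \<times>\<times> H) (bar_cross_chain G H m n a b)"
    and "bar_cross_chain G H m n a b \<in> bar_cycles p (m + n) (G \<times>\<times> H)"
proof -
  interpret G: chain_complex "bar_simplices G" "bar_boundary G" p by (rule chain_complex_bar[OF GH(1) p])
  interpret H: chain_complex "bar_simplices H" "bar_boundary H" p by (rule chain_complex_bar[OF GH(2) p])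
  have k: "Poly_Mapping.keys c \<subseteq> bar_simplices G m" if "c \<in> bar_cls p m G a" for c
    using that G.cls_subset_Z[OF a] G.Z_keys by blast
  have k': "Poly_Mapping.keys c \<subseteq> bar_simplices H n" if "c \<in> bar_cls p n H b" for c
    using that H.cls_subset_Z[OF b] H.Z_keys by blast
  let ?C = "simplicial_product.cross_chain (bar_act G) (bar_act H) (\<lambda>_. zip) m n"
  have eq: "bar_cross_chain G H m n c d = ?C c d" if "c \<in> bar_cls p m G a" "d \<in> bar_cls p n H b" for c d
    by (rule bar_cross_chain_eq[OF GH k k']) (use that in auto)
  have "group_cross p m n G H (bar_cls p m G a) (bar_cls p n H b)
     = {?C c d + w |c d w. c \<in> bar_cls p m G a \<and> d \<in> bar_cls p n H b \<and> w \<in> bar_boundaries p (m + n) (G \<times>\<times> H)}"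
    unfolding group_cross_def bar_cross_chain_def[symmetric]
    by (intro Collect_cong iff_exI) (use eq in auto)
  then show "group_cross p m n G H (bar_cls p m G a) (bar_cls p n H b) = bar_cls p (m + n) (G \<times>\<times> H) (bar_cross_chain G H m n a b)"
    using simplicial_product.cross_cls[OF simplicial_product_bar[OF GH] p a b] eq[OF G.cls_self H.cls_self] by simp
  show "bar_cross_chain G H m n a b \<in> bar_cycles p (m + n) (G \<times>\<times> H)"
    using simplicial_product.cross_Z_Z[OF simplicial_product_bar[OF GH] p a b] eq[OF G.cls_self H.cls_self] by simp
qed

section \<open>Existence of classifying maps\<close>

text \<open>
  A point of the geometric realisation of the simplicial set \<open>E G\<close> is a step function
  \<open>[0, 1) \<rightarrow> G\<close>, with value \<open>gs ! i\<close> on an interval of length \<open>t i\<close>; faces and degeneracies do not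
  change the step function. Let \<open>weight j g\<close> measure how much the value \<open>g\<close> dominates on \<open>[0, 1 / (j + 1))\<close>.
  At most one \<open>g\<close> has \<open>weight j g > 0\<close>, and \<open>weight j g = 1\<close> for the first value \<open>g\<close> and large \<open>j\<close>. The map is
  the infinite composite, over \<open>j\<close>, of the stages which move a point by the time \<open>weight j g\<close> along the
  \<open>g\<close>-translate of the contraction. A stage with \<open>weight j g = 1\<close> is constant, so all later stages are
  irrelevant, and the composite is continuous because it is locally finite.
\<close>

definition initial_part :: "nat \<Rightarrow> (nat \<Rightarrow> real) \<Rightarrow> nat \<Rightarrow> real" where
  "initial_part j t i = min (1 / (real j + 1)) (\<Sum>l<i. t l)"

text \<open>The share of the interval \<open>[0, 1 / (j + 1))\<close> on which the step function
  takes the value \<open>g\<close>. If \<open>g\<close> sits at several vertices, their intervals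
  are added.\<close>

definition occupation :: "nat \<Rightarrow> 'g \<Rightarrow> 'g list \<Rightarrow> (nat \<Rightarrow> real) \<Rightarrow> real" where
  "occupation j g gs t =
     (\<Sum>i<length gs. if gs ! i = g then initial_part j t (Suc i) - initial_part j t i else 0) * (real j + 1)"

text \<open>The constants are chosen so that the weight is positive exactly for a share above 1/2,
  which two values cannot both have, and is 1 from the share 3/4 on, hence on an open neighbourhood
  of any point where the share is 1.\<close>

definition weight :: "nat \<Rightarrow> 'g \<Rightarrow> 'g list \<Rightarrow> (nat \<Rightarrow> real) \<Rightarrow> real" where
  "weight j g gs t = max 0 (min 1 (4 * occupation j g gs t - 2))"

lemma weight_bounds: "0 \<le> weight j g gs t" "weight j g gs t \<le> 1"
  by (auto simp: weight_def)

lemma initial_part_0 [simp]: "initial_part j t 0 = 0"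
  by (simp add: initial_part_def)

lemma initial_part_mono:
  assumes "\<And>i. 0 \<le> t i"
  shows "initial_part j t i \<le> initial_part j t (Suc i)"
proof -
  have "(\<Sum>l<i. t l) \<le> (\<Sum>l<Suc i. t l)" using assms by simp
  then show ?thesis unfolding initial_part_def by (intro min.mono) auto
qed

text \<open>The shares of distinct values come from disjoint sets of intervals, whose lengths
  telescope to at most \<open>1 / (j + 1)\<close>.\<close>

lemma occupation_exclusive:
  assumes "\<And>i. 0 \<le> t i" "g \<noteq> h"
  shows "occupation j g gs t + occupation j h gs t \<le> 1"
proof -
  have "(\<Sum>i<length gs. if gs ! i = g then initial_part j t (Suc i) - initial_part j t i else 0)
     + (\<Sum>i<length gs. if gs ! i = h then initial_part j t (Suc i) - initial_part j t i else 0)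
     \<le> (\<Sum>i<length gs. initial_part j t (Suc i) - initial_part j t i)"
    unfolding sum.distrib[symmetric]
    by (rule sum_mono) (use initial_part_mono[OF assms(1)] assms(2) in auto)
  also have "\<dots> = initial_part j t (length gs) - initial_part j t 0"
    by (rule sum_lessThan_telescope)
  also have "\<dots> \<le> 1 / (real j + 1)" by (simp add: initial_part_def)
  finally have "((\<Sum>i<length gs. if gs ! i = g then initial_part j t (Suc i) - initial_part j t i else 0)
     + (\<Sum>i<length gs. if gs ! i = h then initial_part j t (Suc i) - initial_part j t i else 0)) * (real j + 1) \<le> 1"
    by (simp add: field_simps)
  then show ?thesis by (simp add: occupation_def distrib_right)
qed

lemma weight_exclusive:
  assumes "\<And>i. 0 \<le> t i" "0 < weight j g gs t" "0 < weight j h gs t"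
  shows "g = h"
proof (rule ccontr)
  assume "g \<noteq> h"
  then have "occupation j g gs t + occupation j h gs t \<le> 1" by (rule occupation_exclusive[OF assms(1)])
  moreover have "occupation j g gs t > 1 / 2" "occupation j h gs t > 1 / 2"
    using assms(2,3) by (auto simp: weight_def)
  ultimately show False by simp
qed

lemma downward_closed_nat:
  fixes A :: "nat set"
  assumes "A \<subseteq> {..m}" "\<And>i j. \<lbrakk>j \<in> A; i \<le> j\<rbrakk> \<Longrightarrow> i \<in> A"
  shows "\<exists>N. A = {..<N}"
proof (cases "A = {}")
  case False
  have fin: "finite A" using assms(1) finite_subset by blast
  have "A = {..Max A}"
  proof (intro equalityI subsetI)
    fix i assume "i \<in> {..Max A}"
    then show "i \<in> A" by (intro assms(2)[OF Max_in[OF fin False]]) simp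
  qed (use fin in simp)
  then have "A = {..<Suc (Max A)}" by (simp only: lessThan_Suc_atMost)
  then show ?thesis by blast
qed auto

text \<open>The two points have the same step function. Pushing forward along a monotone
  \<open>\<alpha>\<close> merges neighbouring intervals that carry equal values or inserts empty
  ones.\<close>

lemma occupation_push:
  assumes \<alpha>: "mono_on {..m} \<alpha>" "\<alpha> ` {..m} \<subseteq> {..n}" and len: "length gs = Suc n"
  shows "occupation j g (map (\<lambda>i. gs ! \<alpha> i) [0..<Suc m]) t
       = occupation j g gs (\<lambda>l. \<Sum>i\<le>m. if l = \<alpha> i then t i else 0)"
proof -
  define u where "u = (\<lambda>l. \<Sum>i\<le>m. if l = \<alpha> i then t i else 0)"
  define d where "d i = initial_part j t (Suc i) - initial_part j t i" for i
  have part: "initial_part j u l = (\<Sum>i | i \<le> m \<and> \<alpha> i < l. d i)" for l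
  proof -
    \<comment> \<open>By monotonicity the vertices sent below \<open>l\<close> form an initial
      segment, so the partial sums of \<open>u\<close> are partial sums of \<open>t\<close>.\<close>
    have "\<exists>N. {i. i \<le> m \<and> \<alpha> i < l} = {..<N}"
    proof (rule downward_closed_nat[of _ m])
      fix i i' assume *: "i' \<in> {i. i \<le> m \<and> \<alpha> i < l}" "i \<le> i'"
      then have "\<alpha> i \<le> \<alpha> i'" by (intro mono_onD[OF \<alpha>(1)]) auto
      with * show "i \<in> {i. i \<le> m \<and> \<alpha> i < l}" by auto
    qed auto
    then obtain N where N: "{i. i \<le> m \<and> \<alpha> i < l} = {..<N}" by blast
    have "(\<Sum>k<l. u k) = (\<Sum>i\<le>m. \<Sum>k<l. if k = \<alpha> i then t i else 0)"
      unfolding u_def by (rule sum.swap)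
    also have "\<dots> = (\<Sum>i\<le>m. if \<alpha> i < l then t i else 0)"
      by (rule sum.cong) auto
    also have "\<dots> = (\<Sum>i | i \<le> m \<and> \<alpha> i < l. t i)"
      by (simp add: sum.inter_filter[symmetric])
    finally have "(\<Sum>k<l. u k) = (\<Sum>i<N. t i)" by (simp only: N)
    then have "initial_part j u l = initial_part j t N" by (simp add: initial_part_def)
    also have "\<dots> = (\<Sum>i<N. d i)" unfolding d_def by (simp add: sum_lessThan_telescope)
    finally show ?thesis by (simp only: N)
  qed
  have diff: "initial_part j u (Suc l) - initial_part j u l = (\<Sum>i\<le>m. if \<alpha> i = l then d i else 0)" for l
  proof -
    have "{i. i \<le> m \<and> \<alpha> i < Suc l} = {i. i \<le> m \<and> \<alpha> i < l} \<union> {i. i \<le> m \<and> \<alpha> i = l}" by auto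
    then have "(\<Sum>i | i \<le> m \<and> \<alpha> i < Suc l. d i) = (\<Sum>i | i \<le> m \<and> \<alpha> i < l. d i) + (\<Sum>i | i \<le> m \<and> \<alpha> i = l. d i)"
      by (simp only:) (rule sum.union_disjoint, auto)
    moreover have "(\<Sum>i | i \<le> m \<and> \<alpha> i = l. d i) = (\<Sum>i\<le>m. if \<alpha> i = l then d i else 0)"
      by (simp add: sum.inter_filter[symmetric])
    ultimately show ?thesis by (simp add: part)
  qed
  have "(\<Sum>l<Suc n. if gs ! l = g then initial_part j u (Suc l) - initial_part j u l else 0)
      = (\<Sum>l<Suc n. \<Sum>i\<le>m. if \<alpha> i = l then (if gs ! \<alpha> i = g then d i else 0) else 0)"
  proof (rule sum.cong[OF refl])
    fix l
    show "(if gs ! l = g then initial_part j u (Suc l) - initial_part j u l else 0)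
        = (\<Sum>i\<le>m. if \<alpha> i = l then (if gs ! \<alpha> i = g then d i else 0) else 0)"
    proof (cases "gs ! l = g")
      case True
      then show ?thesis unfolding diff by (auto intro!: sum.cong)
    next
      case False
      have "(\<Sum>i\<le>m. if \<alpha> i = l then (if gs ! \<alpha> i = g then d i else 0) else 0) = 0"
        by (rule sum.neutral) (use False in auto)
      then show ?thesis using False by simp
    qed
  qed
  also have "\<dots> = (\<Sum>i\<le>m. \<Sum>l<Suc n. if \<alpha> i = l then (if gs ! \<alpha> i = g then d i else 0) else 0)"
    by (rule sum.swap)
  also have "\<dots> = (\<Sum>i\<le>m. if gs ! \<alpha> i = g then d i else 0)"
    by (rule sum.cong) (use \<alpha>(2) in \<open>auto simp: less_Suc_eq_le\<close>)
  also have "\<dots> = (\<Sum>i<Suc m. if map (\<lambda>i. gs ! \<alpha> i) [0..<Suc m] ! i = g then d i else 0)"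
    unfolding lessThan_Suc_atMost by (rule sum.cong) (auto simp del: upt_Suc)
  finally show ?thesis
    unfolding occupation_def u_def[symmetric] d_def using len by (simp del: upt_Suc sum.lessThan_Suc)
qed

text \<open>Let \<open>i0\<close> be the first vertex with positive coordinate. As soon as
  \<open>1 / (j + 1) < t i0\<close>, the value at \<open>i0\<close> fills the whole interval
  \<open>[0, 1 / (j + 1))\<close>.\<close>

lemma weight_one_exists:
  assumes t: "t \<in> standard_simplex n" and len: "length gs = Suc n"
  shows "\<exists>j. \<exists>g\<in>set gs. 1 \<le> occupation j g gs t"
proof -
  have nonneg: "\<And>i. 0 \<le> t i" and "(\<Sum>i\<le>n. t i) = 1" using t by (auto simp: standard_simplex_def)
  then obtain i where i: "i \<le> n" "t i > 0"
    by (metis atMost_iff less_eq_real_def sum.neutral zero_neq_one)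
  define i0 where "i0 = (LEAST i. t i > 0)"
  have i0: "t i0 > 0" "i0 \<le> n"
    using i LeastI[of "\<lambda>i. t i > 0" i] Least_le[of "\<lambda>i. t i > 0" i] by (auto simp: i0_def)
  have zero: "t i = 0" if "i < i0" for i
    using not_less_Least[of i "\<lambda>i. t i > 0"] that nonneg[of i] by (auto simp: i0_def)
  obtain j where j: "1 / (real j + 1) < t i0"
    using i0(1) by (metis nat_approx_posE of_nat_Suc add.commute)
  define d where "d i = (if gs ! i = gs ! i0 then initial_part j t (Suc i) - initial_part j t i else 0)" for i
  have "initial_part j t i0 = 0" using zero by (simp add: initial_part_def)
  moreover have "initial_part j t (Suc i0) = 1 / (real j + 1)"
    using zero j by (simp add: initial_part_def)
  ultimately have "1 / (real j + 1) = d i0" by (simp add: d_def)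
  also have "\<dots> \<le> (\<Sum>i<length gs. d i)"
    by (rule member_le_sum) (use i0 len initial_part_mono[OF nonneg] in \<open>auto simp: d_def\<close>)
  finally have "1 \<le> occupation j (gs ! i0) gs t"
    unfolding occupation_def d_def by (simp add: field_simps)
  moreover have "gs ! i0 \<in> set gs" using i0 len by simp
  ultimately show ?thesis by blast
qed

lemma continuous_map_occupation:
  "continuous_map (simplex_space n) euclideanreal (occupation j g gs)"
proof -
  have 1: "continuous_map (simplex_space n) euclideanreal (\<lambda>t. t l)" for l
    by (intro continuous_map_from_subtopology continuous_map_product_projection) auto
  have 2: "continuous_map (simplex_space n) euclideanreal (\<lambda>t. initial_part j t i)" for i
    unfolding initial_part_def by (intro continuous_map_real_min continuous_map_sum 1) auto
  have "continuous_map (simplex_space n) euclideanreal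
      (\<lambda>t. if gs ! i = g then initial_part j t (Suc i) - initial_part j t i else 0)" for i
    by (cases "gs ! i = g") (auto intro!: continuous_map_diff 2)
  then show ?thesis
    unfolding occupation_def[abs_def] by (intro continuous_map_real_mult continuous_map_sum) auto
qed

lemma continuous_map_weight:
  "continuous_map (simplex_space n) (top_of_set {0..1}) (weight j g gs)"
proof -
  have "continuous_map (simplex_space n) euclideanreal (weight j g gs)"
    unfolding weight_def[abs_def]
    by (intro continuous_map_real_max continuous_map_real_min continuous_map_diff continuous_map_real_mult
        continuous_map_occupation) auto
  then show ?thesis
    using weight_bounds by (auto simp: continuous_map_in_subtopology)
qed

lemma continuous_map_local:
  assumes "\<And>x. x \<in> topspace X \<Longrightarrow> \<exists>U h. openin X U \<and> x \<in> U \<and> continuous_map X Y h \<and> (\<forall>y\<in>U. f y = h y)"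
  shows "continuous_map X Y f"
  unfolding continuous_map_def
proof (intro conjI allI impI)
  show "f \<in> topspace X \<rightarrow> topspace Y"
  proof
    fix x assume "x \<in> topspace X"
    then obtain U h where "x \<in> U" "continuous_map X Y h" "\<forall>y\<in>U. f y = h y" using assms by blast
    then show "f x \<in> topspace Y" using \<open>x \<in> topspace X\<close> by (auto simp: continuous_map_def)
  qed
  fix V assume V: "openin Y V"
  show "openin X {x \<in> topspace X. f x \<in> V}"
  proof (subst openin_subopen, clarify)
    fix x assume x: "x \<in> topspace X" "f x \<in> V"
    then obtain U h where U: "openin X U" "x \<in> U" "continuous_map X Y h" "\<forall>y\<in>U. f y = h y" using assms by blast
    have "openin X {y \<in> topspace X. h y \<in> V}" using U(3) V by (auto simp: continuous_map_def)
    then have "openin X (U \<inter> {y \<in> topspace X. h y \<in> V})" using U(1) by blast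
    moreover have "x \<in> U \<inter> {y \<in> topspace X. h y \<in> V}" using U x by auto
    moreover have "U \<inter> {y \<in> topspace X. h y \<in> V} \<subseteq> {x \<in> topspace X. f x \<in> V}" using U by auto
    ultimately show "\<exists>T. openin X T \<and> x \<in> T \<and> T \<subseteq> {x \<in> topspace X. f x \<in> V}" by blast
  qed
qed

section \<open>Equivariant maps into a contractible space with an action of a finite group\<close>

locale contractible_action = group G for G :: "('g, 'm) monoid_scheme" (structure) +
  fixes Y :: "'y topology" and act :: "'g \<Rightarrow> 'y \<Rightarrow> 'y" and H :: "real \<times> 'y \<Rightarrow> 'y" and a :: 'y
  assumes fin: "finite (carrier G)"
    and act_cont: "g \<in> carrier G \<Longrightarrow> continuous_map Y Y (act g)"
    and act_mult: "\<lbrakk>g \<in> carrier G; h \<in> carrier G; y \<in> topspace Y\<rbrakk> \<Longrightarrow> act (g \<otimes> h) y = act g (act h y)"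
    and act_one: "y \<in> topspace Y \<Longrightarrow> act \<one> y = y"
    and a_in: "a \<in> topspace Y"
    and H_cont: "continuous_map (prod_topology (top_of_set {0..1}) Y) Y H"
    and H_0: "y \<in> topspace Y \<Longrightarrow> H (0, y) = y"
    and H_1: "y \<in> topspace Y \<Longrightarrow> H (1, y) = a"
begin

lemma act_closed: "\<lbrakk>g \<in> carrier G; y \<in> topspace Y\<rbrakk> \<Longrightarrow> act g y \<in> topspace Y"
  using continuous_map_funspace[OF act_cont] by blast

lemma act_inv: "\<lbrakk>g \<in> carrier G; y \<in> topspace Y\<rbrakk> \<Longrightarrow> act g (act (inv g) y) = y"
  by (simp add: act_mult[symmetric] act_one)

text \<open>The contraction \<open>H\<close> is not assumed to be equivariant. Its translate by
  \<open>g\<close> contracts to \<open>act g a\<close>, and the action permutes these translates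
  (\<open>move_act\<close>), so a prescription that uses all of them symmetrically is
  equivariant.\<close>

definition move :: "'g \<Rightarrow> real \<Rightarrow> 'y \<Rightarrow> 'y" where
  "move g s y = act g (H (s, act (inv g) y))"

lemma H_closed: "\<lbrakk>0 \<le> s; s \<le> 1; y \<in> topspace Y\<rbrakk> \<Longrightarrow> H (s, y) \<in> topspace Y"
  using continuous_map_funspace[OF H_cont] by fastforce

lemma move_closed: "\<lbrakk>g \<in> carrier G; 0 \<le> s; s \<le> 1; y \<in> topspace Y\<rbrakk> \<Longrightarrow> move g s y \<in> topspace Y"
  by (simp add: move_def act_closed H_closed)

lemma move_0: "\<lbrakk>g \<in> carrier G; y \<in> topspace Y\<rbrakk> \<Longrightarrow> move g 0 y = y"
  by (simp add: move_def H_0 act_closed act_inv)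

lemma move_1: "\<lbrakk>g \<in> carrier G; y \<in> topspace Y\<rbrakk> \<Longrightarrow> move g 1 y = act g a"
  by (simp add: move_def H_1 act_closed)

lemma move_act:
  assumes "g \<in> carrier G" "h \<in> carrier G" "0 \<le> s" "s \<le> 1" "y \<in> topspace Y"
  shows "move (h \<otimes> g) s (act h y) = act h (move g s y)"
proof -
  have "inv (h \<otimes> g) \<otimes> h = inv g" using assms by (simp add: inv_mult_group m_assoc)
  then have "act (inv (h \<otimes> g)) (act h y) = act (inv g) y"
    using assms by (simp add: act_mult[symmetric])
  then show ?thesis using assms by (simp add: move_def act_mult H_closed act_closed)
qed

definition carrier_list :: "'g list" where
  "carrier_list = (SOME xs. set xs = carrier G \<and> distinct xs)"

lemma carrier_list: "set carrier_list = carrier G" "distinct carrier_list"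
  using someI_ex[OF finite_distinct_list[OF fin]] by (auto simp: carrier_list_def)

text \<open>At most one factor of this composite moves the point when \<open>v\<close> is
  admissible, so the order of the group elements has no influence. Keeping all the factors makes
  continuity in the weights evident, without naming the dominating element.\<close>

definition stage :: "('g \<Rightarrow> real) \<Rightarrow> 'y \<Rightarrow> 'y" where
  "stage v y = foldr (\<lambda>g y. move g (v g) y) carrier_list y"

definition admissible :: "('g \<Rightarrow> real) \<Rightarrow> bool" where
  "admissible v \<longleftrightarrow> (\<forall>g. 0 \<le> v g \<and> v g \<le> 1) \<and> (\<forall>g h. 0 < v g \<longrightarrow> 0 < v h \<longrightarrow> g = h)"

lemma foldr_move_closed:
  assumes "admissible v" "set xs \<subseteq> carrier G" "y \<in> topspace Y"
  shows "foldr (\<lambda>g y. move g (v g) y) xs y \<in> topspace Y"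
  using assms(2)
proof (induction xs)
  case (Cons x xs)
  have "0 \<le> v x" "v x \<le> 1" using assms(1) by (simp_all add: admissible_def)
  then show ?case using Cons by (simp add: move_closed)
qed (simp add: assms(3))

lemma foldr_move_zero:
  assumes "set xs \<subseteq> carrier G" "y \<in> topspace Y" "\<And>g. g \<in> set xs \<Longrightarrow> v g = 0"
  shows "foldr (\<lambda>g y. move g (v g) y) xs y = y"
  using assms(1,3) by (induction xs) (simp_all add: move_0 assms(2))

lemma foldr_move_pos:
  assumes v: "admissible v" and y: "y \<in> topspace Y" and g: "0 < v g"
    and xs: "set xs \<subseteq> carrier G" "distinct xs" "g \<in> set xs"
  shows "foldr (\<lambda>g y. move g (v g) y) xs y = move g (v g) y"
  using xs
proof (induction xs)
  case (Cons x xs)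
  have bounds: "0 \<le> v h" "v h \<le> 1" for h using v by (simp_all add: admissible_def)
  have zero: "v h = 0" if "h \<noteq> g" for h
  proof (rule ccontr)
    assume "v h \<noteq> 0"
    then have "0 < v h" using bounds(1)[of h] by simp
    then show False using v g that unfolding admissible_def by blast
  qed
  show ?case
  proof (cases "g = x")
    case True
    have "foldr (\<lambda>g y. move g (v g) y) xs y = y"
    proof (rule foldr_move_zero[OF _ y])
      fix h assume "h \<in> set xs"
      then have "h \<noteq> g" using Cons.prems True by auto
      then show "v h = 0" by (rule zero)
    qed (use Cons.prems in simp)
    then show ?thesis using True by simp
  next
    case False
    then have "foldr (\<lambda>g y. move g (v g) y) xs y = move g (v g) y" using Cons by simp
    moreover have "g \<in> carrier G" "x \<in> carrier G" using Cons.prems by auto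
    ultimately show ?thesis
      using zero[of x] False move_0[of x "move g (v g) y"] move_closed[of g "v g" y] bounds[of g] y by simp
  qed
qed simp

lemma stage_closed: "\<lbrakk>admissible v; y \<in> topspace Y\<rbrakk> \<Longrightarrow> stage v y \<in> topspace Y"
  unfolding stage_def by (rule foldr_move_closed) (simp_all add: carrier_list)

lemma stage_pos: "\<lbrakk>admissible v; y \<in> topspace Y; g \<in> carrier G; 0 < v g\<rbrakk> \<Longrightarrow> stage v y = move g (v g) y"
  unfolding stage_def by (rule foldr_move_pos) (simp_all add: carrier_list)

lemma stage_zero: "\<lbrakk>y \<in> topspace Y; \<And>g. g \<in> carrier G \<Longrightarrow> v g = 0\<rbrakk> \<Longrightarrow> stage v y = y"
  unfolding stage_def by (rule foldr_move_zero) (simp_all add: carrier_list)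

lemma stage_act:
  assumes v: "admissible v" "admissible v'" and h: "h \<in> carrier G" and y: "y \<in> topspace Y"
    and eq: "\<And>g. g \<in> carrier G \<Longrightarrow> v' (h \<otimes> g) = v g"
  shows "stage v' (act h y) = act h (stage v y)"
proof (cases "\<exists>g\<in>carrier G. 0 < v g")
  case True
  then obtain g where g: "g \<in> carrier G" "0 < v g" by blast
  have "v g \<le> 1" using v(1) by (simp add: admissible_def)
  have "stage v' (act h y) = move (h \<otimes> g) (v g) (act h y)"
    using stage_pos[OF v(2) act_closed[OF h y], of "h \<otimes> g"] g h eq by simp
  also have "\<dots> = act h (move g (v g) y)"
    by (rule move_act) (use g h y \<open>v g \<le> 1\<close> in auto)
  finally show ?thesis using stage_pos[OF v(1) y g] by simp
next
  case False
  then have z: "v g = 0" if "g \<in> carrier G" for g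
    using that v(1) by (metis admissible_def less_eq_real_def)
  have "v' g = 0" if g: "g \<in> carrier G" for g
  proof -
    have "g = h \<otimes> (inv h \<otimes> g)" using g h by (simp add: m_assoc[symmetric])
    then show ?thesis using eq[of "inv h \<otimes> g"] z[of "inv h \<otimes> g"] g h by simp
  qed
  then show ?thesis using stage_zero[OF act_closed[OF h y], of v'] stage_zero[OF y z] by simp
qed

text \<open>Stage \<open>j\<close> is outermost and later stages are its argument; \<open>a\<close>
  stands in for the infinite rest. A stage of weight 1 forgets its argument, which is why the
  truncation does not matter (\<open>stages_stable\<close>).\<close>

fun stages :: "(nat \<Rightarrow> 'g \<Rightarrow> real) \<Rightarrow> nat \<Rightarrow> nat \<Rightarrow> 'y" where
  "stages w j 0 = a"
| "stages w j (Suc r) = stage (w j) (stages w (Suc j) r)"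

lemma stages_closed: "(\<And>j. admissible (w j)) \<Longrightarrow> stages w j r \<in> topspace Y"
  by (induction r arbitrary: j) (simp_all add: a_in stage_closed)

lemma stages_stable:
  assumes w: "\<And>j. admissible (w j)" and g: "g \<in> carrier G" "w (j + r) g = 1" and "r < r'"
  shows "stages w j r' = stages w j (Suc r)"
  using g(2) \<open>r < r'\<close>
proof (induction r arbitrary: j r')
  case 0
  then obtain s where "r' = Suc s" using gr0_implies_Suc by blast
  then show ?case
    using 0 stage_pos[OF w[of j] stages_closed[of w "Suc j" s, OF w] g(1)] stage_pos[OF w[of j] a_in g(1)]
      move_1[OF g(1) stages_closed[of w "Suc j" s, OF w]] move_1[OF g(1) a_in] by simp
next
  case (Suc r)
  then obtain s where s: "r' = Suc s" "r < s" by (metis Suc_lessE)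
  then have "stages w (Suc j) s = stages w (Suc j) (Suc r)" using Suc by simp
  then show ?case using s by simp
qed

text \<open>The starting point \<open>a\<close> is not equivariant. Equivariance begins at stage
  \<open>j + r\<close>, which has weight 1 and replaces its argument by \<open>act g a\<close>, and
  the outer stages preserve it.\<close>

lemma stages_act:
  assumes w: "\<And>j. admissible (w j)" "\<And>j. admissible (w' j)" and h: "h \<in> carrier G"
    and eq: "\<And>j g. g \<in> carrier G \<Longrightarrow> w' j (h \<otimes> g) = w j g"
    and g: "g \<in> carrier G" "w (j + r) g = 1"
  shows "stages w' j (Suc r) = act h (stages w j (Suc r))"
  using g(2)
proof (induction r arbitrary: j)
  case 0
  have "stages w' j (Suc 0) = act (h \<otimes> g) a"
    using 0 stage_pos[OF w(2) a_in, of "h \<otimes> g"] move_1[OF _ a_in] eq g h by simp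
  moreover have "stages w j (Suc 0) = act g a"
    using 0 stage_pos[OF w(1) a_in, of g] move_1[OF _ a_in] g by simp
  ultimately show ?case using g h a_in act_mult by simp
next
  case (Suc r)
  have "stages w' (Suc j) (Suc r) = act h (stages w (Suc j) (Suc r))" using Suc by simp
  then show ?case
    using stage_act[OF w(1)[of j] w(2)[of j] h stages_closed[of w "Suc j" "Suc r", OF w(1)] eq]
    by (simp only: stages.simps(2)[of _ j "Suc r"])
qed

definition E_map :: "'g list \<Rightarrow> (nat \<Rightarrow> real) \<Rightarrow> 'y" where
  "E_map gs = (\<lambda>t\<in>standard_simplex (length gs - 1).
     stages (\<lambda>j g. weight j g gs t) 0 (Suc (LEAST j. \<exists>g\<in>carrier G. weight j g gs t = 1)))"

lemma admissible_weight: "t \<in> standard_simplex n \<Longrightarrow> admissible (\<lambda>g. weight j g gs t)"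
  unfolding admissible_def using weight_bounds weight_exclusive[of t] by (auto simp: standard_simplex_def)

text \<open>Unlike the least index in \<open>E_map\<close>, an index \<open>j\<close> with weight 1
  can be held fixed on a neighbourhood, and it can be moved along by a group element. Continuity and
  equivariance rest on this freedom.\<close>

lemma E_map_stages:
  assumes t: "t \<in> standard_simplex n" "length gs = Suc n" and g: "g \<in> carrier G" "weight j g gs t = 1"
  shows "E_map gs t = stages (\<lambda>j g. weight j g gs t) 0 (Suc j)"
proof -
  define J where "J = (LEAST j. \<exists>g\<in>carrier G. weight j g gs t = 1)"
  have "\<exists>g\<in>carrier G. weight J g gs t = 1"
    unfolding J_def by (rule LeastI_ex) (use g in blast)
  then obtain g' where g': "g' \<in> carrier G" "weight J g' gs t = 1" by blast
  have "J \<le> j" unfolding J_def by (rule Least_le) (use g in blast)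
  then have "stages (\<lambda>j g. weight j g gs t) 0 (Suc j) = stages (\<lambda>j g. weight j g gs t) 0 (Suc J)"
    by (intro stages_stable[of _ g' 0 J]) (use g' admissible_weight[OF t(1)] in auto)
  then show ?thesis using t by (simp add: E_map_def J_def del: stages.simps)
qed

lemma weight_one:
  assumes "t \<in> standard_simplex n" "length gs = Suc n" "set gs \<subseteq> carrier G"
  obtains j g where "g \<in> carrier G" "1 \<le> occupation j g gs t"
  using weight_one_exists[OF assms(1,2)] assms(3) by blast

lemma weight_eq_1: "3 / 4 < occupation j g gs t \<Longrightarrow> weight j g gs t = 1"
  by (simp add: weight_def)

lemma continuous_map_stages:
  "continuous_map (simplex_space n) Y (\<lambda>t. stages (\<lambda>j g. weight j g gs t) j r)"
proof (induction r arbitrary: j)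
  case 0
  then show ?case by (simp add: a_in)
next
  case (Suc r)
  have "continuous_map (simplex_space n) Y (\<lambda>t. foldr (\<lambda>g y. move g (weight j g gs t) y) xs (f t))"
    if "set xs \<subseteq> carrier G" "continuous_map (simplex_space n) Y f" for xs f
    using that(1)
  proof (induction xs)
    case Nil
    then show ?case using that(2) by simp
  next
    case (Cons x xs)
    let ?f = "\<lambda>t. foldr (\<lambda>g y. move g (weight j g gs t) y) xs (f t)"
    have x: "x \<in> carrier G" "inv x \<in> carrier G" using Cons by auto
    have "continuous_map (simplex_space n) Y ?f" using Cons by simp
    then have "continuous_map (simplex_space n) Y (act (inv x) \<circ> ?f)"
      by (rule continuous_map_compose[OF _ act_cont[OF x(2)]])
    then have "continuous_map (simplex_space n) (prod_topology (top_of_set {0..1}) Y) (\<lambda>t. (weight j x gs t, act (inv x) (?f t)))"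
      using continuous_map_weight[of n j x gs] by (simp add: continuous_map_pairwise o_def)
    then have "continuous_map (simplex_space n) Y (act x \<circ> (H \<circ> (\<lambda>t. (weight j x gs t, act (inv x) (?f t)))))"
      by (intro continuous_map_compose[OF _ act_cont[OF x(1)]] continuous_map_compose[OF _ H_cont])
    then show ?case by (simp add: move_def o_def)
  qed
  from this[OF _ Suc[of "Suc j"], of carrier_list] show ?case
    by (simp add: stage_def carrier_list)
qed

lemma E_map_simplex:
  assumes gs: "length gs = Suc n" "set gs \<subseteq> carrier G"
  shows "singular_simplex n Y (E_map gs)"
proof -
  have "continuous_map (simplex_space n) Y (E_map gs)"
  proof (rule continuous_map_local)
    fix t assume "t \<in> topspace (simplex_space n)"
    then have t: "t \<in> standard_simplex n" by simp
    obtain j g where g: "g \<in> carrier G" "1 \<le> occupation j g gs t" by (rule weight_one[OF t gs])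
    \<comment> \<open>The share is 1 at \<open>t\<close>, hence above 3/4 nearby, and there the
      weight of stage \<open>j\<close> stays equal to 1.\<close>
    define U where "U = {t \<in> topspace (simplex_space n). occupation j g gs t \<in> {3 / 4 <..}}"
    have "openin (simplex_space n) U"
      unfolding U_def by (rule openin_continuous_map_preimage[OF continuous_map_occupation]) simp
    moreover have "t \<in> U" using t g by (simp add: U_def)
    moreover have "E_map gs s = stages (\<lambda>j g. weight j g gs s) 0 (Suc j)" if "s \<in> U" for s
      using E_map_stages[OF _ gs(1) g(1) weight_eq_1] that by (simp add: U_def del: stages.simps)
    ultimately show "\<exists>U h. openin (simplex_space n) U \<and> t \<in> U \<and> continuous_map (simplex_space n) Y h \<and> (\<forall>s\<in>U. E_map gs s = h s)"
      using continuous_map_stages by blast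
  qed
  then show ?thesis using gs by (simp add: singular_simplex_def E_map_def)
qed

lemma E_map_act:
  assumes gs: "length gs = Suc n" "set gs \<subseteq> carrier G" and h: "h \<in> carrier G"
  shows "E_map (map (\<lambda>g. h \<otimes> g) gs) = simplex_map n (act h) (E_map gs)"
proof
  fix t
  show "E_map (map (\<lambda>g. h \<otimes> g) gs) t = simplex_map n (act h) (E_map gs) t"
  proof (cases "t \<in> standard_simplex n")
    case True
    obtain j g where g: "g \<in> carrier G" "1 \<le> occupation j g gs t" by (rule weight_one[OF True gs])
    have w1: "weight j g gs t = 1" using g by (intro weight_eq_1) simp
    have w: "weight j (h \<otimes> g) (map (\<lambda>g. h \<otimes> g) gs) t = weight j g gs t" if "g \<in> carrier G" for j g
    proof -
      have "h \<otimes> gs ! i = h \<otimes> g \<longleftrightarrow> gs ! i = g" if "i < length gs" for i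
        using \<open>g \<in> carrier G\<close> gs(2) h that nth_mem[OF that] by (auto simp: subset_iff)
      then have "(\<Sum>i<length gs. if map (\<lambda>g. h \<otimes> g) gs ! i = h \<otimes> g then initial_part j t (Suc i) - initial_part j t i else 0)
          = (\<Sum>i<length gs. if gs ! i = g then initial_part j t (Suc i) - initial_part j t i else 0)"
        by (intro sum.cong) auto
      then show ?thesis by (simp add: weight_def occupation_def)
    qed
    have "E_map (map (\<lambda>g. h \<otimes> g) gs) t = stages (\<lambda>j g. weight j g (map (\<lambda>g. h \<otimes> g) gs) t) 0 (Suc j)"
      by (rule E_map_stages[OF True, of _ "h \<otimes> g"]) (use gs g h w w1 in auto)
    also have "\<dots> = act h (stages (\<lambda>j g. weight j g gs t) 0 (Suc j))"
      by (rule stages_act[where g = g]) (use admissible_weight[OF True] h w w1 g in auto)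
    also have "\<dots> = act h (E_map gs t)"
      using E_map_stages[OF True gs(1) g(1) w1] by simp
    finally show ?thesis using True by (simp add: simplex_map_def)
  next
    case False
    then show ?thesis using gs by (simp add: E_map_def simplex_map_def)
  qed
qed

lemma E_map_op:
  assumes gs: "length gs = Suc n" "set gs \<subseteq> carrier G" and \<alpha>: "mono_on {..m} \<alpha>" "\<alpha> ` {..m} \<subseteq> {..n}"
  shows "E_map (map (\<lambda>i. gs ! \<alpha> i) [0..<Suc m]) = simplicial_op m \<alpha> (E_map gs)"
proof
  fix t
  show "E_map (map (\<lambda>i. gs ! \<alpha> i) [0..<Suc m]) t = simplicial_op m \<alpha> (E_map gs) t"
  proof (cases "t \<in> standard_simplex m")
    case True
    define u where "u = (\<lambda>l. \<Sum>i\<le>m. if l = \<alpha> i then t i else 0)"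
    have u: "u = push m \<alpha> t" by (simp add: u_def push_def fun_eq_iff)
    have u_in: "u \<in> standard_simplex n" unfolding u by (rule push_in[OF True \<alpha>(2)])
    have "weight j g (map (\<lambda>i. gs ! \<alpha> i) [0..<Suc m]) t = weight j g gs u" for j g
      using occupation_push[OF \<alpha> gs(1), of j g t] by (simp add: weight_def u_def del: upt_Suc)
    then have "E_map (map (\<lambda>i. gs ! \<alpha> i) [0..<Suc m]) t = E_map gs u"
      using True u_in gs(1) by (simp add: E_map_def del: upt_Suc stages.simps)
    then show ?thesis using True by (simp add: simplicial_op_eq u)
  next
    case False
    then show ?thesis by (simp add: E_map_def simplicial_op_eq del: upt_Suc)
  qed
qed

end

lemma classifying_map_exists:
  fixes P :: "'a operad_data"
  assumes P: "operad P" and Y: "contractible_space (ospace P {1..k})" "opts P {1..k} \<noteq> {}"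
  shows "\<exists>f. classifying_map P k f"
proof -
  interpret operad P by fact
  let ?Y = "ospace P {1..k}"
  obtain b where hom: "homotopic_with (\<lambda>_. True) ?Y ?Y id (\<lambda>_. b)"
    using Y(1) by (auto simp only: contractible_space_def)
  then obtain H :: "real \<times> 'a \<Rightarrow> 'a"
    where H: "continuous_map (prod_topology (top_of_set {0..1}) ?Y) ?Y H"
    "\<And>y. H (0, y) = y" "\<And>y. H (1, y) = b"
    unfolding homotopic_with_def id_apply by blast
  \<comment> \<open>The end of the contraction lies in the space because it is the value of
    \<open>H\<close> at an existing point.\<close>
  have b: "b \<in> topspace ?Y"
  proof -
    obtain y where y: "y \<in> topspace ?Y" using Y(2) by blast
    have "H (1, y) \<in> topspace ?Y" using funcset_mem[OF continuous_map_funspace[OF H(1)], of "(1, y)"] y by simp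
    then show ?thesis using H(3) by simp
  qed
  interpret contractible_action "sym_group k" ?Y "omap P {1..k}" H b
  proof (intro contractible_action.intro sym_group_is_group contractible_action_axioms.intro)
    have "carrier (sym_group k) = {g. g permutes {1..k}}" by (auto simp: sym_group_carrier)
    then show "finite (carrier (sym_group k))" by (simp add: finite_permutations)
    fix g h y assume "g \<in> carrier (sym_group k)"
    then have g: "g permutes {1..k}" by (simp add: sym_group_carrier)
    have img: "f ` {1..k} = {1..k}" "inj_on f {1..k}" if "f permutes {1..k}" for f
      by (rule permutes_image[OF that], rule permutes_inj_on[OF that])
    show "continuous_map ?Y ?Y (omap P {1..k} g)"
      using omap_continuous[of "{1..k}" g] img[OF g] by simp
    assume "h \<in> carrier (sym_group k)" and y: "y \<in> topspace ?Y"
    then have h: "h permutes {1..k}" by (simp add: sym_group_carrier)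
    show "omap P {1..k} (g \<otimes>\<^bsub>sym_group k\<^esub> h) y = omap P {1..k} g (omap P {1..k} h y)"
      using omap_comp[of "{1..k}" h g y] img[OF g] img[OF h] y by (simp add: sym_group_mult)
  next
    show "omap P {1..k} \<one>\<^bsub>sym_group k\<^esub> y = y" if "y \<in> topspace ?Y" for y
      using omap_id[of "{1..k}" y] that by (simp add: sym_group_one)
  qed (use b H in auto)
  have "classifying_map P k E_map"
    unfolding classifying_map_def
    using E_map_simplex E_map_op E_map_act by blast
  then show ?thesis by blast
qed

section \<open>Orbits\<close>

lemma bij_betw_card_nat:
  fixes D :: "nat set"
  assumes "finite D"
  obtains \<beta> where "bij_betw \<beta> D {1..card D}"
  using finite_same_card_bij[of D "{1..card D}"] assms by auto

context operad
begin

lemma omap_closed: "\<lbrakk>finite D; inj_on \<sigma> D; c \<in> opts P D\<rbrakk> \<Longrightarrow> omap P D \<sigma> c \<in> opts P (\<sigma> ` D)"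
  using continuous_map_funspace[OF omap_continuous] by blast

lemma omap_bij_closed: "\<lbrakk>finite D; bij_betw \<beta> D E; c \<in> opts P D\<rbrakk> \<Longrightarrow> omap P D \<beta> c \<in> opts P E"
  using omap_closed[of D \<beta> c] by (simp add: bij_betw_def)

text \<open>A class consists of the images under all numberings of \<open>D\<close>, and relabelling
  \<open>D\<close> permutes the numberings. Thus operations indexed by sets of functions have
  well-defined values in the orbit spaces of \<open>{1..k}\<close>.\<close>

lemma orbit_class_omap:
  assumes D: "finite D" and \<sigma>: "inj_on \<sigma> D" and c: "c \<in> opts P D"
  shows "orbit_class P (\<sigma> ` D) (omap P D \<sigma> c) = orbit_class P D c"
proof (intro equalityI subsetI)
  have card: "card (\<sigma> ` D) = card D" by (rule card_image[OF \<sigma>])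
  fix z
  {
    assume "z \<in> orbit_class P (\<sigma> ` D) (omap P D \<sigma> c)"
    then obtain \<beta> where \<beta>: "bij_betw \<beta> (\<sigma> ` D) {1..card D}" "z = omap P (\<sigma> ` D) \<beta> (omap P D \<sigma> c)"
      unfolding orbit_class_def card by blast
    have "z = omap P D (\<beta> \<circ> \<sigma>) c"
      using omap_comp[OF D \<sigma> _ c, of \<beta>] \<beta> by (simp add: bij_betw_def)
    moreover have "bij_betw (\<beta> \<circ> \<sigma>) D {1..card D}"
      using bij_betw_trans[OF inj_on_imp_bij_betw[OF \<sigma>] \<beta>(1)] .
    ultimately show "z \<in> orbit_class P D c" unfolding orbit_class_def by blast
  next
    assume "z \<in> orbit_class P D c"
    then obtain \<beta> where \<beta>: "bij_betw \<beta> D {1..card D}" "z = omap P D \<beta> c"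
      unfolding orbit_class_def by blast
    define \<gamma> where "\<gamma> = \<beta> \<circ> inv_into D \<sigma>"
    have \<gamma>: "bij_betw \<gamma> (\<sigma> ` D) {1..card D}"
      unfolding \<gamma>_def by (rule bij_betw_trans[OF inj_on_imp_bij_betw[OF \<sigma>, THEN bij_betw_inv_into] \<beta>(1)])
    have "omap P (\<sigma> ` D) \<gamma> (omap P D \<sigma> c) = omap P D (\<gamma> \<circ> \<sigma>) c"
      using omap_comp[OF D \<sigma> _ c, of \<gamma>] \<gamma> by (simp add: bij_betw_def)
    also have "\<dots> = omap P D \<beta> c"
    proof (rule omap_cong[OF D _ _ c])
      have inv: "inv_into D \<sigma> (\<sigma> a) = a" if "a \<in> D" for a using \<sigma> that by simp
      then show "(\<gamma> \<circ> \<sigma>) a = \<beta> a" if "a \<in> D" for a using that by (simp add: \<gamma>_def)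
      show "inj_on (\<gamma> \<circ> \<sigma>) D"
        using \<sigma> \<gamma> by (auto simp: bij_betw_def intro: comp_inj_on)
    qed
    finally have "z = omap P (\<sigma> ` D) \<gamma> (omap P D \<sigma> c)" using \<beta>(2) by simp
    then show "z \<in> orbit_class P (\<sigma> ` D) (omap P D \<sigma> c)"
      using \<gamma> unfolding orbit_class_def card by blast
  }
qed

lemma some_orbit_class:
  assumes "finite D"
  obtains \<beta> where "bij_betw \<beta> D {1..card D}" "(SOME c'. c' \<in> orbit_class P D c) = omap P D \<beta> c"
proof -
  obtain \<beta> where "bij_betw \<beta> D {1..card D}" by (rule bij_betw_card_nat[OF assms])
  then have "omap P D \<beta> c \<in> orbit_class P D c" unfolding orbit_class_def by blast
  then have "(SOME c'. c' \<in> orbit_class P D c) \<in> orbit_class P D c" by (rule someI)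
  then show thesis using that unfolding orbit_class_def by blast
qed

lemma topspace_orbit_space: "topspace (orbit_space P k) = orbit_class P {1..k} ` opts P {1..k}"
  unfolding orbit_space_def by (rule topspace_quot_topology)

lemma continuous_map_orbit_class: "continuous_map (ospace P {1..k}) (orbit_space P k) (orbit_class P {1..k})"
  unfolding orbit_space_def by (rule continuous_map_quot_topology)

lemma orbit_class_self_omap:
  assumes "bij_betw \<beta> {1..k} {1..k}" "c \<in> opts P {1..k}"
  shows "orbit_class P {1..k} (omap P {1..k} \<beta> c) = orbit_class P {1..k} c"
  using orbit_class_omap[of "{1..k}" \<beta> c] assms by (simp add: bij_betw_def)

lemma open_map_orbit_class: "open_map (ospace P {1..k}) (orbit_space P k) (orbit_class P {1..k})"
  unfolding open_map_def orbit_space_def openin_quot_topology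
proof (intro allI impI conjI)
  let ?q = "orbit_class P {1..k}" and ?Y = "ospace P {1..k}"
  fix U assume U: "openin ?Y U"
  then have sub: "U \<subseteq> topspace ?Y" by (rule openin_subset)
  then show "?q ` U \<subseteq> ?q ` topspace ?Y" by (rule image_mono)
  \<comment> \<open>The saturation of \<open>U\<close> is the union of its preimages under the
    permutations, each of which acts continuously.\<close>
  have "{x \<in> topspace ?Y. ?q x \<in> ?q ` U} = (\<Union>\<beta>\<in>{\<beta>. bij_betw \<beta> {1..k} {1..k}}. {x \<in> topspace ?Y. omap P {1..k} \<beta> x \<in> U})"
  proof (intro equalityI subsetI)
    fix x assume "x \<in> {x \<in> topspace ?Y. ?q x \<in> ?q ` U}"
    then obtain u where x: "x \<in> topspace ?Y" and u: "u \<in> U" "?q x = ?q u" by auto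
    have "omap P {1..k} id u \<in> ?q u"
      unfolding orbit_class_def using bij_betw_id[of "{1..k}"] by auto
    then have "u \<in> ?q x" using u sub omap_id[of "{1..k}" u] by auto
    then obtain \<beta> where "bij_betw \<beta> {1..k} {1..k}" "u = omap P {1..k} \<beta> x"
      unfolding orbit_class_def by auto
    then show "x \<in> (\<Union>\<beta>\<in>{\<beta>. bij_betw \<beta> {1..k} {1..k}}. {x \<in> topspace ?Y. omap P {1..k} \<beta> x \<in> U})"
      using x u by auto
  next
    fix x assume "x \<in> (\<Union>\<beta>\<in>{\<beta>. bij_betw \<beta> {1..k} {1..k}}. {x \<in> topspace ?Y. omap P {1..k} \<beta> x \<in> U})"
    then obtain \<beta> where \<beta>: "bij_betw \<beta> {1..k} {1..k}" and x: "x \<in> topspace ?Y" "omap P {1..k} \<beta> x \<in> U" by auto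
    then show "x \<in> {x \<in> topspace ?Y. ?q x \<in> ?q ` U}"
      using orbit_class_self_omap[OF \<beta> x(1)] by (metis (mono_tags, lifting) imageI mem_Collect_eq)
  qed
  moreover have "openin ?Y {x \<in> topspace ?Y. omap P {1..k} \<beta> x \<in> U}" if "bij_betw \<beta> {1..k} {1..k}" for \<beta>
  proof (rule openin_continuous_map_preimage[OF _ U])
    show "continuous_map ?Y ?Y (omap P {1..k} \<beta>)"
      using omap_continuous[of "{1..k}" \<beta>] that by (simp add: bij_betw_def)
  qed
  ultimately show "openin ?Y {x \<in> topspace ?Y. ?q x \<in> ?q ` U}" by auto
qed

lemma k_refine_ospace: "finite D \<Longrightarrow> k_refine (ospace P D) = ospace P D"
  using CGWH_ospace by (simp add: CGWH_def)

end

text \<open>Each summand is open and closed, and a standard simplex is connected and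
  nonempty.\<close>

lemma singular_simplex_sum_topology:
  assumes "singular_simplex n (sum_topology X UNIV) f"
  obtains k g where "continuous_map (simplex_space n) (X k) g" "\<And>t. t \<in> standard_simplex n \<Longrightarrow> f t = (k, g t)"
proof -
  have f: "continuous_map (simplex_space n) (sum_topology X UNIV) f" using assms by (simp add: singular_simplex_def)
  obtain t0 where t0: "t0 \<in> standard_simplex n" using nonempty_standard_simplex by blast
  define k where "k = fst (f t0)"
  define S where "S = {t \<in> topspace (simplex_space n). f t \<in> Pair k ` topspace (X k)}"
  have "openin (simplex_space n) S"
    unfolding S_def using open_map_component_injection[of k UNIV X]
    by (intro openin_continuous_map_preimage[OF f]) (auto simp: open_map_def)
  moreover have "closedin (simplex_space n) S"
    unfolding S_def using closed_map_component_injection[of k UNIV X]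
    by (intro closedin_continuous_map_preimage[OF f]) (auto simp: closed_map_def)
  moreover have "connected_space (simplex_space n)"
    using connectedin_standard_simplex by (simp add: connectedin_def)
  moreover have ft: "f t \<in> Sigma UNIV (topspace \<circ> X)" if "t \<in> standard_simplex n" for t
    using continuous_map_funspace[OF f] that by auto
  then have t0S: "t0 \<in> S" using t0 ft[OF t0] by (cases "f t0") (auto simp: S_def k_def)
  ultimately have "S = {} \<or> S = topspace (simplex_space n)"
    unfolding connected_space_clopen_in by blast
  then have S: "S = standard_simplex n" using t0S by auto
  have eq: "f t = (k, snd (f t))" "snd (f t) \<in> topspace (X k)" if "t \<in> standard_simplex n" for t
  proof -
    have "t \<in> S" using that S by simp
    then show "f t = (k, snd (f t))" "snd (f t) \<in> topspace (X k)" by (auto simp: S_def)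
  qed
  have "continuous_map (simplex_space n) (X k) (snd \<circ> f)"
    unfolding continuous_map_def
  proof (intro conjI allI impI)
    show "snd \<circ> f \<in> topspace (simplex_space n) \<rightarrow> topspace (X k)" using eq(2) by auto
    fix V assume V: "openin (X k) V"
    then have "openin (simplex_space n) {t \<in> topspace (simplex_space n). f t \<in> Pair k ` V}"
      using open_map_component_injection[of k UNIV X]
      by (intro openin_continuous_map_preimage[OF f]) (auto simp: open_map_def)
    moreover have "f t \<in> Pair k ` V \<longleftrightarrow> snd (f t) \<in> V" if "t \<in> standard_simplex n" for t
      using eq(1)[OF that] by (cases "f t") auto
    ultimately show "openin (simplex_space n) {t \<in> topspace (simplex_space n). (snd \<circ> f) t \<in> V}"
      by (simp cong: conj_cong)
  qed
  then show thesis using that[of k "snd \<circ> f"] eq by simp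
qed

section \<open>The operations on simplices\<close>

definition action_map :: "(nat set \<Rightarrow> 'c \<Rightarrow> (nat \<Rightarrow> 'x) \<Rightarrow> 'x) \<Rightarrow> (nat \<times> 'c set) \<times> 'x \<Rightarrow> 'x" where
  "action_map \<theta> = (\<lambda>((k, c), y). \<theta> {1..k} (SOME c'. c' \<in> c) (\<lambda>i\<in>{1..k}. y))"

text \<open>Structure maps take points of \<open>'c \<times> (nat \<Rightarrow> 'x)\<close>, whose
  test spaces live on another type than those of \<open>'c \<times> 'x\<close>. Sending
  \<open>y\<close> to the constant function is injective and carries the encoding of pairs
  over.\<close>

definition encode_diagonal ::
  "('c + (nat \<Rightarrow> real)) set set \<times> ('x + (nat \<Rightarrow> real)) set set \<Rightarrow> ('c \<times> (nat \<Rightarrow> 'x) + (nat \<Rightarrow> real)) set set" where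
  "encode_diagonal = (`) ((`) (map_sum (map_prod id (\<lambda>y _. y)) id)) \<circ> encode_pair"

lemma inj_encode_diagonal: "inj encode_diagonal"
proof -
  have "inj (map_prod id (\<lambda>y _. y) :: 'a \<times> 'b \<Rightarrow> 'a \<times> (nat \<Rightarrow> 'b))"
    by (intro prod.inj_map) (auto simp: inj_def fun_eq_iff)
  then show ?thesis
    unfolding encode_diagonal_def by (intro inj_compose inj_encode_map inj_encode_pair)
qed

text \<open>The product of two test spaces is compact Hausdorff and embeds into the test type of the
  target, so a map from it that is continuous into the ordinary product is continuous into the
  k-product.\<close>

lemma continuous_map_test_diagonal:
  fixes L1 :: "'c test_topology" and L2 :: "'x test_topology" and Y :: "'c topology" and X :: "'x topology"
    and A :: "nat set"
  assumes L: "compact_space L1" "Hausdorff_space L1" "continuous_map L1 Y u1"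
    "compact_space L2" "Hausdorff_space L2" "continuous_map L2 X u2"
    and F: "continuous_map (kprod_family Y (\<lambda>_. X) A) W F"
  shows "continuous_map (prod_topology L1 L2) W (\<lambda>(l1, l2). F (u1 l1, \<lambda>i\<in>A. u2 l2))"
proof -
  let ?v = "\<lambda>z. (u1 (fst z), \<lambda>i\<in>A. u2 (snd z))"
  have "continuous_map (prod_topology L1 L2) Y (\<lambda>z. u1 (fst z))"
    using continuous_map_compose[OF continuous_map_fst L(3)] by (simp add: o_def)
  moreover have "continuous_map (prod_topology L1 L2) X (\<lambda>z. u2 (snd z))"
    using continuous_map_compose[OF continuous_map_snd L(6)] by (simp add: o_def)
  then have "continuous_map (prod_topology L1 L2) (product_topology (\<lambda>_. X) A) (\<lambda>z. \<lambda>i\<in>A. u2 (snd z))"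
    by (auto simp: continuous_map_componentwise)
  ultimately have "continuous_map (prod_topology L1 L2) (prod_topology Y (product_topology (\<lambda>_. X) A)) ?v"
    by (simp add: continuous_map_pairwise o_def)
  then have "continuous_map (prod_topology L1 L2) (kprod_family Y (\<lambda>_. X) A) ?v"
    unfolding kprod_family_def
    by (rule continuous_map_into_k_refine[where j = encode_diagonal, rotated 2])
       (use L inj_encode_diagonal in \<open>auto simp: compact_space_prod_topology Hausdorff_space_prod_topology intro: inj_on_subset\<close>)
  from continuous_map_compose[OF this F] show ?thesis
    by (simp add: o_def case_prod_beta')
qed

lemma transport_const: "transport A \<sigma> (\<lambda>i\<in>A. y) = (\<lambda>i\<in>\<sigma> ` A. y)"
  unfolding transport_def by (rule restrict_ext) (simp add: inv_into_into)

context operad_algebra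
begin

lemma act_const_omap:
  assumes "finite A" "inj_on \<sigma> A" "c \<in> opts P A" "y \<in> topspace X"
  shows "\<theta> (\<sigma> ` A) (omap P A \<sigma> c) (\<lambda>i\<in>\<sigma> ` A. y) = \<theta> A c (\<lambda>i\<in>A. y)"
  using act_natural[OF assms(1-3), of "\<lambda>i\<in>A. y"] assms(4) by (simp add: transport_const)

text \<open>Constant families are invariant under relabelling, so by naturality every representative
  of the orbit gives the same value, including the one that \<open>SOME\<close> selects.\<close>

lemma act_some_orbit:
  assumes "finite D" "c \<in> opts P D" "y \<in> topspace X"
  shows "\<theta> {1..card D} (SOME c'. c' \<in> orbit_class P D c) (\<lambda>i\<in>{1..card D}. y) = \<theta> D c (\<lambda>i\<in>D. y)"
proof -
  obtain \<beta> where \<beta>: "bij_betw \<beta> D {1..card D}" "(SOME c'. c' \<in> orbit_class P D c) = omap P D \<beta> c"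
    by (rule some_orbit_class[OF assms(1)])
  show ?thesis
    using act_const_omap[OF assms(1) _ assms(2,3), of \<beta>] \<beta> by (simp add: bij_betw_def)
qed

lemma action_map_preserving: "simplex_preserving (kprod (free_on_point P) X) X (action_map \<theta>)"
  unfolding simplex_preserving_def
proof (intro allI impI)
  fix n \<sigma> assume "singular_simplex n (kprod (free_on_point P) X) \<sigma>"
  then have \<sigma>: "continuous_map (simplex_space n) (free_on_point P) (fst \<circ> \<sigma>)"
    "continuous_map (simplex_space n) X (snd \<circ> \<sigma>)"
    by (simp_all add: singular_simplex_kprod)
  have "singular_simplex n (sum_topology (orbit_space P) UNIV) (restrict (fst \<circ> \<sigma>) (standard_simplex n))"
    using \<sigma>(1) by (auto simp: singular_simplex_def free_on_point_def intro: continuous_map_eq)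
  then obtain k g where g: "continuous_map (simplex_space n) (orbit_space P k) g"
    "\<And>t. t \<in> standard_simplex n \<Longrightarrow> restrict (fst \<circ> \<sigma>) (standard_simplex n) t = (k, g t)"
    by (rule singular_simplex_sum_topology) blast
  define f where "f z y = \<theta> {1..k} (SOME c'. c' \<in> z) (\<lambda>i\<in>{1..k}. y)" for z y
  have "continuous_map (simplex_space n) X (\<lambda>t. f (g t) ((snd \<circ> \<sigma>) t))"
  \<comment> \<open>The free algebra is a quotient by the symmetric group on the summand
    \<open>k\<close>, while \<open>X\<close> enters as its own quotient under the identity.\<close>
  proof (rule continuous_map_from_quotients[where ?q2.0 = id and ?Y2.0 = X and ?Z2.0 = X,
        OF k_refine_ospace open_map_orbit_class topspace_orbit_space[symmetric] _ _ _
        compact_simplex_space Hausdorff_simplex_space g(1) \<sigma>(2)])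
    show "finite {1..k}" by simp
    show "k_refine X = X" using CGWH_space by (simp add: CGWH_def)
    show "open_map X X id" by (simp add: open_map_def)
    fix L1 :: "'c test_topology" and u1 and L2 :: "'x test_topology" and u2
    assume L: "compact_space L1" "Hausdorff_space L1" "continuous_map L1 (ospace P {1..k}) u1"
      "compact_space L2" "Hausdorff_space L2" "continuous_map L2 X u2"
    have "continuous_map (prod_topology L1 L2) X (\<lambda>(l1, l2). (\<lambda>(c, x). \<theta> {1..k} c x) (u1 l1, \<lambda>i\<in>{1..k}. u2 l2))"
      by (rule continuous_map_test_diagonal[OF L act_continuous]) simp
    then show "continuous_map (prod_topology L1 L2) X (\<lambda>(l1, l2). f (orbit_class P {1..k} (u1 l1)) (id (u2 l2)))"
    proof (rule continuous_map_eq)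
      fix l assume "l \<in> topspace (prod_topology L1 L2)"
      then have "u1 (fst l) \<in> opts P {1..k}" "u2 (snd l) \<in> topspace X"
        using continuous_map_funspace[OF L(3)] continuous_map_funspace[OF L(6)] by auto
      then show "(\<lambda>(l1, l2). (\<lambda>(c, x). \<theta> {1..k} c x) (u1 l1, \<lambda>i\<in>{1..k}. u2 l2)) l
          = (\<lambda>(l1, l2). f (orbit_class P {1..k} (u1 l1)) (id (u2 l2))) l"
        using act_some_orbit[of "{1..k}" "u1 (fst l)" "u2 (snd l)"] by (simp add: f_def case_prod_beta')
    qed
  qed simp
  moreover have "action_map \<theta> (\<sigma> t) = f (g t) ((snd \<circ> \<sigma>) t)" if "t \<in> standard_simplex n" for t
    using g(2)[OF that] that by (cases "\<sigma> t") (auto simp: action_map_def f_def)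
  ultimately have "continuous_map (simplex_space n) X (simplex_map n (action_map \<theta>) \<sigma>)"
    by (rule_tac continuous_map_eq) (auto simp: simplex_map_def)
  then show "singular_simplex n X (simplex_map n (action_map \<theta>) \<sigma>)"
    by (simp add: singular_simplex_def simplex_map_def)
qed

end

section \<open>Relabelling products of index sets, and multiplication on the free algebra\<close>

lemma dprod_cong: "(\<And>a. a \<in> A \<Longrightarrow> B a = B' a) \<Longrightarrow> dprod A B = dprod A B'"
  unfolding dprod_def using PiE_cong[of A B B'] by simp

lemma finite_dprod: "\<lbrakk>finite A; \<And>a. a \<in> A \<Longrightarrow> finite (B a)\<rbrakk> \<Longrightarrow> finite (dprod A B)"
  unfolding dprod_def by (intro finite_imageI finite_PiE)

lemma inj_on_dprod_map:
  assumes A: "finite A" and \<sigma>: "inj_on \<sigma> A" and \<tau>: "\<And>a. a \<in> A \<Longrightarrow> inj_on (\<tau> a) (B a)"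
  shows "inj_on (dprod_map A \<sigma> \<tau>) (dprod A B)"
proof (rule inj_onI)
  fix y z assume y: "y \<in> dprod A B" and z: "z \<in> dprod A B" and eq: "dprod_map A \<sigma> \<tau> y = dprod_map A \<sigma> \<tau> z"
  obtain b where b: "b \<in> (\<Pi>\<^sub>E a\<in>A. B a)" "y = fun_code A b" using y by (auto simp: dprod_def)
  obtain b' where b': "b' \<in> (\<Pi>\<^sub>E a\<in>A. B a)" "z = fun_code A b'" using z by (auto simp: dprod_def)
  have "b a = b' a" if a: "a \<in> A" for a
  proof -
    have "fun_decode (dprod_map A \<sigma> \<tau> w) (\<sigma> a) = \<tau> a (fun_decode w a)" for w
      using fun_decode_code[of "\<sigma> ` A" "\<sigma> a" "transport A \<sigma> (\<lambda>a. \<tau> a (fun_decode w a))"] A a \<sigma>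
      by (simp add: dprod_map_def transport_def)
    then have "\<tau> a (fun_decode y a) = \<tau> a (fun_decode z a)" using eq by metis
    then have "\<tau> a (b a) = \<tau> a (b' a)" using fun_decode_code[OF A a] b b' by simp
    then show ?thesis using \<tau>[OF a] b b' a by (auto simp: inj_on_def PiE_def Pi_def)
  qed
  then have "b = b'" by (rule PiE_ext[OF b(1) b'(1)])
  then show "y = z" using b b' by simp
qed

lemma dprod_map_image:
  assumes A: "finite A" and \<sigma>: "inj_on \<sigma> A"
  shows "dprod_map A \<sigma> \<tau> ` dprod A B = dprod (\<sigma> ` A) (transport A \<sigma> (\<lambda>a. \<tau> a ` B a))"
proof (intro equalityI subsetI)
  fix w assume "w \<in> dprod_map A \<sigma> \<tau> ` dprod A B"
  then obtain b where b: "b \<in> (\<Pi>\<^sub>E a\<in>A. B a)" "w = dprod_map A \<sigma> \<tau> (fun_code A b)" by (auto simp: dprod_def)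
  have "w = fun_code (\<sigma> ` A) (transport A \<sigma> (\<lambda>a. \<tau> a (b a)))"
    unfolding b(2) dprod_map_def fun_code_def[of "\<sigma> ` A"]
    by (rule arg_cong[where f = set_encode], rule image_cong)
       (use \<sigma> in \<open>auto simp: transport_def fun_decode_code[OF A] inv_into_into\<close>)
  moreover have "transport A \<sigma> (\<lambda>a. \<tau> a (b a)) \<in> (\<Pi>\<^sub>E a\<in>\<sigma> ` A. transport A \<sigma> (\<lambda>a. \<tau> a ` B a) a)"
  proof (rule PiE_I)
    fix i assume "i \<in> \<sigma> ` A"
    then obtain a where "a \<in> A" "i = \<sigma> a" by blast
    then show "transport A \<sigma> (\<lambda>a. \<tau> a (b a)) i \<in> transport A \<sigma> (\<lambda>a. \<tau> a ` B a) i"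
      using PiE_mem[OF b(1)] \<sigma> by (simp add: transport_def)
  qed (simp add: transport_def)
  ultimately show "w \<in> dprod (\<sigma> ` A) (transport A \<sigma> (\<lambda>a. \<tau> a ` B a))" by (auto simp: dprod_def)
next
  fix w assume "w \<in> dprod (\<sigma> ` A) (transport A \<sigma> (\<lambda>a. \<tau> a ` B a))"
  then obtain e where e: "e \<in> (\<Pi>\<^sub>E a\<in>\<sigma> ` A. transport A \<sigma> (\<lambda>a. \<tau> a ` B a) a)" "w = fun_code (\<sigma> ` A) e"
    by (auto simp: dprod_def)
  have "\<forall>a\<in>A. \<exists>b\<in>B a. e (\<sigma> a) = \<tau> a b"
  proof
    fix a assume a: "a \<in> A"
    then have "e (\<sigma> a) \<in> transport A \<sigma> (\<lambda>a. \<tau> a ` B a) (\<sigma> a)" using PiE_mem[OF e(1)] by simp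
    also have "transport A \<sigma> (\<lambda>a. \<tau> a ` B a) (\<sigma> a) = \<tau> a ` B a" using a \<sigma> by (simp add: transport_def)
    finally show "\<exists>b\<in>B a. e (\<sigma> a) = \<tau> a b" by blast
  qed
  then obtain b where b: "\<And>a. a \<in> A \<Longrightarrow> b a \<in> B a \<and> e (\<sigma> a) = \<tau> a (b a)" by metis
  have "fun_code A (restrict b A) \<in> dprod A B" using b by (auto simp: dprod_def)
  moreover have "w = dprod_map A \<sigma> \<tau> (fun_code A (restrict b A))"
    unfolding e(2) dprod_map_def fun_code_def[of "\<sigma> ` A"]
    by (rule arg_cong[where f = set_encode], rule image_cong)
       (use \<sigma> b in \<open>auto simp: transport_def fun_decode_code[OF A]\<close>)
  ultimately show "w \<in> dprod_map A \<sigma> \<tau> ` dprod A B" by blast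
qed

context operad_pair
begin

lemma lam_closed:
  "\<lbrakk>finite A; \<And>a. a \<in> A \<Longrightarrow> finite (B a); g \<in> opts G A; c \<in> (\<Pi>\<^sub>E a\<in>A. opts C (B a))\<rbrakk> \<Longrightarrow> lam A B g c \<in> opts C (dprod A B)"
  using funcset_mem[OF continuous_map_funspace[OF lam_continuous[of A B]], of "(g, c)"]
  by (simp add: kprod_family_def)

text \<open>Other representatives of the two orbits arise by relabelling. By
  \<open>lam_natural\<close> this relabels the value along \<open>dprod_map\<close>, a permutation
  of the set of functions, and the orbit class absorbs it.\<close>

lemma mult_some_orbit:
  assumes g: "g \<in> opts G {1..k}" and c: "c \<in> opts C {1..j}"
  shows "free_on_point_mult C lam {1..k} (SOME g'. g' \<in> orbit_class G {1..k} g) (\<lambda>i\<in>{1..k}. (j, orbit_class C {1..j} c))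
    = (card (dprod {1..k} (\<lambda>_. {1..j})), orbit_class C (dprod {1..k} (\<lambda>_. {1..j})) (lam {1..k} (\<lambda>_. {1..j}) g (\<lambda>a\<in>{1..k}. c)))"
proof -
  let ?A = "{1..k}" and ?J = "{1..j}"
  let ?D = "dprod ?A (\<lambda>_. ?J)"
  obtain \<beta> where \<beta>: "bij_betw \<beta> ?A {1..card ?A}" "(SOME g'. g' \<in> orbit_class G ?A g) = omap G ?A \<beta> g"
    by (rule G.some_orbit_class[of ?A]) simp
  obtain \<gamma> where \<gamma>: "bij_betw \<gamma> ?J {1..card ?J}" "(SOME c'. c' \<in> orbit_class C ?J c) = omap C ?J \<gamma> c"
    by (rule C.some_orbit_class[of ?J]) simp
  have \<beta>': "inj_on \<beta> ?A" "\<beta> ` ?A = ?A" and \<gamma>': "inj_on \<gamma> ?J" "\<gamma> ` ?J = ?J"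
    using \<beta>(1) \<gamma>(1) by (auto simp: bij_betw_def)
  \<comment> \<open>The family that results from unfolding. Outside \<open>?A\<close> it is
    unspecified, because the restricted function is undefined there, and \<open>lam_cong\<close>
    passes to the constant family.\<close>
  define B where "B a = {1..fst ((\<lambda>i\<in>?A. (j, orbit_class C ?J c)) a)}" for a
  have B: "B a = ?J" if "a \<in> ?A" for a using that by (simp add: B_def)
  have g': "omap G ?A \<beta> g \<in> opts G ?A" using G.omap_closed[OF _ \<beta>'(1) g] \<beta>'(2) by simp
  have c': "omap C ?J \<gamma> c \<in> opts C ?J" using C.omap_closed[OF _ \<gamma>'(1) c] \<gamma>'(2) by simp
  have D: "dprod ?A B = ?D" by (rule dprod_cong) (rule B)
  have "lam ?A B (omap G ?A \<beta> g) (\<lambda>a\<in>?A. omap C ?J \<gamma> c) = lam ?A (\<lambda>_. ?J) (omap G ?A \<beta> g) (\<lambda>a\<in>?A. omap C ?J \<gamma> c)"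
    by (rule lam_cong) (use B g' c' in auto)
  also have "\<dots> = lam (\<beta> ` ?A) (transport ?A \<beta> (\<lambda>a. \<gamma> ` ?J)) (omap G ?A \<beta> g) (transport ?A \<beta> (\<lambda>a. omap C ?J \<gamma> ((\<lambda>a\<in>?A. c) a)))"
  proof -
    have t: "transport ?A \<beta> (\<lambda>a. omap C ?J \<gamma> ((\<lambda>a\<in>?A. c) a)) = (\<lambda>a\<in>?A. omap C ?J \<gamma> c)"
      unfolding transport_def \<beta>'(2)
    proof (rule restrict_ext)
      fix i assume i: "i \<in> ?A"
      have "inv_into ?A \<beta> i \<in> ?A" by (rule inv_into_into) (use i \<beta>'(2) in simp)
      then show "omap C ?J \<gamma> ((\<lambda>a\<in>?A. c) (inv_into ?A \<beta> i)) = omap C ?J \<gamma> c" by (simp only: restrict_apply')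
    qed
    have B': "?J = transport ?A \<beta> (\<lambda>a. \<gamma> ` ?J) a" if "a \<in> ?A" for a
      unfolding transport_def \<beta>'(2) \<gamma>'(2) using that by (simp only: restrict_apply')
    show ?thesis
      unfolding t \<beta>'(2) by (rule lam_cong) (use g' c' B' in auto)
  qed
  also have "\<dots> = omap C ?D (dprod_map ?A \<beta> (\<lambda>_. \<gamma>)) (lam ?A (\<lambda>_. ?J) g (\<lambda>a\<in>?A. c))"
    by (rule lam_natural) (use \<beta>' \<gamma>' g c in auto)
  finally have lam_eq: "lam ?A B (omap G ?A \<beta> g) (\<lambda>a\<in>?A. omap C ?J \<gamma> c)
      = omap C ?D (dprod_map ?A \<beta> (\<lambda>_. \<gamma>)) (lam ?A (\<lambda>_. ?J) g (\<lambda>a\<in>?A. c))" .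
  have inj: "inj_on (dprod_map ?A \<beta> (\<lambda>_. \<gamma>)) ?D"
    by (rule inj_on_dprod_map) (use \<beta>' \<gamma>' in auto)
  have img: "dprod_map ?A \<beta> (\<lambda>_. \<gamma>) ` ?D = ?D"
  proof -
    have "dprod_map ?A \<beta> (\<lambda>_. \<gamma>) ` ?D = dprod (\<beta> ` ?A) (transport ?A \<beta> (\<lambda>a. \<gamma> ` ?J))"
      by (rule dprod_map_image) (use \<beta>' in auto)
    also have "\<dots> = ?D" unfolding transport_def \<beta>'(2) \<gamma>'(2)
      by (rule dprod_cong) (simp only: restrict_apply')
    finally show ?thesis .
  qed
  have L: "lam ?A (\<lambda>_. ?J) g (\<lambda>a\<in>?A. c) \<in> opts C ?D"
    by (rule lam_closed) (use g c in auto)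
  have orb: "orbit_class C ?D (omap C ?D (dprod_map ?A \<beta> (\<lambda>_. \<gamma>)) (lam ?A (\<lambda>_. ?J) g (\<lambda>a\<in>?A. c)))
      = orbit_class C ?D (lam ?A (\<lambda>_. ?J) g (\<lambda>a\<in>?A. c))"
    using C.orbit_class_omap[OF _ inj L] img finite_dprod[of ?A "\<lambda>_. ?J"] by simp
  have some: "(\<lambda>a\<in>?A. SOME c'. c' \<in> snd ((\<lambda>i\<in>?A. (j, orbit_class C ?J c)) a)) = (\<lambda>a\<in>?A. omap C ?J \<gamma> c)"
    by (rule restrict_ext) (simp add: \<gamma>(2)[simplified])
  show ?thesis
    unfolding free_on_point_mult_def Let_def some B_def[symmetric] D \<beta>(2) lam_eq orb ..
qed

lemma mult_map_preserving:
  "simplex_preserving (kprod (free_on_point G) (free_on_point C)) (free_on_point C) (action_map (free_on_point_mult C lam))"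
  unfolding simplex_preserving_def
proof (intro allI impI)
  fix n \<sigma> assume "singular_simplex n (kprod (free_on_point G) (free_on_point C)) \<sigma>"
  then have \<sigma>: "continuous_map (simplex_space n) (free_on_point G) (fst \<circ> \<sigma>)"
    "continuous_map (simplex_space n) (free_on_point C) (snd \<circ> \<sigma>)"
    by (simp_all add: singular_simplex_kprod)
  have "singular_simplex n (sum_topology (orbit_space G) UNIV) (restrict (fst \<circ> \<sigma>) (standard_simplex n))"
    using \<sigma>(1) by (auto simp: singular_simplex_def free_on_point_def intro: continuous_map_eq)
  then obtain k g where g: "continuous_map (simplex_space n) (orbit_space G k) g"
    "\<And>t. t \<in> standard_simplex n \<Longrightarrow> restrict (fst \<circ> \<sigma>) (standard_simplex n) t = (k, g t)"
    by (rule singular_simplex_sum_topology) blast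
  have "singular_simplex n (sum_topology (orbit_space C) UNIV) (restrict (snd \<circ> \<sigma>) (standard_simplex n))"
    using \<sigma>(2) by (auto simp: singular_simplex_def free_on_point_def intro: continuous_map_eq)
  then obtain j h where h: "continuous_map (simplex_space n) (orbit_space C j) h"
    "\<And>t. t \<in> standard_simplex n \<Longrightarrow> restrict (snd \<circ> \<sigma>) (standard_simplex n) t = (j, h t)"
    by (rule singular_simplex_sum_topology) blast
  let ?A = "{1..k}" and ?J = "{1..j}"
  let ?D = "dprod ?A (\<lambda>_. ?J)"
  define f where "f z w = free_on_point_mult C lam ?A (SOME c'. c' \<in> z) (\<lambda>i\<in>?A. (j, w))" for z w
  have finD: "finite ?D" by (rule finite_dprod) auto
  \<comment> \<open>A fixed numbering of the set of functions writes the class of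
    \<open>\<lambda>\<close> as a composite of continuous maps through the orbit space of
    \<open>{1..card ?D}\<close>.\<close>
  obtain \<delta> where \<delta>: "bij_betw \<delta> ?D {1..card ?D}" by (rule bij_betw_card_nat[OF finD])
  have "continuous_map (simplex_space n) (free_on_point C) (\<lambda>t. f (g t) (h t))"
  proof (rule continuous_map_from_quotients[OF G.k_refine_ospace G.open_map_orbit_class G.topspace_orbit_space[symmetric]
        C.k_refine_ospace C.open_map_orbit_class C.topspace_orbit_space[symmetric]
        compact_simplex_space Hausdorff_simplex_space g(1) h(1)])
    fix L1 :: "'g test_topology" and u1 and L2 :: "'c test_topology" and u2
    assume L: "compact_space L1" "Hausdorff_space L1" "continuous_map L1 (ospace G ?A) u1"
      "compact_space L2" "Hausdorff_space L2" "continuous_map L2 (ospace C ?J) u2"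
    have lam: "continuous_map (prod_topology L1 L2) (ospace C ?D) (\<lambda>(l1, l2). (\<lambda>(g, c). lam ?A (\<lambda>_. ?J) g c) (u1 l1, \<lambda>i\<in>?A. u2 l2))"
      by (rule continuous_map_test_diagonal[OF L lam_continuous]) simp_all
    have om: "continuous_map (ospace C ?D) (ospace C {1..card ?D}) (omap C ?D \<delta>)"
      using C.omap_continuous[OF finD, of \<delta>] \<delta> by (simp add: bij_betw_def)
    have "continuous_map (orbit_space C (card ?D)) (free_on_point C) (Pair (card ?D))"
      unfolding free_on_point_def by (rule continuous_map_component_injection) simp
    from continuous_map_compose[OF continuous_map_compose[OF continuous_map_compose[OF lam om] C.continuous_map_orbit_class] this]
    show "continuous_map (prod_topology L1 L2) (free_on_point C) (\<lambda>(l1, l2). f (orbit_class G ?A (u1 l1)) (orbit_class C ?J (u2 l2)))"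
    proof (rule continuous_map_eq)
      fix l assume "l \<in> topspace (prod_topology L1 L2)"
      then have u: "u1 (fst l) \<in> opts G ?A" "u2 (snd l) \<in> opts C ?J"
        using continuous_map_funspace[OF L(3)] continuous_map_funspace[OF L(6)] by auto
      define y where "y = lam ?A (\<lambda>_. ?J) (u1 (fst l)) (\<lambda>i\<in>?A. u2 (snd l))"
      have y: "y \<in> opts C ?D"
        unfolding y_def by (rule lam_closed) (use u in auto)
      have "orbit_class C {1..card ?D} (omap C ?D \<delta> y) = orbit_class C ?D y"
        using C.orbit_class_omap[OF finD _ y, of \<delta>] \<delta> by (simp add: bij_betw_def)
      then show "(Pair (card ?D) \<circ> (orbit_class C {1..card ?D} \<circ> (omap C ?D \<delta> \<circ> (\<lambda>(l1, l2). (\<lambda>(g, c). lam ?A (\<lambda>_. ?J) g c) (u1 l1, \<lambda>i\<in>?A. u2 l2))))) l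
          = (\<lambda>(l1, l2). f (orbit_class G ?A (u1 l1)) (orbit_class C ?J (u2 l2))) l"
        using mult_some_orbit[OF u] by (simp only: f_def case_prod_beta' o_apply prod.sel y_def)
    qed
  qed simp_all
  moreover have "action_map (free_on_point_mult C lam) (\<sigma> t) = f (g t) (h t)" if "t \<in> standard_simplex n" for t
    using g(2)[OF that] h(2)[OF that] that by (cases "\<sigma> t") (auto simp: action_map_def f_def)
  ultimately have "continuous_map (simplex_space n) (free_on_point C) (simplex_map n (action_map (free_on_point_mult C lam)) \<sigma>)"
    by (rule_tac continuous_map_eq) (auto simp: simplex_map_def)
  then show "singular_simplex n (free_on_point C) (simplex_map n (action_map (free_on_point_mult C lam)) \<sigma>)"
    by (simp add: singular_simplex_def simplex_map_def)
qed

end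

section \<open>From the bar construction to singular chains\<close>

lemma simplicial_map_boundary:
  assumes S: "simplicial_set S sact sface sbd" and T: "simplicial_set T tact tface tbd"
    and closed: "\<And>n s. s \<in> S n \<Longrightarrow> h n s \<in> T n"
    and act: "\<And>n m \<alpha> s. \<lbrakk>s \<in> S n; mono_on {..m} \<alpha>; \<alpha> ` {..m} \<subseteq> {..n}\<rbrakk> \<Longrightarrow> h m (sact m \<alpha> s) = tact m \<alpha> (h n s)"
    and c: "Poly_Mapping.keys c \<subseteq> S n"
  shows "tbd n (frag_extend (\<lambda>s. frag_of (h n s)) c) = frag_extend (\<lambda>s. frag_of (h (n - 1) s)) (sbd n c)"
proof (cases "n = 0")
  case True
  then show ?thesis by (simp add: simplicial_set.bd_zero_dim[OF S] simplicial_set.bd_zero_dim[OF T])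
next
  case False
  then have n: "1 \<le> n" by simp
  have s: "tbd n (frag_of (h n s)) = frag_extend (\<lambda>s. frag_of (h (n - 1) s)) (sbd n (frag_of s))" if "s \<in> S n" for s
  proof -
    have "h (n - 1) (sface n i s) = tface n i (h n s)" if "i \<le> n" for i
      using simplicial_set.face_eq[OF S \<open>s \<in> S n\<close> n that] simplicial_set.face_eq[OF T closed[OF \<open>s \<in> S n\<close>] n that]
        act[OF \<open>s \<in> S n\<close> mono_on_skip skip_into[OF n], of i] by simp
    then show ?thesis
      unfolding simplicial_set.bd_frag_of[OF S n] simplicial_set.bd_frag_of[OF T n]
      by (subst frag_extend_sum) (auto simp: frag_extend_cmul intro!: sum.cong)
  qed
  have "tbd n (frag_extend (\<lambda>s. frag_of (h n s)) c) = frag_extend (\<lambda>s. tbd n (frag_of (h n s))) c"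
    by (rule simplicial_set.bd_extend[OF T])
  also have "\<dots> = frag_extend (\<lambda>s. frag_extend (\<lambda>s. frag_of (h (n - 1) s)) (sbd n (frag_of s))) c"
    by (rule frag_extend_eq) (use s c in auto)
  also have "\<dots> = frag_extend (\<lambda>s. frag_of (h (n - 1) s)) (frag_extend (\<lambda>s. sbd n (frag_of s)) c)"
    by (simp only: frag_extend_frag_extend)
  also have "frag_extend (\<lambda>s. sbd n (frag_of s)) c = sbd n c"
    using simplicial_set.bd_extend[OF S, of n frag_of c] by (simp add: frag_extend_ident)
  finally show ?thesis .
qed

lemma simplicial_map_cycles:
  assumes S: "simplicial_set S sact sface sbd" and T: "simplicial_set T tact tface tbd"
    and closed: "\<And>n s. s \<in> S n \<Longrightarrow> h n s \<in> T n"
    and act: "\<And>n m \<alpha> s. \<lbrakk>s \<in> S n; mono_on {..m} \<alpha>; \<alpha> ` {..m} \<subseteq> {..n}\<rbrakk> \<Longrightarrow> h m (sact m \<alpha> s) = tact m \<alpha> (h n s)"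
  shows simplicial_map_Z: "c \<in> mod_cycles p S sbd n \<Longrightarrow> frag_extend (\<lambda>s. frag_of (h n s)) c \<in> mod_cycles p T tbd n"
    and simplicial_map_B: "c \<in> mod_boundaries p S sbd n \<Longrightarrow> frag_extend (\<lambda>s. frag_of (h n s)) c \<in> mod_boundaries p T tbd n"
proof -
  let ?F = "\<lambda>n. frag_extend (\<lambda>s. frag_of (h n s))"
  have keys: "Poly_Mapping.keys (?F n c) \<subseteq> T n" if "Poly_Mapping.keys c \<subseteq> S n" for n c
    by (rule keys_extend_subset) (use that closed in auto)
  have bd: "tbd n (?F n c) = ?F (n - 1) (sbd n c)" if "Poly_Mapping.keys c \<subseteq> S n" for n c
    by (rule simplicial_map_boundary[OF S T _ _ that]) (fact closed, fact act)
  show "?F n c \<in> mod_cycles p T tbd n" if "c \<in> mod_cycles p S sbd n"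
    by (rule induced_Z[where F = ?F and S = S and bd = sbd]) (fact keys, fact frag_extend_cmul, fact bd, fact that)
  show "?F n c \<in> mod_boundaries p T tbd n" if "c \<in> mod_boundaries p S sbd n"
    by (rule induced_B[where F = ?F and S = S and bd = sbd])
      (fact keys, fact frag_extend_cmul, fact frag_extend_add, fact bd, fact that)
qed

definition orbit_simplex :: "'c operad_data \<Rightarrow> nat \<Rightarrow> nat \<Rightarrow> (nat \<Rightarrow> nat) list \<Rightarrow> (nat \<Rightarrow> real) \<Rightarrow> 'c set" where
  "orbit_simplex P k n gs = simplex_map n (orbit_class P {1..k})
     ((SOME f. classifying_map P k f) (partial_products (sym_group k) gs))"

definition free_simplex :: "'c operad_data \<Rightarrow> nat \<Rightarrow> nat \<Rightarrow> (nat \<Rightarrow> nat) list \<Rightarrow> (nat \<Rightarrow> real) \<Rightarrow> nat \<times> 'c set" where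
  "free_simplex P k n gs = simplex_map n (Pair k) (orbit_simplex P k n gs)"

definition free_chain :: "'c operad_data \<Rightarrow> nat \<Rightarrow> nat \<Rightarrow> ((nat \<Rightarrow> nat) list \<Rightarrow>\<^sub>0 int) \<Rightarrow> (nat \<times> 'c set) chain" where
  "free_chain P k n c = frag_extend (\<lambda>gs. frag_of (free_simplex P k n gs)) c"

lemma partial_products_seg: "partial_products G gs = map (seg G gs 0) [0..<Suc (length gs)]"
  unfolding partial_products_def seg_def by (simp del: upt_Suc)

text \<open>The identification in \<open>sym_class\<close> uses the map chosen by
  \<open>SOME\<close>; the assumption gives this choice its defining property for every
  \<open>k\<close>.\<close>

locale classified_operad = operad P for P :: "'c operad_data" +
  assumes classifying: "\<exists>f. classifying_map P k f"
begin

lemma orbit_simplex_closed: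
  assumes "gs \<in> bar_simplices (sym_group k) n"
  shows "singular_simplex n (orbit_space P k) (orbit_simplex P k n gs)"
    and "singular_simplex n (ospace P {1..k}) ((SOME f. classifying_map P k f) (partial_products (sym_group k) gs))"
proof -
  interpret group "sym_group k" by (rule sym_group_is_group)
  have gs: "length gs = n" "set gs \<subseteq> carrier (sym_group k)" using assms by (auto simp: bar_simplices_def)
  have pp: "length (partial_products (sym_group k) gs) = Suc n" "set (partial_products (sym_group k) gs) \<subseteq> carrier (sym_group k)"
    using seg_closed[OF gs(2)] gs(1) by (auto simp: partial_products_seg simp del: upt_Suc)
  show "singular_simplex n (ospace P {1..k}) ((SOME f. classifying_map P k f) (partial_products (sym_group k) gs))"
    using someI_ex[OF classifying[of k]] pp unfolding classifying_map_def by blast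
  then show "singular_simplex n (orbit_space P k) (orbit_simplex P k n gs)"
    unfolding orbit_simplex_def by (rule singular_simplex_simplex_map[OF _ continuous_map_orbit_class])
qed

text \<open>An operator may start at a vertex other than 0, whereas partial products always start at
  the unit. The two lists differ by left translation by the first partial product \<open>h\<close>;
  the classifying map is equivariant, and the orbit map removes the translation.\<close>

lemma orbit_simplex_act:
  assumes gs: "gs \<in> bar_simplices (sym_group k) n" and \<alpha>: "mono_on {..m} \<alpha>" "\<alpha> ` {..m} \<subseteq> {..n}"
  shows "orbit_simplex P k m (bar_act (sym_group k) m \<alpha> gs) = simplicial_op m \<alpha> (orbit_simplex P k n gs)"
proof -
  let ?G = "sym_group k" and ?q = "orbit_class P {1..k}"
  interpret group ?G by (rule sym_group_is_group)
  define f where "f = (SOME f. classifying_map P k f)"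
  have f: "classifying_map P k f" unfolding f_def by (rule someI_ex[OF classifying])
  have len: "length gs = n" and c: "set gs \<subseteq> carrier ?G" using gs by (auto simp: bar_simplices_def)
  define pp where "pp = partial_products ?G gs"
  define pb where "pb = partial_products ?G (bar_act ?G m \<alpha> gs)"
  define h where "h = seg ?G gs 0 (\<alpha> 0)"
  have h: "h \<in> carrier ?G" unfolding h_def by (rule seg_closed[OF c])
  have pp: "length pp = Suc n" "set pp \<subseteq> carrier ?G"
    using seg_closed[OF c] len by (auto simp: pp_def partial_products_seg simp del: upt_Suc)
  have ba: "bar_act ?G m \<alpha> gs \<in> bar_simplices ?G m" by (rule bar_act_closed[OF c])
  have pb: "length pb = Suc m" "set pb \<subseteq> carrier ?G"
    using seg_closed ba by (auto simp: pb_def partial_products_seg bar_simplices_def simp del: upt_Suc)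
  have "map (\<lambda>i. pp ! \<alpha> i) [0..<Suc m] = map (\<lambda>g. h \<otimes>\<^bsub>?G\<^esub> g) pb"
  proof (rule nth_equalityI)
    fix i assume "i < length (map (\<lambda>i. pp ! \<alpha> i) [0..<Suc m])"
    then have i: "i \<le> m" by simp
    have "\<alpha> i \<le> n" using \<alpha>(2) i by auto
    then have "pp ! \<alpha> i = seg ?G gs 0 (\<alpha> i)"
      using len by (simp add: pp_def partial_products_seg del: upt_Suc)
    moreover have "pb ! i = seg ?G gs (\<alpha> 0) (\<alpha> i)"
      using i seg_bar_act[OF c \<alpha>(1), of 0 i] ba
      by (simp add: pb_def partial_products_seg bar_simplices_def del: upt_Suc)
    moreover have "\<alpha> 0 \<le> \<alpha> i" using \<alpha>(1) i by (auto simp: mono_on_def)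
    ultimately show "map (\<lambda>i. pp ! \<alpha> i) [0..<Suc m] ! i = map (\<lambda>g. h \<otimes>\<^bsub>?G\<^esub> g) pb ! i"
      using seg_mult[OF c, of 0 "\<alpha> 0" "\<alpha> i"] i pb(1) by (simp add: h_def del: upt_Suc)
  qed (simp add: pb)
  moreover have "f (map (\<lambda>i. pp ! \<alpha> i) [0..<Suc m]) = simplicial_op m \<alpha> (f pp)"
    using f pp \<alpha> unfolding classifying_map_def by blast
  moreover have "f (map (\<lambda>g. h \<otimes>\<^bsub>?G\<^esub> g) pb) = simplex_map m (omap P {1..k} h) (f pb)"
    using f pb h unfolding classifying_map_def by blast
  ultimately have eq: "simplicial_op m \<alpha> (f pp) = simplex_map m (omap P {1..k} h) (f pb)" by simp
  have "bij_betw h {1..k} {1..k}" using h by (simp add: sym_group_carrier permutes_imp_bij)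
  then have q: "(?q \<circ> omap P {1..k} h) y = ?q y" if "y \<in> opts P {1..k}" for y
    using orbit_class_self_omap that by simp
  have fpb: "singular_simplex m (ospace P {1..k}) (f pb)"
    using orbit_simplex_closed(2)[OF ba] by (simp add: f_def pb_def)
  have "simplicial_op m \<alpha> (simplex_map n ?q (f pp)) = simplex_map m ?q (simplicial_op m \<alpha> (f pp))"
    by (rule simplicial_op_simplex_map[OF \<alpha>(2)])
  also have "\<dots> = simplex_map m (?q \<circ> omap P {1..k} h) (f pb)"
    unfolding eq by (simp add: simplex_map_compose)
  also have "\<dots> = simplex_map m ?q (f pb)"
    by (rule simplex_map_eq[OF fpb q])
  finally show ?thesis
    by (simp add: orbit_simplex_def f_def pp_def pb_def)
qed

lemma continuous_map_Pair: "continuous_map (orbit_space P k) (free_on_point P) (Pair k)"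
  unfolding free_on_point_def by (rule continuous_map_component_injection) simp

lemma free_simplex_closed:
  "gs \<in> bar_simplices (sym_group k) n \<Longrightarrow> free_simplex P k n gs \<in> singular_simplex_set n (free_on_point P)"
  unfolding free_simplex_def
  using singular_simplex_simplex_map[OF orbit_simplex_closed(1) continuous_map_Pair] by simp

lemma free_simplex_act:
  assumes "gs \<in> bar_simplices (sym_group k) n" "mono_on {..m} \<alpha>" "\<alpha> ` {..m} \<subseteq> {..n}"
  shows "free_simplex P k m (bar_act (sym_group k) m \<alpha> gs) = simplicial_op m \<alpha> (free_simplex P k n gs)"
  unfolding free_simplex_def orbit_simplex_act[OF assms] simplicial_op_simplex_map[OF assms(3)] ..

lemma free_chain_Z: "c \<in> bar_cycles p n (sym_group k) \<Longrightarrow> free_chain P k n c \<in> sing_cycles p n (free_on_point P)"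
  unfolding free_chain_def
  by (rule simplicial_map_Z[where h = "free_simplex P k", OF group.simplicial_set_bar[OF sym_group_is_group[of k]] simplicial_set_singular])
     (simp_all add: free_simplex_closed[simplified] free_simplex_act)

lemma sym_class_eq:
  assumes p: "0 < p"
  shows "sing_induced p n (free_on_point P) (Pair k) (sym_class p n P k (bar_cls p n (sym_group k) c))
       = sing_cls p n (free_on_point P) (free_chain P k n c)"
proof -
  let ?F = "frag_extend (\<lambda>gs. frag_of (orbit_simplex P k n gs))"
  have "sym_class p n P k (bar_cls p n (sym_group k) c) = sing_cls p n (orbit_space P k) (?F c)"
    unfolding sym_class_def Let_def orbit_simplex_def[symmetric]
  proof (rule induced_cls[OF chain_complex_bar[OF sym_group_is_group p] chain_complex_singular[OF p]])
    show "?F c' \<in> sing_boundaries p n (orbit_space P k)" if c': "c' \<in> bar_boundaries p n (sym_group k)" for c'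
    proof (rule simplicial_map_B[where h = "orbit_simplex P k", OF group.simplicial_set_bar[OF sym_group_is_group] simplicial_set_singular _ _ c'])
      show "orbit_simplex P k n gs \<in> singular_simplex_set n (orbit_space P k)" if "gs \<in> bar_simplices (sym_group k) n" for n gs
        using orbit_simplex_closed(1)[OF that] by simp
    qed (rule orbit_simplex_act)
  qed (rule frag_extend_add)
  moreover have "simplex_preserving (orbit_space P k) (free_on_point P) (Pair k)"
    unfolding simplex_preserving_def by (intro allI impI singular_simplex_simplex_map[OF _ continuous_map_Pair])
  moreover have "chain_map n (Pair k) (?F c) = free_chain P k n c"
    by (simp add: chain_map_def free_chain_def free_simplex_def frag_extend_frag_extend)
  ultimately show ?thesis using sing_induced_cls[OF p, of "orbit_space P k" "free_on_point P" "Pair k"] by simp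
qed

lemma free_chain_0 [simp]: "free_chain P k n 0 = 0"
  by (simp add: free_chain_def)

text \<open>The index set \<open>K\<close> may exceed the support, so that several classes can be
  expanded over one common finite set.\<close>

lemma point_class_eq:
  assumes p: "0 < p" and K: "finite K"
    and \<rho>: "\<And>k. \<rho> k \<in> bar_cycles p n (sym_group k)" "\<And>k. k \<notin> K \<Longrightarrow> \<rho> k = 0"
    and r: "\<And>k. r k = bar_cls p n (sym_group k) (\<rho> k)"
  shows "point_class p n P r = sing_cls p n (free_on_point P) (\<Sum>k\<in>K. free_chain P k n (\<rho> k))"
proof -
  interpret X: chain_complex "\<lambda>n. singular_simplex_set n (free_on_point P)" chain_boundary p
    by (rule chain_complex_singular[OF p])
  let ?c = "\<lambda>k. X.cls n (free_chain P k n (\<rho> k))"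
  have cl: "?c \<in> A \<rightarrow> carrier (X.H n)" for A
    using X.cls_closed[OF free_chain_Z[OF \<rho>(1)]] by auto
  have "point_class p n P r = gfinprod (X.H n) ?c UNIV"
    unfolding point_class_def r sym_class_eq[OF p] ..
  also have "\<dots> = gfinprod (X.H n) ?c K"
    by (rule X.H.gfinprod_mono_neutral_cong_right[OF _ _ _ cl]) (use \<rho>(2) in \<open>auto simp: X.one_H\<close>)
  also have "\<dots> = finprod (X.H n) ?c K"
    by (rule X.H.gfinprod_eq_finprod[OF K cl])
  also have "\<dots> = X.cls n (\<Sum>k\<in>K. free_chain P k n (\<rho> k))"
    by (rule X.finprod_H[OF K free_chain_Z[OF \<rho>(1)]])
  finally show ?thesis .
qed

end

text \<open>Trivial classes are represented by the chain 0, which makes the family of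
  representatives finitely supported as well.\<close>

lemma sym_homology_representatives:
  assumes p: "0 < p" and r: "r \<in> sym_homology p d"
  obtains \<rho> where "\<And>k. \<rho> k \<in> bar_cycles p d (sym_group k)" "\<And>k. r k = bar_cls p d (sym_group k) (\<rho> k)"
    "finite {k. \<rho> k \<noteq> 0}"
proof -
  have "\<exists>c. c \<in> bar_cycles p d (sym_group k) \<and> r k = bar_cls p d (sym_group k) c
        \<and> (r k = \<one>\<^bsub>group_homology p d (sym_group k)\<^esub> \<longrightarrow> c = 0)" for k
  proof -
    interpret G: chain_complex "bar_simplices (sym_group k)" "bar_boundary (sym_group k)" p
      by (rule chain_complex_bar[OF sym_group_is_group p])
    have "r k \<in> carrier (G.H d)" using r by (simp add: sym_homology_def)
    then obtain c where "c \<in> G.Z d" "r k = G.cls d c" unfolding G.carrier_H by blast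
    then show ?thesis
      using G.one_H[of d] G.Z_0[of d] by (cases "r k = \<one>\<^bsub>G.H d\<^esub>") auto
  qed
  then obtain \<rho> where \<rho>: "\<And>k. \<rho> k \<in> bar_cycles p d (sym_group k)" "\<And>k. r k = bar_cls p d (sym_group k) (\<rho> k)"
    "\<And>k. r k = \<one>\<^bsub>group_homology p d (sym_group k)\<^esub> \<Longrightarrow> \<rho> k = 0" by metis
  have "finite {k. r k \<noteq> \<one>\<^bsub>group_homology p d (sym_group k)\<^esub>}" using r by (simp add: sym_homology_def)
  then have "finite {k. \<rho> k \<noteq> 0}" by (rule rev_finite_subset) (use \<rho>(3) in blast)
  with \<rho> show thesis using that by blast
qed

lemma E_infinity_classified:
  assumes "E_infinity_operad TYPE('y) P"
  shows "classified_operad P"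
  using assms classifying_map_exists[of P]
  by (auto simp: E_infinity_operad_def classified_operad_def classified_operad_axioms_def)

section \<open>The coproduct and the diagonal\<close>

definition diagonal_chain :: "('g list \<Rightarrow>\<^sub>0 int) \<Rightarrow> (('g \<times> 'g) list \<Rightarrow>\<^sub>0 int)" where
  "diagonal_chain c = frag_extend (\<lambda>gs. frag_of (map (\<lambda>g. (g, g)) gs)) c"

lemma map_diagonal: "map (\<lambda>g. (g, g)) gs = zip gs gs"
  by (induction gs) auto

lemma diagonal_simplicial:
  assumes G: "group G"
  shows "gs \<in> bar_simplices G n \<Longrightarrow> map (\<lambda>g. (g, g)) gs \<in> bar_simplices (G \<times>\<times> G) n"
    and "\<lbrakk>gs \<in> bar_simplices G n; mono_on {..m} \<alpha>; \<alpha> ` {..m} \<subseteq> {..n}\<rbrakk>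
      \<Longrightarrow> map (\<lambda>g. (g, g)) (bar_act G m \<alpha> gs) = bar_act (G \<times>\<times> G) m \<alpha> (map (\<lambda>g. (g, g)) gs)"
  unfolding map_diagonal
  using simplicial_product.pair_closed[OF simplicial_product_bar[OF G G]]
    simplicial_product.act_pair[OF simplicial_product_bar[OF G G]] by auto

lemma group_induced_diagonal:
  assumes G: "group G" and p: "0 < p"
  shows "group_induced p n (G \<times>\<times> G) (\<lambda>g. (g, g)) (bar_cls p n G c) = bar_cls p n (G \<times>\<times> G) (diagonal_chain c)"
  unfolding group_induced_def diagonal_chain_def[symmetric]
proof (rule induced_cls[OF chain_complex_bar[OF G p] chain_complex_bar[OF DirProd_group[OF G G] p]])
  show "diagonal_chain c' \<in> bar_boundaries p n (G \<times>\<times> G)" if "c' \<in> bar_boundaries p n G" for c'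
    unfolding diagonal_chain_def
    by (rule simplicial_map_B[where h = "\<lambda>n. map (\<lambda>g. (g, g))", OF group.simplicial_set_bar[OF G] group.simplicial_set_bar[OF DirProd_group[OF G G]]
          _ _ that]) (fact diagonal_simplicial(1)[OF G], fact diagonal_simplicial(2)[OF G])
qed (simp add: diagonal_chain_def frag_extend_add)

section \<open>Bar chains of a product of symmetric groups as singular chains\<close>

context classified_operad
begin

text \<open>Built from the chosen classifying maps of the two factors instead of one for the product
  group. In this way cross products and the diagonal are respected as chains.\<close>

definition pair_simplex :: "nat \<Rightarrow> nat \<Rightarrow> nat \<Rightarrow> ((nat \<Rightarrow> nat) \<times> (nat \<Rightarrow> nat)) list \<Rightarrow> (nat \<Rightarrow> real) \<Rightarrow> (nat \<times> 'c set) \<times> (nat \<times> 'c set)" where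
  "pair_simplex k l n zs = simplex_pair n (free_simplex P k n (map fst zs)) (free_simplex P l n (map snd zs))"

definition pair_chain :: "nat \<Rightarrow> nat \<Rightarrow> nat \<Rightarrow> (((nat \<Rightarrow> nat) \<times> (nat \<Rightarrow> nat)) list \<Rightarrow>\<^sub>0 int) \<Rightarrow> ((nat \<times> 'c set) \<times> (nat \<times> 'c set)) chain" where
  "pair_chain k l n c = frag_extend (\<lambda>zs. frag_of (pair_simplex k l n zs)) c"

lemma map_fst_snd_bar:
  assumes "zs \<in> bar_simplices (G \<times>\<times> H) n"
  shows "map fst zs \<in> bar_simplices G n" "map snd zs \<in> bar_simplices H n"
  using assms by (auto simp: bar_simplices_def)

lemma pair_chain_B:
  assumes "c \<in> bar_boundaries p n (sym_group k \<times>\<times> sym_group l)"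
  shows "pair_chain k l n c \<in> sing_boundaries p n (kprod (free_on_point P) (free_on_point P))"
  unfolding pair_chain_def
proof (rule simplicial_map_B[where h = "pair_simplex k l", OF group.simplicial_set_bar[OF DirProd_group[OF sym_group_is_group sym_group_is_group]]
      simplicial_set_singular _ _ assms])
  let ?G = "sym_group k" and ?H = "sym_group l"
  fix n zs assume zs: "zs \<in> bar_simplices (?G \<times>\<times> ?H) n"
  note fs = map_fst_snd_bar[OF zs]
  show "pair_simplex k l n zs \<in> singular_simplex_set n (kprod (free_on_point P) (free_on_point P))"
    unfolding pair_simplex_def using singular_simplex_pair free_simplex_closed[OF fs(1)] free_simplex_closed[OF fs(2)] by simp
  fix m :: nat and \<alpha> assume \<alpha>: "mono_on {..m} \<alpha>" "\<alpha> ` {..m} \<subseteq> {..n}"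
  have "zs = zip (map fst zs) (map snd zs)" by (simp add: zip_map_fst_snd)
  then have "bar_act (?G \<times>\<times> ?H) m \<alpha> zs = zip (bar_act ?G m \<alpha> (map fst zs)) (bar_act ?H m \<alpha> (map snd zs))"
    using simplicial_product.act_pair[OF simplicial_product_bar[OF sym_group_is_group sym_group_is_group] fs \<alpha>] by simp
  moreover have "length (bar_act ?G m \<alpha> (map fst zs)) = length (bar_act ?H m \<alpha> (map snd zs))" by (simp add: bar_act_def)
  ultimately have "pair_simplex k l m (bar_act (?G \<times>\<times> ?H) m \<alpha> zs)
     = simplex_pair m (free_simplex P k m (bar_act ?G m \<alpha> (map fst zs))) (free_simplex P l m (bar_act ?H m \<alpha> (map snd zs)))"
    by (simp add: pair_simplex_def)
  also have "\<dots> = simplex_pair m (simplicial_op m \<alpha> (free_simplex P k n (map fst zs))) (simplicial_op m \<alpha> (free_simplex P l n (map snd zs)))"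
    using free_simplex_act[OF fs(1) \<alpha>] free_simplex_act[OF fs(2) \<alpha>] by simp
  also have "\<dots> = simplicial_op m \<alpha> (pair_simplex k l n zs)"
    unfolding pair_simplex_def
    by (rule simplicial_product.act_pair[OF simplicial_product_singular free_simplex_closed[OF fs(1)] free_simplex_closed[OF fs(2)] \<alpha>, symmetric])
  finally show "pair_simplex k l m (bar_act (?G \<times>\<times> ?H) m \<alpha> zs) = simplicial_op m \<alpha> (pair_simplex k l n zs)" .
qed

text \<open>Both products run over the same shuffles with the same signs, and
  \<open>free_simplex\<close> commutes with the degeneracies of each shuffle.\<close>

lemma pair_chain_cross:
  assumes c: "Poly_Mapping.keys c \<subseteq> bar_simplices (sym_group k) m" and d: "Poly_Mapping.keys d \<subseteq> bar_simplices (sym_group l) n"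
  shows "pair_chain k l (m + n) (bar_cross_chain (sym_group k) (sym_group l) m n c d)
       = sing_cross_chain m n (free_chain P k m c) (free_chain P l n d)"
proof -
  let ?G = "sym_group k" and ?H = "sym_group l"
  have simplex: "frag_extend (\<lambda>zs. frag_of (pair_simplex k l (m + n) zs)) (shuffle_sum m n (bar_cross_simplex ?G ?H (m + n) gs hs))
     = shuffle_sum m n (sing_cross_simplex (m + n) (free_simplex P k m gs) (free_simplex P l n hs))"
    if gs: "gs \<in> bar_simplices ?G m" and hs: "hs \<in> bar_simplices ?H n" for gs hs
    unfolding frag_extend_shuffle_sum
  proof (rule shuffle_sum_cong)
    fix \<mu> assume \<mu>: "\<mu> \<subseteq> {..<m + n}" "card \<mu> = m"
    have s: "steps \<mu> ` {..m + n} \<subseteq> {..m}" "steps (- \<mu>) ` {..m + n} \<subseteq> {..n}"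
      using steps_le[OF \<mu>] steps_Compl_le[OF \<mu>] by auto
    have mono: "mono_on {..m + n} (steps M)" for M by (auto simp: mono_on_def steps_mono)
    have "bar_cross_simplex ?G ?H (m + n) gs hs \<mu> = zip (bar_act ?G (m + n) (steps \<mu>) gs) (bar_act ?H (m + n) (steps (- \<mu>)) hs)"
      by (rule bar_cross_simplex_eq[OF sym_group_is_group sym_group_is_group gs hs \<mu>])
    moreover have "length (bar_act ?G (m + n) (steps \<mu>) gs) = length (bar_act ?H (m + n) (steps (- \<mu>)) hs)"
      by (simp add: bar_act_def)
    ultimately show "(pair_simplex k l (m + n) \<circ> bar_cross_simplex ?G ?H (m + n) gs hs) \<mu>
        = sing_cross_simplex (m + n) (free_simplex P k m gs) (free_simplex P l n hs) \<mu>"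
      using free_simplex_act[OF gs mono s(1)] free_simplex_act[OF hs mono s(2)]
      by (simp add: pair_simplex_def sing_cross_simplex_def simplex_pair_def)
  qed
  have "pair_chain k l (m + n) (bar_cross_chain ?G ?H m n c d)
     = frag_extend (\<lambda>gs. frag_extend (\<lambda>hs. frag_extend (\<lambda>zs. frag_of (pair_simplex k l (m + n) zs))
          (shuffle_sum m n (bar_cross_simplex ?G ?H (m + n) gs hs))) d) c"
    unfolding pair_chain_def bar_cross_chain_def frag_extend_frag_extend ..
  also have "\<dots> = frag_extend (\<lambda>gs. frag_extend (\<lambda>hs.
      shuffle_sum m n (sing_cross_simplex (m + n) (free_simplex P k m gs) (free_simplex P l n hs))) d) c"
    by (intro frag_extend_eq simplex) (use c d in auto)
  also have "\<dots> = sing_cross_chain m n (free_chain P k m c) (free_chain P l n d)"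
    unfolding sing_cross_chain_def free_chain_def frag_extend_frag_extend frag_extend_of ..
  finally show ?thesis .
qed

lemma pair_chain_diagonal:
  "pair_chain k k n (diagonal_chain c) = chain_map n (\<lambda>z. (z, z)) (free_chain P k n c)"
proof -
  have "pair_simplex k k n (map (\<lambda>g. (g, g)) gs) = simplex_map n (\<lambda>z. (z, z)) (free_simplex P k n gs)" for gs
    unfolding pair_simplex_def simplex_pair_def simplex_map_def by (rule restrict_ext) (simp add: o_def)
  then show ?thesis
    unfolding pair_chain_def diagonal_chain_def chain_map_def free_chain_def frag_extend_frag_extend
    by (simp only: frag_extend_of o_apply)
qed

lemma pair_chain_diff: "pair_chain k l n (a - b) = pair_chain k l n a - pair_chain k l n b"
  by (simp add: pair_chain_def frag_extend_diff)

lemma pair_chain_sum: "finite I \<Longrightarrow> pair_chain k l n (\<Sum>i\<in>I. c i) = (\<Sum>i\<in>I. pair_chain k l n (c i))"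
  by (simp add: pair_chain_def frag_extend_sum o_def)

end

section \<open>The operations on chains\<close>

text \<open>The representative is taken to be the one that \<open>SOME\<close> selects, so that the
  operations can be evaluated at it directly.\<close>

lemma (in operad) free_on_point_cases:
  assumes "z \<in> topspace (free_on_point P)"
  obtains k c where "z = (k, orbit_class P {1..k} c)" "c \<in> opts P {1..k}" "(SOME c'. c' \<in> orbit_class P {1..k} c) = c"
proof -
  obtain k b where b: "z = (k, orbit_class P {1..k} b)" "b \<in> opts P {1..k}"
    using assms by (auto simp: free_on_point_def topspace_orbit_space)
  obtain \<beta> where \<beta>: "bij_betw \<beta> {1..k} {1..card {1..k}}" "(SOME c'. c' \<in> orbit_class P {1..k} b) = omap P {1..k} \<beta> b"
    by (rule some_orbit_class[of "{1..k}"]) simp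
  have \<beta>': "bij_betw \<beta> {1..k} {1..k}" using \<beta>(1) by simp
  have "orbit_class P {1..k} (omap P {1..k} \<beta> b) = orbit_class P {1..k} b"
    by (rule orbit_class_self_omap[OF \<beta>' b(2)])
  then show thesis
    using that[of k "omap P {1..k} \<beta> b"] b(1) \<beta>(2) omap_bij_closed[OF _ \<beta>' b(2)] by simp
qed

lemma (in operad_algebra) action_closed:
  assumes "finite A" "c \<in> opts P A" "y \<in> topspace X"
  shows "\<theta> A c (\<lambda>i\<in>A. y) \<in> topspace X"
  using funcset_mem[OF continuous_map_funspace[OF act_continuous[OF assms(1)]], of "(c, \<lambda>i\<in>A. y)"] assms
  by (simp add: kprod_family_def)

lemma ring_space_actions:
  assumes pair: "operad_pair C G lam" and ring: "E_infinity_ring_space C G lam X \<theta> \<xi>"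
    and u: "u \<in> topspace (free_on_point G)" and v: "v \<in> topspace (free_on_point C)" and y: "y \<in> topspace X"
  shows "action_map \<xi> (u, action_map \<theta> (v, y))
       = action_map \<theta> (action_map (free_on_point_mult C lam) (u, v), action_map \<xi> (u, y))"
proof -
  interpret pair: operad_pair C G lam by fact
  interpret \<theta>: operad_algebra C X \<theta> using ring by (simp add: E_infinity_ring_space_def)
  interpret \<xi>: operad_algebra G X \<xi> using ring by (simp add: E_infinity_ring_space_def)
  obtain k g where g: "u = (k, orbit_class G {1..k} g)" "g \<in> opts G {1..k}" "(SOME g'. g' \<in> orbit_class G {1..k} g) = g"
    by (rule pair.G.free_on_point_cases[OF u])
  obtain j c where c: "v = (j, orbit_class C {1..j} c)" "c \<in> opts C {1..j}" "(SOME c'. c' \<in> orbit_class C {1..j} c) = c"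
    by (rule pair.C.free_on_point_cases[OF v])
  let ?A = "{1..k}" and ?J = "{1..j}"
  let ?D = "dprod ?A (\<lambda>_. ?J)" and ?w = "\<xi> ?A g (\<lambda>i\<in>?A. y)" and ?l = "lam ?A (\<lambda>_. ?J) g (\<lambda>a\<in>?A. c)"
  have w: "?w \<in> topspace X" by (rule \<xi>.action_closed[OF _ g(2) y]) simp
  have D: "finite ?D" by (rule finite_dprod) auto
  have l: "?l \<in> opts C ?D" by (rule pair.lam_closed) (use g c in auto)
  have m: "action_map (free_on_point_mult C lam) (u, v) = (card ?D, orbit_class C ?D ?l)"
    using pair.mult_some_orbit[OF g(2) c(2)] by (simp only: action_map_def g(1) c(1) prod.case)
  have "action_map \<xi> (u, action_map \<theta> (v, y)) = \<xi> ?A g (\<lambda>a\<in>?A. \<theta> ?J c (\<lambda>b\<in>?J. y))"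
    by (simp only: action_map_def g(1,3) c(1,3) prod.case)
  also have "\<dots> = \<theta> ?D ?l (\<lambda>z\<in>?D. ?w)"
    using ring[unfolded E_infinity_ring_space_def, THEN conjunct2, THEN conjunct2, rule_format,
        of ?A "\<lambda>_. ?J" g "\<lambda>_. c" "\<lambda>_ _. y"] g(2) c(2) y by simp
  \<comment> \<open>The distributivity law yields an action indexed by the set of functions; passing
    to the orbit class numbers this set.\<close>
  also have "\<dots> = \<theta> {1..card ?D} (SOME c'. c' \<in> orbit_class C ?D ?l) (\<lambda>i\<in>{1..card ?D}. ?w)"
    by (rule \<theta>.act_some_orbit[OF D l w, symmetric])
  also have "\<dots> = action_map \<theta> (action_map (free_on_point_mult C lam) (u, v), action_map \<xi> (u, y))"
    unfolding m by (simp only: action_map_def g(1,3) prod.case)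
  finally show ?thesis .
qed

lemma class_op_cls:
  assumes p: "0 < p" and F: "simplex_preserving (kprod (free_on_point P) X) X (action_map \<theta>)"
    and a: "a \<in> sing_cycles p d (free_on_point P)" and c: "c \<in> sing_cycles p n X"
  shows "class_op p P X \<theta> d n (sing_cls p d (free_on_point P) a) (sing_cls p n X c)
       = sing_cls p (d + n) X (chain_map (d + n) (action_map \<theta>) (sing_cross_chain d n a c))"
    and "chain_map (d + n) (action_map \<theta>) (sing_cross_chain d n a c) \<in> sing_cycles p (d + n) X"
  unfolding class_op_def action_map_def[symmetric]
  using sing_cross_cls[OF p a c] sing_induced_cls[OF p F] chain_map_Z[OF F sing_cross_Z[OF p a c]] by simp_all

lemma sing_cross_chain_sum_left:
  "finite K \<Longrightarrow> sing_cross_chain m n (\<Sum>k\<in>K. f k) d = (\<Sum>k\<in>K. sing_cross_chain m n (f k) d)"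
  by (simp add: sing_cross_chain_def frag_extend_sum o_def)

lemma sing_cross_chain_sum_right:
  "finite K \<Longrightarrow> sing_cross_chain m n c (\<Sum>k\<in>K. f k) = (\<Sum>k\<in>K. sing_cross_chain m n c (f k))"
  by (simp add: sing_cross_chain_def frag_extend_sum o_def frag_extend_fun_sum)

lemma sing_cross_chain_diff_left:
  "sing_cross_chain m n (a - b) d = sing_cross_chain m n a d - sing_cross_chain m n b d"
  by (simp add: sing_cross_chain_def frag_extend_diff)

text \<open>The coproduct formula is one equation in the bar homology of each product of two
  symmetric groups, and \<open>pair_chain\<close> carries each of them to a boundary. Summed over
  \<open>K \<times> K\<close>, the diagonal terms give the diagonal of the whole class, since the
  terms with \<open>k\<close> different from \<open>l\<close> are 0, while the cross products
  recombine to products of sums.\<close>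

lemma (in classified_operad) coproduct_chain:
  assumes p: "0 < p" and K: "finite K" and I: "finite I" and dims: "\<And>i. i \<in> I \<Longrightarrow> d' i + d'' i = d"
    and \<rho>: "\<And>k. \<rho> k \<in> bar_cycles p d (sym_group k)"
    and \<rho>': "\<And>i k. i \<in> I \<Longrightarrow> \<rho>' i k \<in> bar_cycles p (d' i) (sym_group k)"
    and \<rho>'': "\<And>i k. i \<in> I \<Longrightarrow> \<rho>'' i k \<in> bar_cycles p (d'' i) (sym_group k)"
    and cop: "\<And>k l. finprod (group_homology p d (sym_group k \<times>\<times> sym_group l))
              (\<lambda>i. group_cross p (d' i) (d'' i) (sym_group k) (sym_group l)
                 (bar_cls p (d' i) (sym_group k) (\<rho>' i k)) (bar_cls p (d'' i) (sym_group l) (\<rho>'' i l))) I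
            = (if k = l then group_induced p d (sym_group k \<times>\<times> sym_group l) (\<lambda>g. (g, g)) (bar_cls p d (sym_group k) (\<rho> k))
               else \<one>\<^bsub>group_homology p d (sym_group k \<times>\<times> sym_group l)\<^esub>)"
  shows "chain_map d (\<lambda>z. (z, z)) (\<Sum>k\<in>K. free_chain P k d (\<rho> k))
       - (\<Sum>i\<in>I. sing_cross_chain (d' i) (d'' i) (\<Sum>k\<in>K. free_chain P k (d' i) (\<rho>' i k)) (\<Sum>l\<in>K. free_chain P l (d'' i) (\<rho>'' i l)))
       \<in> sing_boundaries p d (kprod (free_on_point P) (free_on_point P))"
proof -
  interpret X: chain_complex "\<lambda>n. singular_simplex_set n (kprod (free_on_point P) (free_on_point P))" chain_boundary p
    by (rule chain_complex_singular[OF p])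
  let ?diag = "\<lambda>k l. if k = l then chain_map d (\<lambda>z. (z, z)) (free_chain P k d (\<rho> k)) else 0"
  let ?cross = "\<lambda>i k l. sing_cross_chain (d' i) (d'' i) (free_chain P k (d' i) (\<rho>' i k)) (free_chain P l (d'' i) (\<rho>'' i l))"
  have kl: "?diag k l - (\<Sum>i\<in>I. ?cross i k l) \<in> X.B d" for k l
  proof -
    let ?G = "sym_group k" and ?H = "sym_group l"
    note grp = sym_group_is_group[of k] sym_group_is_group[of l]
    interpret GH: chain_complex "bar_simplices (?G \<times>\<times> ?H)" "bar_boundary (?G \<times>\<times> ?H)" p
      by (rule chain_complex_bar[OF DirProd_group[OF grp] p])
    let ?x = "\<lambda>i. bar_cross_chain ?G ?H (d' i) (d'' i) (\<rho>' i k) (\<rho>'' i l)"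
    let ?y = "if k = l then diagonal_chain (\<rho> k) else 0"
    have x: "?x i \<in> GH.Z d" if "i \<in> I" for i
      using bar_cross(2)[OF grp p \<rho>'[OF that] \<rho>''[OF that]] dims[OF that] by simp
    have "group_cross p (d' i) (d'' i) ?G ?H (bar_cls p (d' i) ?G (\<rho>' i k)) (bar_cls p (d'' i) ?H (\<rho>'' i l)) = GH.cls d (?x i)"
      if "i \<in> I" for i
      using bar_cross(1)[OF grp p \<rho>'[OF that] \<rho>''[OF that]] dims[OF that] by simp
    then have "finprod (GH.H d) (\<lambda>i. group_cross p (d' i) (d'' i) ?G ?H (bar_cls p (d' i) ?G (\<rho>' i k)) (bar_cls p (d'' i) ?H (\<rho>'' i l))) I
        = finprod (GH.H d) (\<lambda>i. GH.cls d (?x i)) I"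
      by (intro GH.H.finprod_cong') (auto simp: GH.cls_closed x)
    also have "\<dots> = GH.cls d (sum ?x I)" by (rule GH.finprod_H[OF I x])
    finally have "GH.cls d ?y = GH.cls d (sum ?x I)"
      using cop[of k l] group_induced_diagonal[OF grp(1) p] by (auto simp: GH.one_H split: if_splits)
    then have "pair_chain k l d (?y - sum ?x I) \<in> X.B d"
      by (intro pair_chain_B) (simp add: GH.cls_eq_iff)
    moreover have "pair_chain k l d (?x i) = ?cross i k l" if "i \<in> I" for i
    proof -
      interpret G': chain_complex "bar_simplices ?G" "bar_boundary ?G" p by (rule chain_complex_bar[OF grp(1) p])
      interpret H': chain_complex "bar_simplices ?H" "bar_boundary ?H" p by (rule chain_complex_bar[OF grp(2) p])
      show ?thesis
        using pair_chain_cross[OF G'.Z_keys[OF \<rho>'[OF that]] H'.Z_keys[OF \<rho>''[OF that]]] dims[OF that] by simp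
    qed
    moreover have "pair_chain k l d ?y = ?diag k l"
      by (auto simp: pair_chain_diagonal) (simp add: pair_chain_def)
    ultimately show ?thesis by (simp add: pair_chain_diff pair_chain_sum[OF I])
  qed
  have "(\<Sum>k\<in>K. \<Sum>l\<in>K. ?diag k l - (\<Sum>i\<in>I. ?cross i k l)) \<in> X.B d"
    by (intro X.B_sum kl)
  also have "(\<Sum>k\<in>K. \<Sum>l\<in>K. ?diag k l - (\<Sum>i\<in>I. ?cross i k l))
      = (\<Sum>k\<in>K. chain_map d (\<lambda>z. (z, z)) (free_chain P k d (\<rho> k))) - (\<Sum>k\<in>K. \<Sum>l\<in>K. \<Sum>i\<in>I. ?cross i k l)"
    using K by (simp add: sum_subtractf sum.delta')
  also have "(\<Sum>k\<in>K. \<Sum>l\<in>K. \<Sum>i\<in>I. ?cross i k l) = (\<Sum>i\<in>I. \<Sum>k\<in>K. \<Sum>l\<in>K. ?cross i k l)"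
    by (subst sum.swap[of _ I]) (rule sum.swap)
  also have "\<dots> = (\<Sum>i\<in>I. sing_cross_chain (d' i) (d'' i) (\<Sum>k\<in>K. free_chain P k (d' i) (\<rho>' i k)) (\<Sum>l\<in>K. free_chain P l (d'' i) (\<rho>'' i l)))"
    using K by (simp add: sing_cross_chain_sum_left sing_cross_chain_sum_right) (rule sum.cong[OF refl], rule sum.swap)
  also have "(\<Sum>k\<in>K. chain_map d (\<lambda>z. (z, z)) (free_chain P k d (\<rho> k))) = chain_map d (\<lambda>z. (z, z)) (\<Sum>k\<in>K. free_chain P k d (\<rho> k))"
    using K by (simp add: chain_map_def frag_extend_sum o_def)
  finally show ?thesis .
qed

section \<open>Simplex-preserving maps between iterated k-products\<close>

lemma topspace_kprod [simp]: "topspace (kprod X Y) = topspace X \<times> topspace Y"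
  by (simp add: kprod_def)

lemma singular_simplex_projections:
  assumes "singular_simplex n (kprod X Y) \<sigma>"
  shows "singular_simplex n X (simplex_map n fst \<sigma>)" "singular_simplex n Y (simplex_map n snd \<sigma>)"
proof -
  have \<sigma>: "continuous_map (simplex_space n) X (fst \<circ> \<sigma>)" "continuous_map (simplex_space n) Y (snd \<circ> \<sigma>)"
    using assms by (simp_all add: singular_simplex_kprod)
  show "singular_simplex n X (simplex_map n fst \<sigma>)"
    unfolding singular_simplex_def using continuous_map_eq[OF \<sigma>(1), of "simplex_map n fst \<sigma>"] by (simp add: simplex_map_def)
  show "singular_simplex n Y (simplex_map n snd \<sigma>)"
    unfolding singular_simplex_def using continuous_map_eq[OF \<sigma>(2), of "simplex_map n snd \<sigma>"] by (simp add: simplex_map_def)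
qed

lemma interchange_preserving:
  "simplex_preserving (kprod (kprod W X) (kprod Y Z)) (kprod (kprod W Y) (kprod X Z)) interchange"
  unfolding simplex_preserving_def
proof (intro allI impI)
  fix n \<sigma> assume \<sigma>: "singular_simplex n (kprod (kprod W X) (kprod Y Z)) \<sigma>"
  note fs = singular_simplex_projections
  have "simplex_map n interchange \<sigma> = simplex_pair n
      (simplex_pair n (simplex_map n fst (simplex_map n fst \<sigma>)) (simplex_map n fst (simplex_map n snd \<sigma>)))
      (simplex_pair n (simplex_map n snd (simplex_map n fst \<sigma>)) (simplex_map n snd (simplex_map n snd \<sigma>)))"
    by (auto simp: simplex_map_def simplex_pair_def interchange_def case_prod_beta')
  then show "singular_simplex n (kprod (kprod W Y) (kprod X Z)) (simplex_map n interchange \<sigma>)"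
    using fs[OF \<sigma>] fs[OF fs(1)[OF \<sigma>]] fs[OF fs(2)[OF \<sigma>]] by (simp add: singular_simplex_pair)
qed

lemma map_prod_preserving:
  assumes "simplex_preserving X X' f" "simplex_preserving Y Y' g"
  shows "simplex_preserving (kprod X Y) (kprod X' Y') (map_prod f g)"
  unfolding simplex_preserving_def
proof (intro allI impI)
  fix n \<sigma> assume \<sigma>: "singular_simplex n (kprod X Y) \<sigma>"
  have "singular_simplex n X (simplex_map n fst \<sigma>)" "singular_simplex n Y (simplex_map n snd \<sigma>)"
    by (rule singular_simplex_projections[OF \<sigma>])+
  moreover have "simplex_map n (map_prod f g) \<sigma> = simplex_pair n (simplex_map n f (simplex_map n fst \<sigma>)) (simplex_map n g (simplex_map n snd \<sigma>))"
    by (auto simp: simplex_map_def simplex_pair_def map_prod_def case_prod_beta')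
  ultimately show "singular_simplex n (kprod X' Y') (simplex_map n (map_prod f g) \<sigma>)"
    using assms by (simp add: simplex_preserving_def singular_simplex_pair)
qed

lemma simplex_preserving_compose:
  "\<lbrakk>simplex_preserving X Y f; simplex_preserving Y Z g\<rbrakk> \<Longrightarrow> simplex_preserving X Z (g \<circ> f)"
  by (simp add: simplex_preserving_def simplex_map_compose)

lemma chain_map_id': "c \<in> sing_cycles p n X \<Longrightarrow> chain_map n id c = c"
  by (rule chain_map_ident[of n X]) (simp add: mod_cycles_def singular_chain_def)

theorem theorem86:
  fixes C :: "'c operad_data" and G :: "'g operad_data"
    and lam :: "nat set \<Rightarrow> (nat \<Rightarrow> nat set) \<Rightarrow> 'g \<Rightarrow> (nat \<Rightarrow> 'c) \<Rightarrow> 'c"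
    and X :: "'x topology"
    and \<theta> :: "nat set \<Rightarrow> 'c \<Rightarrow> (nat \<Rightarrow> 'x) \<Rightarrow> 'x"
    and \<xi> :: "nat set \<Rightarrow> 'g \<Rightarrow> (nat \<Rightarrow> 'x) \<Rightarrow> 'x"
    and p d e n :: nat
    and r s :: "nat \<Rightarrow> ((nat \<Rightarrow> nat) list \<Rightarrow>\<^sub>0 int) set"
    and x :: "'x chain set"
    and I :: "'i set" and d' d'' :: "'i \<Rightarrow> nat"
    and r' r'' :: "'i \<Rightarrow> nat \<Rightarrow> ((nat \<Rightarrow> nat) list \<Rightarrow>\<^sub>0 int) set"
  assumes "prime p"
    and "E_infinity_operad_pair TYPE('y) TYPE('z) C G lam"
    and "E_infinity_ring_space C G lam X \<theta> \<xi>"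
    and "r \<in> sym_homology p d"
    and "s \<in> sym_homology p e"
    and "x \<in> carrier (sing_homology p n X)"
    and "is_coproduct p d r I d' r' d'' r''"
  shows "sym_op p G X \<xi> d (e + n) r (sym_op p C X \<theta> e n s x)
       = finprod (sing_homology p (d + e + n) X)
           (\<lambda>i. class_op p C X \<theta> (d' i + e) (d'' i + n)
                  (sym_sharp p C G lam (d' i) e (r' i) s)
                  (sym_op p G X \<xi> (d'' i) n (r'' i) x)
                [^]\<^bsub>sing_homology p (d + e + n) X\<^esub> ((-1) ^ (e * d'' i) :: int))
           I"
proof -
  have p: "0 < p" using \<open>prime p\<close> by (rule prime_gt_0_nat)
  have CG: "E_infinity_operad TYPE('y) C" "E_infinity_operad TYPE('z) G" "operad_pair C G lam"
    using assms(2) by (simp_all add: E_infinity_operad_pair_def)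
  interpret pair: operad_pair C G lam by (rule CG(3))
  interpret C: classified_operad C by (rule E_infinity_classified[OF CG(1)])
  interpret G: classified_operad G by (rule E_infinity_classified[OF CG(2)])
  interpret \<theta>: operad_algebra C X \<theta> using assms(3) by (simp add: E_infinity_ring_space_def)
  interpret \<xi>: operad_algebra G X \<xi> using assms(3) by (simp add: E_infinity_ring_space_def)
  let ?FC = "free_on_point C" and ?FG = "free_on_point G"
  interpret X: chain_complex "\<lambda>n. singular_simplex_set n X" chain_boundary p
    by (rule chain_complex_singular[OF p])
  interpret FC: chain_complex "\<lambda>n. singular_simplex_set n ?FC" chain_boundary p
    by (rule chain_complex_singular[OF p])
  interpret FG: chain_complex "\<lambda>n. singular_simplex_set n ?FG" chain_boundary p
    by (rule chain_complex_singular[OF p])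
  have cop: "finite I" "\<And>i. i \<in> I \<Longrightarrow> d' i + d'' i = d" "\<And>i. i \<in> I \<Longrightarrow> r' i \<in> sym_homology p (d' i)"
    "\<And>i. i \<in> I \<Longrightarrow> r'' i \<in> sym_homology p (d'' i)"
    using assms(7) by (simp_all add: is_coproduct_def)
  obtain \<rho> where \<rho>: "\<And>k. \<rho> k \<in> bar_cycles p d (sym_group k)" "\<And>k. r k = bar_cls p d (sym_group k) (\<rho> k)" "finite {k. \<rho> k \<noteq> 0}"
    by (rule sym_homology_representatives[OF p assms(4)]) blast
  obtain \<sigma> where \<sigma>: "\<And>k. \<sigma> k \<in> bar_cycles p e (sym_group k)" "\<And>k. s k = bar_cls p e (sym_group k) (\<sigma> k)" "finite {k. \<sigma> k \<noteq> 0}"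
    by (rule sym_homology_representatives[OF p assms(5)]) blast
  have "\<forall>i\<in>I. \<exists>\<rho>. (\<forall>k. \<rho> k \<in> bar_cycles p (d' i) (sym_group k)) \<and> (\<forall>k. r' i k = bar_cls p (d' i) (sym_group k) (\<rho> k)) \<and> finite {k. \<rho> k \<noteq> 0}"
    using sym_homology_representatives[OF p cop(3)] by metis
  then obtain \<rho>' where \<rho>': "\<And>i k. i \<in> I \<Longrightarrow> \<rho>' i k \<in> bar_cycles p (d' i) (sym_group k)"
    "\<And>i k. i \<in> I \<Longrightarrow> r' i k = bar_cls p (d' i) (sym_group k) (\<rho>' i k)" "\<And>i. i \<in> I \<Longrightarrow> finite {k. \<rho>' i k \<noteq> 0}"
    unfolding bchoice_iff by blast
  have "\<forall>i\<in>I. \<exists>\<rho>. (\<forall>k. \<rho> k \<in> bar_cycles p (d'' i) (sym_group k)) \<and> (\<forall>k. r'' i k = bar_cls p (d'' i) (sym_group k) (\<rho> k)) \<and> finite {k. \<rho> k \<noteq> 0}"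
    using sym_homology_representatives[OF p cop(4)] by metis
  then obtain \<rho>'' where \<rho>'': "\<And>i k. i \<in> I \<Longrightarrow> \<rho>'' i k \<in> bar_cycles p (d'' i) (sym_group k)"
    "\<And>i k. i \<in> I \<Longrightarrow> r'' i k = bar_cls p (d'' i) (sym_group k) (\<rho>'' i k)" "\<And>i. i \<in> I \<Longrightarrow> finite {k. \<rho>'' i k \<noteq> 0}"
    unfolding bchoice_iff by blast
  obtain c where c: "c \<in> X.Z n" "x = X.cls n c" using assms(6) unfolding X.carrier_H by blast
  \<comment> \<open>One finite set containing the supports of all the chosen
    representatives.\<close>
  define K where "K = {k. \<rho> k \<noteq> 0} \<union> {k. \<sigma> k \<noteq> 0} \<union> (\<Union>i\<in>I. {k. \<rho>' i k \<noteq> 0} \<union> {k. \<rho>'' i k \<noteq> 0})"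
  have K: "finite K" unfolding K_def using \<rho>(3) \<sigma>(3) \<rho>'(3) \<rho>''(3) cop(1) by simp
  define A where "A = (\<Sum>k\<in>K. free_chain G k d (\<rho> k))"
  define S where "S = (\<Sum>k\<in>K. free_chain C k e (\<sigma> k))"
  define A' where "A' i = (\<Sum>k\<in>K. free_chain G k (d' i) (\<rho>' i k))" for i
  define A'' where "A'' i = (\<Sum>k\<in>K. free_chain G k (d'' i) (\<rho>'' i k))" for i
  have A: "point_class p d G r = FG.cls d A" "A \<in> FG.Z d"
    unfolding A_def by (rule G.point_class_eq[OF p K \<rho>(1) _ \<rho>(2)]) (auto simp: K_def intro!: FG.Z_sum G.free_chain_Z \<rho>(1))
  have S: "point_class p e C s = FC.cls e S" "S \<in> FC.Z e"
    unfolding S_def by (rule C.point_class_eq[OF p K \<sigma>(1) _ \<sigma>(2)]) (auto simp: K_def intro!: FC.Z_sum C.free_chain_Z \<sigma>(1))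
  have A': "point_class p (d' i) G (r' i) = FG.cls (d' i) (A' i)" "A' i \<in> FG.Z (d' i)" if "i \<in> I" for i
    unfolding A'_def by (rule G.point_class_eq[OF p K \<rho>'(1)[OF that] _ \<rho>'(2)[OF that]])
      (use that in \<open>auto simp: K_def intro!: FG.Z_sum G.free_chain_Z \<rho>'(1)\<close>)
  have A'': "point_class p (d'' i) G (r'' i) = FG.cls (d'' i) (A'' i)" "A'' i \<in> FG.Z (d'' i)" if "i \<in> I" for i
    unfolding A''_def by (rule G.point_class_eq[OF p K \<rho>''(1)[OF that] _ \<rho>''(2)[OF that]])
      (use that in \<open>auto simp: K_def intro!: FG.Z_sum G.free_chain_Z \<rho>''(1)\<close>)
  define F\<theta> where "F\<theta> = action_map \<theta>"
  define F\<xi> where "F\<xi> = action_map \<xi>"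
  define F\<mu> where "F\<mu> = action_map (free_on_point_mult C lam)"
  note F\<theta> = \<theta>.action_map_preserving[folded F\<theta>_def]
  note F\<xi> = \<xi>.action_map_preserving[folded F\<xi>_def]
  note F\<mu> = pair.mult_map_preserving[folded F\<mu>_def]
  \<comment> \<open>The right-hand side of the identity of points with its two copies of
    \<open>u\<close> as independent variables. They are filled first with the diagonal class of
    \<open>r\<close> and then with the products \<open>r' \<times> r''\<close>.\<close>
  define Q where "Q = F\<theta> \<circ> (map_prod F\<mu> F\<xi> \<circ> interchange)"
  have Q: "simplex_preserving (kprod (kprod ?FG ?FG) (kprod ?FC X)) X Q"
    unfolding Q_def
    by (rule simplex_preserving_compose[OF simplex_preserving_compose[OF interchange_preserving map_prod_preserving[OF F\<mu> F\<xi>]] F\<theta>])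
  define N where "N = d + e + n"
  note op_\<theta> = class_op_cls[OF p F\<theta>[unfolded F\<theta>_def], folded F\<theta>_def]
  note op_\<xi> = class_op_cls[OF p F\<xi>[unfolded F\<xi>_def], folded F\<xi>_def]
  note op_\<mu> = class_op_cls[OF p F\<mu>[unfolded F\<mu>_def], folded F\<mu>_def]
  define T where "T = sing_cross_chain e n S c"
  have T: "T \<in> sing_cycles p (e + n) (kprod ?FC X)"
    unfolding T_def by (rule sing_cross_Z[OF p S(2) c(1)])
  let ?L = "chain_map (d + (e + n)) F\<xi> (sing_cross_chain d (e + n) A (chain_map (e + n) F\<theta> T))"
  have lhs: "sym_op p G X \<xi> d (e + n) r (sym_op p C X \<theta> e n s x) = X.cls N ?L"
    unfolding sym_op_def A(1) S(1) c(2) op_\<theta>(1)[OF S(2) c(1)] op_\<xi>(1)[OF A(2) op_\<theta>(2)[OF S(2) c(1)]]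
    by (simp add: T_def N_def add.assoc)
  let ?W = "\<lambda>i. sing_cross_chain (d' i) (d'' i) (A' i) (A'' i)"
  let ?q = "\<lambda>w. chain_map N Q (sing_cross_chain d (e + n) w T)"
  have L: "?L = ?q (chain_map d (\<lambda>z. (z, z)) A)"
  proof -
    have "?L = chain_map (d + (e + n)) F\<xi> (chain_map (d + (e + n)) (map_prod id F\<theta>) (sing_cross_chain d (e + n) A T))"
      by (simp only: chain_map_cross chain_map_id'[OF A(2)])
    also have "\<dots> = chain_map N (F\<xi> \<circ> map_prod id F\<theta>) (sing_cross_chain d (e + n) A T)"
      by (simp add: chain_map_compose N_def add.assoc)
    \<comment> \<open>The two maps agree at the points of the spaces, by the distributivity law, and
      this suffices for singular chains in these spaces.\<close>
    also have "\<dots> = chain_map N (Q \<circ> map_prod (\<lambda>z. (z, z)) id) (sing_cross_chain d (e + n) A T)"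
    proof (rule chain_map_eq)
      show "singular_chain N (kprod ?FG (kprod ?FC X)) (sing_cross_chain d (e + n) A T)"
        using sing_cross_Z[OF p A(2) T] by (simp add: mod_cycles_def singular_chain_def N_def add.assoc)
      fix w assume "w \<in> topspace (kprod ?FG (kprod ?FC X))"
      then obtain u v y where "w = (u, (v, y))" "u \<in> topspace ?FG" "v \<in> topspace ?FC" "y \<in> topspace X" by auto
      then show "(F\<xi> \<circ> map_prod id F\<theta>) w = (Q \<circ> map_prod (\<lambda>z. (z, z)) id) w"
        using ring_space_actions[OF CG(3) assms(3)]
        by (simp add: Q_def interchange_def F\<xi>_def F\<theta>_def F\<mu>_def)
    qed
    also have "\<dots> = chain_map (d + (e + n)) Q (chain_map (d + (e + n)) (map_prod (\<lambda>z. (z, z)) id) (sing_cross_chain d (e + n) A T))"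
      by (simp add: chain_map_compose N_def add.assoc)
    also have "\<dots> = ?q (chain_map d (\<lambda>z. (z, z)) A)"
      by (simp only: chain_map_cross chain_map_id'[OF T]) (simp only: N_def add.assoc)
    finally show ?thesis .
  qed
  have "chain_map d (\<lambda>z. (z, z)) A - (\<Sum>i\<in>I. ?W i) \<in> sing_boundaries p d (kprod ?FG ?FG)"
    unfolding A_def A'_def A''_def
  proof (rule G.coproduct_chain[OF p K cop(1,2) \<rho>(1) \<rho>'(1) \<rho>''(1)])
    fix k l
    have "finprod (group_homology p d (sym_group k \<times>\<times> sym_group l))
        (\<lambda>i. group_cross p (d' i) (d'' i) (sym_group k) (sym_group l)
           (bar_cls p (d' i) (sym_group k) (\<rho>' i k)) (bar_cls p (d'' i) (sym_group l) (\<rho>'' i l))) I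
      = finprod (group_homology p d (sym_group k \<times>\<times> sym_group l))
        (\<lambda>i. group_cross p (d' i) (d'' i) (sym_group k) (sym_group l) (r' i k) (r'' i l)) I"
    proof -
      note grp = sym_group_is_group[of k] sym_group_is_group[of l]
      interpret GH: chain_complex "bar_simplices (sym_group k \<times>\<times> sym_group l)" "bar_boundary (sym_group k \<times>\<times> sym_group l)" p
        by (rule chain_complex_bar[OF DirProd_group[OF grp] p])
      \<comment> \<open>Rewriting inside \<open>finprod\<close> requires factors in the carrier, so
        each cross product is recognised as the class of a cycle.\<close>
      have "group_cross p (d' i) (d'' i) (sym_group k) (sym_group l) (r' i k) (r'' i l) \<in> carrier (GH.H d)" if "i \<in> I" for i
        using bar_cross[OF grp p \<rho>'(1)[OF that] \<rho>''(1)[OF that]] cop(2)[OF that] GH.cls_closed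
        by (simp add: \<rho>'(2)[OF that] \<rho>''(2)[OF that])
      then show ?thesis
        by (intro GH.H.finprod_cong') (auto simp: \<rho>'(2) \<rho>''(2))
    qed
    then show "finprod (group_homology p d (sym_group k \<times>\<times> sym_group l))
        (\<lambda>i. group_cross p (d' i) (d'' i) (sym_group k) (sym_group l)
           (bar_cls p (d' i) (sym_group k) (\<rho>' i k)) (bar_cls p (d'' i) (sym_group l) (\<rho>'' i l))) I
      = (if k = l then group_induced p d (sym_group k \<times>\<times> sym_group l) (\<lambda>g. (g, g)) (bar_cls p d (sym_group k) (\<rho> k))
         else \<one>\<^bsub>group_homology p d (sym_group k \<times>\<times> sym_group l)\<^esub>)"
      using assms(7) \<rho>(2) by (simp add: is_coproduct_def)
  qed
  \<comment> \<open>The boundary between the diagonal chain and the sum of products remains a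
    boundary after crossing with the cycle \<open>T\<close> and applying \<open>Q\<close>.\<close>
  from chain_map_B[OF Q sing_cross_B[OF p this T]]
  have "?q (chain_map d (\<lambda>z. (z, z)) A) - (\<Sum>i\<in>I. ?q (?W i)) \<in> X.B N"
    using cop(1) by (simp add: sing_cross_chain_diff_left sing_cross_chain_sum_left chain_map_diff chain_map_sum o_def N_def add.assoc)
  then have "X.cls N ?L = X.cls N (\<Sum>i\<in>I. ?q (?W i))"
    by (simp only: L X.cls_eq_iff)
  also have "\<dots> = finprod (X.H N) (\<lambda>i. X.cls N (?q (?W i))) I"
  proof (rule X.finprod_H[OF cop(1), symmetric])
    fix i assume i: "i \<in> I"
    have "?W i \<in> sing_cycles p d (kprod ?FG ?FG)"
      using sing_cross_Z[OF p A'(2)[OF i] A''(2)[OF i]] cop(2)[OF i] by simp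
    from chain_map_Z[OF Q sing_cross_Z[OF p this T]]
    show "?q (?W i) \<in> X.Z N" by (simp only: N_def add.assoc)
  qed
  also have "\<dots> = finprod (X.H N)
           (\<lambda>i. class_op p C X \<theta> (d' i + e) (d'' i + n)
                  (sym_sharp p C G lam (d' i) e (r' i) s)
                  (sym_op p G X \<xi> (d'' i) n (r'' i) x)
                [^]\<^bsub>X.H N\<^esub> ((-1) ^ (e * d'' i) :: int)) I"
  proof -
    have "class_op p C X \<theta> (d' i + e) (d'' i + n) (sym_sharp p C G lam (d' i) e (r' i) s) (sym_op p G X \<xi> (d'' i) n (r'' i) x)
        [^]\<^bsub>X.H N\<^esub> ((-1) ^ (e * d'' i) :: int) = X.cls N (?q (?W i)) \<and> X.cls N (?q (?W i)) \<in> carrier (X.H N)" if i: "i \<in> I" for i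
    proof -
      let ?R = "chain_map ((d' i + e) + (d'' i + n)) F\<theta> (sing_cross_chain (d' i + e) (d'' i + n)
          (chain_map (d' i + e) F\<mu> (sing_cross_chain (d' i) e (A' i) S)) (chain_map (d'' i + n) F\<xi> (sing_cross_chain (d'' i) n (A'' i) c)))"
      have N: "(d' i + e) + (d'' i + n) = N" "(d' i + d'' i) + (e + n) = N" using cop(2)[OF i] by (simp_all add: N_def)
      note zl = op_\<mu>[OF A'(2)[OF i] S(2)] and zx = op_\<xi>[OF A''(2)[OF i] c(1)]
      have R: "class_op p C X \<theta> (d' i + e) (d'' i + n) (sym_sharp p C G lam (d' i) e (r' i) s) (sym_op p G X \<xi> (d'' i) n (r'' i) x) = X.cls N ?R"
        unfolding sym_sharp_def sym_op_def A'(1)[OF i] A''(1)[OF i] S(1) c(2) zl(1) zx(1) op_\<theta>(1)[OF zl(2) zx(2)]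
        by (simp only: N)
      have RZ: "?R \<in> X.Z N" using op_\<theta>(2)[OF zl(2) zx(2)] by (simp only: N)
      have "?q (?W i) = chain_map N F\<theta> (chain_map N (map_prod F\<mu> F\<xi>) (chain_map ((d' i + d'' i) + (e + n)) interchange
          (sing_cross_chain (d' i + d'' i) (e + n) (?W i) T)))"
        by (simp add: Q_def chain_map_compose cop(2)[OF i] N_def add.assoc)
      \<comment> \<open>The interchange moves \<open>A'' i\<close>, of degree \<open>d'' i\<close>,
        past \<open>S\<close>, of degree \<open>e\<close>; this is the sign of the relation.\<close>
      also have "\<dots> = frag_cmul ((-1) ^ (d'' i * e)) (chain_map N F\<theta> (chain_map ((d' i + e) + (d'' i + n)) (map_prod F\<mu> F\<xi>)
          (sing_cross_chain (d' i + e) (d'' i + n) (sing_cross_chain (d' i) e (A' i) S) (sing_cross_chain (d'' i) n (A'' i) c))))"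
        unfolding T_def sing_cross_interchange by (simp add: N)
      also have "\<dots> = frag_cmul ((-1) ^ (e * d'' i)) ?R"
        unfolding chain_map_cross by (simp only: N mult.commute)
      finally have q: "?q (?W i) = frag_cmul ((-1) ^ (e * d'' i)) ?R" .
      show ?thesis
        unfolding R q X.int_pow_sign_H[OF RZ] using X.cls_closed[OF X.Z_cmul[OF RZ]] by blast
    qed
    then show ?thesis by (intro X.H.finprod_cong') auto
  qed
  finally show ?thesis unfolding lhs by (simp only: N_def)
qed

end
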